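(* Let $r,s\ge1$ be integers, $a_0=0\le a_1\le\dots\le a_r$ integers with $\sum_{i=1}^r a_i\le s$, and $X=\mathbb{P}\left(\mathcal{O}_{\mathbb{P}^s}\oplus\bigoplus_{i=1}^r\mathcal{O}_{\mathbb{P}^s}(a_i)\right)$. With the line bundles $E_{kl}=k\,\pi^*H+l\,\xi$ on $X$ ($0\le k\le s$, $0\le l\le r$), the labelling of the solutions in $Crit(X)$ by pairs $(k,l)$, and the spaces $Hom_{mon}$ defined in the context, for any two solutions $(k_1,l_1),(k_2,l_2)\in Crit(X)$ there is an isomorphism of complex vector spaces $$Hom(E_{k_1l_1},E_{k_2l_2})\simeq Hom_{mon}((k_1,l_1),(k_2,l_2)).$$
   Context: Picard group: $\pi:X\to\mathbb{P}^s$ is the projection, $H$ is the positive generator of $Pic(\mathbb{P}^s)$, and $\xi$ is the tautological line bundle of $X$, normalized so that $\pi_*\xi=\mathcal{O}_{\mathbb{P}^s}\oplus\bigoplus_{i=1}^r\mathcal{O}_{\mathbb{P}^s}(a_i)$; then $Pic(X)=\mathbb{Z}\,\pi^*H\oplus\mathbb{Z}\,\xi$ (written additively). $Hom$ denotes homomorphisms of coherent sheaves on $X$. Landau-Ginzburg side: $L$ denotes the space of Laurent polynomials $$1+\sum_{i=1}^s\alpha_i z_i+\sum_{j=1}^r\beta_j w_j+\alpha_0\frac{\prod_{j=1}^r w_j^{a_j}}{\prod_{i=1}^s z_i}+\beta_0\frac{1}{\prod_{j=1}^r w_j},\qquad \alpha_i,\beta_j\in\mathbb{C}^*$$ (the constant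 term plays no role). For $f\in L$, $Crit(X;f)\subset(\mathbb{C}^* )^{s+r}$ is the scheme of solutions of $z_i\,\partial f/\partial z_i=0$ ($1\le i\le s$), $w_j\,\partial f/\partial w_j=0$ ($1\le j\le r$). For $t\in\mathbb{R}$, $f_t\in L$ is the element with $\alpha_0=e^t$ and all other $\alpha_i,\beta_j$ equal to $1$; $f_X=f_0$ and $Crit(X)=Crit(X;f_X)$. $R_X\subset L$ is the hypersurface of those $f$ for which $Crit(X;f)$ is non-reduced, and $M:\pi_1(L\setminus R_X,f_X)\to Aut(Crit(X))$ is the monodromy action on the finite set $Crit(X)$ obtained by analytic continuation of solutions along loops. Labelling: each solution $(z,w)\in Crit(X)$ is taken to extend to a unique smooth curve $(z(t),w(t))\in Crit(X;f_t)$, $t\le0$, $(z(0),w(0))=(z,w)$ (standing assumption: $f_t\notin R_X$ for all real $t\le 0$). Let $\mathbb{T}$ be the unit circle, and let $\Theta(z,w)\in\mathbb{T}^2$ be obtained by dividing each coordinate of $\left(\frac{\prod_j w_j^{a_j}}{\prod_i z_i},\frac1{\prod_j w_j}\right)$ by its absolute value. The limit $\lim_{t\to-\infty}\Theta(z(t),w(t))$ equals $\left(e^{2\pi i\left(\frac{l\sum_j a_j}{(s+1)(r+1)}+\frac{k}{s+1}\right)},e^{\frac{2\pi i l}{r+1}}\right)$ for a unique pair $0\le k\le s$, $0\le l\le r$; the solution is then denoted $(k,l)$. This identifies $Crit(X)$ with $\{0,\dots,s\}\times\{0,\dots,r\}\simeq\mathbb{Z}/(s+1)\mathbb{Z}\oplus\mathbb{Z}/(r+1)\mathbb{Z}$.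 Monodromies: for tuples of non-negative integers $(n,m)=(n_0,\dots,n_s;m_0,\dots,m_r)$ and $t\in\mathbb{R}$, let $\gamma^t_{(n,m)}(\theta)\in L$, $\theta\in[0,1]$, be the loop based at $f_t$ with $\alpha_i=e^{2\pi i n_i\theta}$ for $1\le i\le s$, $\alpha_0=e^te^{2\pi i n_0\theta}$, $\beta_j=e^{2\pi i m_j\theta}$ for $0\le j\le r$ (in exponentials, $i$ in $2\pi i$ is $\sqrt{-1}$). Let $\eta_t$ be the straight segment in $L$ from $f_X$ to $f_t$. For $t$ sufficiently negative, the class of the loop "first $\eta_t$, then $\gamma^t_{(n,m)}$, then $\eta_t$ reversed" in $\pi_1(L\setminus R_X,f_X)$ is independent of $t$; this class is $\Gamma_{(n,m)}:=\lim_{t\to-\infty}[\eta_t^{-1}\circ\gamma^t_{(n,m)}\circ\eta_t]$. Set $|(n,m)|_1=\sum_{i=0}^s n_i-\sum_{i=0}^r a_im_i$ and $|(n,m)|_2=\sum_{i=0}^r m_i$. For $(k,l)$ with $0\le k\le s$, $0\le l\le r$, let $$D^+(k,l)=\{(n,m)\in(\mathbb{Z}_{\ge0})^{s+1}\times(\mathbb{Z}_{\ge0})^{r+1}: -k\le|(n,m)|_1\le s-k,\ 0\le|(n,m)|_2\le r-l\}.$$ Let $M((k_1,l_1),(k_2,l_2))$ be the set of $(n,m)\in D^+(k_1,l_1)$ with $M(\Gamma_{(n,m)})(k_1,l_1)=(k_2,l_2)$, and let $Hom_{mon}((k_1,l_1),(k_2,l_2))=\bigoplus_{(n,m)\in M((k_1,l_1),(k_2,l_2))}\mathbb{C}\,\Gamma_{(n,m)}$,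 the complex vector space with basis indexed by this set. *)

theory Defs
  imports "HOL-Analysis.Analysis" "HOL-Library.Poly_Mapping"
begin

(* A pair (x, y) of finite coordinate tuples.  Tuples are extensional functions (PiE), so that
   equality and the product topology are those of the finite product of copies of the complex
   numbers. *)
type_synonym cpair = "(nat \<Rightarrow> complex) \<times> (nat \<Rightarrow> complex)"


(* X = P(E) with E = O + O(a_1) + ... + O(a_r) over P^s, as a complex variety (closed points with
   the Zariski topology and the sheaf of regular functions).

   Since the push-forward of xi is E itself (not its dual), a point of X over a line m in
   C^(s+1) is a one-dimensional subspace of the fibre at m of the dual bundle, i.e. of the sum of
   the O(-a_j).  A vector of O(-a) at m is a function h on m - {0} with
   h (c x) = c^(-a) h x.  A line spanned by (h_0, ..., h_r) is therefore recorded by the set of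
   all pairs (x, (mu h_j(x))_j) with x in m - {0} and mu nonzero, which is exactly one orbit of
   the action torus_act on the cone below.  So X is the quotient of the cone by (C - {0})^2. *)
definition cone :: "nat \<Rightarrow> nat \<Rightarrow> cpair set" where
  "cone s r = {(x, y). x \<in> ({0..s} \<rightarrow>\<^sub>E UNIV) \<and> y \<in> ({0..r} \<rightarrow>\<^sub>E UNIV)
                 \<and> (\<exists>i\<le>s. x i \<noteq> 0) \<and> (\<exists>j\<le>r. y j \<noteq> 0)}"

definition torus_act :: "nat \<Rightarrow> nat \<Rightarrow> (nat \<Rightarrow> nat) \<Rightarrow> complex \<Rightarrow> complex \<Rightarrow> cpair \<Rightarrow> cpair" where
  "torus_act s r a c \<mu> p =
     (\<lambda>i\<in>{0..s}. c * fst p i, \<lambda>j\<in>{0..r}. \<mu> * snd p j / c ^ a j)"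

definition orbit_rel :: "nat \<Rightarrow> nat \<Rightarrow> (nat \<Rightarrow> nat) \<Rightarrow> (cpair \<times> cpair) set" where
  "orbit_rel s r a = {(p, q). p \<in> cone s r \<and> q \<in> cone s r \<and>
      (\<exists>c \<mu>. c \<noteq> 0 \<and> \<mu> \<noteq> 0 \<and> q = torus_act s r a c \<mu> p)}"

definition bundle_points :: "nat \<Rightarrow> nat \<Rightarrow> (nat \<Rightarrow> nat) \<Rightarrow> cpair set set" where
  "bundle_points s r a = cone s r // orbit_rel s r a"

inductive_set polyfun :: "nat \<Rightarrow> nat \<Rightarrow> (cpair \<Rightarrow> complex) set" for s r where
  const: "(\<lambda>p. c) \<in> polyfun s r"
| xcoord: "i \<le> s \<Longrightarrow> (\<lambda>p. fst p i) \<in> polyfun s r"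
| ycoord: "j \<le> r \<Longrightarrow> (\<lambda>p. snd p j) \<in> polyfun s r"
| add: "P \<in> polyfun s r \<Longrightarrow> Q \<in> polyfun s r \<Longrightarrow> (\<lambda>p. P p + Q p) \<in> polyfun s r"
| mult: "P \<in> polyfun s r \<Longrightarrow> Q \<in> polyfun s r \<Longrightarrow> (\<lambda>p. P p * Q p) \<in> polyfun s r"

definition zariski_open_cone :: "nat \<Rightarrow> nat \<Rightarrow> cpair set \<Rightarrow> bool" where
  "zariski_open_cone s r W \<longleftrightarrow>
     (\<exists>S \<subseteq> polyfun s r. W = {p \<in> cone s r. \<exists>P\<in>S. P p \<noteq> 0})"

definition regular_on :: "nat \<Rightarrow> nat \<Rightarrow> cpair set \<Rightarrow> (cpair \<Rightarrow> complex) \<Rightarrow> bool" where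
  "regular_on s r W F \<longleftrightarrow>
     (\<forall>p\<in>W. \<exists>V P Q. zariski_open_cone s r V \<and> p \<in> V \<and> V \<subseteq> W
        \<and> P \<in> polyfun s r \<and> Q \<in> polyfun s r \<and> (\<forall>q\<in>V. Q q \<noteq> 0 \<and> F q = P q / Q q))"

(* Quotient topology.  Points of X are orbits, so the preimage of U in the cone is \<Union>U. *)
definition bundle_open :: "nat \<Rightarrow> nat \<Rightarrow> (nat \<Rightarrow> nat) \<Rightarrow> cpair set set \<Rightarrow> bool" where
  "bundle_open s r a U \<longleftrightarrow> U \<subseteq> bundle_points s r a \<and> zariski_open_cone s r (\<Union>U)"

(* Sections over U of the line bundle k pi^*H + l xi.  H is the dual of the tautological line
   {(m, x). x in m} of P^s and xi is the dual of the tautological line of X, whose fibre at an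
   orbit is the line spanned by (h_0, ..., h_r).  Hence a section of the tensor product of the
   k-th power of pi^*H with the l-th power of xi is a regular function F of a nonzero vector x
   in the first line and a nonzero vector (h_j)_j in the second one which is homogeneous of
   degree k in the first and of degree l in the second argument.  In the coordinates
   (x, (h_j(x))_j) this is the equivariance below.  In particular each monomial p(x) y_j with p
   homogeneous of degree a_j is a section of xi, in accordance with
   pi_* xi = O + O(a_1) + ... + O(a_r). *)
definition line_bundle :: "nat \<Rightarrow> nat \<Rightarrow> (nat \<Rightarrow> nat) \<Rightarrow> int \<Rightarrow> int
    \<Rightarrow> cpair set set \<Rightarrow> (cpair \<Rightarrow> complex) set" where
  "line_bundle s r a k l U = {F. regular_on s r (\<Union>U) F
      \<and> (\<forall>p\<in>\<Union>U. \<forall>c \<mu>. c \<noteq> 0 \<longrightarrow> \<mu> \<noteq> 0 \<longrightarrow>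
            F (torus_act s r a c \<mu> p) = c powi k * \<mu> powi l * F p)
      \<and> (\<forall>p. p \<notin> \<Union>U \<longrightarrow> F p = 0)}"

definition structure_sheaf :: "nat \<Rightarrow> nat \<Rightarrow> (nat \<Rightarrow> nat)
    \<Rightarrow> cpair set set \<Rightarrow> (cpair \<Rightarrow> complex) set" where
  "structure_sheaf s r a = line_bundle s r a 0 0"

definition restrict_section :: "cpair set set \<Rightarrow> (cpair \<Rightarrow> complex) \<Rightarrow> cpair \<Rightarrow> complex" where
  "restrict_section V F = (\<lambda>p. if p \<in> \<Union>V then F p else 0)"

(* Homomorphisms of sheaves of O_X-modules between two sheaves F, G whose sections are functions
   on the cone.  The clauses with result 0 only fix junk values, so that equality of the families
   is equality of sheaf homomorphisms. *)
definition sheaf_hom :: "nat \<Rightarrow> nat \<Rightarrow> (nat \<Rightarrow> nat)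
    \<Rightarrow> (cpair set set \<Rightarrow> (cpair \<Rightarrow> complex) set) \<Rightarrow> (cpair set set \<Rightarrow> (cpair \<Rightarrow> complex) set)
    \<Rightarrow> (cpair set set \<Rightarrow> (cpair \<Rightarrow> complex) \<Rightarrow> cpair \<Rightarrow> complex) set" where
  "sheaf_hom s r a F G = {\<phi>.
      (\<forall>U. bundle_open s r a U \<longrightarrow>
         (\<forall>f\<in>F U. \<phi> U f \<in> G U) \<and>
         (\<forall>f\<in>F U. \<forall>g\<in>F U. \<phi> U (\<lambda>p. f p + g p) = (\<lambda>p. \<phi> U f p + \<phi> U g p)) \<and>
         (\<forall>h\<in>structure_sheaf s r a U. \<forall>f\<in>F U. \<phi> U (\<lambda>p. h p * f p) = (\<lambda>p. h p * \<phi> U f p))) \<and>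
      (\<forall>U V. bundle_open s r a U \<longrightarrow> bundle_open s r a V \<longrightarrow> V \<subseteq> U \<longrightarrow>
         (\<forall>f\<in>F U. \<phi> V (restrict_section V f) = restrict_section V (\<phi> U f))) \<and>
      (\<forall>U f. \<not> (bundle_open s r a U \<and> f \<in> F U) \<longrightarrow> \<phi> U f = (\<lambda>p. 0))}"

definition Hom_bundle :: "nat \<Rightarrow> nat \<Rightarrow> (nat \<Rightarrow> nat) \<Rightarrow> nat \<times> nat \<Rightarrow> nat \<times> nat
    \<Rightarrow> (cpair set set \<Rightarrow> (cpair \<Rightarrow> complex) \<Rightarrow> cpair \<Rightarrow> complex) set" where
  "Hom_bundle s r a e1 e2 = sheaf_hom s r a
      (line_bundle s r a (int (fst e1)) (int (snd e1)))
      (line_bundle s r a (int (fst e2)) (int (snd e2)))"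


(* A Laurent polynomial in L is given by its coefficients
   ((alpha_0, ..., alpha_s), (beta_0, ..., beta_r)); the monomials are pairwise distinct, so L is
   the space of these tuples, with its usual topology. *)
definition LG_space :: "nat \<Rightarrow> nat \<Rightarrow> cpair set" where
  "LG_space s r = ({0..s} \<rightarrow>\<^sub>E - {0}) \<times> ({0..r} \<rightarrow>\<^sub>E - {0})"

definition LG_torus :: "nat \<Rightarrow> nat \<Rightarrow> cpair set" where
  "LG_torus s r = ({1..s} \<rightarrow>\<^sub>E - {0}) \<times> ({1..r} \<rightarrow>\<^sub>E - {0})"

definition LG_poly :: "nat \<Rightarrow> nat \<Rightarrow> (nat \<Rightarrow> nat) \<Rightarrow> cpair \<Rightarrow> cpair \<Rightarrow> complex" where
  "LG_poly s r a = (\<lambda>(\<alpha>, \<beta>) (z, w).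
      1 + (\<Sum>i=1..s. \<alpha> i * z i) + (\<Sum>j=1..r. \<beta> j * w j)
        + \<alpha> 0 * ((\<Prod>j=1..r. w j ^ a j) / (\<Prod>i=1..s. z i))
        + \<beta> 0 * (1 / (\<Prod>j=1..r. w j)))"

fun log_deriv :: "(cpair \<Rightarrow> complex) \<Rightarrow> nat + nat \<Rightarrow> cpair \<Rightarrow> complex" where
  "log_deriv f (Inl i) (z, w) = z i * deriv (\<lambda>u. f (z(i := u), w)) (z i)"
| "log_deriv f (Inr j) (z, w) = w j * deriv (\<lambda>u. f (z, w(j := u))) (w j)"

definition Crit :: "nat \<Rightarrow> nat \<Rightarrow> (nat \<Rightarrow> nat) \<Rightarrow> cpair \<Rightarrow> cpair set" where
  "Crit s r a f = {p \<in> LG_torus s r.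
      \<forall>d \<in> {1..s} <+> {1..r}. log_deriv (LG_poly s r a f) d p = 0}"

(* Laurent polynomial functions; only their values on the torus matter. *)
inductive_set laurent :: "nat \<Rightarrow> nat \<Rightarrow> (cpair \<Rightarrow> complex) set" for s r where
  const: "(\<lambda>p. c) \<in> laurent s r"
| z: "i \<in> {1..s} \<Longrightarrow> (\<lambda>p. fst p i) \<in> laurent s r"
| z_inv: "i \<in> {1..s} \<Longrightarrow> (\<lambda>p. inverse (fst p i)) \<in> laurent s r"
| w: "j \<in> {1..r} \<Longrightarrow> (\<lambda>p. snd p j) \<in> laurent s r"
| w_inv: "j \<in> {1..r} \<Longrightarrow> (\<lambda>p. inverse (snd p j)) \<in> laurent s r"
| add: "P \<in> laurent s r \<Longrightarrow> Q \<in> laurent s r \<Longrightarrow> (\<lambda>p. P p + Q p) \<in> laurent s r"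
| mult: "P \<in> laurent s r \<Longrightarrow> Q \<in> laurent s r \<Longrightarrow> (\<lambda>p. P p * Q p) \<in> laurent s r"

definition crit_ideal :: "nat \<Rightarrow> nat \<Rightarrow> (nat \<Rightarrow> nat) \<Rightarrow> cpair \<Rightarrow> (cpair \<Rightarrow> complex) set" where
  "crit_ideal s r a f = {h \<in> laurent s r.
      \<exists>q. (\<forall>d \<in> {1..s} <+> {1..r}. q d \<in> laurent s r) \<and>
          (\<forall>p \<in> LG_torus s r.
             h p = (\<Sum>d \<in> {1..s} <+> {1..r}. q d p * log_deriv (LG_poly s r a f) d p))}"

(* The critical scheme is the spectrum of the Laurent polynomial ring modulo crit_ideal; it is
   reduced iff that ring has no nonzero nilpotent element. *)
definition crit_reduced :: "nat \<Rightarrow> nat \<Rightarrow> (nat \<Rightarrow> nat) \<Rightarrow> cpair \<Rightarrow> bool" where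
  "crit_reduced s r a f \<longleftrightarrow>
     (\<forall>h \<in> laurent s r. \<forall>N::nat. (\<lambda>p. h p ^ N) \<in> crit_ideal s r a f \<longrightarrow> h \<in> crit_ideal s r a f)"

definition discriminant :: "nat \<Rightarrow> nat \<Rightarrow> (nat \<Rightarrow> nat) \<Rightarrow> cpair set" where
  "discriminant s r a = {f \<in> LG_space s r. \<not> crit_reduced s r a f}"

definition LG_alpha0 :: "nat \<Rightarrow> nat \<Rightarrow> complex \<Rightarrow> cpair" where
  "LG_alpha0 s r b = (\<lambda>i\<in>{0..s}. if i = 0 then b else 1, \<lambda>j\<in>{0..r}. 1)"

definition LG_f :: "nat \<Rightarrow> nat \<Rightarrow> real \<Rightarrow> cpair" where
  "LG_f s r t = LG_alpha0 s r (of_real (exp t))"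

definition CritX :: "nat \<Rightarrow> nat \<Rightarrow> (nat \<Rightarrow> nat) \<Rightarrow> cpair set" where
  "CritX s r a = Crit s r a (LG_f s r 0)"

(* Infinitely differentiable on the half-line t <= 0, with one-sided derivatives at 0. *)
definition smooth_on_nonpos :: "(real \<Rightarrow> complex) \<Rightarrow> bool" where
  "smooth_on_nonpos g \<longleftrightarrow> (\<exists>D :: nat \<Rightarrow> real \<Rightarrow> complex. D 0 = g \<and>
     (\<forall>n. \<forall>t\<le>0. (D n has_vector_derivative D (Suc n) t) (at t within {..0})))"

definition solution_curve :: "nat \<Rightarrow> nat \<Rightarrow> (nat \<Rightarrow> nat) \<Rightarrow> (real \<Rightarrow> cpair) \<Rightarrow> bool" where
  "solution_curve s r a c \<longleftrightarrow> (\<forall>t\<le>0. c t \<in> Crit s r a (LG_f s r t))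
     \<and> (\<forall>i\<in>{1..s}. smooth_on_nonpos (\<lambda>t. fst (c t) i))
     \<and> (\<forall>j\<in>{1..r}. smooth_on_nonpos (\<lambda>t. snd (c t) j))"

definition Theta :: "nat \<Rightarrow> nat \<Rightarrow> (nat \<Rightarrow> nat) \<Rightarrow> cpair \<Rightarrow> complex \<times> complex" where
  "Theta s r a = (\<lambda>(z, w). (sgn ((\<Prod>j=1..r. w j ^ a j) / (\<Prod>i=1..s. z i)),
                              sgn (1 / (\<Prod>j=1..r. w j))))"

definition has_label :: "nat \<Rightarrow> nat \<Rightarrow> (nat \<Rightarrow> nat) \<Rightarrow> cpair \<Rightarrow> nat \<times> nat \<Rightarrow> bool" where
  "has_label s r a p = (\<lambda>(k, l). k \<le> s \<and> l \<le> r \<and>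
     (\<exists>c. solution_curve s r a c \<and> c 0 = p \<and>
        ((\<lambda>t. Theta s r a (c t)) \<longlongrightarrow>
           (cis (2 * pi * (real l * (\<Sum>j=1..r. real (a j)) / ((real s + 1) * (real r + 1))
                            + real k / (real s + 1))),
            cis (2 * pi * real l / (real r + 1)))) at_bot))"

definition solution :: "nat \<Rightarrow> nat \<Rightarrow> (nat \<Rightarrow> nat) \<Rightarrow> nat \<times> nat \<Rightarrow> cpair" where
  "solution s r a kl = (THE p. p \<in> CritX s r a \<and> has_label s r a p kl)"


(* Elements of the fundamental group of S based at pathstart g, as sets of loops. *)
definition loop_class :: "cpair set \<Rightarrow> (real \<Rightarrow> cpair) \<Rightarrow> (real \<Rightarrow> cpair) set" where
  "loop_class S g = {h. homotopic_paths S g h}"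

definition continues_to :: "nat \<Rightarrow> nat \<Rightarrow> (nat \<Rightarrow> nat) \<Rightarrow> (real \<Rightarrow> cpair) \<Rightarrow> cpair \<Rightarrow> cpair \<Rightarrow> bool" where
  "continues_to s r a g p q \<longleftrightarrow> (\<exists>h. path h \<and> pathstart h = p \<and> pathfinish h = q \<and>
      (\<forall>\<theta>\<in>{0..1}. h \<theta> \<in> Crit s r a (g \<theta>)))"

definition monodromy :: "nat \<Rightarrow> nat \<Rightarrow> (nat \<Rightarrow> nat) \<Rightarrow> (real \<Rightarrow> cpair) set \<Rightarrow> cpair \<Rightarrow> cpair" where
  "monodromy s r a C p = (THE q. \<exists>g\<in>C. continues_to s r a g p q)"

definition LG_loop :: "nat \<Rightarrow> nat \<Rightarrow> (nat \<Rightarrow> nat) \<times> (nat \<Rightarrow> nat) \<Rightarrow> real \<Rightarrow> real \<Rightarrow> cpair" where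
  "LG_loop s r = (\<lambda>(n, m) t \<theta>.
     (\<lambda>i\<in>{0..s}. (if i = 0 then of_real (exp t) else 1) * exp (2 * of_real pi * \<i> * of_nat (n i) * of_real \<theta>),
      \<lambda>j\<in>{0..r}. exp (2 * of_real pi * \<i> * of_nat (m j) * of_real \<theta>)))"

definition LG_segment :: "nat \<Rightarrow> nat \<Rightarrow> real \<Rightarrow> real \<Rightarrow> cpair" where
  "LG_segment s r t = (\<lambda>\<theta>. LG_alpha0 s r (linepath 1 (of_real (exp t)) \<theta>))"

definition Gamma_class :: "nat \<Rightarrow> nat \<Rightarrow> (nat \<Rightarrow> nat) \<Rightarrow> (nat \<Rightarrow> nat) \<times> (nat \<Rightarrow> nat)
    \<Rightarrow> (real \<Rightarrow> cpair) set" where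
  "Gamma_class s r a nm = (THE C. eventually (\<lambda>t.
      loop_class (LG_space s r - discriminant s r a)
        (LG_segment s r t +++ LG_loop s r nm t +++ reversepath (LG_segment s r t)) = C) at_bot)"

definition deg1 :: "nat \<Rightarrow> nat \<Rightarrow> (nat \<Rightarrow> nat) \<Rightarrow> (nat \<Rightarrow> nat) \<times> (nat \<Rightarrow> nat) \<Rightarrow> int" where
  "deg1 s r a = (\<lambda>(n, m). (\<Sum>i=0..s. int (n i)) - (\<Sum>i=0..r. int (a i) * int (m i)))"

definition deg2 :: "nat \<Rightarrow> (nat \<Rightarrow> nat) \<times> (nat \<Rightarrow> nat) \<Rightarrow> int" where
  "deg2 r = (\<lambda>(n, m). \<Sum>i=0..r. int (m i))"

definition D_plus :: "nat \<Rightarrow> nat \<Rightarrow> (nat \<Rightarrow> nat) \<Rightarrow> nat \<times> nat \<Rightarrow> ((nat \<Rightarrow> nat) \<times> (nat \<Rightarrow> nat)) set" where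
  "D_plus s r a = (\<lambda>(k, l). {nm \<in> ({0..s} \<rightarrow>\<^sub>E UNIV) \<times> ({0..r} \<rightarrow>\<^sub>E UNIV).
      - int k \<le> deg1 s r a nm \<and> deg1 s r a nm \<le> int s - int k \<and>
      0 \<le> deg2 r nm \<and> deg2 r nm \<le> int r - int l})"

definition mon_set :: "nat \<Rightarrow> nat \<Rightarrow> (nat \<Rightarrow> nat) \<Rightarrow> nat \<times> nat \<Rightarrow> nat \<times> nat
    \<Rightarrow> ((nat \<Rightarrow> nat) \<times> (nat \<Rightarrow> nat)) set" where
  "mon_set s r a e1 e2 = {nm \<in> D_plus s r a e1.
      monodromy s r a (Gamma_class s r a nm) (solution s r a e1) = solution s r a e2}"

definition Hom_mon :: "nat \<Rightarrow> nat \<Rightarrow> (nat \<Rightarrow> nat) \<Rightarrow> nat \<times> nat \<Rightarrow> nat \<times> nat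
    \<Rightarrow> (((nat \<Rightarrow> nat) \<times> (nat \<Rightarrow> nat)) \<Rightarrow>\<^sub>0 complex) set" where
  "Hom_mon s r a e1 e2 = {v. Poly_Mapping.keys v \<subseteq> mon_set s r a e1 e2}"

end

theory Submission
  imports Defs "HOL-Complex_Analysis.Complex_Analysis" "HOL-Computational_Algebra.Fundamental_Theorem_Algebra"
begin

text \<open>Both sides of the asserted isomorphism have the same basis: the pairs of exponents \<open>(n, m)\<close> of the
monomials \<open>\<Prod> x_i^n_i \<Prod> y_j^m_j\<close> of bidegree \<open>(k2 - k1, l2 - l1)\<close>, where \<open>x_i\<close> has degree \<open>(1, 0)\<close>
and \<open>y_j\<close> has degree \<open>(- a_j, 1)\<close> (\<open>section_monomials\<close>).

On the algebraic side, dividing the image of a local frame by the frame shows that every homomorphism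
between the two line bundles is multiplication by one function on the cone, regular and equivariant
of bidegree \<open>(k2 - k1, l2 - l1)\<close>. Such a function is a polynomial: as a function of a single coordinate
it is entire, and homogeneity bounds its growth, so that Liouville's theorem applies one coordinate at
a time (\<open>homogeneous_holomorphic_imp_polynomial\<close>, \<open>Hom_bundle_isomorphism\<close>).

On the Landau-Ginzburg side, put \<open>u = \<alpha>_0 \<Prod> w_j^a_j / \<Prod> z_i\<close> and \<open>v = \<beta>_0 / \<Prod> w_j\<close>. The critical
equations become \<open>\<alpha>_i z_i = u\<close> and \<open>\<beta>_j w_j = v - a_j u\<close>, so a critical point is a solution of
\<open>u^(s+1) = A \<Prod> (v - a_j u)^a_j\<close>, \<open>v \<Prod> (v - a_j u) = B\<close>, with
\<open>A = \<Prod> \<alpha>_i / \<Prod> \<beta>_j^a_j\<close> and \<open>B = \<Prod> \<beta>_j\<close>. Hence only the loop described by \<open>(A, B)\<close> matters, and along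
the loop of \<open>(n, m)\<close> it winds \<open>deg1\<close> and \<open>deg2\<close> times around the origin. Substituting \<open>A \<tau>^(s+1)\<close>
for \<open>A\<close> and \<open>\<tau> x\<close> for \<open>u\<close> gives the system \<open>x^(s+1) = A \<Prod> (v - a_j \<tau> x)^a_j\<close>,
\<open>v \<Prod> (v - a_j \<tau> x) = B\<close>, which stays meaningful at \<open>\<tau> = 0\<close>, the limit \<open>t \<rightarrow> -\<infinity>\<close>. There it reads
\<open>x^(s+1) = A v^\<Sigma>a\<close>, \<open>v^(r+1) = B\<close>: its solutions for \<open>A = B = 1\<close> are exactly the labels, and
following them while \<open>A\<close> and \<open>B\<close> run around circles carries the label \<open>(k, l)\<close> to
\<open>(k + deg1, l + deg2)\<close>.

To transport this computation from \<open>\<tau> = 0\<close> to \<open>f_X\<close>, the solutions \<open>(x, v)\<close> have to form a covering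
over the space of \<open>(A, B, \<tau>)\<close> (\<open>covering\<close>). Properness comes from \<open>\<Sum> a_j \<le> s\<close>, which keeps solutions
bounded. Local injectivity amounts to nonvanishing of a Jacobian determinant, and reducedness of the
critical scheme implies it (\<open>reduced_imp_nondegenerate\<close>); conversely, the loops near \<open>\<tau> = 0\<close> avoid the
discriminant because their critical points are as numerous as the ring of functions on the critical
scheme permits (\<open>crit_reduced_if_many_points\<close>). The lifting properties of the covering then
give \<open>monodromy_label\<close>. For \<open>(n, m)\<close> in \<open>D_plus\<close> the target label is in the range where labels are
distinct, so that \<open>mon_set\<close> is the set of monomials of the required bidegree.\<close>

section \<open>Homogeneous holomorphic functions\<close>

definition monomials :: "'i set \<Rightarrow> int \<Rightarrow> ('i \<Rightarrow> nat) set" where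
  "monomials I d = {m \<in> I \<rightarrow>\<^sub>E UNIV. (\<Sum>i\<in>I. int (m i)) = d}"

definition nonzero_vectors :: "'i set \<Rightarrow> ('i \<Rightarrow> complex) set" where
  "nonzero_vectors I = {y \<in> I \<rightarrow>\<^sub>E UNIV. \<exists>i\<in>I. y i \<noteq> 0}"

text \<open>Holomorphy is only ever used on complex affine lines, where the theory of one variable applies. The
condition is imposed at those parameters at which the line avoids the origin.\<close>

definition holomorphic_along_lines :: "'i set \<Rightarrow> (('i \<Rightarrow> complex) \<Rightarrow> complex) \<Rightarrow> bool" where
  "holomorphic_along_lines I f \<longleftrightarrow> (\<forall>y y' \<epsilon>\<^sub>0. (\<lambda>i\<in>I. y i + \<epsilon>\<^sub>0 * y' i) \<in> nonzero_vectors I \<longrightarrow>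
      (\<lambda>\<epsilon>. f (\<lambda>i\<in>I. y i + \<epsilon> * y' i)) field_differentiable at \<epsilon>\<^sub>0)"

lemma monomials_nonneg: "m \<in> monomials I d \<Longrightarrow> d \<ge> 0"
  by (auto simp: monomials_def intro: sum_nonneg)

lemma finite_monomials:
  assumes "finite I" shows "finite (monomials I d)"
proof (rule finite_subset)
  show "monomials I d \<subseteq> I \<rightarrow>\<^sub>E {..nat d}"
  proof
    fix m assume m: "m \<in> monomials I d"
    have "m i \<le> nat d" if "i \<in> I" for i
      using member_le_sum[of i I "\<lambda>i. int (m i)"] that assms m by (auto simp: monomials_def)
    then show "m \<in> I \<rightarrow>\<^sub>E {..nat d}" using m by (auto simp: monomials_def PiE_iff)
  qed
qed (use assms in \<open>auto intro: finite_PiE\<close>)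

text \<open>Lagrange interpolation at the nodes \<open>0, \<dots>, d\<close>. That the coefficients of a polynomial are fixed
linear combinations of its values lets them inherit holomorphy from the values.\<close>

lemma coefficient_from_values:
  fixes d :: nat
  shows "\<exists>L :: nat \<Rightarrow> nat \<Rightarrow> complex. \<forall>c e. e \<le> d \<longrightarrow>
     c e = (\<Sum>j\<le>d. L e j * (\<Sum>k\<le>d. c k * of_nat j ^ k))"
proof -
  \<comment> \<open>The Lagrange basis polynomial that is 1 at the node j and 0 at the other nodes.\<close>
  define lag :: "nat \<Rightarrow> complex poly" where
    "lag j = smult (inverse (\<Prod>i\<in>{..d}-{j}. of_nat j - of_nat i)) (\<Prod>i\<in>{..d}-{j}. [:- of_nat i, 1:])" for j
  have deg: "degree (lag j) \<le> d" if "j \<le> d" for j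
  proof -
    have "degree (\<Prod>i\<in>{..d}-{j}. [:- of_nat i, 1:] :: complex poly) \<le> sum (degree \<circ> (\<lambda>i. [:- of_nat i, 1:] :: complex poly)) ({..d}-{j})"
      by (rule degree_prod_sum_le) auto
    also have "\<dots> = d" using that by simp
    finally show ?thesis unfolding lag_def using degree_smult_le le_trans by blast
  qed
  have val: "poly (lag j) (of_nat i) = (if i = j then 1 else 0)" if "i \<le> d" "j \<le> d" for i j
    using that by (auto simp: lag_def poly_prod prod_zero_iff)
  have "c e = (\<Sum>j\<le>d. coeff (lag j) e * (\<Sum>k\<le>d. c k * of_nat j ^ k))" if "e \<le> d" for c e
  proof -
    define p where "p = (\<Sum>k\<le>d. monom (c k) k)"
    define q where "q = p - (\<Sum>j\<le>d. smult (poly p (of_nat j)) (lag j))"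
    have "q = 0"
    proof (rule ccontr)
      assume "q \<noteq> 0"
      have "degree p \<le> d" unfolding p_def
        by (intro degree_sum_le) (auto intro: order_trans[OF degree_monom_le])
      then have "degree q \<le> d" unfolding q_def
        by (intro degree_diff_le degree_sum_le) (auto intro: order_trans[OF degree_smult_le] deg)
      moreover have "poly q (of_nat i) = 0" if "i \<in> {..d}" for i
      proof -
        from that have "(\<Sum>j\<le>d. poly p (of_nat j) * poly (lag j) (of_nat i)) = (\<Sum>j\<le>d. if j = i then poly p (of_nat i) else 0)"
          by (intro sum.cong) (auto simp: val)
        then show "poly q (of_nat i) = 0" using \<open>i \<in> {..d}\<close>
          by (simp add: q_def poly_sum)
      qed
      then have "of_nat ` {..d} \<subseteq> {x. poly q x = 0}" by auto
      then have "card (of_nat ` {..d} :: complex set) \<le> card {x. poly q x = 0}"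
        using poly_roots_finite[OF \<open>q \<noteq> 0\<close>] card_mono by blast
      moreover have "card (of_nat ` {..d} :: complex set) = Suc d"
        by (simp add: card_image inj_on_def)
      moreover have "card {x. poly q x = 0} \<le> degree q" using \<open>q \<noteq> 0\<close> by (rule card_poly_roots_bound)
      ultimately show False by simp
    qed
    then have "p = (\<Sum>j\<le>d. smult (poly p (of_nat j)) (lag j))" by (simp add: q_def)
    from arg_cong[OF this, of "\<lambda>p. coeff p e"]
    have "coeff p e = (\<Sum>j\<le>d. coeff (lag j) e * poly p (of_nat j))"
      unfolding coeff_sum coeff_smult by (simp only: mult.commute)
    moreover have "coeff p e = c e" using that
      by (simp add: p_def coeff_sum)
    moreover have "poly p x = (\<Sum>k\<le>d. c k * x ^ k)" for x
      by (simp add: p_def poly_sum poly_monom)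
    ultimately show ?thesis by simp
  qed
  then show ?thesis by (intro exI[of _ "\<lambda>e j. coeff (lag j) e"]) simp
qed

lemma poly_function_coeffs_unique:
  fixes c c' :: "nat \<Rightarrow> complex"
  assumes "\<And>z. z \<noteq> 0 \<Longrightarrow> (\<Sum>k\<le>d. c k * z ^ k) = (\<Sum>k\<le>d. c' k * z ^ k)" "k \<le> d"
  shows "c k = c' k"
proof -
  define p where "p = (\<Sum>k\<le>d. monom (c k - c' k) k)"
  have "poly p z = 0" if "z \<noteq> 0" for z
    using assms(1)[OF that] by (simp add: p_def poly_sum poly_monom left_diff_distrib sum_subtractf)
  then have "UNIV - {0} \<subseteq> {z. poly p z = 0}" by auto
  then have "infinite {z. poly p z = 0}"
    using infinite_UNIV_char_0 by (meson finite.emptyI finite_Diff2 finite_insert finite_subset)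
  then have "p = 0" using poly_roots_finite by blast
  then have "coeff p k = 0" by simp
  then show ?thesis using assms(2) by (simp add: p_def coeff_sum)
qed

text \<open>Splits off the exponent of one variable, as in the expansion of a polynomial in powers of that variable.\<close>

lemma sum_monomials_insert:
  fixes F :: "('i \<Rightarrow> nat) \<Rightarrow> complex"
  assumes "finite I" "i0 \<notin> I"
  shows "(\<Sum>m\<in>monomials (insert i0 I) (int d). F m) =
     (\<Sum>e\<le>d. \<Sum>m\<in>monomials I (int (d - e)). F (m(i0 := e)))"
proof -
  have "(\<Sum>e\<le>d. \<Sum>m\<in>monomials I (int (d - e)). F (m(i0 := e))) =
      (\<Sum>(e,m)\<in>(SIGMA e:{..d}. monomials I (int (d - e))). F (m(i0 := e)))"
    by (rule sum.Sigma) (auto intro: finite_monomials assms)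
  also have "\<dots> = (\<Sum>m\<in>monomials (insert i0 I) (int d). F m)"
  proof (rule sum.reindex_bij_witness[where j = "\<lambda>(e,m). m(i0 := e)" and i = "\<lambda>m. (m i0, m(i0 := undefined))"])
    fix x assume x: "x \<in> (SIGMA e:{..d}. monomials I (int (d - e)))"
    obtain e m where x_eq: "x = (e, m)" by (cases x)
    have *: "e \<le> d" "m \<in> monomials I (int (d - e))" using x x_eq by auto
    then have "m i0 = undefined" using assms by (auto simp: monomials_def PiE_iff extensional_def)
    then have "m(i0 := undefined) = m" by auto
    then show "(\<lambda>m. (m i0, m(i0 := undefined))) (case x of (e, m) \<Rightarrow> m(i0 := e)) = x" by (simp add: x_eq)
    have "(\<Sum>i\<in>I. int ((m(i0 := e)) i)) = (\<Sum>i\<in>I. int (m i))"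
      using assms by (intro sum.cong) auto
    then show "(case x of (e, m) \<Rightarrow> m(i0 := e)) \<in> monomials (insert i0 I) (int d)"
      using * assms by (auto simp: monomials_def PiE_iff extensional_def of_nat_diff x_eq)
    show "F (case x of (e, m) \<Rightarrow> m(i0 := e)) = (case x of (e, m) \<Rightarrow> F (m(i0 := e)))" by (simp add: x_eq)
  next
    fix m assume m: "m \<in> monomials (insert i0 I) (int d)"
    have eq: "(\<Sum>i\<in>I. int ((m(i0 := undefined)) i)) = (\<Sum>i\<in>I. int (m i))"
      using assms by (intro sum.cong) auto
    have "int (m i0) + (\<Sum>i\<in>I. int (m i)) = int d"
      using m assms by (auto simp: monomials_def)
    moreover have "0 \<le> (\<Sum>i\<in>I. int (m i))" by (intro sum_nonneg) auto
    ultimately have "m i0 \<le> d" "(\<Sum>i\<in>I. int (m i)) = int (d - m i0)" by linarith+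
    then show "(m i0, m(i0 := undefined)) \<in> (SIGMA e:{..d}. monomials I (int (d - e)))"
      using m assms eq by (auto simp: monomials_def PiE_iff extensional_def)
  qed simp
  finally show ?thesis ..
qed

lemma power_growth_along_ray:
  fixes g h :: "complex \<Rightarrow> complex" and d :: int
  assumes "continuous (at 0) h" and "\<And>z. z \<noteq> 0 \<Longrightarrow> g z = z powi d * h (1 / z)"
  shows "\<exists>A>0. \<exists>B. \<forall>z. norm z \<ge> A \<longrightarrow> norm (g z) \<le> B * norm z powi d"
proof -
  from assms(1) obtain \<delta> where "\<delta> > 0" and \<delta>: "\<And>w. dist w 0 < \<delta> \<Longrightarrow> dist (h w) (h 0) < 1"
    unfolding continuous_at_eps_delta by (metis zero_less_one dist_norm)
  have "norm (g z) \<le> (norm (h 0) + 1) * norm z powi d" if "norm z \<ge> 2 / \<delta>" for z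
  proof -
    have "0 < 2 / \<delta>" using \<open>\<delta> > 0\<close> by simp
    then have "z \<noteq> 0" using that by auto
    have "1 / norm z < \<delta>"
      using that \<open>\<delta> > 0\<close> \<open>z \<noteq> 0\<close> by (simp add: field_simps)
    then have "norm (h (1/z)) \<le> norm (h 0) + 1"
      using \<delta>[of "1/z"] norm_triangle_sub[of "h (1/z)" "h 0"] by (auto simp: dist_norm norm_divide)
    then show ?thesis
      using assms(2)[OF \<open>z \<noteq> 0\<close>] by (simp add: norm_mult norm_power_int mult.commute mult_left_mono)
  qed
  moreover have "2 / \<delta> > 0" using \<open>\<delta> > 0\<close> by simp
  ultimately show ?thesis by blast
qed

text \<open>The equation with \<open>h\<close> says that \<open>g\<close> has at most a pole of order \<open>d\<close> at infinity.\<close>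

lemma entire_power_growth:
  fixes g h :: "complex \<Rightarrow> complex" and d :: int
  assumes "g holomorphic_on UNIV" "continuous (at 0) h"
    and "\<And>z. z \<noteq> 0 \<Longrightarrow> g z = z powi d * h (1 / z)"
  shows "d \<ge> 0 \<Longrightarrow> \<exists>c. \<forall>z. g z = (\<Sum>k\<le>nat d. c k * z ^ k)"
    and "d < 0 \<Longrightarrow> g z = 0"
proof -
  obtain A B where "A > 0" and AB: "\<And>z. norm z \<ge> A \<Longrightarrow> norm (g z) \<le> B * norm z powi d"
    using power_growth_along_ray[OF assms(2,3)] by blast
  show "\<exists>c. \<forall>z. g z = (\<Sum>k\<le>nat d. c k * z ^ k)" if "d \<ge> 0"
  proof (intro exI allI)
    fix z show "g z = (\<Sum>k\<le>nat d. ((deriv ^^ k) g 0 / fact k) * z ^ k)"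
      using Liouville_polynomial[OF assms(1), of A B "nat d" z] AB that
      by (auto simp: power_int_def)
  qed
  show "g z = 0" if "d < 0"
  proof -
    have "(g \<longlongrightarrow> 0) at_infinity"
    proof (rule Lim_null_comparison)
      show "\<forall>\<^sub>F z in at_infinity. norm (g z) \<le> B * inverse (norm z ^ nat (- d))"
        unfolding eventually_at_infinity using AB that
        by (auto simp: power_int_def power_inverse intro!: exI[of _ A])
      have "((\<lambda>z::complex. inverse (norm z ^ nat (- d))) \<longlongrightarrow> 0) at_infinity"
        using that by (intro tendsto_inverse_0_at_top filterlim_pow_at_top filterlim_norm_at_top) auto
      then show "((\<lambda>z::complex. B * inverse (norm z ^ nat (- d))) \<longlongrightarrow> 0) at_infinity"
        by (rule tendsto_mult_right_zero)
    qed
    then show ?thesis using Liouville_weak_0[OF assms(1)] by blast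
  qed
qed

text \<open>The key step on the algebraic side. By homogeneity, \<open>F(y, z) = z^d F(y / z, 1)\<close> for a distinguished
coordinate \<open>z\<close>, so \<open>F\<close> grows at most like \<open>z^d\<close> and is a polynomial in \<open>z\<close> by Liouville's theorem. Its
coefficients are homogeneous functions of the other coordinates, to which induction applies. This
requires the other coordinates not to vanish simultaneously; the remaining points are reached by
continuity. In one variable the argument breaks down, since \<open>z powi d\<close> is holomorphic on nonzero
vectors even for negative \<open>d\<close>.

The parameter \<open>t\<close> and the class \<open>A\<close>, closed under linear combinations, record how the coefficients
depend on further variables. They allow the result to be applied first in one group of variables
and then to the coefficients in the other.\<close>

lemma homogeneous_holomorphic_imp_polynomial:
  fixes I :: "'i set" and d :: int and F :: "'t \<Rightarrow> ('i \<Rightarrow> complex) \<Rightarrow> complex"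
    and T :: "'t set" and A :: "('t \<Rightarrow> complex) set"
  assumes "finite I" "I \<noteq> {}" "card I = 1 \<Longrightarrow> d \<ge> 0"
    and "\<And>t y c. t \<in> T \<Longrightarrow> y \<in> nonzero_vectors I \<Longrightarrow> c \<noteq> 0 \<Longrightarrow> F t (\<lambda>i\<in>I. c * y i) = c powi d * F t y"
    and "\<And>t. t \<in> T \<Longrightarrow> card I \<ge> 2 \<Longrightarrow> holomorphic_along_lines I (F t)"
    and "\<And>y. y \<in> nonzero_vectors I \<Longrightarrow> (\<lambda>t. F t y) \<in> A"
    and Alin: "\<And>(J::nat set) c f. finite J \<Longrightarrow> (\<And>j. j \<in> J \<Longrightarrow> f j \<in> A) \<Longrightarrow> (\<lambda>t. \<Sum>j\<in>J. c j * f j t) \<in> A"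
  shows "\<exists>g. (\<forall>m. g m \<in> A) \<and> (\<forall>t\<in>T. \<forall>y\<in>nonzero_vectors I.
            F t y = (\<Sum>m\<in>monomials I d. g m t * (\<Prod>i\<in>I. y i ^ m i)))"
  using assms(1-6)
proof (induction I arbitrary: F d rule: finite_ne_induct)
  case (singleton i0)
  then have "d \<ge> 0" by simp
  have mons: "monomials {i0} d = {\<lambda>i\<in>{i0}. nat d}"
    using \<open>d \<ge> 0\<close> by (auto simp: monomials_def PiE_iff extensional_def fun_eq_iff)
  define e where "e = (\<lambda>i\<in>{i0}. 1 :: complex)"
  have e: "e \<in> nonzero_vectors {i0}" by (auto simp: e_def nonzero_vectors_def)
  show ?case
  proof (intro exI[of _ "\<lambda>m t. F t e"] conjI allI ballI)
    show "(\<lambda>t. F t e) \<in> A" using singleton(4)[OF e] .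
    fix t y assume "t \<in> T" and y: "y \<in> nonzero_vectors {i0}"
    then have "y i0 \<noteq> 0" by (auto simp: nonzero_vectors_def)
    then have "F t (\<lambda>i\<in>{i0}. y i0 * e i) = y i0 powi d * F t e" using singleton(2) \<open>t \<in> T\<close> e by blast
    moreover have "(\<lambda>i\<in>{i0}. y i0 * e i) = y"
      using y by (auto simp: e_def nonzero_vectors_def PiE_iff extensional_def fun_eq_iff)
    ultimately show "F t y = (\<Sum>m\<in>monomials {i0} d. F t e * (\<Prod>i\<in>{i0}. y i ^ m i))"
      using \<open>d \<ge> 0\<close> by (simp add: mons power_int_def)
  qed
next
  case (insert i0 I)
  let ?I = "insert i0 I"
  have "card ?I \<ge> 2"
    using insert.hyps by (simp add: Suc_le_eq card_gt_0_iff)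
  note hom = insert.prems(2) and hol = insert.prems(3)[OF _ \<open>card ?I \<ge> 2\<close>] and FA = insert.prems(4)
  have upd: "y(i0 := z) \<in> nonzero_vectors ?I" if "y \<in> nonzero_vectors I" for y z
    using that insert.hyps by (auto simp: nonzero_vectors_def PiE_iff extensional_def)
  have line: "(\<lambda>\<epsilon>. F t (\<lambda>i\<in>?I. y i + \<epsilon> * y' i)) field_differentiable at \<epsilon>\<^sub>0"
    if "t \<in> T" "(\<lambda>i\<in>?I. y i + \<epsilon>\<^sub>0 * y' i) \<in> nonzero_vectors ?I" for t y y' \<epsilon>\<^sub>0
    using hol that unfolding holomorphic_along_lines_def by blast
  have entire: "(\<lambda>z. F t (y(i0 := z))) holomorphic_on UNIV" if "t \<in> T" "y \<in> nonzero_vectors I" for t y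
  proof -
    have eq: "(\<lambda>i\<in>?I. (y(i0 := 0)) i + z * (if i = i0 then 1 else 0)) = y(i0 := z)" for z
      using that insert.hyps by (auto simp: nonzero_vectors_def PiE_iff extensional_def fun_eq_iff)
    show ?thesis
      using line[OF \<open>t \<in> T\<close>, of "y(i0 := 0)" _ "\<lambda>i. if i = i0 then 1 else 0"] upd[OF that(2)]
      unfolding eq holomorphic_on_def by (auto intro: field_differentiable_at_within)
  qed
  have growth: "\<exists>h. continuous (at 0) h \<and> (\<forall>z. z \<noteq> 0 \<longrightarrow> F t (y(i0 := z)) = z powi d * h (1 / z))"
    if "t \<in> T" "y \<in> nonzero_vectors I" for t y
  proof (intro exI conjI allI impI)
    let ?y = "\<lambda>z. \<lambda>i\<in>?I. (if i = i0 then 1 else 0) + z * (y(i0 := 0)) i"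
    have nz: "?y z \<in> nonzero_vectors ?I" for z by (auto simp: nonzero_vectors_def)
    show "continuous (at 0) (\<lambda>z. F t (?y z))"
      using line[OF \<open>t \<in> T\<close> nz] by (rule field_differentiable_imp_continuous_at)
    fix z :: complex assume "z \<noteq> 0"
    have "(\<lambda>i\<in>?I. z * ?y (1/z) i) = y(i0 := z)"
      using that insert.hyps \<open>z \<noteq> 0\<close> by (auto simp: nonzero_vectors_def PiE_iff extensional_def fun_eq_iff)
    moreover have "F t (\<lambda>i\<in>?I. z * ?y (1/z) i) = z powi d * F t (?y (1 / z))"
      by (rule hom[OF \<open>t \<in> T\<close> nz \<open>z \<noteq> 0\<close>])
    ultimately show "F t (y(i0 := z)) = z powi d * F t (?y (1 / z))" by (simp only:)
  qed
  \<comment> \<open>The expansion at points whose coordinates in I do not all vanish.\<close>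
  have generic: "\<exists>g. (\<forall>m. g m \<in> A) \<and> (\<forall>t\<in>T. \<forall>y. \<forall>z. y \<in> nonzero_vectors I \<longrightarrow>
      F t (y(i0 := z)) = (\<Sum>m\<in>monomials ?I d. g m t * (\<Prod>i\<in>?I. (y(i0 := z)) i ^ m i)))"
  proof (cases "d \<ge> 0")
    case False
    have "monomials ?I d = {}" using False monomials_nonneg by fastforce
    moreover have "F t (y(i0 := z)) = 0" if ty: "t \<in> T" "y \<in> nonzero_vectors I" for t y z
    proof -
      obtain h where "continuous (at 0) h" "\<And>z. z \<noteq> 0 \<Longrightarrow> F t (y(i0 := z)) = z powi d * h (1 / z)"
        using growth[OF ty] by auto
      from entire_power_growth(2)[OF entire[OF ty] this] False show ?thesis by simp
    qed
    moreover have "(\<lambda>t. 0) \<in> A" using Alin[of "{}"] by simp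
    ultimately show ?thesis by (intro exI[of _ "\<lambda>m t. 0"]) auto
  next
    case True
    define n where "n = nat d"
    have d: "d = int n" using True by (simp add: n_def)
    obtain L where L: "\<And>c e. e \<le> n \<Longrightarrow> c e = (\<Sum>j\<le>n. L e j * (\<Sum>k\<le>n. c k * of_nat j ^ k :: complex))"
      using coefficient_from_values[of n] by metis
    \<comment> \<open>The coefficient of z^e, written as a linear combination of values.\<close>
    define C where "C e t y = (\<Sum>j\<le>n. L e j * F t (y(i0 := of_nat j)))" for e t y
    have expand: "F t (y(i0 := z)) = (\<Sum>e\<le>n. C e t y * z ^ e)"
      if t: "t \<in> T" and y: "y \<in> nonzero_vectors I" for t y z
    proof -
      obtain h where "continuous (at 0) h" "\<And>z. z \<noteq> 0 \<Longrightarrow> F t (y(i0 := z)) = z powi d * h (1 / z)"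
        using growth[OF t y] by auto
      from entire_power_growth(1)[OF entire[OF t y] this True]
      obtain c where c: "\<And>z. F t (y(i0 := z)) = (\<Sum>k\<le>n. c k * z ^ k)" by (auto simp: n_def)
      have "C e t y = c e" if "e \<le> n" for e unfolding C_def c L[OF that, of c] ..
      then show ?thesis by (simp add: c)
    qed
    let ?P = "\<lambda>e g. (\<forall>m. g m \<in> A) \<and> (\<forall>t\<in>T. \<forall>y\<in>nonzero_vectors I.
            C e t y = (\<Sum>m\<in>monomials I (int (n - e)). g m t * (\<Prod>i\<in>I. y i ^ m i)))"
    have "\<exists>g. ?P e g" if "e \<le> n" for e
    proof (rule insert.IH)
      show "int (n - e) \<ge> 0" by simp
    next
      fix t y and c :: complex assume t: "t \<in> T" and y: "y \<in> nonzero_vectors I" and "c \<noteq> 0"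
      let ?y = "\<lambda>i\<in>I. c * y i"
      have cy: "?y \<in> nonzero_vectors I"
        using y \<open>c \<noteq> 0\<close> by (auto simp: nonzero_vectors_def)
      \<comment> \<open>Comparing coefficients of z^e in the homogeneity relation of F.\<close>
      have "C e t ?y * c ^ e = c ^ n * C e t y"
      proof (rule poly_function_coeffs_unique[OF _ \<open>e \<le> n\<close>])
        fix z :: complex
        have "?y(i0 := c * z) = (\<lambda>i\<in>?I. c * (y(i0 := z)) i)"
          using insert.hyps by (auto simp: fun_eq_iff)
        moreover have "F t (\<lambda>i\<in>?I. c * (y(i0 := z)) i) = c powi int n * F t (y(i0 := z))"
          using hom[OF t upd[OF y] \<open>c \<noteq> 0\<close>] unfolding d .
        ultimately have "F t (?y(i0 := c * z)) = c ^ n * F t (y(i0 := z))"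
          by (simp only: power_int_of_nat)
        then show "(\<Sum>k\<le>n. C k t ?y * c ^ k * z ^ k) = (\<Sum>k\<le>n. c ^ n * C k t y * z ^ k)"
          unfolding expand[OF t y] expand[OF t cy]
          by (simp add: power_mult_distrib mult.assoc sum_distrib_left)
      qed
      moreover have "c ^ n = c ^ (n - e) * c ^ e" using \<open>e \<le> n\<close> by (simp flip: power_add)
      ultimately show "C e t ?y = c powi int (n - e) * C e t y" using \<open>c \<noteq> 0\<close> by simp
    next
      fix t assume t: "t \<in> T"
      show "holomorphic_along_lines I (C e t)" unfolding holomorphic_along_lines_def
      proof (intro allI impI)
        fix y y' \<epsilon>\<^sub>0 assume nz: "(\<lambda>i\<in>I. y i + \<epsilon>\<^sub>0 * y' i) \<in> nonzero_vectors I"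
        have eq: "(\<lambda>i\<in>?I. (y(i0 := z)) i + \<epsilon> * (y'(i0 := 0)) i) = (\<lambda>i\<in>I. y i + \<epsilon> * y' i)(i0 := z)" for \<epsilon> z
          using insert.hyps by (auto simp: fun_eq_iff)
        show "(\<lambda>\<epsilon>. C e t (\<lambda>i\<in>I. y i + \<epsilon> * y' i)) field_differentiable at \<epsilon>\<^sub>0"
          unfolding C_def
          using line[OF t, of "y(i0 := _)" _ "y'(i0 := 0)"] upd[OF nz]
          unfolding eq by (intro field_differentiable_sum field_differentiable_mult field_differentiable_const) auto
      qed
    next
      fix y assume y: "y \<in> nonzero_vectors I"
      show "(\<lambda>t. C e t y) \<in> A" unfolding C_def by (intro Alin FA upd y) simp
    qed
    then have "\<forall>e. \<exists>g. e \<le> n \<longrightarrow> ?P e g" by blast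
    from choice[OF this] obtain G where G0: "\<forall>e. e \<le> n \<longrightarrow> ?P e (G e)" ..
    have G1: "?P e (G e)" if "e \<le> n" for e using that by (rule mp[OF spec[OF G0]])
    have GA: "G e m \<in> A" if "e \<le> n" for e m using conjunct1[OF G1[OF that]] by (rule spec)
    have G: "C e t y = (\<Sum>m\<in>monomials I (int (n - e)). G e m t * (\<Prod>i\<in>I. y i ^ m i))"
      if "e \<le> n" "t \<in> T" "y \<in> nonzero_vectors I" for e t y
      by (rule conjunct2[OF G1[OF that(1)], rule_format, OF that(2,3)])
    define g where "g m = (if m i0 \<le> n then G (m i0) (m(i0 := undefined)) else (\<lambda>t. 0))" for m
    have "(\<lambda>t. 0) \<in> A" using Alin[of "{}"] by simp
    then have "g m \<in> A" for m using GA by (auto simp: g_def)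
    moreover have "F t (y(i0 := z)) = (\<Sum>m\<in>monomials ?I d. g m t * (\<Prod>i\<in>?I. (y(i0 := z)) i ^ m i))"
      if t: "t \<in> T" and y: "y \<in> nonzero_vectors I" for t y z
    proof -
      have "(\<Sum>m\<in>monomials ?I d. g m t * (\<Prod>i\<in>?I. (y(i0 := z)) i ^ m i)) =
         (\<Sum>e\<le>n. \<Sum>m\<in>monomials I (int (n - e)). g (m(i0 := e)) t * (\<Prod>i\<in>?I. (y(i0 := z)) i ^ (m(i0 := e)) i))"
        unfolding d by (rule sum_monomials_insert) (use insert.hyps in auto)
      also have "\<dots> = (\<Sum>e\<le>n. C e t y * z ^ e)"
      proof (rule sum.cong[OF refl])
        fix e assume e: "e \<in> {..n}"
        have "g (m(i0 := e)) t * (\<Prod>i\<in>?I. (y(i0 := z)) i ^ (m(i0 := e)) i) =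
            G e m t * (\<Prod>i\<in>I. y i ^ m i) * z ^ e" if m: "m \<in> monomials I (int (n - e))" for m
        proof -
          have "m(i0 := undefined) = m"
            using m insert.hyps by (auto simp: monomials_def PiE_iff extensional_def)
          moreover have "(\<Prod>i\<in>I. (y(i0 := z)) i ^ (m(i0 := e)) i) = (\<Prod>i\<in>I. y i ^ m i)"
            using insert.hyps by (intro prod.cong) auto
          ultimately show ?thesis using e insert.hyps by (simp add: g_def)
        qed
        then show "(\<Sum>m\<in>monomials I (int (n - e)). g (m(i0 := e)) t * (\<Prod>i\<in>?I. (y(i0 := z)) i ^ (m(i0 := e)) i))
             = C e t y * z ^ e"
          using e by (simp add: G[OF _ t y] sum_distrib_right)
      qed
      also have "\<dots> = F t (y(i0 := z))" using expand[OF t y] by simp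
      finally show ?thesis ..
    qed
    ultimately show ?thesis by blast
  qed
  then obtain g where gA: "\<And>m. g m \<in> A" and
    g: "\<And>t y z. t \<in> T \<Longrightarrow> y \<in> nonzero_vectors I \<Longrightarrow>
      F t (y(i0 := z)) = (\<Sum>m\<in>monomials ?I d. g m t * (\<Prod>i\<in>?I. (y(i0 := z)) i ^ m i))" by blast
  define R where "R t y = (\<Sum>m\<in>monomials ?I d. g m t * (\<Prod>i\<in>?I. y i ^ m i))" for t y
  obtain i1 where "i1 \<in> I" using insert.hyps by auto
  have "F t y = R t y" if t: "t \<in> T" and y: "y \<in> nonzero_vectors ?I" for t y
  proof (cases "restrict y I \<in> nonzero_vectors I")
    case True
    have "(restrict y I)(i0 := y i0) = y"
      using y by (auto simp: nonzero_vectors_def PiE_iff extensional_def fun_eq_iff)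
    then show ?thesis using g[OF t True, of "y i0"] by (simp add: R_def)
  next
    case False
    \<comment> \<open>A line through y that leaves the exceptional locus immediately.\<close>
    let ?y = "\<lambda>\<epsilon>. \<lambda>i\<in>?I. y i + \<epsilon> * (if i = i1 then 1 else 0)"
    have y0: "?y 0 = y" using y by (auto simp: nonzero_vectors_def PiE_iff extensional_def fun_eq_iff)
    have "F t (?y \<epsilon>) = R t (?y \<epsilon>)" if "\<epsilon> \<noteq> 0" for \<epsilon>
    proof -
      have "y i1 = 0" using False \<open>i1 \<in> I\<close> by (auto simp: nonzero_vectors_def)
      then have "restrict (?y \<epsilon>) I \<in> nonzero_vectors I"
        using that \<open>i1 \<in> I\<close> by (auto simp: nonzero_vectors_def intro!: bexI[of _ i1])
      moreover have "(restrict (?y \<epsilon>) I)(i0 := ?y \<epsilon> i0) = ?y \<epsilon>" by (auto simp: fun_eq_iff)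
      ultimately show ?thesis using g[OF t, of "restrict (?y \<epsilon>) I" "?y \<epsilon> i0"] by (simp add: R_def)
    qed
    then have lim0: "((\<lambda>\<epsilon>. F t (?y \<epsilon>) - R t (?y \<epsilon>)) \<longlongrightarrow> 0) (at 0)"
      by (intro tendsto_eventually) (simp add: eventually_at_filter)
    have "isCont (\<lambda>\<epsilon>. F t (?y \<epsilon>) - R t (?y \<epsilon>)) 0"
    proof (intro continuous_intros)
      show "isCont (\<lambda>\<epsilon>. F t (?y \<epsilon>)) 0"
        using line[OF t, of y 0 "\<lambda>i. if i = i1 then 1 else 0"] y unfolding y0
        by (intro field_differentiable_imp_continuous_at) auto
      show "isCont (\<lambda>\<epsilon>. R t (?y \<epsilon>)) 0" unfolding R_def restrict_def
        by (intro continuous_intros) auto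
    qed
    then have "((\<lambda>\<epsilon>. F t (?y \<epsilon>) - R t (?y \<epsilon>)) \<longlongrightarrow> F t (?y 0) - R t (?y 0)) (at 0)"
      by (simp add: isCont_def)
    then have "F t (?y 0) - R t (?y 0) = 0"
      by (rule tendsto_unique[OF at_neq_bot]) (rule lim0)
    then show ?thesis unfolding y0 by simp
  qed
  then show ?case using gA by (auto simp: R_def)
qed

text \<open>It suffices to test on the torus, because a polynomial in one variable vanishing at all nonzero points
is zero.\<close>

lemma monomials_independent:
  fixes c :: "('i \<Rightarrow> nat) \<Rightarrow> complex"
  assumes "finite I" "finite M" "M \<subseteq> I \<rightarrow>\<^sub>E UNIV"
    and "\<And>y. y \<in> (I \<rightarrow>\<^sub>E - {0}) \<Longrightarrow> (\<Sum>m\<in>M. c m * (\<Prod>i\<in>I. y i ^ m i)) = 0"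
    and "m \<in> M"
  shows "c m = 0"
  using assms
proof (induction I arbitrary: M c m rule: finite_induct)
  case empty
  then have "M = {\<lambda>x. undefined}" "m = (\<lambda>x. undefined)" by auto
  then show ?case using empty(3)[of "\<lambda>x. undefined"] by simp
next
  case (insert i0 I)
  obtain n where n: "\<And>m. m \<in> M \<Longrightarrow> m i0 \<le> n"
    using finite_nat_set_iff_bounded_le[of "(\<lambda>m. m i0) ` M"] insert.prems(1) by auto
  let ?M = "\<lambda>e. {m \<in> M. m i0 = e}"
  let ?r = "\<lambda>m. m(i0 := undefined)"
  have inj: "inj_on ?r (?M e)" for e
    by (rule inj_onI) (metis (mono_tags, lifting) fun_upd_triv fun_upd_upd mem_Collect_eq)
  define e where "e = m i0"
  have "c ((?r m)(i0 := e)) = 0"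
  proof (rule insert.IH[of "?r ` ?M e" "\<lambda>m. c (m(i0 := e))"])
    show "finite (?r ` ?M e)" using insert.prems(1) by simp
    show "?r ` ?M e \<subseteq> I \<rightarrow>\<^sub>E UNIV"
      using insert.prems(2) by (auto simp: PiE_iff extensional_def)
    show "?r m \<in> ?r ` ?M e" using insert.prems(4) by (auto simp: e_def)
    fix y assume y: "y \<in> (I \<rightarrow>\<^sub>E - {0 :: complex})"
    let ?a = "\<lambda>e. \<Sum>m\<in>?M e. c m * (\<Prod>i\<in>I. y i ^ m i)"
    have "?a e = 0"
    proof (rule poly_function_coeffs_unique)
      show "e \<le> n" using n insert.prems(4) by (simp add: e_def)
      fix z :: complex assume "z \<noteq> 0"
      then have "y(i0 := z) \<in> (insert i0 I \<rightarrow>\<^sub>E - {0})"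
        using y by (auto simp: PiE_iff extensional_def)
      from insert.prems(3)[OF this]
      have "0 = (\<Sum>m\<in>M. c m * (\<Prod>i\<in>I. y i ^ m i) * z ^ m i0)"
      proof -
        have "(\<Prod>i\<in>I. (y(i0 := z)) i ^ m i) = (\<Prod>i\<in>I. y i ^ m i)" for m :: "'i \<Rightarrow> nat"
          using insert.hyps by (intro prod.cong) auto
        then show ?thesis using insert.prems(3)[OF \<open>y(i0 := z) \<in> _\<close>] insert.hyps
          by (simp add: mult_ac)
      qed
      also have "\<dots> = (\<Sum>e\<le>n. \<Sum>m\<in>?M e. c m * (\<Prod>i\<in>I. y i ^ m i) * z ^ m i0)"
        using insert.prems(1) n by (intro sum.group[symmetric]) auto
      also have "\<dots> = (\<Sum>e\<le>n. ?a e * z ^ e)"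
        by (intro sum.cong refl) (simp add: sum_distrib_right)
      finally show "(\<Sum>k\<le>n. ?a k * z ^ k) = (\<Sum>k\<le>n. 0 * z ^ k)" by simp
    qed
    also have "?a e = (\<Sum>m\<in>?M e. c ((?r m)(i0 := e)) * (\<Prod>i\<in>I. y i ^ (?r m) i))"
    proof (intro sum.cong refl arg_cong2[where f = "(*)"] prod.cong arg_cong[where f = c])
      fix m assume "m \<in> ?M e" then show "m = (?r m)(i0 := e)" by auto
    next
      fix m i assume "i \<in> I" then show "y i ^ m i = y i ^ (?r m) i" using insert.hyps by auto
    qed
    also have "\<dots> = (\<Sum>m\<in>?r ` ?M e. c (m(i0 := e)) * (\<Prod>i\<in>I. y i ^ m i))"
      by (subst sum.reindex[OF inj]) simp
    finally show "(\<Sum>m\<in>?r ` ?M e. c (m(i0 := e)) * (\<Prod>i\<in>I. y i ^ m i)) = 0" .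
  qed
  then show ?case by (simp add: e_def)
qed

section \<open>Homomorphisms between the line bundles\<close>

lemma mem_cone_iff: "(x, y) \<in> cone s r \<longleftrightarrow> x \<in> nonzero_vectors {0..s} \<and> y \<in> nonzero_vectors {0..r}"
  by (auto simp: cone_def nonzero_vectors_def)

lemma torus_act_in_cone:
  "p \<in> cone s r \<Longrightarrow> c \<noteq> 0 \<Longrightarrow> \<mu> \<noteq> 0 \<Longrightarrow> torus_act s r a c \<mu> p \<in> cone s r"
  by (fastforce simp: cone_def torus_act_def)

lemma torus_act_torus_act:
  "torus_act s r a c \<mu> (torus_act s r a c' \<mu>' p) = torus_act s r a (c * c') (\<mu> * \<mu>') p"
  by (auto simp: torus_act_def fun_eq_iff field_simps)

lemma torus_act_one: "p \<in> cone s r \<Longrightarrow> torus_act s r a 1 1 p = p"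
  by (auto simp: torus_act_def cone_def PiE_iff extensional_def fun_eq_iff)

lemma equiv_orbit_rel: "equiv (cone s r) (orbit_rel s r a)"
proof (rule equivI)
  show "orbit_rel s r a \<subseteq> cone s r \<times> cone s r" by (auto simp: orbit_rel_def)
  show "refl_on (cone s r) (orbit_rel s r a)"
    by (rule refl_onI) (auto simp: orbit_rel_def intro!: exI[of _ 1] simp: torus_act_one)
  show "sym (orbit_rel s r a)"
  proof (rule symI)
    fix p q assume "(p, q) \<in> orbit_rel s r a"
    then obtain c \<mu> where *: "p \<in> cone s r" "q \<in> cone s r" "c \<noteq> 0" "\<mu> \<noteq> 0" "q = torus_act s r a c \<mu> p"
      by (auto simp: orbit_rel_def)
    then have "p = torus_act s r a (1/c) (1/\<mu>) q" by (simp add: torus_act_torus_act torus_act_one)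
    then show "(q, p) \<in> orbit_rel s r a" using *
      unfolding orbit_rel_def by (intro CollectI case_prodI conjI exI[of _ "1/c"] exI[of _ "1/\<mu>"]) auto
  qed
  show "trans (orbit_rel s r a)"
  proof (rule transI)
    fix p q t assume "(p, q) \<in> orbit_rel s r a" "(q, t) \<in> orbit_rel s r a"
    then obtain c \<mu> c' \<mu>' where *: "p \<in> cone s r" "t \<in> cone s r" "c \<noteq> 0" "\<mu> \<noteq> 0" "q = torus_act s r a c \<mu> p"
        "c' \<noteq> 0" "\<mu>' \<noteq> 0" "t = torus_act s r a c' \<mu>' q"
      by (auto simp: orbit_rel_def)
    then have "t = torus_act s r a (c' * c) (\<mu>' * \<mu>) p" by (simp add: torus_act_torus_act)
    then show "(p, t) \<in> orbit_rel s r a" using *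
      unfolding orbit_rel_def by (intro CollectI case_prodI conjI exI[of _ "c' * c"] exI[of _ "\<mu>' * \<mu>"]) auto
  qed
qed

lemma Union_bundle_subset: "U \<subseteq> bundle_points s r a \<Longrightarrow> \<Union>U \<subseteq> cone s r"
  using Union_quotient[OF equiv_orbit_rel, of s r a] unfolding bundle_points_def by blast

lemma Union_bundle_points: "\<Union>(bundle_points s r a) = cone s r"
  unfolding bundle_points_def by (rule Union_quotient[OF equiv_orbit_rel])

lemma Union_bundle_invariant:
  assumes "U \<subseteq> bundle_points s r a" "p \<in> \<Union>U" "c \<noteq> 0" "\<mu> \<noteq> 0"
  shows "torus_act s r a c \<mu> p \<in> \<Union>U"
proof -
  obtain X where X: "X \<in> U" "p \<in> X" using assms by auto
  have "p \<in> cone s r" using Union_bundle_subset[OF assms(1)] assms(2) by blast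
  then have "(p, torus_act s r a c \<mu> p) \<in> orbit_rel s r a"
    using torus_act_in_cone[OF _ assms(3,4)] assms(3,4) by (auto simp: orbit_rel_def)
  then have "torus_act s r a c \<mu> p \<in> X"
    using in_quotient_imp_closed[OF equiv_orbit_rel, of X s r a] X assms(1) unfolding bundle_points_def by blast
  then show ?thesis using X by blast
qed

lemma Union_bundle_Int:
  assumes "U \<subseteq> bundle_points s r a" "V \<subseteq> bundle_points s r a"
  shows "\<Union>(U \<inter> V) = \<Union>U \<inter> \<Union>V"
proof
  show "\<Union>U \<inter> \<Union>V \<subseteq> \<Union>(U \<inter> V)"
  proof
    fix p assume "p \<in> \<Union>U \<inter> \<Union>V"
    then obtain X Y where *: "X \<in> U" "Y \<in> V" "p \<in> X" "p \<in> Y" by auto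
    then have "X = Y" using quotient_disj[OF equiv_orbit_rel, of X s r a Y] assms unfolding bundle_points_def by blast
    then show "p \<in> \<Union>(U \<inter> V)" using * by blast
  qed
qed blast

lemma zariski_open_cone_Int:
  assumes "zariski_open_cone s r V" "zariski_open_cone s r W"
  shows "zariski_open_cone s r (V \<inter> W)"
proof -
  obtain S S' where S: "S \<subseteq> polyfun s r" "V = {p \<in> cone s r. \<exists>P\<in>S. P p \<noteq> 0}"
    and S': "S' \<subseteq> polyfun s r" "W = {p \<in> cone s r. \<exists>P\<in>S'. P p \<noteq> 0}"
    using assms unfolding zariski_open_cone_def by blast
  show ?thesis unfolding zariski_open_cone_def
    by (intro exI[of _ "{\<lambda>p. P p * Q p | P Q. P \<in> S \<and> Q \<in> S'}"])
       (use S S' in \<open>fastforce intro: polyfun.mult\<close>)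
qed

lemma bundle_open_Int:
  "bundle_open s r a U \<Longrightarrow> bundle_open s r a V \<Longrightarrow> bundle_open s r a (U \<inter> V)"
  unfolding bundle_open_def by (auto simp: Union_bundle_Int zariski_open_cone_Int)

lemma bundle_open_points: "bundle_open s r a (bundle_points s r a)"
  unfolding bundle_open_def Union_bundle_points zariski_open_cone_def
  by (intro conjI exI[of _ "{\<lambda>p. 1}"]) (auto intro: polyfun.const)

definition coordinate_chart :: "nat \<Rightarrow> nat \<Rightarrow> (nat \<Rightarrow> nat) \<Rightarrow> nat \<Rightarrow> nat \<Rightarrow> cpair set set" where
  "coordinate_chart s r a i j = {X \<in> bundle_points s r a. \<forall>p\<in>X. fst p i \<noteq> 0 \<and> snd p j \<noteq> 0}"

lemma Union_coordinate_chart: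
  assumes "i \<le> s" "j \<le> r"
  shows "\<Union>(coordinate_chart s r a i j) = {p \<in> cone s r. fst p i \<noteq> 0 \<and> snd p j \<noteq> 0}"
proof
  show "\<Union>(coordinate_chart s r a i j) \<subseteq> {p \<in> cone s r. fst p i \<noteq> 0 \<and> snd p j \<noteq> 0}"
    using Union_bundle_points[of s r a] by (auto simp: coordinate_chart_def)
  show "{p \<in> cone s r. fst p i \<noteq> 0 \<and> snd p j \<noteq> 0} \<subseteq> \<Union>(coordinate_chart s r a i j)"
  proof
    fix p assume p: "p \<in> {p \<in> cone s r. fst p i \<noteq> 0 \<and> snd p j \<noteq> 0}"
    let ?X = "orbit_rel s r a `` {p}"
    have "?X \<in> bundle_points s r a" using p unfolding bundle_points_def by (auto intro: quotientI)
    moreover have "\<forall>q\<in>?X. fst q i \<noteq> 0 \<and> snd q j \<noteq> 0"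
      using p assms by (auto simp: orbit_rel_def torus_act_def)
    moreover have "p \<in> ?X" using p equiv_class_self[OF equiv_orbit_rel] by blast
    ultimately show "p \<in> \<Union>(coordinate_chart s r a i j)" by (auto simp: coordinate_chart_def)
  qed
qed

lemma bundle_open_coordinate_chart:
  assumes "i \<le> s" "j \<le> r"
  shows "bundle_open s r a (coordinate_chart s r a i j)"
  unfolding bundle_open_def Union_coordinate_chart[OF assms] zariski_open_cone_def
  using assms
  by (intro conjI exI[of _ "{\<lambda>p. fst p i * snd p j}"])
     (auto simp: coordinate_chart_def intro: polyfun.intros)

lemma regular_onE:
  assumes "regular_on s r W F" "p \<in> W"
  obtains V P Q where "zariski_open_cone s r V" "p \<in> V" "V \<subseteq> W" "P \<in> polyfun s r" "Q \<in> polyfun s r"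
    "\<And>q. q \<in> V \<Longrightarrow> Q q \<noteq> 0" "\<And>q. q \<in> V \<Longrightarrow> F q = P q / Q q"
  using assms unfolding regular_on_def by metis

lemma regular_onI:
  assumes "\<And>p. p \<in> W \<Longrightarrow> \<exists>V P Q. zariski_open_cone s r V \<and> p \<in> V \<and> V \<subseteq> W \<and> P \<in> polyfun s r
     \<and> Q \<in> polyfun s r \<and> (\<forall>q\<in>V. Q q \<noteq> 0 \<and> F q = P q / Q q)"
  shows "regular_on s r W F"
  using assms unfolding regular_on_def by blast

lemma regular_on_add:
  assumes "regular_on s r W F" "regular_on s r W G"
  shows "regular_on s r W (\<lambda>p. F p + G p)"
proof (rule regular_onI)
  fix p assume p: "p \<in> W"
  obtain V P Q where 1: "zariski_open_cone s r V" "p \<in> V" "V \<subseteq> W" "P \<in> polyfun s r" "Q \<in> polyfun s r"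
    "\<And>q. q \<in> V \<Longrightarrow> Q q \<noteq> 0" "\<And>q. q \<in> V \<Longrightarrow> F q = P q / Q q" using regular_onE[OF assms(1) p] by blast
  obtain V' P' Q' where 2: "zariski_open_cone s r V'" "p \<in> V'" "V' \<subseteq> W" "P' \<in> polyfun s r" "Q' \<in> polyfun s r"
    "\<And>q. q \<in> V' \<Longrightarrow> Q' q \<noteq> 0" "\<And>q. q \<in> V' \<Longrightarrow> G q = P' q / Q' q" using regular_onE[OF assms(2) p] by blast
  show "\<exists>V P Q. zariski_open_cone s r V \<and> p \<in> V \<and> V \<subseteq> W \<and> P \<in> polyfun s r
     \<and> Q \<in> polyfun s r \<and> (\<forall>q\<in>V. Q q \<noteq> 0 \<and> F q + G q = P q / Q q)"
    using 1 2
    by (intro exI[of _ "V \<inter> V'"] exI[of _ "\<lambda>p. P p * Q' p + P' p * Q p"] exI[of _ "\<lambda>p. Q p * Q' p"])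
       (auto simp: zariski_open_cone_Int field_simps intro!: polyfun.add polyfun.mult)
qed

lemma regular_on_mult:
  assumes "regular_on s r W F" "regular_on s r W G"
  shows "regular_on s r W (\<lambda>p. F p * G p)"
proof (rule regular_onI)
  fix p assume p: "p \<in> W"
  obtain V P Q where 1: "zariski_open_cone s r V" "p \<in> V" "V \<subseteq> W" "P \<in> polyfun s r" "Q \<in> polyfun s r"
    "\<And>q. q \<in> V \<Longrightarrow> Q q \<noteq> 0" "\<And>q. q \<in> V \<Longrightarrow> F q = P q / Q q" using regular_onE[OF assms(1) p] by blast
  obtain V' P' Q' where 2: "zariski_open_cone s r V'" "p \<in> V'" "V' \<subseteq> W" "P' \<in> polyfun s r" "Q' \<in> polyfun s r"
    "\<And>q. q \<in> V' \<Longrightarrow> Q' q \<noteq> 0" "\<And>q. q \<in> V' \<Longrightarrow> G q = P' q / Q' q" using regular_onE[OF assms(2) p] by blast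
  show "\<exists>V P Q. zariski_open_cone s r V \<and> p \<in> V \<and> V \<subseteq> W \<and> P \<in> polyfun s r
     \<and> Q \<in> polyfun s r \<and> (\<forall>q\<in>V. Q q \<noteq> 0 \<and> F q * G q = P q / Q q)"
    using 1 2
    by (intro exI[of _ "V \<inter> V'"] exI[of _ "\<lambda>p. P p * P' p"] exI[of _ "\<lambda>p. Q p * Q' p"])
       (auto simp: zariski_open_cone_Int intro!: polyfun.mult)
qed

lemma regular_on_inverse:
  assumes "regular_on s r W F" "\<And>p. p \<in> W \<Longrightarrow> F p \<noteq> 0"
  shows "regular_on s r W (\<lambda>p. inverse (F p))"
proof (rule regular_onI)
  fix p assume p: "p \<in> W"
  obtain V P Q where 1: "zariski_open_cone s r V" "p \<in> V" "V \<subseteq> W" "P \<in> polyfun s r" "Q \<in> polyfun s r"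
    "\<And>q. q \<in> V \<Longrightarrow> Q q \<noteq> 0" "\<And>q. q \<in> V \<Longrightarrow> F q = P q / Q q" using regular_onE[OF assms(1) p] by blast
  have "P q \<noteq> 0" if "q \<in> V" for q using 1(3) 1(7)[of q] assms(2)[of q] that by auto
  then show "\<exists>V P Q. zariski_open_cone s r V \<and> p \<in> V \<and> V \<subseteq> W \<and> P \<in> polyfun s r
     \<and> Q \<in> polyfun s r \<and> (\<forall>q\<in>V. Q q \<noteq> 0 \<and> inverse (F q) = P q / Q q)"
    using 1 by (intro exI[of _ V] exI[of _ Q] exI[of _ P]) auto
qed

lemma regular_on_subset:
  assumes "regular_on s r W F" "zariski_open_cone s r W'" "W' \<subseteq> W" "\<And>p. p \<in> W' \<Longrightarrow> G p = F p"
  shows "regular_on s r W' G"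
proof (rule regular_onI)
  fix p assume p: "p \<in> W'"
  then have "p \<in> W" using assms(3) by blast
  then obtain V P Q where 1: "zariski_open_cone s r V" "p \<in> V" "V \<subseteq> W" "P \<in> polyfun s r" "Q \<in> polyfun s r"
    "\<And>q. q \<in> V \<Longrightarrow> Q q \<noteq> 0" "\<And>q. q \<in> V \<Longrightarrow> F q = P q / Q q" using regular_onE[OF assms(1)] by blast
  then show "\<exists>V P Q. zariski_open_cone s r V \<and> p \<in> V \<and> V \<subseteq> W' \<and> P \<in> polyfun s r
     \<and> Q \<in> polyfun s r \<and> (\<forall>q\<in>V. Q q \<noteq> 0 \<and> G q = P q / Q q)"
    using p assms(2,4) by (intro exI[of _ "V \<inter> W'"] exI[of _ P] exI[of _ Q]) (auto simp: zariski_open_cone_Int)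
qed

lemma line_bundleD:
  assumes "F \<in> line_bundle s r a k l U"
  shows "regular_on s r (\<Union>U) F"
    and "p \<in> \<Union>U \<Longrightarrow> c \<noteq> 0 \<Longrightarrow> \<mu> \<noteq> 0 \<Longrightarrow> F (torus_act s r a c \<mu> p) = c powi k * \<mu> powi l * F p"
    and "p \<notin> \<Union>U \<Longrightarrow> F p = 0"
  using assms unfolding line_bundle_def by blast+

lemma line_bundle_add:
  "F \<in> line_bundle s r a k l U \<Longrightarrow> G \<in> line_bundle s r a k l U \<Longrightarrow> (\<lambda>p. F p + G p) \<in> line_bundle s r a k l U"
  unfolding line_bundle_def by (auto simp: regular_on_add distrib_left)

lemma line_bundle_mult:
  "F \<in> line_bundle s r a k l U \<Longrightarrow> G \<in> line_bundle s r a k' l' U \<Longrightarrow>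
     (\<lambda>p. F p * G p) \<in> line_bundle s r a (k + k') (l + l') U"
  unfolding line_bundle_def by (auto simp: regular_on_mult power_int_add)

lemma line_bundle_inverse:
  "F \<in> line_bundle s r a k l U \<Longrightarrow> (\<And>p. p \<in> \<Union>U \<Longrightarrow> F p \<noteq> 0) \<Longrightarrow>
     (\<lambda>p. inverse (F p)) \<in> line_bundle s r a (- k) (- l) U"
  unfolding line_bundle_def using regular_on_inverse[of s r "\<Union>U" F] by (simp add: power_int_minus)

lemma line_bundle_restrict:
  assumes "F \<in> line_bundle s r a k l U" "bundle_open s r a V" "V \<subseteq> U"
  shows "restrict_section V F \<in> line_bundle s r a k l V"
proof -
  have "zariski_open_cone s r (\<Union>V)" "V \<subseteq> bundle_points s r a" using assms(2) by (auto simp: bundle_open_def)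
  moreover have "\<Union>V \<subseteq> \<Union>U" using assms(3) by blast
  ultimately show ?thesis
    using line_bundleD[OF assms(1)] Union_bundle_invariant[of V s r a]
    unfolding line_bundle_def restrict_section_def
    by (auto intro!: regular_on_subset[of s r "\<Union>U" F]) blast+
qed

text \<open>The global section \<open>x_i^(k + l a_j) y_j^l\<close>, which generates the line bundle where \<open>x_i\<close> and \<open>y_j\<close> do
not vanish. The exponent of \<open>x_i\<close> makes up for the weight \<open>- a_j\<close> of \<open>y_j\<close>.\<close>

definition frame_section :: "nat \<Rightarrow> nat \<Rightarrow> (nat \<Rightarrow> nat) \<Rightarrow> nat \<Rightarrow> nat \<Rightarrow> nat \<Rightarrow> nat \<Rightarrow> cpair \<Rightarrow> complex" where
  "frame_section s r a k l i j p =
     (if p \<in> cone s r then fst p i ^ (k + l * a j) * snd p j ^ l else 0)"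

lemma polyfun_power: "P \<in> polyfun s r \<Longrightarrow> (\<lambda>p. P p ^ n) \<in> polyfun s r"
  by (induction n) (auto intro: polyfun.const polyfun.mult)

lemma polyfun_prod: "(\<And>i. i \<in> A \<Longrightarrow> P i \<in> polyfun s r) \<Longrightarrow> (\<lambda>p. \<Prod>i\<in>A. P i p) \<in> polyfun s r"
  by (induction A rule: infinite_finite_induct) (auto intro: polyfun.const polyfun.mult)

lemma polyfun_sum: "(\<And>i. i \<in> A \<Longrightarrow> P i \<in> polyfun s r) \<Longrightarrow> (\<lambda>p. \<Sum>i\<in>A. P i p) \<in> polyfun s r"
  by (induction A rule: infinite_finite_induct) (auto intro: polyfun.const polyfun.add)

lemma polyfun_regular:
  assumes "P \<in> polyfun s r" "\<And>p. p \<in> cone s r \<Longrightarrow> F p = P p"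
  shows "regular_on s r (cone s r) F"
proof (rule regular_onI)
  fix p assume "p \<in> cone s r"
  moreover have "zariski_open_cone s r (cone s r)"
    using bundle_open_points[of s r] by (auto simp: bundle_open_def Union_bundle_points)
  ultimately show "\<exists>V P Q. zariski_open_cone s r V \<and> p \<in> V \<and> V \<subseteq> cone s r \<and> P \<in> polyfun s r
     \<and> Q \<in> polyfun s r \<and> (\<forall>q\<in>V. Q q \<noteq> 0 \<and> F q = P q / Q q)"
    using assms by (intro exI[of _ "cone s r"] exI[of _ P] exI[of _ "\<lambda>p. 1"]) (auto intro: polyfun.const)
qed

lemma frame_section_in_line_bundle:
  assumes "i \<le> s" "j \<le> r"
  shows "frame_section s r a k l i j \<in> line_bundle s r a (int k) (int l) (bundle_points s r a)"
  unfolding line_bundle_def Union_bundle_points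
proof (intro CollectI conjI ballI allI impI)
  show "regular_on s r (cone s r) (frame_section s r a k l i j)"
    by (rule polyfun_regular[of "\<lambda>p. fst p i ^ (k + l * a j) * snd p j ^ l"])
       (use assms in \<open>auto simp: frame_section_def intro!: polyfun.intros polyfun_power\<close>)
  fix p and c \<mu> :: complex assume "p \<in> cone s r" "c \<noteq> 0" "\<mu> \<noteq> 0"
  moreover have "(c * x) ^ (k + l * a j) * (\<mu> * y / c ^ a j) ^ l = c ^ k * \<mu> ^ l * (x ^ (k + l * a j) * y ^ l)" for x y
    using \<open>c \<noteq> 0\<close> by (simp add: power_mult_distrib power_divide power_add mult.commute[of l] power_mult)
  ultimately show "frame_section s r a k l i j (torus_act s r a c \<mu> p) =
      c powi int k * \<mu> powi int l * frame_section s r a k l i j p"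
    using torus_act_in_cone assms by (simp add: frame_section_def torus_act_def)
qed (simp add: frame_section_def)

lemma sheaf_homD:
  assumes "\<phi> \<in> sheaf_hom s r a F G" "bundle_open s r a U"
  shows "f \<in> F U \<Longrightarrow> \<phi> U f \<in> G U"
    and "h \<in> structure_sheaf s r a U \<Longrightarrow> f \<in> F U \<Longrightarrow> \<phi> U (\<lambda>p. h p * f p) = (\<lambda>p. h p * \<phi> U f p)"
    and "bundle_open s r a V \<Longrightarrow> V \<subseteq> U \<Longrightarrow> f \<in> F U \<Longrightarrow>
           \<phi> V (restrict_section V f) = restrict_section V (\<phi> U f)"
proof -
  note * = assms(1)[unfolded sheaf_hom_def mem_Collect_eq]
  note 1 = mp[OF spec[OF conjunct1[OF *]] assms(2)]
  show "\<phi> U f \<in> G U" if "f \<in> F U" using conjunct1[OF 1] that by (rule bspec)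
  show "\<phi> U (\<lambda>p. h p * f p) = (\<lambda>p. h p * \<phi> U f p)" if "h \<in> structure_sheaf s r a U" "f \<in> F U"
    by (rule bspec[OF bspec[OF conjunct2[OF conjunct2[OF 1]] that(1)] that(2)])
  show "\<phi> V (restrict_section V f) = restrict_section V (\<phi> U f)"
    if "bundle_open s r a V" "V \<subseteq> U" "f \<in> F U"
    by (rule conjunct1[OF conjunct2[OF *], rule_format, OF assms(2) that])
qed

text \<open>On the chart, \<open>f\<close> is the multiple \<open>f / e\<close> of the frame \<open>e\<close>, with \<open>f / e\<close> in the structure sheaf.
Linearity and compatibility with restriction therefore express \<open>\<phi> f\<close> through \<open>\<phi> e\<close>.\<close>

lemma sheaf_hom_on_chart:
  fixes \<phi> :: "cpair set set \<Rightarrow> (cpair \<Rightarrow> complex) \<Rightarrow> cpair \<Rightarrow> complex"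
  assumes \<phi>: "\<phi> \<in> sheaf_hom s r a (line_bundle s r a (int k1) (int l1)) (line_bundle s r a k2 l2)"
    and U: "bundle_open s r a U" and f: "f \<in> line_bundle s r a (int k1) (int l1) U"
    and p: "p \<in> \<Union>U" and ij: "i \<le> s" "j \<le> r" "fst p i \<noteq> 0" "snd p j \<noteq> 0"
  defines "e \<equiv> frame_section s r a k1 l1 i j"
  shows "\<phi> U f p = \<phi> (bundle_points s r a) e p / e p * f p"
proof -
  let ?X = "bundle_points s r a"
  define V where "V = U \<inter> coordinate_chart s r a i j"
  have V: "bundle_open s r a V" unfolding V_def
    by (intro bundle_open_Int U bundle_open_coordinate_chart ij)
  have VU: "V \<subseteq> U" and VX: "V \<subseteq> ?X" by (auto simp: V_def coordinate_chart_def)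
  have UnV: "\<Union>V = \<Union>U \<inter> {p \<in> cone s r. fst p i \<noteq> 0 \<and> snd p j \<noteq> 0}"
    using U unfolding V_def bundle_open_def Union_coordinate_chart[OF ij(1,2), symmetric, of a]
    by (intro Union_bundle_Int) (auto simp: coordinate_chart_def)
  have pV: "p \<in> \<Union>V" using p ij U Union_bundle_subset unfolding UnV bundle_open_def by blast
  have e: "e \<in> line_bundle s r a (int k1) (int l1) ?X"
    unfolding e_def by (rule frame_section_in_line_bundle) (use ij in auto)
  have e0: "e q \<noteq> 0" if "q \<in> \<Union>V" for q
    using that by (auto simp: e_def frame_section_def UnV)
  have eV: "restrict_section V e \<in> line_bundle s r a (int k1) (int l1) V"
    by (rule line_bundle_restrict[OF e V VX])
  have fV: "restrict_section V f \<in> line_bundle s r a (int k1) (int l1) V"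
    by (rule line_bundle_restrict[OF f V VU])
  define h where "h = (\<lambda>q. restrict_section V f q * inverse (restrict_section V e q))"
  have "(\<lambda>q. inverse (restrict_section V e q)) \<in> line_bundle s r a (- int k1) (- int l1) V"
    by (rule line_bundle_inverse[OF eV]) (use e0 in \<open>auto simp: restrict_section_def\<close>)
  from line_bundle_mult[OF fV this] have h: "h \<in> structure_sheaf s r a V"
    by (simp add: structure_sheaf_def h_def)
  have "restrict_section V f = (\<lambda>q. h q * restrict_section V e q)"
    using e0 by (auto simp: h_def restrict_section_def fun_eq_iff)
  then have "\<phi> V (restrict_section V f) = (\<lambda>q. h q * \<phi> V (restrict_section V e) q)"
    using sheaf_homD(2)[OF \<phi> V h eV] by simp
  moreover have "\<phi> V (restrict_section V f) = restrict_section V (\<phi> U f)"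
    by (rule sheaf_homD(3)[OF \<phi> U V VU f])
  moreover have "\<phi> V (restrict_section V e) = restrict_section V (\<phi> ?X e)"
    by (rule sheaf_homD(3)[OF \<phi> bundle_open_points V VX e])
  ultimately have "restrict_section V (\<phi> U f) p = h p * restrict_section V (\<phi> ?X e) p" by simp
  then show ?thesis using pV by (simp add: restrict_section_def h_def field_simps)
qed

text \<open>The quotient of \<open>\<phi> e\<close> by \<open>e\<close> is the same for all frames \<open>e\<close> that do not vanish at \<open>p\<close> (see
\<open>hom_multiplier_chart\<close>), so the choice of indices is immaterial.\<close>

definition hom_multiplier :: "nat \<Rightarrow> nat \<Rightarrow> (nat \<Rightarrow> nat) \<Rightarrow> nat \<Rightarrow> nat
    \<Rightarrow> (cpair set set \<Rightarrow> (cpair \<Rightarrow> complex) \<Rightarrow> cpair \<Rightarrow> complex) \<Rightarrow> cpair \<Rightarrow> complex" where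
  "hom_multiplier s r a k l \<phi> p =
     (let (i, j) = (SOME (i, j). i \<le> s \<and> j \<le> r \<and> fst p i \<noteq> 0 \<and> snd p j \<noteq> 0);
          e = frame_section s r a k l i j
      in \<phi> (bundle_points s r a) e p / e p)"

lemma cone_nonzero_coords:
  assumes "p \<in> cone s r"
  obtains i j where "i \<le> s" "j \<le> r" "fst p i \<noteq> 0" "snd p j \<noteq> 0"
  using assms by (auto simp: cone_def)

lemma sheaf_hom_eq_multiplication:
  assumes \<phi>: "\<phi> \<in> sheaf_hom s r a (line_bundle s r a (int k1) (int l1)) (line_bundle s r a k2 l2)"
    and U: "bundle_open s r a U" and f: "f \<in> line_bundle s r a (int k1) (int l1) U"
  shows "\<phi> U f = (\<lambda>p. hom_multiplier s r a k1 l1 \<phi> p * f p)"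
proof
  fix p
  show "\<phi> U f p = hom_multiplier s r a k1 l1 \<phi> p * f p"
  proof (cases "p \<in> \<Union>U")
    case True
    then have "p \<in> cone s r" using U Union_bundle_subset unfolding bundle_open_def by blast
    then obtain i' j' where "i' \<le> s" "j' \<le> r" "fst p i' \<noteq> 0" "snd p j' \<noteq> 0" by (rule cone_nonzero_coords)
    then have "\<exists>ij. (case ij of (i, j) \<Rightarrow> i \<le> s \<and> j \<le> r \<and> fst p i \<noteq> 0 \<and> snd p j \<noteq> 0)" by auto
    from someI_ex[OF this] obtain i j where
      ij: "(SOME (i, j). i \<le> s \<and> j \<le> r \<and> fst p i \<noteq> 0 \<and> snd p j \<noteq> 0) = (i, j)"
        "i \<le> s" "j \<le> r" "fst p i \<noteq> 0" "snd p j \<noteq> 0" by (auto split: prod.splits)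
    show ?thesis using sheaf_hom_on_chart[OF \<phi> U f True ij(2-5)]
      by (simp add: hom_multiplier_def ij(1) Let_def)
  next
    case False
    then show ?thesis using line_bundleD(3)[OF f] line_bundleD(3)[OF sheaf_homD(1)[OF \<phi> U f]] by simp
  qed
qed

lemma hom_multiplier_chart:
  assumes \<phi>: "\<phi> \<in> sheaf_hom s r a (line_bundle s r a (int k1) (int l1)) (line_bundle s r a k2 l2)"
    and "p \<in> cone s r" and ij: "i \<le> s" "j \<le> r" "fst p i \<noteq> 0" "snd p j \<noteq> 0"
  defines "e \<equiv> frame_section s r a k1 l1 i j"
  shows "hom_multiplier s r a k1 l1 \<phi> p = \<phi> (bundle_points s r a) e p / e p"
proof -
  have "e p \<noteq> 0" using assms by (simp add: frame_section_def)
  then show ?thesis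
    using fun_cong[OF sheaf_hom_eq_multiplication[OF \<phi> bundle_open_points frame_section_in_line_bundle[OF ij(1,2)]], of p]
    by (simp add: e_def)
qed

lemma hom_multiplier_equivariant:
  assumes \<phi>: "\<phi> \<in> sheaf_hom s r a (line_bundle s r a (int k1) (int l1)) (line_bundle s r a k2 l2)"
    and p: "p \<in> cone s r" and "c \<noteq> 0" "\<mu> \<noteq> 0"
  shows "hom_multiplier s r a k1 l1 \<phi> (torus_act s r a c \<mu> p) =
     c powi (k2 - int k1) * \<mu> powi (l2 - int l1) * hom_multiplier s r a k1 l1 \<phi> p"
proof -
  obtain i j where ij: "i \<le> s" "j \<le> r" "fst p i \<noteq> 0" "snd p j \<noteq> 0" using p by (rule cone_nonzero_coords)
  let ?q = "torus_act s r a c \<mu> p" and ?e = "frame_section s r a k1 l1 i j" and ?X = "bundle_points s r a"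
  have q: "?q \<in> cone s r" "fst ?q i \<noteq> 0" "snd ?q j \<noteq> 0"
    using assms ij torus_act_in_cone by (auto simp: torus_act_def)
  have e: "?e \<in> line_bundle s r a (int k1) (int l1) ?X" by (rule frame_section_in_line_bundle[OF ij(1,2)])
  have "?e ?q = c powi int k1 * \<mu> powi int l1 * ?e p"
    using line_bundleD(2)[OF e] assms by (simp add: Union_bundle_points)
  moreover have "\<phi> ?X ?e ?q = c powi k2 * \<mu> powi l2 * \<phi> ?X ?e p"
    using line_bundleD(2)[OF sheaf_homD(1)[OF \<phi> bundle_open_points e]] assms by (simp add: Union_bundle_points)
  ultimately show ?thesis
    unfolding hom_multiplier_chart[OF \<phi> p ij] hom_multiplier_chart[OF \<phi> q(1) ij(1,2) q(2,3)]
    using assms by (simp add: power_int_diff field_simps)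
qed

definition cone_line :: "nat \<Rightarrow> nat \<Rightarrow> cpair \<Rightarrow> cpair \<Rightarrow> complex \<Rightarrow> cpair" where
  "cone_line s r p q \<epsilon> = (\<lambda>i\<in>{0..s}. fst p i + \<epsilon> * fst q i, \<lambda>j\<in>{0..r}. snd p j + \<epsilon> * snd q j)"

lemma polyfun_along_line:
  "P \<in> polyfun s r \<Longrightarrow> (\<lambda>\<epsilon>. P (cone_line s r p q \<epsilon>)) field_differentiable at \<epsilon>\<^sub>0"
  by (induction rule: polyfun.induct)
     (auto simp: cone_line_def intro!: derivative_intros field_differentiable_add field_differentiable_mult)

lemma cone_line_eventually_in_cone:
  assumes "cone_line s r p q \<epsilon>\<^sub>0 \<in> cone s r" and "P \<in> polyfun s r" "P (cone_line s r p q \<epsilon>\<^sub>0) \<noteq> 0"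
  shows "\<forall>\<^sub>F \<epsilon> in nhds \<epsilon>\<^sub>0. cone_line s r p q \<epsilon> \<in> cone s r \<and> P (cone_line s r p q \<epsilon>) \<noteq> 0"
proof -
  have ev: "\<forall>\<^sub>F \<epsilon> in nhds \<epsilon>\<^sub>0. Q (cone_line s r p q \<epsilon>) \<noteq> 0" if "Q \<in> polyfun s r" "Q (cone_line s r p q \<epsilon>\<^sub>0) \<noteq> 0" for Q
  proof -
    have "((\<lambda>\<epsilon>. Q (cone_line s r p q \<epsilon>)) \<longlongrightarrow> Q (cone_line s r p q \<epsilon>\<^sub>0)) (nhds \<epsilon>\<^sub>0)"
      using field_differentiable_imp_continuous_at[OF polyfun_along_line[OF that(1), of p q \<epsilon>\<^sub>0]]
        tendsto_at_iff_tendsto_nhds[of "\<lambda>\<epsilon>. Q (cone_line s r p q \<epsilon>)" \<epsilon>\<^sub>0] by (simp add: isCont_def)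
    then show ?thesis by (rule tendsto_imp_eventually_ne) (rule that(2))
  qed
  obtain i j where ij: "i \<le> s" "j \<le> r" "fst (cone_line s r p q \<epsilon>\<^sub>0) i \<noteq> 0" "snd (cone_line s r p q \<epsilon>\<^sub>0) j \<noteq> 0"
    using assms(1) by (rule cone_nonzero_coords)
  have "\<forall>\<^sub>F \<epsilon> in nhds \<epsilon>\<^sub>0. fst (cone_line s r p q \<epsilon>) i \<noteq> 0" "\<forall>\<^sub>F \<epsilon> in nhds \<epsilon>\<^sub>0. snd (cone_line s r p q \<epsilon>) j \<noteq> 0"
    using ev[OF polyfun.xcoord[OF ij(1)] ij(3)] ev[OF polyfun.ycoord[OF ij(2)] ij(4)] by auto
  then show ?thesis using ev[OF assms(2,3)]
  proof eventually_elim
    case (elim \<epsilon>)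
    then have "cone_line s r p q \<epsilon> \<in> cone s r" using ij(1,2)
      by (auto simp: cone_line_def cone_def)
    then show ?case using elim by blast
  qed
qed

text \<open>Near a point of the line the multiplier is a quotient of polynomials in the coordinates.\<close>

lemma hom_multiplier_along_line:
  assumes \<phi>: "\<phi> \<in> sheaf_hom s r a (line_bundle s r a (int k1) (int l1)) (line_bundle s r a k2 l2)"
    and p: "cone_line s r p q \<epsilon>\<^sub>0 \<in> cone s r"
  shows "(\<lambda>\<epsilon>. hom_multiplier s r a k1 l1 \<phi> (cone_line s r p q \<epsilon>)) field_differentiable at \<epsilon>\<^sub>0"
proof -
  let ?\<gamma> = "cone_line s r p q" and ?X = "bundle_points s r a"
  obtain i j where ij: "i \<le> s" "j \<le> r" "fst (?\<gamma> \<epsilon>\<^sub>0) i \<noteq> 0" "snd (?\<gamma> \<epsilon>\<^sub>0) j \<noteq> 0"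
    using p by (rule cone_nonzero_coords)
  let ?e = "frame_section s r a k1 l1 i j"
  have "?e \<in> line_bundle s r a (int k1) (int l1) ?X" by (rule frame_section_in_line_bundle[OF ij(1,2)])
  from line_bundleD(1)[OF sheaf_homD(1)[OF \<phi> bundle_open_points this]]
  have "regular_on s r (cone s r) (\<phi> ?X ?e)" by (simp add: Union_bundle_points)
  from bspec[OF this[unfolded regular_on_def] p] obtain V P Q where VPQ:
    "zariski_open_cone s r V \<and> ?\<gamma> \<epsilon>\<^sub>0 \<in> V \<and> V \<subseteq> cone s r \<and> P \<in> polyfun s r \<and> Q \<in> polyfun s r \<and>
      (\<forall>q\<in>V. Q q \<noteq> 0 \<and> \<phi> ?X ?e q = P q / Q q)" by (elim exE)
  then have V: "zariski_open_cone s r V" "?\<gamma> \<epsilon>\<^sub>0 \<in> V"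
    and PQ: "P \<in> polyfun s r" "Q \<in> polyfun s r" "\<And>q. q \<in> V \<Longrightarrow> Q q \<noteq> 0" "\<And>q. q \<in> V \<Longrightarrow> \<phi> ?X ?e q = P q / Q q"
    by simp_all
  obtain R where R: "R \<in> polyfun s r" "R (?\<gamma> \<epsilon>\<^sub>0) \<noteq> 0" "\<And>q. q \<in> cone s r \<Longrightarrow> R q \<noteq> 0 \<Longrightarrow> q \<in> V"
    using V unfolding zariski_open_cone_def by blast
  define E where "E = (\<lambda>q :: cpair. fst q i ^ (k1 + l1 * a j) * snd q j ^ l1)"
  have E: "E \<in> polyfun s r" unfolding E_def
    using ij by (intro polyfun.mult polyfun_power polyfun.intros)
  have "(\<lambda>q. R q * (fst q i * snd q j)) \<in> polyfun s r"
    using ij by (intro polyfun.mult R polyfun.intros)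
  from cone_line_eventually_in_cone[OF p this]
  have ev0: "\<forall>\<^sub>F \<epsilon> in nhds \<epsilon>\<^sub>0. ?\<gamma> \<epsilon> \<in> cone s r \<and> R (?\<gamma> \<epsilon>) * (fst (?\<gamma> \<epsilon>) i * snd (?\<gamma> \<epsilon>) j) \<noteq> 0"
    using R(2) ij(3,4) by simp
  have ev: "\<forall>\<^sub>F \<epsilon> in nhds \<epsilon>\<^sub>0. hom_multiplier s r a k1 l1 \<phi> (?\<gamma> \<epsilon>) = P (?\<gamma> \<epsilon>) / (Q (?\<gamma> \<epsilon>) * E (?\<gamma> \<epsilon>))"
  proof (rule eventually_mono[OF ev0])
    fix \<epsilon> assume "?\<gamma> \<epsilon> \<in> cone s r \<and> R (?\<gamma> \<epsilon>) * (fst (?\<gamma> \<epsilon>) i * snd (?\<gamma> \<epsilon>) j) \<noteq> 0"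
    then have *: "?\<gamma> \<epsilon> \<in> cone s r" "R (?\<gamma> \<epsilon>) \<noteq> 0" "fst (?\<gamma> \<epsilon>) i \<noteq> 0" "snd (?\<gamma> \<epsilon>) j \<noteq> 0" by simp_all
    have "?e (?\<gamma> \<epsilon>) = E (?\<gamma> \<epsilon>)" using *(1) by (simp add: frame_section_def E_def)
    moreover have "\<phi> ?X ?e (?\<gamma> \<epsilon>) = P (?\<gamma> \<epsilon>) / Q (?\<gamma> \<epsilon>)" by (rule PQ(4)[OF R(3)[OF *(1,2)]])
    ultimately show "hom_multiplier s r a k1 l1 \<phi> (?\<gamma> \<epsilon>) = P (?\<gamma> \<epsilon>) / (Q (?\<gamma> \<epsilon>) * E (?\<gamma> \<epsilon>))"
      using hom_multiplier_chart[OF \<phi> *(1) ij(1,2) *(3,4)] by simp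
  qed
  have "Q (?\<gamma> \<epsilon>\<^sub>0) * E (?\<gamma> \<epsilon>\<^sub>0) \<noteq> 0" using PQ(3) V(2) ij by (simp add: E_def)
  then have "(\<lambda>\<epsilon>. P (?\<gamma> \<epsilon>) / (Q (?\<gamma> \<epsilon>) * E (?\<gamma> \<epsilon>))) field_differentiable at \<epsilon>\<^sub>0"
    by (intro field_differentiable_divide field_differentiable_mult polyfun_along_line PQ E)
  then show ?thesis unfolding field_differentiable_def using DERIV_cong_ev[OF refl ev refl] by blast
qed

text \<open>The exponents of monomials that are sections of the line bundle with indices \<open>k\<close>, \<open>l\<close>: under
\<open>torus_act\<close> the monomial with exponents \<open>nm\<close> is multiplied by \<open>c powi deg1 nm * \<mu> powi deg2 nm\<close>.\<close>

definition section_monomials :: "nat \<Rightarrow> nat \<Rightarrow> (nat \<Rightarrow> nat) \<Rightarrow> int \<Rightarrow> int \<Rightarrow> ((nat \<Rightarrow> nat) \<times> (nat \<Rightarrow> nat)) set" where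
  "section_monomials s r a k l =
     {nm \<in> ({0..s} \<rightarrow>\<^sub>E UNIV) \<times> ({0..r} \<rightarrow>\<^sub>E UNIV). deg1 s r a nm = k \<and> deg2 r nm = l}"

definition monomial_value :: "nat \<Rightarrow> nat \<Rightarrow> (nat \<Rightarrow> nat) \<times> (nat \<Rightarrow> nat) \<Rightarrow> cpair \<Rightarrow> complex" where
  "monomial_value s r nm p = (\<Prod>i\<in>{0..s}. fst p i ^ fst nm i) * (\<Prod>j\<in>{0..r}. snd p j ^ snd nm j)"

text \<open>The degree in \<open>x\<close> that a monomial with \<open>y\<close>-exponents \<open>m\<close> needs in order to have weight \<open>k\<close>.\<close>

definition x_degree :: "nat \<Rightarrow> (nat \<Rightarrow> nat) \<Rightarrow> int \<Rightarrow> (nat \<Rightarrow> nat) \<Rightarrow> int" where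
  "x_degree r a k m = k + (\<Sum>j=0..r. int (a j) * int (m j))"

lemma section_monomials_eq:
  "section_monomials s r a k l =
     (\<lambda>(m, n). (n, m)) ` (SIGMA m:monomials {0..r} l. monomials {0..s} (x_degree r a k m))"
  by (auto simp: section_monomials_def monomials_def deg1_def deg2_def image_iff x_degree_def)

lemma finite_section_monomials: "finite (section_monomials s r a k l)"
  unfolding section_monomials_eq by (intro finite_imageI finite_SigmaI finite_monomials) auto

lemma sum_section_monomials:
  "(\<Sum>nm\<in>section_monomials s r a k l. F nm) =
     (\<Sum>m\<in>monomials {0..r} l. \<Sum>n\<in>monomials {0..s} (x_degree r a k m). F (n, m))"
  for F :: "_ \<Rightarrow> complex"
  unfolding section_monomials_eq
  by (subst sum.reindex) (auto simp: inj_on_def sum.Sigma finite_monomials intro!: sum.cong)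

text \<open>First \<open>F\<close> is expanded in \<open>y\<close>, with coefficients that are holomorphic along lines in \<open>x\<close>. Equivariance
and the independence of the monomials in \<open>y\<close> show that each coefficient is homogeneous in \<open>x\<close>, so that
it can be expanded as well.\<close>

lemma equivariant_holomorphic_imp_polynomial:
  assumes "r \<ge> 1" "s \<ge> 1"
    and equivariant: "\<And>p c \<mu>. p \<in> cone s r \<Longrightarrow> c \<noteq> 0 \<Longrightarrow> \<mu> \<noteq> 0 \<Longrightarrow>
          F (torus_act s r a c \<mu> p) = c powi k * \<mu> powi l * F p"
    and hol: "\<And>p q \<epsilon>\<^sub>0. cone_line s r p q \<epsilon>\<^sub>0 \<in> cone s r \<Longrightarrow>
          (\<lambda>\<epsilon>. F (cone_line s r p q \<epsilon>)) field_differentiable at \<epsilon>\<^sub>0"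
  shows "\<exists>c. \<forall>p\<in>cone s r. F p = (\<Sum>nm\<in>section_monomials s r a k l. c nm * monomial_value s r nm p)"
proof -
  let ?X = "nonzero_vectors {0..s}" and ?Y = "nonzero_vectors {0..r}"
  have ext: "(\<lambda>i\<in>I. x i) = x" if "x \<in> nonzero_vectors I" for x and I :: "nat set"
    using that by (auto simp: nonzero_vectors_def PiE_iff extensional_restrict)
  have "\<exists>g. (\<forall>m. g m \<in> {g. holomorphic_along_lines {0..s} g}) \<and> (\<forall>x\<in>?X. \<forall>y\<in>?Y.
            F (x, y) = (\<Sum>m\<in>monomials {0..r} l. g m x * (\<Prod>j\<in>{0..r}. y j ^ m j)))"
  proof (rule homogeneous_holomorphic_imp_polynomial)
    fix x y and c :: complex assume x: "x \<in> ?X" and y: "y \<in> ?Y" and "c \<noteq> 0"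
    have "(x, \<lambda>j\<in>{0..r}. c * y j) = torus_act s r a 1 c (x, y)"
      using ext[OF x] by (simp add: torus_act_def)
    then show "F (x, \<lambda>j\<in>{0..r}. c * y j) = c powi l * F (x, y)"
      using equivariant[of "(x, y)" 1 c] x y \<open>c \<noteq> 0\<close> by (simp add: mem_cone_iff)
  next
    fix x assume x: "x \<in> ?X"
    show "holomorphic_along_lines {0..r} (\<lambda>y. F (x, y))" unfolding holomorphic_along_lines_def
    proof (intro allI impI)
      fix y y' \<epsilon>\<^sub>0 assume "(\<lambda>j\<in>{0..r}. y j + \<epsilon>\<^sub>0 * y' j) \<in> ?Y"
      moreover have "cone_line s r (x, y) (\<lambda>_. 0, y') \<epsilon> = (x, \<lambda>j\<in>{0..r}. y j + \<epsilon> * y' j)" for \<epsilon>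
        using ext[OF x] by (simp add: cone_line_def)
      ultimately show "(\<lambda>\<epsilon>. F (x, \<lambda>j\<in>{0..r}. y j + \<epsilon> * y' j)) field_differentiable at \<epsilon>\<^sub>0"
        using hol[of "(x, y)" "(\<lambda>_. 0, y')" \<epsilon>\<^sub>0] x by (simp add: mem_cone_iff)
    qed
  next
    fix y assume y: "y \<in> ?Y"
    have "holomorphic_along_lines {0..s} (\<lambda>x. F (x, y))" unfolding holomorphic_along_lines_def
    proof (intro allI impI)
      fix x x' \<epsilon>\<^sub>0 assume "(\<lambda>i\<in>{0..s}. x i + \<epsilon>\<^sub>0 * x' i) \<in> ?X"
      moreover have "cone_line s r (x, y) (x', \<lambda>_. 0) \<epsilon> = (\<lambda>i\<in>{0..s}. x i + \<epsilon> * x' i, y)" for \<epsilon>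
        using ext[OF y] by (simp add: cone_line_def)
      ultimately show "(\<lambda>\<epsilon>. F (\<lambda>i\<in>{0..s}. x i + \<epsilon> * x' i, y)) field_differentiable at \<epsilon>\<^sub>0"
        using hol[of "(x, y)" "(x', \<lambda>_. 0)" \<epsilon>\<^sub>0] y by (simp add: mem_cone_iff)
    qed
    then show "(\<lambda>x. F (x, y)) \<in> {g. holomorphic_along_lines {0..s} g}" by simp
  next
    fix J :: "nat set" and c :: "nat \<Rightarrow> complex" and f :: "nat \<Rightarrow> (nat \<Rightarrow> complex) \<Rightarrow> complex"
    assume "finite J" "\<And>j. j \<in> J \<Longrightarrow> f j \<in> {g. holomorphic_along_lines {0..s} g}"
    then show "(\<lambda>t. \<Sum>j\<in>J. c j * f j t) \<in> {g. holomorphic_along_lines {0..s} g}"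
      unfolding holomorphic_along_lines_def mem_Collect_eq
      by (intro allI impI field_differentiable_sum field_differentiable_mult field_differentiable_const) blast
  qed (use assms(1) in auto)
  then obtain g where g_hol: "\<And>m. holomorphic_along_lines {0..s} (g m)"
    and g: "\<And>x y. x \<in> ?X \<Longrightarrow> y \<in> ?Y \<Longrightarrow>
            F (x, y) = (\<Sum>m\<in>monomials {0..r} l. g m x * (\<Prod>j\<in>{0..r}. y j ^ m j))" by auto
  have g_hom: "g m (\<lambda>i\<in>{0..s}. c * x i) = c powi (x_degree r a k m) * g m x"
    if m: "m \<in> monomials {0..r} l" and x: "x \<in> ?X" and "c \<noteq> 0" for m x c
  proof -
    let ?cx = "\<lambda>i\<in>{0..s}. c * x i"
    have cx: "?cx \<in> ?X" using x \<open>c \<noteq> 0\<close> by (auto simp: nonzero_vectors_def)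
    have "g m ?cx * (\<Prod>j\<in>{0..r}. (1 / c ^ a j) ^ m j) - c powi k * g m x = 0"
    proof (rule monomials_independent[OF _ _ _ _ m])
      show "monomials {0..r} l \<subseteq> {0..r} \<rightarrow>\<^sub>E UNIV" by (auto simp: monomials_def)
      fix y assume y: "y \<in> ({0..r} \<rightarrow>\<^sub>E - {0 :: complex})"
      then have yY: "y \<in> ?Y" by (auto simp: nonzero_vectors_def PiE_iff)
      let ?y = "\<lambda>j\<in>{0..r}. y j / c ^ a j"
      have yc: "?y \<in> ?Y" using yY \<open>c \<noteq> 0\<close> by (auto simp: nonzero_vectors_def)
      have "torus_act s r a c 1 (x, y) = (?cx, ?y)" by (simp add: torus_act_def)
      then have "F (?cx, ?y) = c powi k * F (x, y)"
        using equivariant[of "(x, y)" c 1] x yY \<open>c \<noteq> 0\<close> by (simp add: mem_cone_iff)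
      moreover have "(\<Prod>j\<in>{0..r}. ?y j ^ m j) =
          (\<Prod>j\<in>{0..r}. (1 / c ^ a j) ^ m j) * (\<Prod>j\<in>{0..r}. y j ^ m j)" for m
        by (simp add: power_divide flip: prod.distrib)
      ultimately show "(\<Sum>m\<in>monomials {0..r} l. (g m ?cx * (\<Prod>j\<in>{0..r}. (1 / c ^ a j) ^ m j) - c powi k * g m x)
           * (\<Prod>j\<in>{0..r}. y j ^ m j)) = 0"
        using g[OF cx yc] g[OF x yY]
        by (simp add: left_diff_distrib sum_subtractf sum_distrib_left mult.assoc)
    qed (auto intro: finite_monomials)
    moreover have "(\<Prod>j\<in>{0..r}. (1 / c ^ a j) ^ m j) * c powi (\<Sum>j=0..r. int (a j) * int (m j)) = 1"
    proof -
      have "c powi (\<Sum>j=0..r. int (a j) * int (m j)) = (\<Prod>j\<in>{0..r}. (c ^ a j) ^ m j)"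
      proof -
        have "(\<Sum>j=0..r. int (a j) * int (m j)) = int (\<Sum>j=0..r. a j * m j)" by simp
        then show ?thesis by (simp only: power_int_of_nat power_sum power_mult)
      qed
      then show ?thesis using \<open>c \<noteq> 0\<close> by (simp flip: prod.distrib power_mult_distrib)
    qed
    moreover have "u = K * S * v" if "u * P - K * v = 0" "P * S = 1" for u v K P S :: complex
    proof -
      have "(u * P) * S = (K * v) * S" using that(1) by simp
      moreover have "(u * P) * S = u" using that(2) by (simp only: mult.assoc mult_1_right)
      ultimately show ?thesis by (simp only: mult_ac)
    qed
    ultimately have "g m ?cx = c powi k * c powi (\<Sum>j=0..r. int (a j) * int (m j)) * g m x" by blast
    then show ?thesis using \<open>c \<noteq> 0\<close> by (simp add: x_degree_def power_int_add)
  qed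
  have "\<forall>m. \<exists>h. m \<in> monomials {0..r} l \<longrightarrow> (\<forall>x\<in>?X.
            g m x = (\<Sum>n\<in>monomials {0..s} (x_degree r a k m). h n * (\<Prod>i\<in>{0..s}. x i ^ n i)))"
  proof
    fix m
    have "\<exists>h. (\<forall>n. h n \<in> (UNIV :: (unit \<Rightarrow> complex) set)) \<and> (\<forall>t\<in>UNIV. \<forall>x\<in>?X.
            g m x = (\<Sum>n\<in>monomials {0..s} (x_degree r a k m). h n t * (\<Prod>i\<in>{0..s}. x i ^ n i)))"
      if m: "m \<in> monomials {0..r} l"
      by (rule homogeneous_holomorphic_imp_polynomial) (use assms(2) g_hom[OF m] g_hol in auto)
    then obtain h :: "(nat \<Rightarrow> nat) \<Rightarrow> unit \<Rightarrow> complex" where "m \<in> monomials {0..r} l \<longrightarrow> (\<forall>t\<in>UNIV. \<forall>x\<in>?X.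
            g m x = (\<Sum>n\<in>monomials {0..s} (x_degree r a k m). h n t * (\<Prod>i\<in>{0..s}. x i ^ n i)))"
      by (cases "m \<in> monomials {0..r} l") auto
    then show "\<exists>h. m \<in> monomials {0..r} l \<longrightarrow> (\<forall>x\<in>?X.
            g m x = (\<Sum>n\<in>monomials {0..s} (x_degree r a k m). h n * (\<Prod>i\<in>{0..s}. x i ^ n i)))"
      by (intro exI[of _ "\<lambda>n. h n ()"]) auto
  qed
  from choice[OF this] obtain h where h: "\<forall>m. m \<in> monomials {0..r} l \<longrightarrow> (\<forall>x\<in>?X.
            g m x = (\<Sum>n\<in>monomials {0..s} (x_degree r a k m). h m n * (\<Prod>i\<in>{0..s}. x i ^ n i)))" ..
  have "F p = (\<Sum>nm\<in>section_monomials s r a k l. h (snd nm) (fst nm) * monomial_value s r nm p)"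
    if p: "p \<in> cone s r" for p
  proof -
    obtain x y where xy: "p = (x, y)" "x \<in> ?X" "y \<in> ?Y" using p by (cases p) (auto simp: mem_cone_iff)
    have "F p = (\<Sum>m\<in>monomials {0..r} l. g m x * (\<Prod>j\<in>{0..r}. y j ^ m j))" using g xy by simp
    also have "\<dots> = (\<Sum>m\<in>monomials {0..r} l. \<Sum>n\<in>monomials {0..s} (x_degree r a k m).
        h m n * monomial_value s r (n, m) p)"
    proof (rule sum.cong[OF refl])
      fix m assume "m \<in> monomials {0..r} l"
      then have "g m x = (\<Sum>n\<in>monomials {0..s} (x_degree r a k m). h m n * (\<Prod>i\<in>{0..s}. x i ^ n i))"
        using h xy by blast
      then show "g m x * (\<Prod>j\<in>{0..r}. y j ^ m j) =
          (\<Sum>n\<in>monomials {0..s} (x_degree r a k m). h m n * monomial_value s r (n, m) p)"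
        by (simp add: monomial_value_def xy sum_distrib_right mult.assoc)
    qed
    finally show ?thesis by (simp add: sum_section_monomials)
  qed
  then show ?thesis by (intro exI[of _ "\<lambda>nm. h (snd nm) (fst nm)"]) blast
qed

lemma section_monomials_independent:
  assumes "\<And>p. p \<in> cone s r \<Longrightarrow> (\<Sum>nm\<in>section_monomials s r a k l. c nm * monomial_value s r nm p) = 0"
    and "nm \<in> section_monomials s r a k l"
  shows "c nm = 0"
proof -
  obtain n m where nm: "nm = (n, m)" "m \<in> monomials {0..r} l" "n \<in> monomials {0..s} (x_degree r a k m)"
    using assms(2) by (auto simp: section_monomials_eq)
  have "c (n, m) = 0"
  proof (rule monomials_independent[OF _ _ _ _ nm(3)])
    fix x assume x: "x \<in> ({0..s} \<rightarrow>\<^sub>E - {0 :: complex})"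
    show "(\<Sum>n\<in>monomials {0..s} (x_degree r a k m). c (n, m) * (\<Prod>i\<in>{0..s}. x i ^ n i)) = 0"
    proof (rule monomials_independent[OF _ _ _ _ nm(2)])
      fix y assume y: "y \<in> ({0..r} \<rightarrow>\<^sub>E - {0 :: complex})"
      have "(x, y) \<in> cone s r" using x y by (auto simp: cone_def PiE_iff)
      from assms(1)[OF this]
      show "(\<Sum>m\<in>monomials {0..r} l. (\<Sum>n\<in>monomials {0..s} (x_degree r a k m). c (n, m) * (\<Prod>i\<in>{0..s}. x i ^ n i))
            * (\<Prod>j\<in>{0..r}. y j ^ m j)) = 0"
        by (simp add: sum_section_monomials monomial_value_def sum_distrib_right mult.assoc)
    qed (auto simp: monomials_def[of "{0..r}" l] intro: finite_monomials[of "{0..r}" l, unfolded monomials_def])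
  qed (auto simp: monomials_def intro: finite_monomials[unfolded monomials_def])
  then show ?thesis by (simp add: nm)
qed

definition section_of :: "nat \<Rightarrow> nat \<Rightarrow> (nat \<Rightarrow> nat) \<Rightarrow> int \<Rightarrow> int
    \<Rightarrow> (((nat \<Rightarrow> nat) \<times> (nat \<Rightarrow> nat)) \<Rightarrow>\<^sub>0 complex) \<Rightarrow> cpair \<Rightarrow> complex" where
  "section_of s r a k l v p =
     (if p \<in> cone s r then \<Sum>nm\<in>section_monomials s r a k l. Poly_Mapping.lookup v nm * monomial_value s r nm p else 0)"

lemma section_of_in_line_bundle: "section_of s r a k l v \<in> line_bundle s r a k l (bundle_points s r a)"
  unfolding line_bundle_def Union_bundle_points
proof (intro CollectI conjI ballI allI impI)
  show "regular_on s r (cone s r) (section_of s r a k l v)"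
    by (rule polyfun_regular[of "\<lambda>p. \<Sum>nm\<in>section_monomials s r a k l. Poly_Mapping.lookup v nm * monomial_value s r nm p"])
       (auto simp: section_of_def monomial_value_def intro!: polyfun_sum polyfun_prod polyfun.intros polyfun_power)
  fix p and c \<mu> :: complex assume p: "p \<in> cone s r" and "c \<noteq> 0" "\<mu> \<noteq> 0"
  have "monomial_value s r nm (torus_act s r a c \<mu> p) = c powi k * \<mu> powi l * monomial_value s r nm p"
    if nm: "nm \<in> section_monomials s r a k l" for nm
  proof -
    obtain n m where nm_eq: "nm = (n, m)" by (cases nm)
    have deg: "k = (\<Sum>i=0..s. int (n i)) - (\<Sum>i=0..r. int (a i) * int (m i))" "l = (\<Sum>i=0..r. int (m i))"
      using nm by (auto simp: section_monomials_def deg1_def deg2_def nm_eq)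
    have "c powi k = (\<Prod>i\<in>{0..s}. c ^ n i) / (\<Prod>j\<in>{0..r}. (c ^ a j) ^ m j)"
    proof -
      have "(\<Sum>i=0..s. int (n i)) = int (\<Sum>i=0..s. n i)"
        "(\<Sum>j=0..r. int (a j) * int (m j)) = int (\<Sum>j=0..r. a j * m j)" by simp_all
      then show ?thesis unfolding deg(1) power_int_diff[OF disjI1[OF \<open>c \<noteq> 0\<close>]]
        by (simp only: power_int_of_nat power_sum power_mult)
    qed
    moreover have "\<mu> powi l = (\<Prod>j\<in>{0..r}. \<mu> ^ m j)"
    proof -
      have "(\<Sum>j=0..r. int (m j)) = int (\<Sum>j=0..r. m j)" by simp
      then show ?thesis unfolding deg(2) by (simp only: power_int_of_nat power_sum)
    qed
    ultimately show ?thesis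
      by (simp add: monomial_value_def nm_eq torus_act_def power_mult_distrib power_divide prod.distrib prod_dividef)
  qed
  then show "section_of s r a k l v (torus_act s r a c \<mu> p) = c powi k * \<mu> powi l * section_of s r a k l v p"
    using torus_act_in_cone[OF p \<open>c \<noteq> 0\<close> \<open>\<mu> \<noteq> 0\<close>] p
    by (simp add: section_of_def sum_distrib_left mult_ac)
qed (simp add: section_of_def)

definition multiplication_hom :: "nat \<Rightarrow> nat \<Rightarrow> (nat \<Rightarrow> nat) \<Rightarrow> int \<Rightarrow> int \<Rightarrow> (cpair \<Rightarrow> complex)
    \<Rightarrow> cpair set set \<Rightarrow> (cpair \<Rightarrow> complex) \<Rightarrow> cpair \<Rightarrow> complex" where
  "multiplication_hom s r a k l F U f p =
     (if bundle_open s r a U \<and> f \<in> line_bundle s r a k l U then F p * f p else 0)"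

lemma multiplication_hom_in_sheaf_hom:
  assumes F: "F \<in> line_bundle s r a k l (bundle_points s r a)"
  shows "multiplication_hom s r a k1 l1 F \<in>
    sheaf_hom s r a (line_bundle s r a k1 l1) (line_bundle s r a (k + k1) (l + l1))"
  unfolding sheaf_hom_def
proof (intro CollectI conjI allI impI ballI)
  fix U assume U: "bundle_open s r a U"
  fix f assume f: "f \<in> line_bundle s r a k1 l1 U"
  have U': "U \<subseteq> bundle_points s r a" using U by (simp add: bundle_open_def)
  have "multiplication_hom s r a k1 l1 F U f = (\<lambda>p. restrict_section U F p * f p)"
    using U f line_bundleD(3)[OF f] by (auto simp: multiplication_hom_def restrict_section_def fun_eq_iff)
  then show "multiplication_hom s r a k1 l1 F U f \<in> line_bundle s r a (k + k1) (l + l1) U"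
    using line_bundle_mult[OF line_bundle_restrict[OF F U U'] f] by simp
  show "multiplication_hom s r a k1 l1 F U (\<lambda>p. f p + g p) =
      (\<lambda>p. multiplication_hom s r a k1 l1 F U f p + multiplication_hom s r a k1 l1 F U g p)"
    if g: "g \<in> line_bundle s r a k1 l1 U" for g
    using U f g line_bundle_add[OF f g] by (simp add: multiplication_hom_def fun_eq_iff distrib_left)
  show "multiplication_hom s r a k1 l1 F U (\<lambda>p. h p * f p) = (\<lambda>p. h p * multiplication_hom s r a k1 l1 F U f p)"
    if h: "h \<in> structure_sheaf s r a U" for h
    using U f line_bundle_mult[OF h[unfolded structure_sheaf_def] f] by (simp add: multiplication_hom_def fun_eq_iff)
  show "multiplication_hom s r a k1 l1 F V (restrict_section V f) =
       restrict_section V (multiplication_hom s r a k1 l1 F U f)"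
    if V: "bundle_open s r a V" "V \<subseteq> U" for V
    using U f V line_bundle_restrict[OF f V] by (simp add: multiplication_hom_def restrict_section_def fun_eq_iff)
qed (auto simp: multiplication_hom_def fun_eq_iff)

theorem Hom_bundle_isomorphism:
  fixes s r k1 l1 k2 l2 :: nat and a :: "nat \<Rightarrow> nat"
  assumes "r \<ge> 1" "s \<ge> 1"
  defines "H \<equiv> Hom_bundle s r a (k1, l1) (k2, l2)"
    and "M \<equiv> section_monomials s r a (int k2 - int k1) (int l2 - int l1)"
  shows "\<exists>\<Phi>. bij_betw \<Phi> H {v. Poly_Mapping.keys v \<subseteq> M}
     \<and> (\<forall>\<phi>\<in>H. \<forall>\<psi>\<in>H. \<Phi> (\<lambda>U f p. \<phi> U f p + \<psi> U f p) = \<Phi> \<phi> + \<Phi> \<psi>)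
     \<and> (\<forall>c::complex. \<forall>\<phi>\<in>H. \<Phi> (\<lambda>U f p. c * \<phi> U f p) = Poly_Mapping.map ((*) c) (\<Phi> \<phi>))"
proof -
  let ?k = "int k2 - int k1" and ?l = "int l2 - int l1" and ?X = "bundle_points s r a"
  let ?V = "{v :: _ \<Rightarrow>\<^sub>0 complex. Poly_Mapping.keys v \<subseteq> M}"
  have H_eq: "H = sheaf_hom s r a (line_bundle s r a (int k1) (int l1)) (line_bundle s r a (int k2) (int l2))"
    by (simp add: H_def Hom_bundle_def)
  define \<Psi> where "\<Psi> v = multiplication_hom s r a (int k1) (int l1) (section_of s r a ?k ?l v)" for v
  have \<Psi>_H: "\<Psi> v \<in> H" for v
    using multiplication_hom_in_sheaf_hom[OF section_of_in_line_bundle[of s r a ?k ?l v], of "int k1" "int l1"]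
    by (simp add: H_eq \<Psi>_def)
  have lookup0: "Poly_Mapping.lookup v nm = 0" if "v \<in> ?V" "nm \<notin> M" for v nm
    using that by (auto simp: in_keys_iff)
  have inj: "inj_on \<Psi> ?V"
  proof (rule inj_onI)
    fix v w assume v: "v \<in> ?V" and w: "w \<in> ?V" and eq: "\<Psi> v = \<Psi> w"
    have sec: "section_of s r a ?k ?l v p = section_of s r a ?k ?l w p" if p: "p \<in> cone s r" for p
    proof -
      obtain i j where ij: "i \<le> s" "j \<le> r" "fst p i \<noteq> 0" "snd p j \<noteq> 0" using p by (rule cone_nonzero_coords)
      let ?e = "frame_section s r a k1 l1 i j"
      have "?e p \<noteq> 0" using p ij by (simp add: frame_section_def)
      moreover have "\<Psi> v ?X ?e p = \<Psi> w ?X ?e p" by (simp add: eq)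
      ultimately show ?thesis
        using bundle_open_points frame_section_in_line_bundle[OF ij(1,2)]
        by (simp add: \<Psi>_def multiplication_hom_def)
    qed
    have "Poly_Mapping.lookup v nm = Poly_Mapping.lookup w nm" if "nm \<in> M" for nm
    proof -
      have "Poly_Mapping.lookup v nm - Poly_Mapping.lookup w nm = 0"
      proof (rule section_monomials_independent[where s=s and r=r and a=a and k="?k" and l="?l"
            and c="\<lambda>nm. Poly_Mapping.lookup v nm - Poly_Mapping.lookup w nm"])
        fix p assume p: "p \<in> cone s r"
        then show "(\<Sum>nm\<in>section_monomials s r a ?k ?l.
           (Poly_Mapping.lookup v nm - Poly_Mapping.lookup w nm) * monomial_value s r nm p) = 0"
          using sec[OF p] by (simp add: section_of_def left_diff_distrib sum_subtractf)
      qed (use that in \<open>simp add: M_def\<close>)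
      then show ?thesis by simp
    qed
    then show "v = w" using lookup0 v w by (metis poly_mapping_eqI)
  qed
  have surj: "\<phi> \<in> \<Psi> ` ?V" if \<phi>: "\<phi> \<in> H" for \<phi>
  proof -
    note \<phi>' = \<phi>[unfolded H_eq]
    have "\<exists>c. \<forall>p\<in>cone s r. hom_multiplier s r a k1 l1 \<phi> p = (\<Sum>nm\<in>section_monomials s r a ?k ?l. c nm * monomial_value s r nm p)"
      by (rule equivariant_holomorphic_imp_polynomial[OF assms(1,2)])
         (auto intro: hom_multiplier_equivariant[OF \<phi>'] hom_multiplier_along_line[OF \<phi>'])
    then obtain c where c: "\<And>p. p \<in> cone s r \<Longrightarrow> hom_multiplier s r a k1 l1 \<phi> p = (\<Sum>nm\<in>M. c nm * monomial_value s r nm p)"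
      unfolding M_def by blast
    have "finite M" unfolding M_def by (rule finite_section_monomials)
    then have "finite {nm. (if nm \<in> M then c nm else 0) \<noteq> 0}" by (auto intro: finite_subset[of _ M])
    then have lookup: "Poly_Mapping.lookup (Abs_poly_mapping (\<lambda>nm. if nm \<in> M then c nm else 0)) = (\<lambda>nm. if nm \<in> M then c nm else 0)"
      by (rule lookup_Abs_poly_mapping)
    define v where "v = Abs_poly_mapping (\<lambda>nm. if nm \<in> M then c nm else 0)"
    have v: "v \<in> ?V" by (auto simp: v_def lookup in_keys_iff split: if_splits)
    have sec: "section_of s r a ?k ?l v p = hom_multiplier s r a k1 l1 \<phi> p" if "p \<in> cone s r" for p
      using that by (simp add: section_of_def v_def lookup c flip: M_def)
    have "\<phi> U f = \<Psi> v U f" for U f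
    proof (cases "bundle_open s r a U \<and> f \<in> line_bundle s r a (int k1) (int l1) U")
      case True
      then have "\<phi> U f = (\<lambda>p. hom_multiplier s r a k1 l1 \<phi> p * f p)"
        using sheaf_hom_eq_multiplication[OF \<phi>'] by blast
      moreover have "\<Psi> v U f p = hom_multiplier s r a k1 l1 \<phi> p * f p" for p
      proof (cases "p \<in> cone s r")
        case False
        then have "p \<notin> \<Union>U" using True Union_bundle_subset unfolding bundle_open_def by blast
        then have "f p = 0" using line_bundleD(3)[OF conjunct2[OF True]] by blast
        then show ?thesis by (simp add: \<Psi>_def multiplication_hom_def)
      qed (use True sec in \<open>simp add: \<Psi>_def multiplication_hom_def\<close>)
      ultimately show ?thesis by auto
    next
      case False
      then have "\<phi> U f = (\<lambda>p. 0)"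
        by (rule conjunct2[OF conjunct2[OF \<phi>'[unfolded sheaf_hom_def mem_Collect_eq]], rule_format])
      then show ?thesis using False by (auto simp: \<Psi>_def multiplication_hom_def fun_eq_iff)
    qed
    then have "\<phi> = \<Psi> v" by (intro ext) simp
    then show ?thesis using v by blast
  qed
  have bij: "bij_betw \<Psi> ?V H" using inj surj \<Psi>_H by (auto simp: bij_betw_def)
  have add: "(\<lambda>U f p. \<Psi> v U f p + \<Psi> w U f p) = \<Psi> (v + w)" for v w
    by (auto simp: \<Psi>_def multiplication_hom_def section_of_def fun_eq_iff lookup_add distrib_right sum.distrib)
  have lookup_map: "Poly_Mapping.lookup (Poly_Mapping.map ((*) c) v) nm = c * Poly_Mapping.lookup v nm" for c :: complex and v nm
    by (simp add: Poly_Mapping.map.rep_eq when_def)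
  have scale: "(\<lambda>U f p. c * \<Psi> v U f p) = \<Psi> (Poly_Mapping.map ((*) c) v)" for c v
    by (auto simp: \<Psi>_def multiplication_hom_def section_of_def fun_eq_iff lookup_map sum_distrib_left mult.assoc)
  have V_add: "v + w \<in> ?V" if "v \<in> ?V" "w \<in> ?V" for v w
    using that Poly_Mapping.keys_add[of v w] by auto
  have V_scale: "Poly_Mapping.map ((*) c) v \<in> ?V" if "v \<in> ?V" for c v
    using that by (auto simp: in_keys_iff lookup_map)
  let ?\<Phi> = "the_inv_into ?V \<Psi>"
  have \<Phi>_in: "?\<Phi> \<phi> \<in> ?V" and \<Psi>\<Phi>: "\<Psi> (?\<Phi> \<phi>) = \<phi>" if "\<phi> \<in> H" for \<phi>
    using that bij the_inv_into_into[of \<Psi> ?V \<phi> ?V] f_the_inv_into_f[of \<Psi> ?V \<phi>]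
    by (simp_all add: bij_betw_def)
  have \<Phi>\<Psi>: "?\<Phi> (\<Psi> v) = v" if "v \<in> ?V" for v using that inj by (simp add: the_inv_into_f_f)
  show ?thesis
  proof (intro exI[of _ ?\<Phi>] conjI ballI allI)
    show "bij_betw ?\<Phi> H ?V" using bij by (rule bij_betw_the_inv_into)
    fix \<phi> assume \<phi>: "\<phi> \<in> H"
    show "?\<Phi> (\<lambda>U f p. \<phi> U f p + \<psi> U f p) = ?\<Phi> \<phi> + ?\<Phi> \<psi>" if "\<psi> \<in> H" for \<psi>
      using add[of "?\<Phi> \<phi>" "?\<Phi> \<psi>"] \<Phi>\<Psi>[OF V_add[OF \<Phi>_in[OF \<phi>] \<Phi>_in[OF that]]] \<Psi>\<Phi>[OF \<phi>] \<Psi>\<Phi>[OF that] by simp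
    show "?\<Phi> (\<lambda>U f p. c * \<phi> U f p) = Poly_Mapping.map ((*) c) (?\<Phi> \<phi>)" for c
      using scale[of c "?\<Phi> \<phi>"] \<Phi>\<Psi>[OF V_scale[OF \<Phi>_in[OF \<phi>]]] \<Psi>\<Phi>[OF \<phi>] by simp
  qed
qed

section \<open>The ring of functions on the critical scheme\<close>

lemma homogeneous_system_nontrivial_solution:
  fixes c :: "'i \<Rightarrow> 'j \<Rightarrow> complex"
  assumes "finite J" "finite I" "card J < card I"
  shows "\<exists>x. (\<exists>i\<in>I. x i \<noteq> 0) \<and> (\<forall>j\<in>J. (\<Sum>i\<in>I. x i * c i j) = 0)"
  using assms
proof (induction J arbitrary: I c rule: finite_induct)
  case empty
  then obtain i where "i \<in> I" by (metis card_gt_0_iff ex_in_conv card.empty)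
  then show ?case by (intro exI[of _ "\<lambda>_. 1"]) auto
next
  case (insert j0 J)
  show ?case
  proof (cases "\<forall>i\<in>I. c i j0 = 0")
    case True
    have "card J < card I" using insert by simp
    from insert.IH[OF insert.prems(1) this, of c] True show ?thesis by auto
  next
    case False
    then obtain i0 where i0: "i0 \<in> I" "c i0 j0 \<noteq> 0" by blast
    define c' where "c' i j = c i j - c i j0 / c i0 j0 * c i0 j" for i j
    have "card J < card (I - {i0})" using insert i0 by simp
    from insert.IH[OF _ this, of c'] insert.prems(1) obtain x where
      x: "\<exists>i\<in>I - {i0}. x i \<noteq> 0" "\<And>j. j \<in> J \<Longrightarrow> (\<Sum>i\<in>I - {i0}. x i * c' i j) = 0" by auto
    define t where "t = (\<Sum>i\<in>I - {i0}. x i * c i j0) / c i0 j0"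
    define y where "y = x(i0 := - t)"
    have sum_y: "(\<Sum>i\<in>I. y i * c i j) = (\<Sum>i\<in>I - {i0}. x i * c i j) - t * c i0 j" for j
    proof -
      have "(\<Sum>i\<in>I. y i * c i j) = y i0 * c i0 j + (\<Sum>i\<in>I - {i0}. y i * c i j)"
        using i0 insert.prems(1) by (simp add: sum.remove)
      also have "(\<Sum>i\<in>I - {i0}. y i * c i j) = (\<Sum>i\<in>I - {i0}. x i * c i j)"
        by (intro sum.cong) (auto simp: y_def)
      finally show ?thesis by (simp add: y_def)
    qed
    have "(\<Sum>i\<in>I. y i * c i j) = 0" if "j \<in> insert j0 J" for j
    proof (cases "j = j0")
      case True
      then show ?thesis using i0 by (simp add: sum_y t_def)
    next
      case False
      then have "(\<Sum>i\<in>I - {i0}. x i * c' i j) = 0" using x(2) that by blast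
      moreover have "(\<Sum>i\<in>I - {i0}. x i * c' i j) = (\<Sum>i\<in>I - {i0}. x i * c i j) - t * c i0 j"
        by (simp add: c'_def right_diff_distrib sum_subtractf t_def sum_divide_distrib sum_distrib_right mult.assoc)
      ultimately show ?thesis by (simp add: sum_y)
    qed
    moreover have "\<exists>i\<in>I. y i \<noteq> 0" using x(1) by (auto simp: y_def)
    ultimately show ?thesis by blast
  qed
qed

text \<open>Normalizing the coefficient of \<open>v^d\<close> to 1 is what allows a relation between powers of \<open>u\<close> and \<open>v\<close> to be
solved for the highest power of \<open>v\<close>.\<close>

definition monic_binary_form :: "nat \<Rightarrow> (complex \<Rightarrow> complex \<Rightarrow> complex) \<Rightarrow> bool" where
  "monic_binary_form d F \<longleftrightarrow> (\<exists>c. c d = 1 \<and> (\<forall>u v. F u v = (\<Sum>i\<le>d. c i * (u ^ (d - i) * v ^ i))))"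

lemma monic_binary_form_linear_mult:
  assumes "monic_binary_form d F"
  shows "monic_binary_form (Suc d) (\<lambda>u v. (v - \<rho> * u) * F u v)"
proof -
  obtain c where c: "c d = 1" "\<And>u v. F u v = (\<Sum>i\<le>d. c i * (u ^ (d - i) * v ^ i))"
    using assms unfolding monic_binary_form_def by blast
  define c' where "c' i = (if i = 0 then 0 else c (i - 1)) - (if i \<le> d then \<rho> * c i else 0)" for i
  have "(v - \<rho> * u) * F u v = (\<Sum>i\<le>Suc d. c' i * (u ^ (Suc d - i) * v ^ i))" for u v
  proof -
    have 1: "v * F u v = (\<Sum>i\<le>Suc d. (if i = 0 then 0 else c (i - 1)) * (u ^ (Suc d - i) * v ^ i))"
      by (subst sum.atMost_Suc_shift) (simp add: c(2) sum_distrib_left mult_ac)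
    have "(\<Sum>i\<le>Suc d. (if i \<le> d then \<rho> * c i else 0) * (u ^ (Suc d - i) * v ^ i)) =
        (\<Sum>i\<le>d. \<rho> * c i * (u ^ (Suc d - i) * v ^ i))" by simp
    also have "\<dots> = \<rho> * u * F u v"
      unfolding c(2) sum_distrib_left by (intro sum.cong) (auto simp: Suc_diff_le mult_ac)
    finally show ?thesis using 1
      by (simp only: c'_def left_diff_distrib sum_subtractf)
  qed
  moreover have "c' (Suc d) = 1" using c(1) by (simp add: c'_def)
  ultimately show ?thesis unfolding monic_binary_form_def by blast
qed

lemma monic_binary_form_linear_power_mult:
  "monic_binary_form d F \<Longrightarrow> monic_binary_form (n + d) (\<lambda>u v. (v - \<rho> * u) ^ n * F u v)"
proof (induction n)
  case (Suc n)
  from monic_binary_form_linear_mult[OF Suc.IH[OF Suc.prems], of \<rho>] show ?case by (simp add: mult.assoc)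
qed simp

lemma monic_binary_form_prod:
  "finite J \<Longrightarrow> monic_binary_form (\<Sum>j\<in>J. n j) (\<lambda>u v. \<Prod>j\<in>J. (v - \<rho> j * u) ^ n j)"
proof (induction J rule: finite_induct)
  case empty
  show ?case by (auto simp: monic_binary_form_def intro: exI[of _ "\<lambda>_. 1"])
next
  case (insert j J)
  from monic_binary_form_linear_power_mult[OF insert.IH, of "n j" "\<rho> j"] insert.hyps show ?case by simp
qed

lemma laurent_power: "P \<in> laurent s r \<Longrightarrow> (\<lambda>p. P p ^ n) \<in> laurent s r"
  by (induction n) (auto intro: laurent.const laurent.mult)

lemma laurent_prod: "(\<And>i. i \<in> A \<Longrightarrow> P i \<in> laurent s r) \<Longrightarrow> (\<lambda>p. \<Prod>i\<in>A. P i p) \<in> laurent s r"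
  by (induction A rule: infinite_finite_induct) (auto intro: laurent.const laurent.mult)

lemma laurent_sum: "(\<And>i. i \<in> A \<Longrightarrow> P i \<in> laurent s r) \<Longrightarrow> (\<lambda>p. \<Sum>i\<in>A. P i p) \<in> laurent s r"
  by (induction A rule: infinite_finite_induct) (auto intro: laurent.const laurent.add)

lemma laurent_diff:
  assumes "P \<in> laurent s r" "Q \<in> laurent s r" shows "(\<lambda>p. P p - Q p) \<in> laurent s r"
  using laurent.add[OF assms(1) laurent.mult[OF laurent.const[of "-1"] assms(2)]] by simp

locale LG_member =
  fixes s r :: nat and a :: "nat \<Rightarrow> nat" and \<alpha> \<beta> :: "nat \<Rightarrow> complex"
  assumes in_LG_space: "(\<alpha>, \<beta>) \<in> LG_space s r"
begin

abbreviation "f \<equiv> (\<alpha>, \<beta>)"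
abbreviation "ideal \<equiv> crit_ideal s r a f"
abbreviation "indices \<equiv> {1..s} <+> {1..r}"

definition u_value :: "cpair \<Rightarrow> complex" where
  "u_value p = \<alpha> 0 * ((\<Prod>j=1..r. snd p j ^ a j) / (\<Prod>i=1..s. fst p i))"

definition v_value :: "cpair \<Rightarrow> complex" where
  "v_value p = \<beta> 0 * (1 / (\<Prod>j=1..r. snd p j))"

lemma alpha_nonzero: "i \<le> s \<Longrightarrow> \<alpha> i \<noteq> 0" and beta_nonzero: "j \<le> r \<Longrightarrow> \<beta> j \<noteq> 0"
  using in_LG_space by (auto simp: LG_space_def PiE_iff)

lemma torus_nonzero:
  assumes "p \<in> LG_torus s r"
  shows "i \<in> {1..s} \<Longrightarrow> fst p i \<noteq> 0" and "j \<in> {1..r} \<Longrightarrow> snd p j \<noteq> 0"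
  using assms by (auto simp: LG_torus_def PiE_iff)

lemma log_deriv_z:
  assumes p: "p \<in> LG_torus s r" and i: "i \<in> {1..s}"
  shows "log_deriv (LG_poly s r a f) (Inl i) p = \<alpha> i * fst p i - u_value p"
proof -
  obtain z w where zw: "p = (z, w)" by (cases p)
  have zi: "z i \<noteq> 0" using torus_nonzero[OF p] i by (auto simp: zw)
  define C where "C = 1 + (\<Sum>i'\<in>{1..s}-{i}. \<alpha> i' * z i') + (\<Sum>j=1..r. \<beta> j * w j) + \<beta> 0 * (1 / (\<Prod>j=1..r. w j))"
  define K where "K = \<alpha> 0 * ((\<Prod>j=1..r. w j ^ a j) / (\<Prod>i'\<in>{1..s}-{i}. z i'))"
  have "LG_poly s r a f (z(i := x), w) = C + \<alpha> i * x + K / x" for x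
  proof -
    have "(\<Sum>i'=1..s. \<alpha> i' * (z(i := x)) i') = \<alpha> i * x + (\<Sum>i'\<in>{1..s}-{i}. \<alpha> i' * z i')"
      using i by (subst sum.remove[of _ i]) (auto intro!: sum.cong)
    moreover have "(\<Prod>i'=1..s. (z(i := x)) i') = x * (\<Prod>i'\<in>{1..s}-{i}. z i')"
      using i by (subst prod.remove[of _ i]) (auto intro!: prod.cong)
    ultimately show ?thesis by (simp add: LG_poly_def C_def K_def mult_ac)
  qed
  then have "deriv (\<lambda>x. LG_poly s r a f (z(i := x), w)) (z i) = deriv (\<lambda>x. C + \<alpha> i * x + K / x) (z i)" by simp
  also have "\<dots> = \<alpha> i - K / (z i)\<^sup>2"
    using zi by (intro DERIV_imp_deriv) (auto intro!: derivative_eq_intros simp: power2_eq_square)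
  finally have "log_deriv (LG_poly s r a f) (Inl i) p = \<alpha> i * z i - K / z i"
    using zi by (simp add: zw right_diff_distrib power2_eq_square)
  moreover have "K / z i = u_value p"
    using i by (simp add: K_def u_value_def zw prod.remove[of _ i z] mult.commute)
  ultimately show ?thesis by (simp add: zw)
qed

lemma log_deriv_w:
  assumes p: "p \<in> LG_torus s r" and j: "j \<in> {1..r}"
  shows "log_deriv (LG_poly s r a f) (Inr j) p = \<beta> j * snd p j + of_nat (a j) * u_value p - v_value p"
proof -
  obtain z w where zw: "p = (z, w)" by (cases p)
  have wj: "w j \<noteq> 0" using torus_nonzero[OF p] j by (auto simp: zw)
  define C where "C = 1 + (\<Sum>i=1..s. \<alpha> i * z i) + (\<Sum>j'\<in>{1..r}-{j}. \<beta> j' * w j')"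
  define U where "U = \<alpha> 0 * ((\<Prod>j'\<in>{1..r}-{j}. w j' ^ a j') / (\<Prod>i=1..s. z i))"
  define V where "V = \<beta> 0 * (1 / (\<Prod>j'\<in>{1..r}-{j}. w j'))"
  have "LG_poly s r a f (z, w(j := x)) = C + \<beta> j * x + U * x ^ a j + V / x" for x
  proof -
    have "(\<Sum>j'=1..r. \<beta> j' * (w(j := x)) j') = \<beta> j * x + (\<Sum>j'\<in>{1..r}-{j}. \<beta> j' * w j')"
      using j by (subst sum.remove[of _ j]) (auto intro!: sum.cong)
    moreover have "(\<Prod>j'=1..r. (w(j := x)) j' ^ a j') = x ^ a j * (\<Prod>j'\<in>{1..r}-{j}. w j' ^ a j')"
      using j by (subst prod.remove[of _ j]) (auto intro!: prod.cong)
    moreover have "(\<Prod>j'=1..r. (w(j := x)) j') = x * (\<Prod>j'\<in>{1..r}-{j}. w j')"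
      using j by (subst prod.remove[of _ j]) (auto intro!: prod.cong)
    ultimately show ?thesis by (simp add: LG_poly_def C_def U_def V_def mult_ac)
  qed
  then have "deriv (\<lambda>x. LG_poly s r a f (z, w(j := x))) (w j) = deriv (\<lambda>x. C + \<beta> j * x + U * x ^ a j + V / x) (w j)" by simp
  also have "\<dots> = \<beta> j + U * (of_nat (a j) * w j ^ (a j - 1)) - V / (w j)\<^sup>2"
    using wj by (intro DERIV_imp_deriv) (auto intro!: derivative_eq_intros simp: power2_eq_square)
  finally have "log_deriv (LG_poly s r a f) (Inr j) p =
      w j * (\<beta> j + U * (of_nat (a j) * w j ^ (a j - 1)) - V / (w j)\<^sup>2)" by (simp add: zw)
  also have "\<dots> = \<beta> j * w j + of_nat (a j) * (U * w j ^ a j) - V / w j"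
    using wj by (cases "a j") (simp_all add: field_simps power2_eq_square)
  also have "U * w j ^ a j = u_value p"
    using j by (simp add: U_def u_value_def zw prod.remove[of _ j "\<lambda>j. w j ^ a j"] mult_ac)
  also have "V / w j = v_value p"
    using j by (simp add: V_def v_value_def zw prod.remove[of _ j w] mult_ac)
  finally show ?thesis by (simp add: zw)
qed

text \<open>The critical equations express all coordinates by the two quantities \<open>u\<close> and \<open>v\<close>.\<close>

lemma Crit_iff:
  "p \<in> Crit s r a f \<longleftrightarrow> p \<in> LG_torus s r \<and> (\<forall>i\<in>{1..s}. \<alpha> i * fst p i = u_value p)
     \<and> (\<forall>j\<in>{1..r}. \<beta> j * snd p j = v_value p - of_nat (a j) * u_value p)"
  by (auto simp: Crit_def log_deriv_z log_deriv_w algebra_simps Plus_def ball_Un)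

lemma u_value_laurent: "u_value \<in> laurent s r"
proof -
  have "(\<lambda>p. \<alpha> 0 * ((\<Prod>j=1..r. snd p j ^ a j) * (\<Prod>i=1..s. inverse (fst p i)))) \<in> laurent s r"
    by (intro laurent.mult laurent.const laurent_prod laurent_power laurent.w laurent.z_inv)
  then show ?thesis by (simp add: u_value_def[abs_def] divide_inverse prod_inversef[unfolded o_def])
qed

lemma v_value_laurent: "v_value \<in> laurent s r"
proof -
  have "(\<lambda>p. \<beta> 0 * (\<Prod>j=1..r. inverse (snd p j))) \<in> laurent s r"
    by (intro laurent.mult laurent.const laurent_prod laurent.w_inv)
  then show ?thesis by (simp add: v_value_def[abs_def] divide_inverse prod_inversef[unfolded o_def])
qed

lemma idealI:
  assumes "h \<in> laurent s r" "\<And>d. d \<in> indices \<Longrightarrow> q d \<in> laurent s r"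
    and "\<And>p. p \<in> LG_torus s r \<Longrightarrow> h p = (\<Sum>d\<in>indices. q d p * log_deriv (LG_poly s r a f) d p)"
  shows "h \<in> ideal"
  using assms unfolding crit_ideal_def by blast

lemma idealE:
  assumes "h \<in> ideal"
  obtains q where "h \<in> laurent s r" "\<forall>d\<in>indices. q d \<in> laurent s r"
    and "\<forall>p\<in>LG_torus s r. h p = (\<Sum>d\<in>indices. q d p * log_deriv (LG_poly s r a f) d p)"
  using assms unfolding crit_ideal_def mem_Collect_eq by (elim conjE exE)

lemma ideal_zero: "h \<in> laurent s r \<Longrightarrow> (\<And>p. p \<in> LG_torus s r \<Longrightarrow> h p = 0) \<Longrightarrow> h \<in> ideal"
  by (rule idealI[where q = "\<lambda>d p. 0"]) (auto intro: laurent.const)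

lemma ideal_add:
  assumes "h \<in> ideal" "h' \<in> ideal" shows "(\<lambda>p. h p + h' p) \<in> ideal"
proof -
  obtain q where q: "h \<in> laurent s r" "\<forall>d\<in>indices. q d \<in> laurent s r"
    "\<forall>p\<in>LG_torus s r. h p = (\<Sum>d\<in>indices. q d p * log_deriv (LG_poly s r a f) d p)"
    using assms(1) by (rule idealE)
  obtain q' where q': "h' \<in> laurent s r" "\<forall>d\<in>indices. q' d \<in> laurent s r"
    "\<forall>p\<in>LG_torus s r. h' p = (\<Sum>d\<in>indices. q' d p * log_deriv (LG_poly s r a f) d p)"
    using assms(2) by (rule idealE)
  show ?thesis
    by (rule idealI[where q = "\<lambda>d p. q d p + q' d p"])
       (use q q' in \<open>simp_all add: laurent.add distrib_right sum.distrib\<close>)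
qed

lemma ideal_mult:
  assumes "h \<in> ideal" "g \<in> laurent s r" shows "(\<lambda>p. g p * h p) \<in> ideal"
proof -
  obtain q where q: "h \<in> laurent s r" "\<forall>d\<in>indices. q d \<in> laurent s r"
    "\<forall>p\<in>LG_torus s r. h p = (\<Sum>d\<in>indices. q d p * log_deriv (LG_poly s r a f) d p)"
    using assms(1) by (rule idealE)
  show ?thesis
    by (rule idealI[where q = "\<lambda>d p. g p * q d p"])
       (use q assms in \<open>simp_all add: laurent.mult sum_distrib_left mult.assoc\<close>)
qed

lemma ideal_vanishes_on_Crit:
  assumes "h \<in> ideal" "p \<in> Crit s r a f" shows "h p = 0"
proof -
  obtain q where q: "h \<in> laurent s r" "\<forall>d\<in>indices. q d \<in> laurent s r"
    "\<forall>p\<in>LG_torus s r. h p = (\<Sum>d\<in>indices. q d p * log_deriv (LG_poly s r a f) d p)"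
    using assms(1) by (rule idealE)
  have "p \<in> LG_torus s r" "\<forall>d\<in>indices. log_deriv (LG_poly s r a f) d p = 0"
    using assms(2) by (simp_all add: Crit_def)
  then show ?thesis using q(3) by simp
qed

lemma generator_in_ideal:
  assumes "d \<in> indices" "g \<in> laurent s r" "\<And>p. p \<in> LG_torus s r \<Longrightarrow> g p = log_deriv (LG_poly s r a f) d p"
  shows "g \<in> ideal"
proof (rule idealI[where q = "\<lambda>d' p. if d' = d then 1 else 0"])
  show "(\<lambda>p. if d' = d then 1 else 0) \<in> laurent s r" for d' by (cases "d' = d") (auto intro: laurent.const)
  fix p assume "p \<in> LG_torus s r"
  then show "g p = (\<Sum>d'\<in>indices. (if d' = d then 1 else 0) * log_deriv (LG_poly s r a f) d' p)"
    using assms by (simp add: if_distrib[of "\<lambda>x. x * _"] sum.delta cong: if_cong)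
qed (use assms in auto)

text \<open>Congruence of Laurent polynomials modulo the ideal of the critical scheme.\<close>

definition mod_eq :: "(cpair \<Rightarrow> complex) \<Rightarrow> (cpair \<Rightarrow> complex) \<Rightarrow> bool" where
  "mod_eq h h' \<longleftrightarrow> h \<in> laurent s r \<and> h' \<in> laurent s r \<and> (\<lambda>p. h p - h' p) \<in> ideal"

lemma mod_eq_refl: "h \<in> laurent s r \<Longrightarrow> mod_eq h h"
  unfolding mod_eq_def by (auto intro: ideal_zero laurent.const)

lemma mod_eq_exact:
  "h \<in> laurent s r \<Longrightarrow> h' \<in> laurent s r \<Longrightarrow> (\<And>p. p \<in> LG_torus s r \<Longrightarrow> h p = h' p) \<Longrightarrow> mod_eq h h'"
  unfolding mod_eq_def by (auto intro: ideal_zero laurent_diff)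

lemma mod_eq_sym: "mod_eq h h' \<Longrightarrow> mod_eq h' h"
  unfolding mod_eq_def
  using ideal_mult[of "\<lambda>p. h p - h' p" "\<lambda>p. -1"] by (auto intro: laurent.const)

lemma mod_eq_trans: "mod_eq h h' \<Longrightarrow> mod_eq h' h'' \<Longrightarrow> mod_eq h h''"
  unfolding mod_eq_def using ideal_add[of "\<lambda>p. h p - h' p" "\<lambda>p. h' p - h'' p"] by auto

lemma mod_eq_add: "mod_eq g g' \<Longrightarrow> mod_eq h h' \<Longrightarrow> mod_eq (\<lambda>p. g p + h p) (\<lambda>p. g' p + h' p)"
  unfolding mod_eq_def using ideal_add[of "\<lambda>p. g p - g' p" "\<lambda>p. h p - h' p"]
  by (auto intro: laurent.add simp: algebra_simps)

lemma mod_eq_mult: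
  assumes "mod_eq g g'" "mod_eq h h'" shows "mod_eq (\<lambda>p. g p * h p) (\<lambda>p. g' p * h' p)"
proof -
  have "(\<lambda>p. h p * (g p - g' p) + g' p * (h p - h' p)) \<in> ideal"
    using assms unfolding mod_eq_def by (intro ideal_add ideal_mult) auto
  then show ?thesis using assms unfolding mod_eq_def by (auto intro: laurent.mult simp: algebra_simps)
qed

lemma mod_eq_power: "mod_eq g g' \<Longrightarrow> mod_eq (\<lambda>p. g p ^ n) (\<lambda>p. g' p ^ n)"
  by (induction n) (auto intro: mod_eq_mult mod_eq_refl laurent.const)

lemma mod_eq_prod: "(\<And>i. i \<in> A \<Longrightarrow> mod_eq (g i) (g' i)) \<Longrightarrow> mod_eq (\<lambda>p. \<Prod>i\<in>A. g i p) (\<lambda>p. \<Prod>i\<in>A. g' i p)"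
  by (induction A rule: infinite_finite_induct) (auto intro: mod_eq_mult mod_eq_refl laurent.const)

lemma mod_eq_sum: "(\<And>i. i \<in> A \<Longrightarrow> mod_eq (g i) (g' i)) \<Longrightarrow> mod_eq (\<lambda>p. \<Sum>i\<in>A. g i p) (\<lambda>p. \<Sum>i\<in>A. g' i p)"
  by (induction A rule: infinite_finite_induct) (auto intro: mod_eq_add mod_eq_refl laurent.const)

lemma z_mod_eq_u: "i \<in> {1..s} \<Longrightarrow> mod_eq (\<lambda>p. \<alpha> i * fst p i) u_value"
  unfolding mod_eq_def
  by (intro conjI laurent.mult laurent.const laurent.z u_value_laurent generator_in_ideal[of "Inl i"] laurent_diff)
     (auto simp: log_deriv_z)

lemma w_mod_eq: "j \<in> {1..r} \<Longrightarrow> mod_eq (\<lambda>p. \<beta> j * snd p j) (\<lambda>p. v_value p - of_nat (a j) * u_value p)"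
  unfolding mod_eq_def
  by (intro conjI laurent.mult laurent.const laurent.w u_value_laurent v_value_laurent
        generator_in_ideal[of "Inr j"] laurent_diff)
     (auto simp: log_deriv_w)

text \<open>Obtained by multiplying the definition of \<open>v\<close> with the equations for all \<open>w_j\<close>.\<close>

lemma v_relation:
  "mod_eq (\<lambda>p. v_value p * (\<Prod>j=1..r. v_value p - of_nat (a j) * u_value p)) (\<lambda>p. \<Prod>j=0..r. \<beta> j)"
proof -
  have "mod_eq (\<lambda>p. v_value p * (\<Prod>j=1..r. \<beta> j * snd p j)) (\<lambda>p. v_value p * (\<Prod>j=1..r. v_value p - of_nat (a j) * u_value p))"
    by (intro mod_eq_mult mod_eq_prod mod_eq_refl v_value_laurent w_mod_eq)
  moreover have "mod_eq (\<lambda>p. v_value p * (\<Prod>j=1..r. \<beta> j * snd p j)) (\<lambda>p. \<Prod>j=0..r. \<beta> j)"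
  proof (rule mod_eq_exact)
    show "(\<lambda>p. v_value p * (\<Prod>j=1..r. \<beta> j * snd p j)) \<in> laurent s r"
      by (intro laurent.mult laurent_prod laurent.const laurent.w v_value_laurent)
    fix p assume "p \<in> LG_torus s r"
    then have "(\<Prod>j=1..r. snd p j) \<noteq> 0" by (simp add: torus_nonzero(2))
    moreover have "(\<Prod>j=0..r. \<beta> j) = \<beta> 0 * (\<Prod>j=1..r. \<beta> j)"
      using prod.atLeast_Suc_atMost[of 0 r \<beta>] by simp
    ultimately show "v_value p * (\<Prod>j=1..r. \<beta> j * snd p j) = (\<Prod>j=0..r. \<beta> j)"
      by (simp add: v_value_def prod.distrib)
  qed (auto intro: laurent.const)
  ultimately show ?thesis using mod_eq_trans mod_eq_sym by blast
qed

definition A0 :: complex where "A0 = (\<Prod>i=0..s. \<alpha> i) / (\<Prod>j=1..r. \<beta> j ^ a j)"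

text \<open>Obtained by multiplying the definition of \<open>u\<close> with the equations for all \<open>z_i\<close>.\<close>

lemma u_relation:
  "mod_eq (\<lambda>p. u_value p ^ Suc s) (\<lambda>p. A0 * (\<Prod>j=1..r. (v_value p - of_nat (a j) * u_value p) ^ a j))"
proof -
  have "mod_eq (\<lambda>p. u_value p * (\<Prod>i=1..s. \<alpha> i * fst p i)) (\<lambda>p. u_value p * (\<Prod>i=1..s. u_value p))"
    by (intro mod_eq_mult mod_eq_prod mod_eq_refl u_value_laurent z_mod_eq_u)
  then have "mod_eq (\<lambda>p. u_value p ^ Suc s) (\<lambda>p. u_value p * (\<Prod>i=1..s. \<alpha> i * fst p i))"
    by (auto intro: mod_eq_sym)
  moreover have "mod_eq (\<lambda>p. u_value p * (\<Prod>i=1..s. \<alpha> i * fst p i)) (\<lambda>p. A0 * (\<Prod>j=1..r. (\<beta> j * snd p j) ^ a j))"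
  proof (rule mod_eq_exact)
    fix p assume p: "p \<in> LG_torus s r"
    then have "(\<Prod>i=1..s. fst p i) \<noteq> 0" by (simp add: torus_nonzero(1))
    moreover have "(\<Prod>j=1..r. \<beta> j ^ a j) \<noteq> 0" using beta_nonzero by auto
    moreover have "(\<Prod>i=0..s. \<alpha> i) = \<alpha> 0 * (\<Prod>i=1..s. \<alpha> i)"
      using prod.atLeast_Suc_atMost[of 0 s \<alpha>] by simp
    ultimately show "u_value p * (\<Prod>i=1..s. \<alpha> i * fst p i) = A0 * (\<Prod>j=1..r. (\<beta> j * snd p j) ^ a j)"
      by (simp add: u_value_def A0_def prod.distrib power_mult_distrib del: prod_zero_iff)
  qed (intro laurent.mult laurent_prod laurent_power laurent.const laurent.w laurent.z u_value_laurent; simp)+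
  moreover have "mod_eq (\<lambda>p. A0 * (\<Prod>j=1..r. (\<beta> j * snd p j) ^ a j))
      (\<lambda>p. A0 * (\<Prod>j=1..r. (v_value p - of_nat (a j) * u_value p) ^ a j))"
    by (intro mod_eq_mult mod_eq_prod mod_eq_power mod_eq_refl laurent.const w_mod_eq)
  ultimately show ?thesis using mod_eq_trans by blast
qed

text \<open>For indices in \<open>{..s} \<times> {..r}\<close> these monomials span the ring of functions on the critical scheme
(\<open>laurent_spanned\<close>); they form a basis when there are \<open>(s + 1) * (r + 1)\<close> critical points.\<close>

definition basis :: "nat \<times> nat \<Rightarrow> cpair \<Rightarrow> complex" where
  "basis = (\<lambda>(k, l) p. u_value p ^ k * v_value p ^ l)"

abbreviation "basis_indices \<equiv> {..s} \<times> {..r}"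

definition spanned :: "(cpair \<Rightarrow> complex) set" where
  "spanned = {h \<in> laurent s r. \<exists>c. mod_eq h (\<lambda>p. \<Sum>kl\<in>basis_indices. c kl * basis kl p)}"

lemma basis_laurent: "basis kl \<in> laurent s r"
  by (cases kl) (auto simp: basis_def intro!: laurent.mult laurent_power u_value_laurent v_value_laurent)

lemma basis_shift: "basis (k + d, l + e) p = basis (k, l) p * (u_value p ^ d * v_value p ^ e)"
  by (simp add: basis_def power_add mult_ac)

lemma spannedI: "mod_eq h (\<lambda>p. \<Sum>kl\<in>basis_indices. c kl * basis kl p) \<Longrightarrow> h \<in> spanned"
  unfolding spanned_def mod_eq_def by auto

lemma spannedE:
  assumes "h \<in> spanned"
  obtains c where "mod_eq h (\<lambda>p. \<Sum>kl\<in>basis_indices. c kl * basis kl p)"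
  using assms unfolding spanned_def by auto

lemma spanned_mod_eq: "h' \<in> spanned \<Longrightarrow> mod_eq h h' \<Longrightarrow> h \<in> spanned"
  by (elim spannedE) (rule spannedI, rule mod_eq_trans)

lemma spanned_basis: "kl \<in> basis_indices \<Longrightarrow> basis kl \<in> spanned"
  by (rule spannedI[where c = "\<lambda>x. if x = kl then 1 else 0"])
     (auto simp: if_distrib[of "\<lambda>x. x * _"] sum.delta cong: if_cong intro!: mod_eq_refl basis_laurent)

lemma spanned_add:
  assumes "g \<in> spanned" "h \<in> spanned" shows "(\<lambda>p. g p + h p) \<in> spanned"
proof -
  obtain c d where "mod_eq g (\<lambda>p. \<Sum>kl\<in>basis_indices. c kl * basis kl p)"
    "mod_eq h (\<lambda>p. \<Sum>kl\<in>basis_indices. d kl * basis kl p)"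
    using assms by (elim spannedE)
  from mod_eq_add[OF this] show ?thesis
    by (intro spannedI[where c = "\<lambda>kl. c kl + d kl"]) (simp add: distrib_right sum.distrib)
qed

lemma spanned_scale:
  assumes "h \<in> spanned" shows "(\<lambda>p. x * h p) \<in> spanned"
proof -
  obtain c where "mod_eq h (\<lambda>p. \<Sum>kl\<in>basis_indices. c kl * basis kl p)" using assms by (elim spannedE)
  from mod_eq_mult[OF mod_eq_refl[OF laurent.const[of x]] this] show ?thesis
    by (intro spannedI[where c = "\<lambda>kl. x * c kl"]) (simp add: sum_distrib_left mult.assoc)
qed

lemma spanned_zero: "(\<lambda>p. 0) \<in> spanned"
  by (rule spannedI[where c = "\<lambda>_. 0"]) (auto intro: mod_eq_refl laurent.const)

lemma spanned_sum: "(\<And>i. i \<in> A \<Longrightarrow> h i \<in> spanned) \<Longrightarrow> (\<lambda>p. \<Sum>i\<in>A. h i p) \<in> spanned"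
  by (induction A rule: infinite_finite_induct) (auto intro: spanned_add spanned_zero)

lemma u_power_reduction:
  "\<exists>c. mod_eq (\<lambda>p. u_value p ^ Suc s) (\<lambda>p. \<Sum>i\<le>(\<Sum>j=1..r. a j). c i * (u_value p ^ ((\<Sum>j=1..r. a j) - i) * v_value p ^ i))"
proof -
  obtain c where c: "\<And>u v :: complex. (\<Prod>j=1..r. (v - of_nat (a j) * u) ^ a j) = (\<Sum>i\<le>(\<Sum>j=1..r. a j). c i * (u ^ ((\<Sum>j=1..r. a j) - i) * v ^ i))"
    using monic_binary_form_prod[of "{1..r}" a "\<lambda>j. of_nat (a j)"] unfolding monic_binary_form_def by auto
  show ?thesis using u_relation
    by (intro exI[of _ "\<lambda>i. A0 * c i"]) (simp only: c sum_distrib_left mult.assoc)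
qed

lemma v_power_reduction:
  "\<exists>c b. mod_eq (\<lambda>p. v_value p ^ Suc r) (\<lambda>p. b + (\<Sum>i<r. c i * (u_value p ^ (r - i) * v_value p ^ Suc i)))"
proof -
  have "monic_binary_form r (\<lambda>u v. \<Prod>j=1..r. v - of_nat (a j) * u)"
    using monic_binary_form_prod[of "{1..r}" "\<lambda>_. 1" "\<lambda>j. of_nat (a j)"] by simp
  then obtain c where c: "c r = 1" "\<And>u v :: complex. (\<Prod>j=1..r. v - of_nat (a j) * u) = (\<Sum>i\<le>r. c i * (u ^ (r - i) * v ^ i))"
    unfolding monic_binary_form_def by auto
  have expand: "v * (\<Prod>j=1..r. v - of_nat (a j) * u) = v ^ Suc r + (\<Sum>i<r. c i * (u ^ (r - i) * v ^ Suc i))" for u v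
    unfolding c(2) by (simp add: lessThan_Suc_atMost[symmetric] c(1) sum_distrib_left algebra_simps)
  have L: "(\<lambda>p. - (\<Sum>i<r. c i * (u_value p ^ (r - i) * v_value p ^ Suc i))) \<in> laurent s r"
  proof -
    have "(\<lambda>p. \<Sum>i<r. - c i * (u_value p ^ (r - i) * v_value p ^ Suc i)) \<in> laurent s r"
      by (intro laurent_sum laurent.mult laurent_power laurent.const u_value_laurent v_value_laurent)
    then show ?thesis by (simp add: sum_negf)
  qed
  from mod_eq_add[OF v_relation mod_eq_refl[OF this]]
  have "mod_eq (\<lambda>p. v_value p ^ Suc r) (\<lambda>p. (\<Prod>j=0..r. \<beta> j) + - (\<Sum>i<r. c i * (u_value p ^ (r - i) * v_value p ^ Suc i)))"
    unfolding expand by (simp only: add.assoc add.right_inverse add_0_right)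
  then show ?thesis
    by (intro exI[of _ "\<lambda>i. - c i"] exI[of _ "\<Prod>j=0..r. \<beta> j"]) (simp add: sum_negf)
qed

text \<open>The two relations are rewriting rules. The one for \<open>u^(s+1)\<close> lowers the total degree, because
\<open>\<Sum> a_j \<le> s\<close>. The one for \<open>v^(r+1)\<close> yields a constant and terms of the same total degree with a lower
power of \<open>v\<close>. Hence rewriting terminates in the lexicographic order on total degree and \<open>v\<close>-degree.\<close>

lemma basis_spanned:
  assumes "(\<Sum>j=1..r. a j) \<le> s"
  shows "basis (k, l) \<in> spanned"
proof -
  define \<sigma> where "\<sigma> = (\<Sum>j=1..r. a j)"
  have "\<sigma> \<le> s" using assms by (simp add: \<sigma>_def)
  have "wf (measures [\<lambda>(k :: nat, l :: nat). k + l, \<lambda>(k, l). l])" by simp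
  then have "basis kl \<in> spanned" for kl
  proof (induction kl rule: wf_induct_rule)
    case (less kl)
    obtain k l where kl: "kl = (k, l)" by (cases kl)
    have IH: "basis (k', l') \<in> spanned" if "k' + l' < k + l \<or> (k' + l' = k + l \<and> l' < l)" for k' l'
      using less[of "(k', l')"] that by (auto simp: kl)
    consider "k \<le> s" "l \<le> r" | "l > r" | "k > s" by linarith
    then show ?case
    proof cases
      case 1 then show ?thesis by (intro spanned_basis) (simp add: kl)
    next
      case 2
      obtain c b where cb: "mod_eq (\<lambda>p. v_value p ^ Suc r) (\<lambda>p. b + (\<Sum>i<r. c i * (u_value p ^ (r - i) * v_value p ^ Suc i)))"
        using v_power_reduction by blast
      have l: "l = (l - Suc r) + Suc r" using 2 by simp
      have eq: "basis kl = (\<lambda>p. basis (k, l - Suc r) p * v_value p ^ Suc r)"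
        by (subst kl, subst l) (simp only: basis_def prod.case power_add mult.assoc)
      from mod_eq_mult[OF mod_eq_refl[OF basis_laurent] cb, of "(k, l - Suc r)"]
      have "mod_eq (basis kl) (\<lambda>p. b * basis (k, l - Suc r) p + (\<Sum>i<r. c i * basis (k + (r - i), (l - Suc r) + Suc i) p))"
        unfolding eq basis_shift distrib_left sum_distrib_left by (simp only: mult.commute mult.left_commute)
      moreover have "(\<lambda>p. b * basis (k, l - Suc r) p + (\<Sum>i<r. c i * basis (k + (r - i), (l - Suc r) + Suc i) p)) \<in> spanned"
        by (intro spanned_add spanned_scale spanned_sum IH) (use 2 in auto)
      ultimately show ?thesis by (rule spanned_mod_eq[rotated])
    next
      case 3
      obtain c where c: "mod_eq (\<lambda>p. u_value p ^ Suc s) (\<lambda>p. \<Sum>i\<le>\<sigma>. c i * (u_value p ^ (\<sigma> - i) * v_value p ^ i))"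
        using u_power_reduction unfolding \<sigma>_def by blast
      have k: "k = (k - Suc s) + Suc s" using 3 by simp
      have eq: "basis kl = (\<lambda>p. basis (k - Suc s, l) p * u_value p ^ Suc s)"
        by (subst kl, subst k) (simp add: basis_def power_add mult_ac)
      from mod_eq_mult[OF mod_eq_refl[OF basis_laurent] c, of "(k - Suc s, l)"]
      have "mod_eq (basis kl) (\<lambda>p. \<Sum>i\<le>\<sigma>. c i * basis ((k - Suc s) + (\<sigma> - i), l + i) p)"
        unfolding eq basis_shift sum_distrib_left by (simp only: mult.commute mult.left_commute)
      moreover have "(\<lambda>p. \<Sum>i\<le>\<sigma>. c i * basis ((k - Suc s) + (\<sigma> - i), l + i) p) \<in> spanned"
        by (intro spanned_scale spanned_sum IH) (use 3 \<open>\<sigma> \<le> s\<close> in auto)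
      ultimately show ?thesis by (rule spanned_mod_eq[rotated])
    qed
  qed
  then show ?thesis .
qed

text \<open>Unlike \<open>spanned\<close>, this set is closed under products by a direct argument, so a Laurent polynomial is
seen to belong to it by induction on its construction.\<close>

definition multipliers :: "(cpair \<Rightarrow> complex) set" where
  "multipliers = {h \<in> laurent s r. \<forall>kl. (\<lambda>p. basis kl p * h p) \<in> spanned}"

lemma multipliersD: "h \<in> multipliers \<Longrightarrow> (\<lambda>p. basis kl p * h p) \<in> spanned"
  by (cases kl) (auto simp: multipliers_def)

lemma multipliers_mult:
  assumes g: "g \<in> multipliers" and h: "h \<in> multipliers" shows "(\<lambda>p. g p * h p) \<in> multipliers"
proof -
  have hL: "h \<in> laurent s r" using h by (simp add: multipliers_def)
  have "(\<lambda>p. basis kl p * (g p * h p)) \<in> spanned" for kl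
  proof -
    have "(\<lambda>p. basis kl p * g p) \<in> spanned" using g by (rule multipliersD)
    then obtain c where "mod_eq (\<lambda>p. basis kl p * g p) (\<lambda>p. \<Sum>kl\<in>basis_indices. c kl * basis kl p)" by (rule spannedE)
    from mod_eq_mult[OF this mod_eq_refl[OF hL]]
    have "mod_eq (\<lambda>p. basis kl p * (g p * h p)) (\<lambda>p. \<Sum>kl\<in>basis_indices. c kl * (basis kl p * h p))"
      by (simp add: sum_distrib_right mult.assoc)
    moreover have "(\<lambda>p. \<Sum>kl\<in>basis_indices. c kl * (basis kl p * h p)) \<in> spanned"
      using h by (intro spanned_sum spanned_scale multipliersD)
    ultimately show ?thesis by (rule spanned_mod_eq[rotated])
  qed
  then show ?thesis using g h by (auto simp: multipliers_def intro: laurent.mult)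
qed

lemma multipliers_mod_eq:
  assumes "h' \<in> multipliers" "mod_eq h h'" shows "h \<in> multipliers"
proof -
  have "(\<lambda>p. basis kl p * h p) \<in> spanned" for kl
    by (rule spanned_mod_eq[OF multipliersD[OF assms(1)] mod_eq_mult[OF mod_eq_refl[OF basis_laurent] assms(2)]])
  then show ?thesis using assms by (auto simp: multipliers_def mod_eq_def)
qed

lemma multipliers_prod:
  assumes "\<And>i. i \<in> A \<Longrightarrow> h i \<in> multipliers" "(\<lambda>p. 1) \<in> multipliers"
  shows "(\<lambda>p. \<Prod>i\<in>A. h i p) \<in> multipliers"
  using assms by (induction A rule: infinite_finite_induct) (auto intro: multipliers_mult)

lemma multipliers_power:
  "h \<in> multipliers \<Longrightarrow> (\<lambda>p. 1) \<in> multipliers \<Longrightarrow> (\<lambda>p. h p ^ n) \<in> multipliers"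
  by (induction n) (auto intro: multipliers_mult)

lemma multipliers_add:
  "g \<in> multipliers \<Longrightarrow> h \<in> multipliers \<Longrightarrow> (\<lambda>p. g p + h p) \<in> multipliers"
  by (simp add: multipliers_def distrib_left spanned_add laurent.add)

text \<open>The coordinates are congruent to linear combinations of \<open>u\<close> and \<open>v\<close>, and their inverses are products
of \<open>u\<close>, \<open>v\<close> and other coordinates.\<close>

lemma laurent_spanned:
  assumes \<sigma>: "(\<Sum>j=1..r. a j) \<le> s" and h: "h \<in> laurent s r"
  shows "h \<in> spanned"
proof -
  have const: "(\<lambda>p. c) \<in> multipliers" for c
    using spanned_scale[OF basis_spanned[OF \<sigma>], of c] by (auto simp: multipliers_def mult.commute intro: laurent.const)
  have u: "u_value \<in> multipliers"
  proof -
    have "(\<lambda>p. basis (k, l) p * u_value p) = basis (Suc k, l)" for k l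
      by (simp add: basis_def fun_eq_iff mult_ac)
    then show ?thesis using basis_spanned[OF \<sigma>] by (auto simp: multipliers_def u_value_laurent)
  qed
  have v: "v_value \<in> multipliers"
  proof -
    have "(\<lambda>p. basis (k, l) p * v_value p) = basis (k, Suc l)" for k l
      by (simp add: basis_def fun_eq_iff mult_ac)
    then show ?thesis using basis_spanned[OF \<sigma>] by (auto simp: multipliers_def v_value_laurent)
  qed
  have z: "(\<lambda>p. fst p i) \<in> multipliers" if i: "i \<in> {1..s}" for i
  proof -
    have "(\<lambda>p. \<alpha> i * fst p i) \<in> multipliers" by (rule multipliers_mod_eq[OF u z_mod_eq_u[OF i]])
    from multipliers_mult[OF const[of "1 / \<alpha> i"] this] show ?thesis using alpha_nonzero i by simp
  qed
  have w: "(\<lambda>p. snd p j) \<in> multipliers" if j: "j \<in> {1..r}" for j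
  proof -
    have "(\<lambda>p. v_value p + - of_nat (a j) * u_value p) \<in> multipliers"
      by (intro multipliers_add multipliers_mult const u v)
    then have "(\<lambda>p. \<beta> j * snd p j) \<in> multipliers" using multipliers_mod_eq w_mod_eq[OF j] by simp
    from multipliers_mult[OF const[of "1 / \<beta> j"] this] show ?thesis using beta_nonzero j by simp
  qed
  have w_inv: "(\<lambda>p. inverse (snd p j)) \<in> multipliers" if j: "j \<in> {1..r}" for j
  proof (rule multipliers_mod_eq)
    show "(\<lambda>p. 1 / \<beta> 0 * (v_value p * (\<Prod>j'\<in>{1..r}-{j}. snd p j'))) \<in> multipliers"
      by (intro multipliers_mult multipliers_prod const v w) auto
    show "mod_eq (\<lambda>p. inverse (snd p j)) (\<lambda>p. 1 / \<beta> 0 * (v_value p * (\<Prod>j'\<in>{1..r}-{j}. snd p j')))"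
    proof (rule mod_eq_exact)
      fix p assume p: "p \<in> LG_torus s r"
      have "(\<Prod>j'\<in>{1..r}-{j}. snd p j') \<noteq> 0" using torus_nonzero(2)[OF p] by simp
      then show "inverse (snd p j) = 1 / \<beta> 0 * (v_value p * (\<Prod>j'\<in>{1..r}-{j}. snd p j'))"
        using beta_nonzero[of 0] prod.remove[of "{1..r}" j "snd p"] j
        by (simp add: v_value_def field_simps del: prod_zero_iff)
    next
      show "(\<lambda>p. 1 / \<beta> 0 * (v_value p * (\<Prod>j'\<in>{1..r}-{j}. snd p j'))) \<in> laurent s r"
        by (intro laurent.mult laurent.const laurent_prod v_value_laurent laurent.w) auto
    qed (use j in \<open>auto intro: laurent.w_inv\<close>)
  qed
  have z_inv: "(\<lambda>p. inverse (fst p i)) \<in> multipliers" if i: "i \<in> {1..s}" for i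
  proof (rule multipliers_mod_eq)
    let ?g = "\<lambda>p. 1 / \<alpha> 0 * (u_value p * ((\<Prod>i'\<in>{1..s}-{i}. fst p i') * (\<Prod>j=1..r. inverse (snd p j) ^ a j)))"
    show "?g \<in> multipliers"
      by (intro multipliers_mult multipliers_prod multipliers_power const u z w_inv) auto
    show "mod_eq (\<lambda>p. inverse (fst p i)) ?g"
    proof (rule mod_eq_exact)
      fix p assume p: "p \<in> LG_torus s r"
      define Z where "Z = (\<Prod>i'\<in>{1..s}-{i}. fst p i')"
      define W where "W = (\<Prod>j=1..r. snd p j ^ a j)"
      have nz: "Z \<noteq> 0" "W \<noteq> 0" "fst p i \<noteq> 0" using torus_nonzero[OF p] i by (simp_all add: Z_def W_def)
      have W_inv: "(\<Prod>j=1..r. inverse (snd p j) ^ a j) = inverse W"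
        by (simp add: W_def power_inverse prod_inversef[unfolded o_def])
      have u_eq: "u_value p = \<alpha> 0 * (W / (fst p i * Z))"
        using prod.remove[of "{1..s}" i "fst p"] i by (simp add: u_value_def W_def Z_def)
      have "inverse (fst p i) = 1 / \<alpha> 0 * (\<alpha> 0 * (W / (fst p i * Z)) * (Z * inverse W))"
        using nz alpha_nonzero[of 0] by (simp add: field_simps)
      then show "inverse (fst p i) = ?g p" unfolding W_inv u_eq Z_def[symmetric] .
    next
      show "?g \<in> laurent s r"
        by (intro laurent.mult laurent.const laurent_prod u_value_laurent laurent.z laurent_power laurent.w_inv) auto
    qed (use i in \<open>auto intro: laurent.z_inv\<close>)
  qed
  from h have "h \<in> multipliers"
    by (induction rule: laurent.induct) (auto intro: const z w z_inv w_inv multipliers_add multipliers_mult)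
  then have "(\<lambda>p. basis (0, 0) p * h p) \<in> spanned" by (simp add: multipliers_def)
  then show ?thesis by (simp add: basis_def)
qed

end

context LG_member
begin

section \<open>Reducedness of the critical scheme\<close>

lemma torus_points_separated:
  assumes "p \<in> LG_torus s r" "q \<in> LG_torus s r" "p \<noteq> q"
  shows "\<exists>g\<in>laurent s r. g p \<noteq> g q"
proof -
  have "(\<exists>i\<in>{1..s}. fst p i \<noteq> fst q i) \<or> (\<exists>j\<in>{1..r}. snd p j \<noteq> snd q j)"
  proof (rule ccontr)
    assume "\<not> ?thesis"
    then have eq: "\<And>i. i \<in> {1..s} \<Longrightarrow> fst p i = fst q i" "\<And>j. j \<in> {1..r} \<Longrightarrow> snd p j = snd q j" by blast+
    have "fst p = fst q" using assms(1,2) unfolding LG_torus_def mem_Times_iff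
      by (intro PiE_ext[of _ "{1..s}" "\<lambda>_. - {0}"] eq) auto
    moreover have "snd p = snd q" using assms(1,2) unfolding LG_torus_def mem_Times_iff
      by (intro PiE_ext[of _ "{1..r}" "\<lambda>_. - {0}"] eq) auto
    ultimately show False using assms(3) by (simp add: prod_eq_iff)
  qed
  then show ?thesis
  proof (elim disjE bexE)
    fix i assume "i \<in> {1..s}" "fst p i \<noteq> fst q i"
    then show ?thesis by (intro bexI[of _ "\<lambda>p. fst p i"] laurent.z)
  next
    fix j assume "j \<in> {1..r}" "snd p j \<noteq> snd q j"
    then show ?thesis by (intro bexI[of _ "\<lambda>p. snd p j"] laurent.w)
  qed
qed

text \<open>The ring of functions on the critical scheme has dimension at most \<open>(s + 1) * (r + 1)\<close>. Functions
\<open>e_p\<close> that single out the points \<open>p\<close> of \<open>Z\<close> already span a space of that dimension, and a nilpotent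
\<open>h\<close> vanishes on \<open>Z\<close>. If \<open>h\<close> were nonzero in the ring, \<open>h\<close> and the \<open>e_p\<close> would be linearly dependent;
evaluating the dependency at the points of \<open>Z\<close> shows that this is impossible.\<close>

theorem crit_reduced_if_many_points:
  assumes \<sigma>: "(\<Sum>j=1..r. a j) \<le> s"
    and Z: "Z \<subseteq> Crit s r a f" "finite Z" "card Z \<ge> Suc s * Suc r"
  shows "crit_reduced s r a f"
  unfolding crit_reduced_def
proof (intro ballI allI impI)
  fix h N assume hL: "h \<in> laurent s r" and hN: "(\<lambda>p. h p ^ N) \<in> ideal"
  have h0: "h p = 0" if "p \<in> Z" for p
    using ideal_vanishes_on_Crit[OF hN, of p] that Z(1) by auto
  obtain c where c: "mod_eq h (\<lambda>p. \<Sum>kl\<in>basis_indices. c kl * basis kl p)"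
    using laurent_spanned[OF \<sigma> hL] by (rule spannedE)
  show "h \<in> ideal"
  proof (cases "\<forall>kl\<in>basis_indices. c kl = 0")
    case True
    then have "(\<lambda>p. \<Sum>kl\<in>basis_indices. c kl * basis kl p) = (\<lambda>p. 0)"
      by (intro ext sum.neutral) simp
    then show ?thesis using c by (simp add: mod_eq_def)
  next
    case False
    then obtain kl0 where kl0: "kl0 \<in> basis_indices" "c kl0 \<noteq> 0" by blast
    let ?J = "basis_indices - {kl0}"
    have "\<forall>p q. \<exists>g. p \<in> Z \<longrightarrow> q \<in> Z - {p} \<longrightarrow> g \<in> laurent s r \<and> g p \<noteq> g q"
      using torus_points_separated Z(1) unfolding Crit_def by blast
    then obtain g where g: "\<And>p q. p \<in> Z \<Longrightarrow> q \<in> Z - {p} \<Longrightarrow> g p q \<in> laurent s r \<and> g p q p \<noteq> g p q q"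
      by metis
    define e where "e p x = (\<Prod>q\<in>Z - {p}. g p q x - g p q q)" for p x
    have eL: "e p \<in> laurent s r" if "p \<in> Z" for p
    proof -
      have "(\<lambda>x. \<Prod>q\<in>Z - {p}. g p q x - g p q q) \<in> laurent s r"
        using g that by (intro laurent_prod laurent_diff laurent.const) blast
      then show ?thesis by (simp add: e_def[abs_def])
    qed
    have e0: "e p q = 0" if "p \<in> Z" "q \<in> Z" "p \<noteq> q" for p q
      unfolding e_def using that Z(2) by (intro prod_zero) auto
    have e1: "e p p \<noteq> 0" if "p \<in> Z" for p
      using g[OF that] Z(2) by (auto simp: e_def)
    have "\<forall>p. \<exists>d. p \<in> Z \<longrightarrow> mod_eq (e p) (\<lambda>x. \<Sum>kl\<in>basis_indices. d kl * basis kl x)"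
      using laurent_spanned[OF \<sigma> eL] spannedE by meson
    from choice[OF this] obtain d where
      d: "\<forall>p. p \<in> Z \<longrightarrow> mod_eq (e p) (\<lambda>x. \<Sum>kl\<in>basis_indices. d p kl * basis kl x)" ..
    \<comment> \<open>Adding this multiple of h to e_p removes the coordinate with index kl0.\<close>
    define \<mu> where "\<mu> p = - (d p kl0 / c kl0)" for p
    define d' where "d' p kl = d p kl + \<mu> p * c kl" for p kl
    have red: "mod_eq (\<lambda>x. e p x + \<mu> p * h x) (\<lambda>x. \<Sum>kl\<in>?J. d' p kl * basis kl x)" if "p \<in> Z" for p
    proof -
      have "mod_eq (\<lambda>x. e p x + \<mu> p * h x)
         (\<lambda>x. (\<Sum>kl\<in>basis_indices. d p kl * basis kl x) + \<mu> p * (\<Sum>kl\<in>basis_indices. c kl * basis kl x))"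
        by (intro mod_eq_add mod_eq_mult mod_eq_refl laurent.const c d[rule_format, OF that])
      also have "(\<lambda>x. (\<Sum>kl\<in>basis_indices. d p kl * basis kl x) + \<mu> p * (\<Sum>kl\<in>basis_indices. c kl * basis kl x))
         = (\<lambda>x. \<Sum>kl\<in>basis_indices. d' p kl * basis kl x)"
        by (simp add: d'_def distrib_right sum.distrib sum_distrib_left mult.assoc)
      also have "\<dots> = (\<lambda>x. \<Sum>kl\<in>?J. d' p kl * basis kl x)"
      proof
        fix x
        have "d' p kl0 = 0" using kl0 by (simp add: d'_def \<mu>_def)
        then show "(\<Sum>kl\<in>basis_indices. d' p kl * basis kl x) = (\<Sum>kl\<in>?J. d' p kl * basis kl x)"
          using kl0(1) by (subst sum.remove[of _ kl0]) auto
      qed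
      finally show ?thesis .
    qed
    have "card ?J < card Z" using Z(3) kl0(1) by (simp add: card_Diff_singleton_if)
    from homogeneous_system_nontrivial_solution[OF _ Z(2) this, of d']
    obtain x where x: "\<exists>p\<in>Z. x p \<noteq> 0" "\<And>kl. kl \<in> ?J \<Longrightarrow> (\<Sum>p\<in>Z. x p * d' p kl) = 0" by auto
    have "mod_eq (\<lambda>y. \<Sum>p\<in>Z. x p * (e p y + \<mu> p * h y)) (\<lambda>y. \<Sum>p\<in>Z. x p * (\<Sum>kl\<in>?J. d' p kl * basis kl y))"
      by (intro mod_eq_sum mod_eq_mult mod_eq_refl laurent.const red)
    moreover have "(\<Sum>p\<in>Z. x p * (\<Sum>kl\<in>?J. d' p kl * basis kl y)) = 0" for y
    proof -
      have "(\<Sum>p\<in>Z. x p * (\<Sum>kl\<in>?J. d' p kl * basis kl y)) = (\<Sum>kl\<in>?J. (\<Sum>p\<in>Z. x p * d' p kl) * basis kl y)"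
        unfolding sum_distrib_left sum_distrib_right by (subst sum.swap) (simp only: mult.assoc)
      then show ?thesis using x(2) by simp
    qed
    ultimately have I: "(\<lambda>y. \<Sum>p\<in>Z. x p * (e p y + \<mu> p * h y)) \<in> ideal"
      by (simp add: mod_eq_def)
    obtain q where q: "q \<in> Z" "x q \<noteq> 0" using x(1) by blast
    have "0 = (\<Sum>p\<in>Z. x p * (e p q + \<mu> p * h q))"
      using ideal_vanishes_on_Crit[OF I, of q] q Z(1) by auto
    also have "\<dots> = (\<Sum>p\<in>Z. if p = q then x q * e q q else 0)"
      using q h0 e0 by (intro sum.cong) auto
    also have "\<dots> = x q * e q q" using q Z(2) by simp
    finally show ?thesis using q e1 by simp
  qed
qed

lemma laurent_differentiable:
  assumes "h \<in> laurent s r" and p0: "\<gamma> 0 \<in> LG_torus s r"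
    and z: "\<And>i. i \<in> {1..s} \<Longrightarrow> (\<lambda>\<epsilon>. fst (\<gamma> \<epsilon>) i) field_differentiable at 0"
    and w: "\<And>j. j \<in> {1..r} \<Longrightarrow> (\<lambda>\<epsilon>. snd (\<gamma> \<epsilon>) j) field_differentiable at (0 :: complex)"
  shows "(\<lambda>\<epsilon>. h (\<gamma> \<epsilon>)) field_differentiable at 0"
  using assms(1)
proof (induction rule: laurent.induct)
  case (z_inv i)
  then show ?case by (intro field_differentiable_inverse z torus_nonzero(1)[OF p0])
next
  case (w_inv j)
  then show ?case by (intro field_differentiable_inverse w torus_nonzero(2)[OF p0])
qed (simp_all add: field_differentiable_add field_differentiable_mult z w)

text \<open>If all critical equations vanish to second order along the curve \<open>\<gamma>\<close>, then \<open>\<gamma>\<close> is tangent to the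
critical scheme, which is zero-dimensional and reduced and thus has no tangent vectors. In elementary
terms: some polynomial \<open>P\<close> of \<open>y\<close> lies in the ideal by finite dimensionality, hence by reducedness
so does the squarefree polynomial \<open>Q\<close> of \<open>y\<close> with the same roots. Differentiating along \<open>\<gamma>\<close> gives
\<open>Q'(y) y' = 0\<close>, where \<open>Q'\<close> does not vanish at the simple roots of \<open>Q\<close>.\<close>

theorem reduced_imp_no_null_tangent:
  assumes \<sigma>: "(\<Sum>j=1..r. a j) \<le> s" and reduced: "crit_reduced s r a f"
    and p0: "\<gamma> 0 \<in> Crit s r a f"
    and torus: "\<forall>\<^sub>F \<epsilon> in nhds 0. \<gamma> \<epsilon> \<in> LG_torus s r"
    and z: "\<And>i. i \<in> {1..s} \<Longrightarrow> (\<lambda>\<epsilon>. fst (\<gamma> \<epsilon>) i) field_differentiable at 0"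
    and w: "\<And>j. j \<in> {1..r} \<Longrightarrow> (\<lambda>\<epsilon>. snd (\<gamma> \<epsilon>) j) field_differentiable at (0 :: complex)"
    and null: "\<And>d. d \<in> indices \<Longrightarrow> ((\<lambda>\<epsilon>. log_deriv (LG_poly s r a f) d (\<gamma> \<epsilon>)) has_field_derivative 0) (at 0)"
    and y: "y \<in> laurent s r"
  shows "((\<lambda>\<epsilon>. y (\<gamma> \<epsilon>)) has_field_derivative 0) (at 0)"
proof -
  define N where "N = card basis_indices"
  have "\<forall>i. \<exists>c. mod_eq (\<lambda>p. y p ^ i) (\<lambda>p. \<Sum>kl\<in>basis_indices. c kl * basis kl p)"
    using laurent_spanned[OF \<sigma> laurent_power[OF y]] spannedE by meson
  from choice[OF this] obtain c where c: "\<And>i. mod_eq (\<lambda>p. y p ^ i) (\<lambda>p. \<Sum>kl\<in>basis_indices. c i kl * basis kl p)" by blast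
  have "card basis_indices < card {..N}" by (simp add: N_def)
  from homogeneous_system_nontrivial_solution[OF _ _ this, of c]
  obtain x where x: "\<exists>i\<in>{..N}. x i \<noteq> 0" "\<And>kl. kl \<in> basis_indices \<Longrightarrow> (\<Sum>i\<le>N. x i * c i kl) = 0" by auto
  define P where "P = (\<Sum>i\<le>N. monom (x i) i)"
  have "P \<noteq> 0"
  proof
    assume "P = 0"
    obtain i where "i \<le> N" "x i \<noteq> 0" using x(1) by auto
    moreover from this have "coeff P i = x i" by (simp add: P_def coeff_sum)
    ultimately show False using \<open>P = 0\<close> by simp
  qed
  have PI: "(\<lambda>p. poly P (y p)) \<in> ideal"
  proof -
    have "mod_eq (\<lambda>p. \<Sum>i\<le>N. x i * y p ^ i) (\<lambda>p. \<Sum>i\<le>N. x i * (\<Sum>kl\<in>basis_indices. c i kl * basis kl p))"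
      by (intro mod_eq_sum mod_eq_mult mod_eq_refl laurent.const c)
    moreover have "(\<Sum>i\<le>N. x i * (\<Sum>kl\<in>basis_indices. c i kl * basis kl p)) = 0" for p
    proof -
      have "(\<Sum>i\<le>N. x i * (\<Sum>kl\<in>basis_indices. c i kl * basis kl p)) = (\<Sum>kl\<in>basis_indices. (\<Sum>i\<le>N. x i * c i kl) * basis kl p)"
        unfolding sum_distrib_left sum_distrib_right by (subst sum.swap) (simp only: mult.assoc)
      then show ?thesis using x(2) by simp
    qed
    ultimately show ?thesis by (simp add: mod_eq_def P_def poly_sum poly_monom)
  qed
  define S where "S = {t. poly P t = 0}"
  have "finite S" unfolding S_def using \<open>P \<noteq> 0\<close> by (rule poly_roots_finite)
  define Q where "Q = (\<Prod>t\<in>S. [:- t, 1:])"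
  have polyQ: "poly Q u = (\<Prod>t\<in>S. u - t)" for u by (simp add: Q_def poly_prod)
  have "\<forall>t. poly P t = 0 \<longrightarrow> poly Q t = 0" using \<open>finite S\<close> by (auto simp: polyQ S_def)
  \<comment> \<open>A power of Q(y) is a multiple of P(y), hence lies in the ideal.\<close>
  then have "P dvd Q ^ degree P" using nullstellensatz_univariate[of P Q] \<open>P \<noteq> 0\<close> by simp
  then obtain R where R: "Q ^ degree P = P * R" by blast
  have poly_laurent: "(\<lambda>p. poly p' (y p)) \<in> laurent s r" for p'
    unfolding poly_altdef by (intro laurent_sum laurent.mult laurent.const laurent_power y)
  have "(\<lambda>p. poly R (y p) * poly P (y p)) \<in> ideal"
    by (rule ideal_mult[OF PI poly_laurent])
  moreover have "(\<lambda>p. poly R (y p) * poly P (y p)) = (\<lambda>p. poly Q (y p) ^ degree P)"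
    using arg_cong[OF R, of poly] by (auto simp: fun_eq_iff mult.commute)
  ultimately have "(\<lambda>p. poly Q (y p) ^ degree P) \<in> ideal" by (simp only:)
  then have QI: "(\<lambda>p. poly Q (y p)) \<in> ideal"
    by (rule reduced[unfolded crit_reduced_def, rule_format, OF poly_laurent])
  obtain q where q: "\<forall>d\<in>indices. q d \<in> laurent s r"
    "\<forall>p\<in>LG_torus s r. poly Q (y p) = (\<Sum>d\<in>indices. q d p * log_deriv (LG_poly s r a f) d p)"
    using QI by (rule idealE)
  have \<gamma>0: "\<gamma> 0 \<in> LG_torus s r" using p0 by (simp add: Crit_def)
  have crit0: "log_deriv (LG_poly s r a f) d (\<gamma> 0) = 0" if "d \<in> indices" for d
    using p0 that by (simp add: Crit_def)
  have "((\<lambda>\<epsilon>. \<Sum>d\<in>indices. q d (\<gamma> \<epsilon>) * log_deriv (LG_poly s r a f) d (\<gamma> \<epsilon>)) has_field_derivative (\<Sum>d\<in>indices. 0)) (at 0)"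
  proof (rule DERIV_sum)
    fix d assume d: "d \<in> indices"
    have "(\<lambda>\<epsilon>. q d (\<gamma> \<epsilon>)) field_differentiable at 0"
      using laurent_differentiable[of "q d" \<gamma>] q(1) d \<gamma>0 z w by blast
    then obtain q' where "((\<lambda>\<epsilon>. q d (\<gamma> \<epsilon>)) has_field_derivative q') (at 0)" by (auto simp: field_differentiable_def)
    from DERIV_mult[OF this null[OF d]]
    show "((\<lambda>\<epsilon>. q d (\<gamma> \<epsilon>) * log_deriv (LG_poly s r a f) d (\<gamma> \<epsilon>)) has_field_derivative 0) (at 0)"
      by (simp add: crit0[OF d])
  qed
  moreover have "\<forall>\<^sub>F \<epsilon> in nhds 0. poly Q (y (\<gamma> \<epsilon>)) = (\<Sum>d\<in>indices. q d (\<gamma> \<epsilon>) * log_deriv (LG_poly s r a f) d (\<gamma> \<epsilon>))"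
    using torus by eventually_elim (rule bspec[OF q(2)])
  ultimately have QD: "((\<lambda>\<epsilon>. poly Q (y (\<gamma> \<epsilon>))) has_field_derivative 0) (at 0)"
    by (simp add: DERIV_cong_ev[OF refl _ refl])
  obtain y' where y': "((\<lambda>\<epsilon>. y (\<gamma> \<epsilon>)) has_field_derivative y') (at 0)"
    using laurent_differentiable[of y \<gamma>] y \<gamma>0 z w by (auto simp: field_differentiable_def)
  define t0 where "t0 = y (\<gamma> 0)"
  have t0: "t0 \<in> S" using ideal_vanishes_on_Crit[OF PI p0] by (simp add: S_def t0_def)
  define Q1 where "Q1 = (\<Prod>t\<in>S - {t0}. [:- t, 1:])"
  have Q_eq: "poly Q u = (u - t0) * poly Q1 u" for u
    using prod.remove[OF \<open>finite S\<close> t0, of "\<lambda>t. [:- t, 1:]"] by (simp add: Q_def Q1_def left_diff_distrib)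
  have "((\<lambda>\<epsilon>. y (\<gamma> \<epsilon>) - t0) has_field_derivative y' - 0) (at 0)"
    by (intro DERIV_diff y' DERIV_const)
  from DERIV_mult[OF this DERIV_chain2[OF poly_DERIV[of Q1] y']]
  have "((\<lambda>\<epsilon>. poly Q (y (\<gamma> \<epsilon>))) has_field_derivative y' * poly Q1 t0) (at 0)"
    unfolding Q_eq by (simp add: t0_def)
  moreover have "poly Q1 t0 = (\<Prod>t\<in>S - {t0}. t0 - t)" by (simp add: Q1_def poly_prod)
  ultimately have "((\<lambda>\<epsilon>. poly Q (y (\<gamma> \<epsilon>))) has_field_derivative y' * (\<Prod>t\<in>S - {t0}. t0 - t)) (at 0)"
    by simp
  then have "y' * (\<Prod>t\<in>S - {t0}. t0 - t) = 0" using QD by (rule DERIV_unique)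
  then have "y' = 0" using \<open>finite S\<close> by auto
  then show ?thesis using y' by simp
qed

end

section \<open>The covering by critical points\<close>

text \<open>Properness makes the fibres finite. It also makes \<open>G\<close> closed, which excludes further preimages near \<open>y\<close>
outside small disjoint balls around the points of the fibre. Invariance of domain turns injectivity
on these balls into homeomorphy.\<close>

theorem proper_local_injection_covering:
  fixes G :: "'a::euclidean_space \<Rightarrow> 'a"
  assumes "open \<Omega>" "open Y" and cont: "continuous_on \<Omega> G" and surj: "Y \<subseteq> G ` \<Omega>"
    and inj: "\<And>p. p \<in> \<Omega> \<Longrightarrow> G p \<in> Y \<Longrightarrow> \<exists>\<rho>>0. ball p \<rho> \<subseteq> \<Omega> \<and> inj_on G (ball p \<rho>)"
    and proper: "\<And>K. compact K \<Longrightarrow> K \<subseteq> Y \<Longrightarrow> compact (\<Omega> \<inter> G -` K)"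
  shows "covering_space (\<Omega> \<inter> G -` Y) G Y"
proof (rule covering_spaceI)
  show "continuous_on (\<Omega> \<inter> G -` Y) G" using cont by (rule continuous_on_subset) auto
  show "G ` (\<Omega> \<inter> G -` Y) = Y" using surj by auto
  fix y assume y: "y \<in> Y"
  define F where "F = \<Omega> \<inter> G -` {y}"
  have "\<forall>p. \<exists>\<rho>. p \<in> F \<longrightarrow> \<rho> > 0 \<and> ball p \<rho> \<subseteq> \<Omega> \<and> inj_on G (ball p \<rho>)"
    using inj y by (auto simp: F_def)
  from choice[OF this] obtain \<rho> where \<rho>: "\<forall>p. p \<in> F \<longrightarrow> \<rho> p > 0 \<and> ball p (\<rho> p) \<subseteq> \<Omega> \<and> inj_on G (ball p (\<rho> p))" ..
  have "compact F" unfolding F_def using y by (intro proper) auto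
  have F_ball: "q = p" if "p \<in> F" "q \<in> F" "q \<in> ball p (\<rho> p)" for p q
    using \<rho>[rule_format, OF that(1)] that by (auto simp: F_def inj_on_def)
  have "finite F"
  proof -
    have "F \<subseteq> (\<Union>p\<in>F. ball p (\<rho> p))" using \<rho> by auto
    then obtain F' where F': "F' \<subseteq> F" "finite F'" "F \<subseteq> (\<Union>p\<in>F'. ball p (\<rho> p))"
      using compactE_image[OF \<open>compact F\<close>, of F "\<lambda>p. ball p (\<rho> p)"] open_ball by metis
    then have "F \<subseteq> F'" using F_ball by blast
    then show ?thesis using F' finite_subset by blast
  qed
  have "\<forall>p. \<exists>d>0. \<forall>q\<in>F. q \<noteq> p \<longrightarrow> d \<le> dist p q" using finite_set_avoid[OF \<open>finite F\<close>] by blast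
  from choice[OF this] obtain d where d: "\<And>p. d p > 0" "\<And>p q. q \<in> F \<Longrightarrow> q \<noteq> p \<Longrightarrow> d p \<le> dist p q" by blast
  define e where "e p = min (\<rho> p) (d p / 2)" for p
  define B where "B p = ball p (e p)" for p
  have e_pos: "e p > 0" if "p \<in> F" for p using \<rho> d(1) that by (simp add: e_def)
  have B\<Omega>: "B p \<subseteq> \<Omega>" and B_inj: "inj_on G (B p)" if "p \<in> F" for p
    using \<rho>[rule_format, OF that] by (auto simp: B_def e_def inj_on_def)
  have B_disj: "B p \<inter> B q = {}" if "p \<in> F" "q \<in> F" "p \<noteq> q" for p q
  proof (rule ccontr)
    assume "B p \<inter> B q \<noteq> {}"
    then obtain z where "dist p z < e p" "dist q z < e q" by (auto simp: B_def)
    then have "dist p q < e p + e q" using dist_triangle2[of p q z] by linarith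
    moreover have "e p \<le> dist p q / 2" "e q \<le> dist p q / 2"
      using d(2)[of q p] d(2)[of p q] that by (auto simp: e_def dist_commute)
    ultimately show False by simp
  qed
  have GB_open: "open (G ` B p)" if "p \<in> F" for p
    by (rule invariance_of_domain) (use B\<Omega>[OF that] B_inj[OF that] cont in \<open>auto simp: B_def intro: continuous_on_subset\<close>)
  define U where "U = (\<Union>p\<in>F. B p)"
  have "open U" by (auto simp: U_def B_def)
  obtain e0 where e0: "e0 > 0" "cball y e0 \<subseteq> Y" using \<open>open Y\<close> y open_contains_cball by blast
  define K where "K = \<Omega> \<inter> G -` cball y e0"
  have "compact K" unfolding K_def using e0 by (intro proper) auto
  then have "compact (K - U)" using \<open>open U\<close> by (rule compact_diff)
  moreover have "continuous_on (K - U) G" using cont by (rule continuous_on_subset) (auto simp: K_def)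
  ultimately have "closed (G ` (K - U))" by (intro compact_imp_closed compact_continuous_image)
  \<comment> \<open>A neighbourhood of y that each ball covers and that has no preimages outside the balls.\<close>
  define T where "T = ball y e0 \<inter> - (G ` (K - U)) \<inter> (\<Inter>p\<in>F. G ` B p)"
  have "open T" unfolding T_def
    using \<open>closed (G ` (K - U))\<close> \<open>finite F\<close> GB_open by (intro open_Int open_Compl open_INT) auto
  have "y \<in> T"
  proof -
    have "y \<notin> G ` (K - U)"
    proof
      assume "y \<in> G ` (K - U)"
      then obtain p where "p \<in> F" "p \<notin> U" by (auto simp: F_def K_def)
      then show False using e_pos by (auto simp: U_def B_def)
    qed
    moreover have "y \<in> G ` B p" if "p \<in> F" for p
      using that e_pos[OF that] by (auto simp: F_def B_def)
    ultimately show ?thesis using e0 by (auto simp: T_def)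
  qed
  have "T \<subseteq> Y" using e0 by (auto simp: T_def)
  define v where "v = (\<lambda>p. B p \<inter> G -` T) ` F"
  have "\<Union>v = (\<Omega> \<inter> G -` Y) \<inter> G -` T"
  proof
    show "\<Union>v \<subseteq> (\<Omega> \<inter> G -` Y) \<inter> G -` T" using B\<Omega> \<open>T \<subseteq> Y\<close> by (auto simp: v_def)
    show "(\<Omega> \<inter> G -` Y) \<inter> G -` T \<subseteq> \<Union>v"
    proof
      fix x assume x: "x \<in> (\<Omega> \<inter> G -` Y) \<inter> G -` T"
      then have "x \<in> K" "G x \<notin> G ` (K - U)" by (auto simp: K_def T_def)
      then have "x \<in> U" by blast
      then show "x \<in> \<Union>v" using x by (auto simp: U_def v_def)
    qed
  qed
  moreover have "openin (top_of_set (\<Omega> \<inter> G -` Y)) (B p \<inter> G -` T)" if "p \<in> F" for p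
  proof (rule open_subset)
    show "B p \<inter> G -` T \<subseteq> \<Omega> \<inter> G -` Y" using B\<Omega>[OF that] \<open>T \<subseteq> Y\<close> by auto
    show "open (B p \<inter> G -` T)"
      using \<open>open T\<close> B\<Omega>[OF that] cont
      by (intro continuous_open_preimage) (auto simp: B_def intro: continuous_on_subset)
  qed
  moreover have "pairwise disjnt v"
    unfolding v_def pairwise_image by (auto simp: pairwise_def disjnt_def dest: B_disj)
  moreover have "\<exists>q. homeomorphism (B p \<inter> G -` T) T G q" if p: "p \<in> F" for p
  proof -
    have "open (B p)" "continuous_on (B p) G"
      using continuous_on_subset[OF cont B\<Omega>[OF p]] by (simp_all add: B_def)
    then obtain g where g: "homeomorphism (B p) (G ` B p) G g"
      using invariance_of_domain_homeomorphism[of "B p" G] B_inj[OF p] by blast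
    have TG: "T \<subseteq> G ` B p" using p by (auto simp: T_def)
    then have "G ` (B p \<inter> G -` T) = T" by blast
    then show ?thesis
      using homeomorphism_of_subsets[OF g, of "B p \<inter> G -` T" T] TG by blast
  qed
  ultimately show "\<exists>T. y \<in> T \<and> openin (top_of_set Y) T \<and>
       (\<exists>v. \<Union> v = \<Omega> \<inter> G -` Y \<inter> G -` T \<and> (\<forall>u\<in>v. openin (top_of_set (\<Omega> \<inter> G -` Y)) u) \<and>
            pairwise disjnt v \<and> (\<forall>u\<in>v. \<exists>q. homeomorphism u T G q))"
    using \<open>y \<in> T\<close> \<open>open T\<close> \<open>T \<subseteq> Y\<close>
    by (intro exI[of _ T] conjI exI[of _ v]) (auto simp: v_def intro: open_subset)
qed

text \<open>The derivative divided by the value, which is additive on products.\<close>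

definition has_log_derivative :: "('a::real_normed_vector \<Rightarrow> complex) \<Rightarrow> ('a \<Rightarrow> complex) \<Rightarrow> 'a \<Rightarrow> bool" where
  "has_log_derivative f L p \<longleftrightarrow> f p \<noteq> 0 \<and> (f has_derivative (\<lambda>h. f p * L h)) (at p)"

lemma has_log_derivative_mult:
  "has_log_derivative f L p \<Longrightarrow> has_log_derivative g L' p \<Longrightarrow>
     has_log_derivative (\<lambda>x. f x * g x) (\<lambda>h. L h + L' h) p"
  unfolding has_log_derivative_def by (auto intro!: derivative_eq_intros simp: algebra_simps)

lemma has_log_derivative_inverse:
  "has_log_derivative f L p \<Longrightarrow> has_log_derivative (\<lambda>x. inverse (f x)) (\<lambda>h. - L h) p"
  unfolding has_log_derivative_def by (auto intro!: derivative_eq_intros simp: field_simps)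

lemma has_log_derivative_const: "c \<noteq> 0 \<Longrightarrow> has_log_derivative (\<lambda>x. c) (\<lambda>h. 0) p"
  unfolding has_log_derivative_def by auto

lemma has_log_derivative_power:
  "has_log_derivative f L p \<Longrightarrow> has_log_derivative (\<lambda>x. f x ^ n) (\<lambda>h. of_nat n * L h) p"
proof (induction n)
  case (Suc n)
  from has_log_derivative_mult[OF Suc.prems Suc.IH[OF Suc.prems]] show ?case by (simp add: algebra_simps)
qed (simp add: has_log_derivative_const)

lemma has_log_derivative_prod:
  "finite J \<Longrightarrow> (\<And>j. j \<in> J \<Longrightarrow> has_log_derivative (f j) (L j) p) \<Longrightarrow>
     has_log_derivative (\<lambda>x. \<Prod>j\<in>J. f j x) (\<lambda>h. \<Sum>j\<in>J. L j h) p"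
  by (induction J rule: finite_induct) (auto intro: has_log_derivative_const has_log_derivative_mult)

lemma has_log_derivativeI:
  "(f has_derivative f') (at p) \<Longrightarrow> f p \<noteq> 0 \<Longrightarrow> has_log_derivative f (\<lambda>h. f' h / f p) p"
  unfolding has_log_derivative_def by simp

type_synonym point3 = "complex \<times> complex \<times> complex"

locale LG_data =
  fixes s r :: nat and a :: "nat \<Rightarrow> nat"
  assumes sum_a_le: "(\<Sum>j=1..r. a j) \<le> s"
begin

text \<open>The value of \<open>\<beta>_j w_j\<close> at the critical point with \<open>u = \<tau> x\<close>.\<close>

definition ell :: "nat \<Rightarrow> point3 \<Rightarrow> complex" where
  "ell j = (\<lambda>(x, v, \<tau>). v - of_nat (a j) * \<tau> * x)"

definition total :: "point3 set" where
  "total = {p. fst p \<noteq> 0 \<and> fst (snd p) \<noteq> 0 \<and> (\<forall>j\<in>{1..r}. ell j p \<noteq> 0)}"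

text \<open>Points of the source are triples \<open>(x, v, \<tau>)\<close>, those of the target triples \<open>(A, B, \<tau>)\<close>. The fibre over
\<open>(A, B, \<tau>)\<close> with \<open>\<tau> \<noteq> 0\<close> is the set of values of \<open>(u / \<tau>, v)\<close> at the critical points of any
Laurent polynomial with invariants \<open>A \<tau>^(s+1)\<close> and \<open>B\<close>. The rescaling by \<open>\<tau>\<close> extends the family
of critical points to \<open>\<tau> = 0\<close>, where the labels live.\<close>

definition G :: "point3 \<Rightarrow> point3" where
  "G p = (fst p ^ Suc s / (\<Prod>j=1..r. ell j p ^ a j), fst (snd p) * (\<Prod>j=1..r. ell j p), snd (snd p))"

definition base :: "point3 set" where
  "base = {q. fst q \<noteq> 0 \<and> fst (snd q) \<noteq> 0}"

definition pole_sum :: "nat \<Rightarrow> point3 \<Rightarrow> complex" where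
  "pole_sum n p = (\<Sum>j=1..r. of_nat (a j) ^ n / ell j p)"

text \<open>The determinant of the logarithmic derivatives of the first two components of \<open>G\<close> in the directions
\<open>x\<close> and \<open>v\<close>, compare \<open>deriv_x\<close> and \<open>deriv_v\<close> below.\<close>

definition jac :: "point3 \<Rightarrow> complex" where
  "jac p = (of_nat (Suc s) / fst p + snd (snd p) * pole_sum 2 p) * (1 / fst (snd p) + pole_sum 0 p)
           - snd (snd p) * (pole_sum 1 p)\<^sup>2"

lemma continuous_ell [continuous_intros]: "continuous_on A (ell j)"
  unfolding ell_def split_beta by (intro continuous_intros)

lemma open_total: "open total"
proof -
  have "total = (- {p. fst p = 0}) \<inter> (- {p. fst (snd p) = 0}) \<inter> (\<Inter>j\<in>{1..r}. - {p. ell j p = 0})"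
    by (auto simp: total_def)
  also have "open \<dots>"
    by (intro open_Int open_INT ballI open_Compl closed_Collect_eq continuous_intros) auto
  finally show ?thesis .
qed

lemma open_base: "open base"
proof -
  have "base = (- {p. fst p = 0}) \<inter> (- {p. fst (snd p) = 0})" by (auto simp: base_def)
  also have "open \<dots>" by (intro open_Int open_Compl closed_Collect_eq continuous_intros)
  finally show ?thesis .
qed

lemma totalD: "p \<in> total \<Longrightarrow> fst p \<noteq> 0" "p \<in> total \<Longrightarrow> fst (snd p) \<noteq> 0"
  "p \<in> total \<Longrightarrow> j \<in> {1..r} \<Longrightarrow> ell j p \<noteq> 0"
  by (auto simp: total_def)

lemma G_in_base: "p \<in> total \<Longrightarrow> G p \<in> base"
  by (auto simp: G_def base_def total_def)

lemma continuous_G: "continuous_on total G"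
  unfolding G_def by (intro continuous_intros) (auto dest: totalD)

text \<open>In this polynomial form the equations of a fibre pass to limits.\<close>

lemma fibre_iff:
  assumes "A \<noteq> 0" "B \<noteq> 0"
  shows "(x, v, \<tau>) \<in> total \<and> G (x, v, \<tau>) = (A, B, \<tau>') \<longleftrightarrow> \<tau> = \<tau>' \<and>
     x ^ Suc s = A * (\<Prod>j=1..r. (v - of_nat (a j) * \<tau> * x) ^ a j) \<and>
     v * (\<Prod>j=1..r. v - of_nat (a j) * \<tau> * x) = B"
proof
  assume *: "(x, v, \<tau>) \<in> total \<and> G (x, v, \<tau>) = (A, B, \<tau>')"
  then have W: "(\<Prod>j=1..r. ell j (x, v, \<tau>) ^ a j) \<noteq> 0"
    using totalD(3)[OF conjunct1[OF *]] by simp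
  have 1: "x ^ Suc s / (\<Prod>j=1..r. ell j (x, v, \<tau>) ^ a j) = A"
    and 2: "v * (\<Prod>j=1..r. ell j (x, v, \<tau>)) = B" "\<tau> = \<tau>'"
    using * by (auto simp: G_def)
  have "x ^ Suc s = A * (\<Prod>j=1..r. ell j (x, v, \<tau>) ^ a j)"
    using 1 unfolding nonzero_divide_eq_eq[OF W] .
  with 2 show "\<tau> = \<tau>' \<and>
     x ^ Suc s = A * (\<Prod>j=1..r. (v - of_nat (a j) * \<tau> * x) ^ a j) \<and>
     v * (\<Prod>j=1..r. v - of_nat (a j) * \<tau> * x) = B"
    by (simp add: ell_def)
next
  assume *: "\<tau> = \<tau>' \<and>
     x ^ Suc s = A * (\<Prod>j=1..r. (v - of_nat (a j) * \<tau> * x) ^ a j) \<and>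
     v * (\<Prod>j=1..r. v - of_nat (a j) * \<tau> * x) = B"
  then have "v \<noteq> 0" using assms by auto
  have P: "(\<Prod>j=1..r. v - of_nat (a j) * \<tau> * x) \<noteq> 0" using * assms(2) by (metis mult_zero_right)
  have l: "v - of_nat (a j) * \<tau> * x \<noteq> 0" if "j \<in> {1..r}" for j
    using P that by (simp only: prod_zero_iff finite_atLeastAtMost) blast
  have W: "(\<Prod>j=1..r. (v - of_nat (a j) * \<tau> * x) ^ a j) \<noteq> 0"
  proof -
    have "\<forall>j\<in>{1..r}. (v - of_nat (a j) * \<tau> * x) ^ a j \<noteq> 0" by (intro ballI power_not_zero l)
    then show ?thesis by (simp only: prod_zero_iff finite_atLeastAtMost) blast
  qed
  have "x ^ Suc s \<noteq> 0" using * assms(1) W by (metis mult_eq_0_iff)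
  then have "x \<noteq> 0" by auto
  then have "(x, v, \<tau>) \<in> total" using \<open>v \<noteq> 0\<close> l by (auto simp: total_def ell_def)
  moreover have "x ^ Suc s / (\<Prod>j=1..r. (v - of_nat (a j) * \<tau> * x) ^ a j) = A"
    unfolding nonzero_divide_eq_eq[OF W] using * by blast
  then have "G (x, v, \<tau>) = (A, B, \<tau>')"
    using * unfolding G_def ell_def prod.case fst_conv snd_conv by blast
  ultimately show "(x, v, \<tau>) \<in> total \<and> G (x, v, \<tau>) = (A, B, \<tau>')" by blast
qed

text \<open>If \<open>v\<close> is much larger than \<open>x\<close>, then every \<open>ell j\<close> is comparable to \<open>v\<close>, and the second equation
bounds \<open>v^(r+1)\<close>. So \<open>v\<close> is bounded by a multiple of \<open>max 1 |x|\<close>. The first equation then bounds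
\<open>|x|^(s+1)\<close> by a multiple of \<open>|x|^\<Sigma>a \<le> |x|^s\<close> for \<open>|x| \<ge> 1\<close>.\<close>

lemma G_bounded_preimage:
  assumes "C \<ge> 1"
  shows "\<exists>R. \<forall>p\<in>total. norm (fst (G p)) \<le> C \<longrightarrow> norm (fst (snd (G p))) \<le> C \<longrightarrow> norm (snd (snd p)) \<le> C \<longrightarrow>
           norm (fst p) \<le> R \<and> norm (fst (snd p)) \<le> R"
proof -
  \<comment> \<open>The constant c bounds ell in terms of x and v, D bounds v in terms of x, and X bounds x.\<close>
  define c where "c = 1 + of_nat s * C"
  define D where "D = 2 ^ r * C + 2 * of_nat s * C"
  define X where "X = C * c ^ s * D ^ s"
  have c1: "c \<ge> 1" using assms by (simp add: c_def)
  have "1 * 1 \<le> (2::real) ^ r * C" using assms by (intro mult_mono) auto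
  moreover have "0 \<le> 2 * of_nat s * C" using assms by simp
  ultimately have D1: "D \<ge> 1" and D2: "2 ^ r * C \<le> D" "2 * of_nat s * C \<le> D"
    unfolding D_def by linarith+
  have "1 * 1 * 1 \<le> C * c ^ s * D ^ s" using assms c1 D1 by (intro mult_mono one_le_power) auto
  then have X1: "X \<ge> 1" by (simp add: X_def)
  have "norm x \<le> X \<and> norm v \<le> D * X"
    if p: "(x, v, \<tau>) \<in> total" and A: "norm (fst (G (x, v, \<tau>))) \<le> C" and B: "norm (fst (snd (G (x, v, \<tau>)))) \<le> C"
      and \<tau>: "norm \<tau> \<le> C" for x v \<tau>
  proof -
    let ?l = "\<lambda>j. ell j (x, v, \<tau>)"
    have a_le: "a j \<le> s" if "j \<in> {1..r}" for j
      using member_le_sum[OF that, of a] sum_a_le by simp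
    have diff: "norm (of_nat (a j) * \<tau> * x) \<le> of_nat s * C * norm x" if "j \<in> {1..r}" for j
      using a_le[OF that] \<tau> assms by (auto simp: norm_mult intro!: mult_mono)
    define \<rho> where "\<rho> = max 1 (max (norm x) (norm v))"
    have l_le: "norm (?l j) \<le> c * \<rho>" if "j \<in> {1..r}" for j
    proof -
      have "norm (?l j) \<le> norm v + norm (of_nat (a j) * \<tau> * x)"
        unfolding ell_def by (auto intro: norm_triangle_ineq4)
      also have "\<dots> \<le> \<rho> + of_nat s * C * \<rho>"
        using diff[OF that] assms by (intro add_mono order_trans[OF diff[OF that]] mult_left_mono) (auto simp: \<rho>_def)
      finally show ?thesis by (simp add: c_def algebra_simps)
    qed
    have c\<rho>: "1 \<le> c * \<rho>" using mult_mono[OF c1, of 1 \<rho>] c1 by (simp add: \<rho>_def)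
    have "norm (\<Prod>j=1..r. ?l j ^ a j) \<le> (\<Prod>j=1..r. (c * \<rho>) ^ a j)"
      unfolding prod_norm[symmetric] norm_power by (intro prod_mono conjI power_mono l_le) auto
    also have "\<dots> = (c * \<rho>) ^ (\<Sum>j=1..r. a j)" by (simp add: power_sum)
    also have "\<dots> \<le> (c * \<rho>) ^ s" by (rule power_increasing[OF sum_a_le c\<rho>])
    finally have W: "norm (\<Prod>j=1..r. ?l j ^ a j) \<le> (c * \<rho>) ^ s" .
    have "x ^ Suc s = fst (G (x, v, \<tau>)) * (\<Prod>j=1..r. ?l j ^ a j)"
      using totalD(3)[OF p] by (simp add: G_def)
    then have "norm x ^ Suc s = norm (fst (G (x, v, \<tau>))) * norm (\<Prod>j=1..r. ?l j ^ a j)"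
      by (metis norm_mult norm_power)
    also have "\<dots> \<le> C * (c * \<rho>) ^ s" using A W assms by (intro mult_mono) auto
    finally have x_le: "norm x ^ Suc s \<le> C * (c * \<rho>) ^ s" .
    have v_le: "norm v \<le> D * max 1 (norm x)"
    proof (cases "norm v \<ge> 2 * of_nat s * C * norm x \<and> norm v \<ge> 1")
      case True
      have "norm v / 2 \<le> norm (?l j)" if "j \<in> {1..r}" for j
        using norm_triangle_ineq2[of v "of_nat (a j) * \<tau> * x"] diff[OF that] True by (simp add: ell_def)
      then have "(\<Prod>j=1..r. norm v / 2) \<le> (\<Prod>j=1..r. norm (?l j))"
        by (intro prod_mono) auto
      then have "norm v * (norm v / 2) ^ r \<le> norm v * (\<Prod>j=1..r. norm (?l j))"
        by (intro mult_left_mono) auto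
      also have "\<dots> = norm (fst (snd (G (x, v, \<tau>))))" by (simp add: G_def norm_mult prod_norm)
      also have "\<dots> \<le> C" by (rule B)
      finally have "norm v ^ Suc r \<le> 2 ^ r * C" by (simp add: power_divide field_simps)
      moreover have "norm v \<le> norm v ^ Suc r" using True power_increasing[of 1 "Suc r" "norm v"] by simp
      ultimately have "norm v \<le> D" using D2 by simp
      also have "\<dots> \<le> D * max 1 (norm x)" using D1 by (simp add: mult_le_cancel_left1)
      finally show ?thesis .
    next
      case False
      then consider "norm v \<le> 2 * of_nat s * C * norm x" | "norm v \<le> 1" by linarith
      then show ?thesis
      proof cases
        case 1
        have "2 * of_nat s * C * norm x \<le> D * max 1 (norm x)" using D2 D1 by (intro mult_mono) auto
        then show ?thesis using 1 by linarith
      next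
        case 2
        have "1 * 1 \<le> D * max 1 (norm x)" using D1 by (intro mult_mono) auto
        then show ?thesis using 2 by linarith
      qed
    qed
    have "norm x \<le> X"
    proof (cases "norm x \<le> 1")
      case True then show ?thesis using X1 by linarith
    next
      case False
      then have max_x: "max 1 (norm x) = norm x" by simp
      have "norm x \<le> D * norm x" using D1 by (simp add: mult_le_cancel_right1)
      moreover have "1 \<le> D * norm x" using False \<open>norm x \<le> D * norm x\<close> by linarith
      ultimately have "\<rho> \<le> D * norm x" using v_le unfolding max_x \<rho>_def by simp
      then have "C * (c * \<rho>) ^ s \<le> C * (c * (D * norm x)) ^ s"
        using assms c1 by (intro mult_left_mono power_mono) (auto simp: \<rho>_def)
      also have "\<dots> = X * norm x ^ s" by (simp add: X_def power_mult_distrib)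
      finally have "norm x * norm x ^ s \<le> X * norm x ^ s" using x_le by simp
      moreover have "norm x ^ s > 0" using False by (intro zero_less_power) linarith
      ultimately show ?thesis by simp
    qed
    moreover have "norm v \<le> D * X"
    proof -
      have "D * max 1 (norm x) \<le> D * X" using \<open>norm x \<le> X\<close> X1 D1 by (intro mult_left_mono) auto
      then show ?thesis using v_le by linarith
    qed
    ultimately show ?thesis by blast
  qed
  moreover have "X \<le> D * X" using D1 X1 by (simp add: mult_le_cancel_right1)
  ultimately show ?thesis by (intro exI[of _ "D * X"]) force
qed

text \<open>Closedness uses that the limit of points of the fibres satisfies the polynomial equations again and
that these keep it away from the zeros of \<open>x\<close>, \<open>v\<close> and \<open>ell j\<close>.\<close>

lemma compact_preimage:
  assumes "compact K" "K \<subseteq> base"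
  shows "compact (total \<inter> G -` K)"
proof -
  obtain C0 where C0: "\<And>q. q \<in> K \<Longrightarrow> norm q \<le> C0"
    using compact_imp_bounded[OF assms(1)] by (auto simp: bounded_iff)
  define C where "C = max 1 C0"
  have "C \<ge> 1" by (simp add: C_def)
  have K_le: "norm (fst q) \<le> C" "norm (fst (snd q)) \<le> C" "norm (snd (snd q)) \<le> C" if "q \<in> K" for q
  proof -
    have "norm q \<le> C" using C0[OF that] by (simp add: C_def)
    then show "norm (fst q) \<le> C" "norm (fst (snd q)) \<le> C" "norm (snd (snd q)) \<le> C"
      using norm_fst_le[of "fst q" "snd q"] norm_snd_le[of "snd q" "fst q"]
        norm_fst_le[of "fst (snd q)" "snd (snd q)"] norm_snd_le[of "snd (snd q)" "fst (snd q)"] by auto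
  qed
  obtain R where R: "\<And>p. p \<in> total \<Longrightarrow> norm (fst (G p)) \<le> C \<Longrightarrow> norm (fst (snd (G p))) \<le> C \<Longrightarrow>
      norm (snd (snd p)) \<le> C \<Longrightarrow> norm (fst p) \<le> R \<and> norm (fst (snd p)) \<le> R"
    using G_bounded_preimage[OF \<open>C \<ge> 1\<close>] by blast
  have "bounded (total \<inter> G -` K)"
  proof (rule bounded_subset)
    show "bounded (cball 0 R \<times> cball 0 R \<times> cball (0::complex) C)" by (intro bounded_Times bounded_cball)
    show "total \<inter> G -` K \<subseteq> cball 0 R \<times> cball 0 R \<times> cball 0 C"
    proof
      fix p assume p: "p \<in> total \<inter> G -` K"
      then have "norm (snd (snd p)) \<le> C" using K_le(3)[of "G p"] by (simp add: G_def)
      then show "p \<in> cball 0 R \<times> cball 0 R \<times> cball 0 C"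
        using R[of p] K_le(1,2)[of "G p"] p by (cases p) auto
    qed
  qed
  moreover have "closed (total \<inter> G -` K)"
    unfolding closed_sequential_limits
  proof (intro allI impI, elim conjE)
    fix p l assume pn: "\<forall>n. p n \<in> total \<inter> G -` K" and lim: "p \<longlonglongrightarrow> l"
    obtain q \<phi> where q: "q \<in> K" "strict_mono \<phi>" "((G \<circ> p) \<circ> \<phi>) \<longlonglongrightarrow> q"
      using assms(1) pn unfolding compact_eq_seq_compact_metric seq_compact_def
      by (metis (no_types, lifting) IntD2 comp_apply vimageD)
    obtain A B \<tau>' where q_eq: "q = (A, B, \<tau>')" by (cases q)
    obtain x v \<tau> where l_eq: "l = (x, v, \<tau>)" by (cases l)
    have AB: "A \<noteq> 0" "B \<noteq> 0" using q(1) assms(2) by (auto simp: q_eq base_def)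
    define P where "P n = p (\<phi> n)" for n
    have Pl: "P \<longlonglongrightarrow> l" using LIMSEQ_subseq_LIMSEQ[OF lim q(2)] by (simp add: P_def[abs_def] o_def)
    have GP: "(\<lambda>n. G (P n)) \<longlonglongrightarrow> q" using q(3) by (simp add: P_def[abs_def] o_def)
    note Pc = tendsto_fst[OF Pl] tendsto_fst[OF tendsto_snd[OF Pl]] tendsto_snd[OF tendsto_snd[OF Pl]]
    note Gc = tendsto_fst[OF GP] tendsto_fst[OF tendsto_snd[OF GP]] tendsto_snd[OF tendsto_snd[OF GP]]
    have ell_lim: "(\<lambda>n. ell j (P n)) \<longlonglongrightarrow> ell j l" for j
      unfolding ell_def split_beta by (intro tendsto_intros Pc)
    have Pt: "P n \<in> total" for n using pn by (simp add: P_def)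
    have "snd (snd (G (P n))) = snd (snd (P n))" for n by (simp add: G_def)
    then have "\<tau>' = \<tau>" using LIMSEQ_unique[OF Gc(3)] Pc(3) by (simp add: q_eq l_eq)
    have "(\<lambda>n. fst (P n) ^ Suc s) \<longlonglongrightarrow> x ^ Suc s" using Pc(1) by (intro tendsto_intros) (simp add: l_eq)
    moreover have "(\<lambda>n. fst (G (P n)) * (\<Prod>j=1..r. ell j (P n) ^ a j)) \<longlonglongrightarrow> A * (\<Prod>j=1..r. ell j l ^ a j)"
      using Gc(1) by (intro tendsto_intros ell_lim) (simp add: q_eq)
    moreover have "fst (G (P n)) * (\<Prod>j=1..r. ell j (P n) ^ a j) = fst (P n) ^ Suc s" for n
      using totalD(3)[OF Pt] by (simp add: G_def)
    ultimately have 1: "x ^ Suc s = A * (\<Prod>j=1..r. ell j l ^ a j)" using LIMSEQ_unique by auto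
    have "(\<lambda>n. fst (snd (P n)) * (\<Prod>j=1..r. ell j (P n))) \<longlonglongrightarrow> v * (\<Prod>j=1..r. ell j l)"
      using Pc(2) by (intro tendsto_intros ell_lim) (simp add: l_eq)
    then have 2: "v * (\<Prod>j=1..r. ell j l) = B" using LIMSEQ_unique[OF Gc(2)] by (simp add: G_def q_eq)
    have "l \<in> total \<and> G l = q"
      unfolding l_eq q_eq fibre_iff[OF AB] using 1 2 \<open>\<tau>' = \<tau>\<close> by (simp add: ell_def l_eq)
    then show "l \<in> total \<inter> G -` K" using q(1) by simp
  qed
  ultimately show ?thesis by (simp add: compact_eq_bounded_closed)
qed

definition deriv_x :: "point3 \<Rightarrow> point3 \<Rightarrow> complex" where
  "deriv_x p h = (of_nat (Suc s) / fst p + snd (snd p) * pole_sum 2 p) * fst h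
     - pole_sum 1 p * fst (snd h) + fst p * pole_sum 2 p * snd (snd h)"

definition deriv_v :: "point3 \<Rightarrow> point3 \<Rightarrow> complex" where
  "deriv_v p h = - snd (snd p) * pole_sum 1 p * fst h
     + (1 / fst (snd p) + pole_sum 0 p) * fst (snd h) - fst p * pole_sum 1 p * snd (snd h)"

definition G_deriv :: "point3 \<Rightarrow> point3 \<Rightarrow> point3" where
  "G_deriv p h = (fst (G p) * deriv_x p h, fst (snd (G p)) * deriv_v p h, snd (snd h))"

lemma ell_has_log_derivative:
  assumes "p \<in> total" "j \<in> {1..r}"
  shows "has_log_derivative (ell j)
    (\<lambda>h. (fst (snd h) - of_nat (a j) * (snd (snd p) * fst h + snd (snd h) * fst p)) / ell j p) p"
proof (rule has_log_derivativeI)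
  show "(ell j has_derivative (\<lambda>h. fst (snd h) - of_nat (a j) * (snd (snd p) * fst h + snd (snd h) * fst p))) (at p)"
    unfolding ell_def split_beta by (auto intro!: derivative_eq_intros simp: algebra_simps)
qed (use totalD(3)[OF assms] in simp)

lemma G_has_derivative:
  assumes p: "p \<in> total"
  shows "(G has_derivative G_deriv p) (at p)"
proof -
  let ?L = "\<lambda>j h. (fst (snd h) - of_nat (a j) * (snd (snd p) * fst h + snd (snd h) * fst p)) / ell j p"
  have fst_log: "has_log_derivative fst (\<lambda>h. fst h / fst p) p"
    by (rule has_log_derivativeI) (use totalD(1)[OF p] in \<open>auto intro!: derivative_eq_intros\<close>)
  have v_log: "has_log_derivative (\<lambda>q. fst (snd q)) (\<lambda>h. fst (snd h) / fst (snd p)) p"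
    by (rule has_log_derivativeI) (use totalD(2)[OF p] in \<open>auto intro!: derivative_eq_intros\<close>)
  have "has_log_derivative (\<lambda>q. fst q ^ Suc s * inverse (\<Prod>j=1..r. ell j q ^ a j))
      (\<lambda>h. of_nat (Suc s) * (fst h / fst p) + - (\<Sum>j=1..r. of_nat (a j) * ?L j h)) p"
    by (intro has_log_derivative_mult has_log_derivative_power has_log_derivative_inverse has_log_derivative_prod
          fst_log ell_has_log_derivative[OF p]) auto
  moreover have "of_nat (Suc s) * (fst h / fst p) + - (\<Sum>j=1..r. of_nat (a j) * ?L j h) = deriv_x p h" for h
  proof -
    have "(\<Sum>j=1..r. of_nat (a j) * ?L j h) =
        (\<Sum>j=1..r. (of_nat (a j) ^ 1 / ell j p) * fst (snd h) - (of_nat (a j) ^ 2 / ell j p) * (snd (snd p) * fst h + snd (snd h) * fst p))"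
      by (intro sum.cong refl) (simp add: power2_eq_square diff_divide_distrib right_diff_distrib)
    also have "\<dots> = pole_sum 1 p * fst (snd h) - pole_sum 2 p * (snd (snd p) * fst h + snd (snd h) * fst p)"
      unfolding pole_sum_def by (simp add: sum_subtractf sum_distrib_right)
    finally show ?thesis by (simp add: deriv_x_def algebra_simps)
  qed
  ultimately have 1: "((\<lambda>q. fst (G q)) has_derivative (\<lambda>h. fst (G p) * deriv_x p h)) (at p)"
    by (simp add: has_log_derivative_def G_def divide_inverse)
  have "has_log_derivative (\<lambda>q. fst (snd q) * (\<Prod>j=1..r. ell j q))
      (\<lambda>h. fst (snd h) / fst (snd p) + (\<Sum>j=1..r. ?L j h)) p"
    by (intro has_log_derivative_mult has_log_derivative_prod v_log ell_has_log_derivative[OF p]) auto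
  moreover have "fst (snd h) / fst (snd p) + (\<Sum>j=1..r. ?L j h) = deriv_v p h" for h
  proof -
    have "(\<Sum>j=1..r. ?L j h) =
        (\<Sum>j=1..r. (of_nat (a j) ^ 0 / ell j p) * fst (snd h) - (of_nat (a j) ^ 1 / ell j p) * (snd (snd p) * fst h + snd (snd h) * fst p))"
      by (intro sum.cong refl) (simp add: diff_divide_distrib)
    also have "\<dots> = pole_sum 0 p * fst (snd h) - pole_sum 1 p * (snd (snd p) * fst h + snd (snd h) * fst p)"
      unfolding pole_sum_def sum_subtractf sum_distrib_right ..
    finally show ?thesis by (simp add: deriv_v_def algebra_simps)
  qed
  ultimately have 2: "((\<lambda>q. fst (snd (G q))) has_derivative (\<lambda>h. fst (snd (G p)) * deriv_v p h)) (at p)"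
    by (simp add: has_log_derivative_def G_def)
  have 3: "((\<lambda>q. snd (snd (G q))) has_derivative (\<lambda>h. snd (snd h))) (at p)"
    by (auto simp: G_def intro!: derivative_eq_intros)
  from has_derivative_Pair[OF 1 has_derivative_Pair[OF 2 3]] show ?thesis
    by (simp add: G_deriv_def[abs_def])
qed

lemma kernel_trivial:
  assumes "jac p \<noteq> 0" "deriv_x p (x, v, 0) = 0" "deriv_v p (x, v, 0) = 0"
  shows "x = 0 \<and> v = 0"
proof -
  define m11 where "m11 = of_nat (Suc s) / fst p + snd (snd p) * pole_sum 2 p"
  define m22 where "m22 = 1 / fst (snd p) + pole_sum 0 p"
  define q where "q = pole_sum 1 p"
  define \<tau> where "\<tau> = snd (snd p)"
  have j: "jac p = m11 * m22 - \<tau> * q\<^sup>2" by (simp add: jac_def m11_def m22_def q_def \<tau>_def)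
  have 1: "m11 * x - q * v = 0" using assms(2) by (simp add: deriv_x_def m11_def q_def)
  have 2: "- \<tau> * q * x + m22 * v = 0" using assms(3) by (simp add: deriv_v_def m22_def q_def \<tau>_def)
  have "jac p * x = m22 * (m11 * x - q * v) + q * (- \<tau> * q * x + m22 * v)"
    by (simp add: j algebra_simps power2_eq_square)
  moreover have "jac p * v = \<tau> * q * (m11 * x - q * v) + m11 * (- \<tau> * q * x + m22 * v)"
    by (simp add: j algebra_simps power2_eq_square)
  ultimately show ?thesis using 1 2 assms(1) by simp
qed

lemma G_deriv_inj:
  assumes "p \<in> total" "jac p \<noteq> 0" "G_deriv p h = 0"
  shows "h = 0"
proof -
  obtain x v t where h: "h = (x, v, t)" by (cases h)
  have "fst (G p) \<noteq> 0" "fst (snd (G p)) \<noteq> 0" using G_in_base[OF assms(1)] by (auto simp: base_def)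
  then have "t = 0" "deriv_x p (x, v, t) = 0" "deriv_v p (x, v, t) = 0"
    using assms(3) by (auto simp: G_deriv_def h prod_eq_iff)
  then show ?thesis using kernel_trivial[OF assms(2), of x v] by (simp add: h prod_eq_iff)
qed

lemma G_deriv_left_inverse:
  assumes "p \<in> total" "jac p \<noteq> 0"
  obtains g' where "bounded_linear g'" "g' \<circ> G_deriv p = id"
proof -
  have lin: "linear (G_deriv p)" using G_has_derivative[OF assms(1)] has_derivative_linear by blast
  then have "inj (G_deriv p)" using G_deriv_inj[OF assms] linear_injective_0 by blast
  then obtain g' where "linear g'" "g' \<circ> G_deriv p = id" using linear_injective_left_inverse[OF lin] by blast
  then show ?thesis using that linear_conv_bounded_linear by blast
qed

lemma isCont_ell [continuous_intros]: "isCont (ell j) p"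
  using continuous_ell[of UNIV j] continuous_on_eq_continuous_at open_UNIV by blast

lemma isCont_pole_sum:
  assumes "p \<in> total" shows "isCont (pole_sum n) p"
  unfolding pole_sum_def by (intro continuous_intros) (use totalD(3)[OF assms] in auto)

lemma isCont_G:
  assumes "p \<in> total" shows "isCont G p"
  using continuous_G assms open_total continuous_on_eq_continuous_at by blast

lemma isCont_jac:
  assumes "p \<in> total" shows "isCont jac p"
  unfolding jac_def
  by (intro continuous_intros isCont_pole_sum assms) (use totalD[OF assms] in auto)

text \<open>The quantitative inverse function theorem needs continuity of the derivative in the operator norm;
\<open>E\<close> below bounds its variation by that of the six nonconstant entries of the Jacobian matrix.\<close>

lemma G_locally_injective:
  assumes p: "p \<in> total" "jac p \<noteq> 0"
  shows "\<exists>\<rho>>0. ball p \<rho> \<subseteq> total \<and> inj_on G (ball p \<rho>)"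
proof -
  obtain g' where g': "bounded_linear g'" "g' \<circ> G_deriv p = id" using G_deriv_left_inverse[OF p] by blast
  define c1 where "c1 q = fst (G q) * (of_nat (Suc s) / fst q + snd (snd q) * pole_sum 2 q)" for q
  define c2 where "c2 q = fst (G q) * pole_sum 1 q" for q
  define c3 where "c3 q = fst (G q) * (fst q * pole_sum 2 q)" for q
  define d1 where "d1 q = fst (snd (G q)) * (- snd (snd q) * pole_sum 1 q)" for q
  define d2 where "d2 q = fst (snd (G q)) * (1 / fst (snd q) + pole_sum 0 q)" for q
  define d3 where "d3 q = fst (snd (G q)) * (fst q * pole_sum 1 q)" for q
  define E where "E q = norm (c1 q - c1 p) + norm (c2 q - c2 p) + norm (c3 q - c3 p)
      + norm (d1 q - d1 p) + norm (d2 q - d2 p) + norm (d3 q - d3 p)" for q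
  have "isCont E p"
    unfolding E_def c1_def c2_def c3_def d1_def d2_def d3_def
    by (intro continuous_intros isCont_pole_sum isCont_G p) (use totalD[OF p(1)] in auto)
  have E0: "E p = 0" by (simp add: E_def)
  have bound: "norm (G_deriv q h - G_deriv p h) \<le> E q * norm h" for q h
  proof -
    obtain x v t where h: "h = (x, v, t)" by (cases h)
    have le: "norm x \<le> norm h" "norm v \<le> norm h" "norm t \<le> norm h"
      using norm_fst_le[of x "(v, t)"] norm_snd_le[of "(v, t)" x] norm_fst_le[of v t] norm_snd_le[of t v]
      unfolding h by linarith+
    have "G_deriv q h - G_deriv p h =
        ((c1 q - c1 p) * x - (c2 q - c2 p) * v + (c3 q - c3 p) * t,
         (d1 q - d1 p) * x + (d2 q - d2 p) * v - (d3 q - d3 p) * t, 0)"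
      by (simp add: G_deriv_def deriv_x_def deriv_v_def h c1_def c2_def c3_def d1_def d2_def d3_def algebra_simps)
    also have "norm \<dots> \<le> norm ((c1 q - c1 p) * x - (c2 q - c2 p) * v + (c3 q - c3 p) * t)
        + norm ((d1 q - d1 p) * x + (d2 q - d2 p) * v - (d3 q - d3 p) * t)"
    proof -
      have "norm (x, y, 0 :: complex) \<le> norm x + norm y" for x y :: complex
        using norm_Pair_le[of x "(y, 0)"] norm_Pair_le[of y "0 :: complex"] by simp
      then show ?thesis .
    qed
    also have "\<dots> \<le> (norm ((c1 q - c1 p) * x) + norm ((c2 q - c2 p) * v) + norm ((c3 q - c3 p) * t))
        + (norm ((d1 q - d1 p) * x) + norm ((d2 q - d2 p) * v) + norm ((d3 q - d3 p) * t))"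
      by (intro add_mono norm_triangle_le norm_triangle_le_diff order_refl)
    also have "\<dots> \<le> E q * norm h"
      unfolding norm_mult E_def distrib_right using le
      by (simp only: add.assoc) (intro add_mono mult_left_mono le norm_ge_zero)
    finally show ?thesis .
  qed
  have "\<exists>d>0. \<forall>q. dist p q < d \<longrightarrow> onorm (\<lambda>h. G_deriv q h - G_deriv p h) < e" if "e > 0" for e
  proof -
    obtain d where d: "d > 0" "\<And>q. dist q p < d \<Longrightarrow> norm (E q - E p) < e"
      using \<open>isCont E p\<close> \<open>e > 0\<close> unfolding continuous_at_eps_delta dist_norm by blast
    have "onorm (\<lambda>h. G_deriv q h - G_deriv p h) < e" if "dist p q < d" for q
    proof -
      have "onorm (\<lambda>h. G_deriv q h - G_deriv p h) \<le> E q" by (rule onorm_le[OF bound])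
      also have "E q < e" using d(2)[of q] that by (simp add: E0 dist_commute)
      finally show ?thesis .
    qed
    then show ?thesis using d(1) by blast
  qed
  with p(1) open_total g' G_has_derivative obtain \<rho> where "\<rho> > 0" "ball p \<rho> \<subseteq> total" "inj_on G (ball p \<rho>)"
    by (rule has_derivative_locally_injective[where f = G and f' = G_deriv]) auto
  then show ?thesis by blast
qed

definition nondegenerate :: "point3 set" where
  "nondegenerate = {q \<in> base. \<forall>p\<in>total. G p = q \<longrightarrow> jac p \<noteq> 0}"

text \<open>Over \<open>nondegenerate\<close> the map is a local homeomorphism, but a fibre may be empty, whereas the
definition of a covering space requires surjectivity.\<close>

definition regular_values :: "point3 set" where
  "regular_values = nondegenerate \<inter> G ` total"

text \<open>The map is closed, being proper.\<close>

lemma open_complement_image: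
  assumes "C \<subseteq> total" "\<And>K. compact K \<Longrightarrow> K \<subseteq> total \<Longrightarrow> compact (K \<inter> C)"
  shows "open (base - G ` C)"
  unfolding open_contains_ball
proof
  fix y assume y: "y \<in> base - G ` C"
  obtain e where e: "e > 0" "cball y e \<subseteq> base" using open_base y open_contains_cball by blast
  have "compact ((total \<inter> G -` cball y e) \<inter> C)"
    by (intro assms(2) compact_preimage e) auto
  then have "closed (G ` ((total \<inter> G -` cball y e) \<inter> C))"
    by (intro compact_imp_closed compact_continuous_image continuous_on_subset[OF continuous_G]) auto
  moreover have "y \<in> - G ` ((total \<inter> G -` cball y e) \<inter> C)" using y by auto
  ultimately obtain d where d: "d > 0" "ball y d \<subseteq> - G ` ((total \<inter> G -` cball y e) \<inter> C)"
    by (meson open_Compl openE)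
  have "ball y (min d e) \<subseteq> base - G ` C"
  proof
    fix z assume z: "z \<in> ball y (min d e)"
    then have "z \<in> base" using e by auto
    moreover have "z \<notin> G ` C"
    proof
      assume "z \<in> G ` C"
      then have "z \<in> G ` ((total \<inter> G -` cball y e) \<inter> C)" using assms(1) z by auto
      moreover have "z \<in> ball y d" using z by simp
      ultimately show False using d(2) by blast
    qed
    ultimately show "z \<in> base - G ` C" by blast
  qed
  then show "\<exists>e>0. ball y e \<subseteq> base - G ` C" using e(1) d(1) by (intro exI[of _ "min d e"]) auto
qed

lemma open_nondegenerate: "open nondegenerate"
proof -
  have "nondegenerate = base - G ` {p \<in> total. jac p = 0}" unfolding nondegenerate_def by blast
  also have "open \<dots>"
  proof (rule open_complement_image)
    fix K assume K: "compact K" "K \<subseteq> total"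
    have "continuous_on K jac" by (rule continuous_at_imp_continuous_on) (use K(2) isCont_jac in blast)
    then have "closed (K \<inter> jac -` {0})"
      using K by (intro continuous_closed_preimage compact_imp_closed) auto
    moreover have "K \<inter> {p \<in> total. jac p = 0} = K \<inter> (K \<inter> jac -` {0})" using K by auto
    ultimately show "compact (K \<inter> {p \<in> total. jac p = 0})" using K(1) compact_Int_closed by metis
  qed auto
  finally show ?thesis .
qed

lemma open_regular_values: "open regular_values"
  unfolding open_subopen[of regular_values]
proof
  fix q assume q: "q \<in> regular_values"
  then obtain p where p: "p \<in> total" "G p = q" by (auto simp: regular_values_def)
  then have "jac p \<noteq> 0" using q by (auto simp: regular_values_def nondegenerate_def)
  then obtain \<rho> where \<rho>: "\<rho> > 0" "ball p \<rho> \<subseteq> total" "inj_on G (ball p \<rho>)" using G_locally_injective p by blast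
  have "open (G ` ball p \<rho>)"
    using \<rho> by (intro invariance_of_domain continuous_on_subset[OF continuous_G]) auto
  then show "\<exists>T. open T \<and> q \<in> T \<and> T \<subseteq> regular_values"
    using p \<rho> q open_nondegenerate
    by (intro exI[of _ "nondegenerate \<inter> G ` ball p \<rho>"]) (auto simp: regular_values_def)
qed

definition covering_total :: "point3 set" where
  "covering_total = total \<inter> G -` regular_values"

theorem covering: "covering_space covering_total G regular_values"
  unfolding covering_total_def
proof (rule proper_local_injection_covering)
  show "regular_values \<subseteq> G ` total" by (auto simp: regular_values_def)
  fix p assume "p \<in> total" "G p \<in> regular_values"
  then show "\<exists>\<rho>>0. ball p \<rho> \<subseteq> total \<and> inj_on G (ball p \<rho>)"
    by (intro G_locally_injective) (auto simp: regular_values_def nondegenerate_def)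
next
  fix K assume "compact K" "K \<subseteq> regular_values"
  then show "compact (total \<inter> G -` K)"
    by (intro compact_preimage) (auto simp: regular_values_def nondegenerate_def)
qed (simp_all add: open_total open_regular_values continuous_G)

text \<open>Having a point in the fibre is an open condition by local injectivity, and having none is an open
condition by properness.\<close>

lemma connected_nondegenerate_imp_regular:
  assumes "connected C" "C \<subseteq> nondegenerate" "C \<inter> regular_values \<noteq> {}"
  shows "C \<subseteq> regular_values"
proof -
  have "open (base - G ` total)" by (rule open_complement_image) (auto simp: Int_absorb2)
  then have "regular_values \<inter> C = {} \<or> (base - G ` total) \<inter> C = {}"
    using assms(2) by (intro connectedD[OF assms(1) open_regular_values]) (auto simp: regular_values_def nondegenerate_def)
  then show ?thesis using assms(2,3) by (auto simp: regular_values_def nondegenerate_def)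
qed

end

section \<open>Critical points as points of the covering\<close>

context LG_data
begin

text \<open>Rescaling the coordinates \<open>z_i\<close> and \<open>w_j\<close> changes the coefficients \<open>\<alpha>_i\<close> and \<open>\<beta>_j\<close>. This quantity and
\<open>B_invariant\<close> are unaffected, and they determine the critical points up to rescaling.\<close>

definition A_invariant :: "cpair \<Rightarrow> complex" where
  "A_invariant f = (\<Prod>i=0..s. fst f i) / (\<Prod>j=1..r. snd f j ^ a j)"

definition B_invariant :: "cpair \<Rightarrow> complex" where
  "B_invariant f = (\<Prod>j=0..r. snd f j)"

definition fibre_point :: "cpair \<Rightarrow> complex \<Rightarrow> cpair \<Rightarrow> point3" where
  "fibre_point f \<tau> p =
     (fst f 0 * ((\<Prod>j=1..r. snd p j ^ a j) / (\<Prod>i=1..s. fst p i)) / \<tau>, snd f 0 * (1 / (\<Prod>j=1..r. snd p j)), \<tau>)"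

definition crit_point :: "cpair \<Rightarrow> point3 \<Rightarrow> cpair" where
  "crit_point f P = (\<lambda>i\<in>{1..s}. snd (snd P) * fst P / fst f i, \<lambda>j\<in>{1..r}. ell j P / snd f j)"

lemma LG_space_nonzero:
  assumes "f \<in> LG_space s r"
  shows "i \<le> s \<Longrightarrow> fst f i \<noteq> 0" and "j \<le> r \<Longrightarrow> snd f j \<noteq> 0"
  using assms by (auto simp: LG_space_def PiE_iff)

lemma A_invariant_nonzero: "f \<in> LG_space s r \<Longrightarrow> A_invariant f \<noteq> 0"
  and B_invariant_nonzero: "f \<in> LG_space s r \<Longrightarrow> B_invariant f \<noteq> 0"
  using LG_space_nonzero by (auto simp: A_invariant_def B_invariant_def)

lemma LG_memberI: "f \<in> LG_space s r \<Longrightarrow> LG_member s r (fst f) (snd f)"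
  by unfold_locales simp

text \<open>Evaluating the congruences \<open>u_relation\<close> and \<open>v_relation\<close> at a critical point yields the equations of
the fibre.\<close>

lemma fibre_point_correct:
  assumes f: "f \<in> LG_space s r" and \<tau>: "\<tau> \<noteq> 0" "A_invariant f = A * \<tau> ^ Suc s" and p: "p \<in> Crit s r a f"
  shows "fibre_point f \<tau> p \<in> total" "G (fibre_point f \<tau> p) = (A, B_invariant f, \<tau>)"
    and "crit_point f (fibre_point f \<tau> p) = p"
proof -
  interpret LG_member s r a "fst f" "snd f" using LG_memberI[OF f] .
  have p': "p \<in> Crit s r a (fst f, snd f)" using p by simp
  note crit = p'[unfolded Crit_iff]
  define u where "u = u_value p"
  define v where "v = v_value p"
  have P: "fibre_point f \<tau> p = (u / \<tau>, v, \<tau>)"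
    by (simp add: fibre_point_def u_def v_def u_value_def v_value_def)
  have ell: "ell j (u / \<tau>, v, \<tau>) = v - of_nat (a j) * u" for j using \<tau> by (simp add: ell_def)
  have AB: "A \<noteq> 0" "B_invariant f \<noteq> 0" using A_invariant_nonzero[OF f] B_invariant_nonzero[OF f] \<tau> by auto
  have eval: "h p = h' p" if "mod_eq h h'" for h h'
    using ideal_vanishes_on_Crit[OF _ p', of "\<lambda>p. h p - h' p"] that by (simp add: mod_eq_def)
  have U: "u ^ Suc s = A * \<tau> ^ Suc s * (\<Prod>j=1..r. (v - of_nat (a j) * u) ^ a j)"
    using eval[OF u_relation] \<tau>(2) by (simp only: u_def v_def A0_def A_invariant_def)
  have V: "v * (\<Prod>j=1..r. v - of_nat (a j) * u) = B_invariant f"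
    using eval[OF v_relation] by (simp add: u_def v_def B_invariant_def)
  have "(u / \<tau>) ^ Suc s = A * (\<Prod>j=1..r. (v - of_nat (a j) * u) ^ a j)"
  proof -
    have "\<tau> ^ Suc s \<noteq> 0" using \<tau>(1) by (rule power_not_zero)
    then show ?thesis unfolding power_divide U by (simp del: power_Suc)
  qed
  then have "(u / \<tau>, v, \<tau>) \<in> total \<and> G (u / \<tau>, v, \<tau>) = (A, B_invariant f, \<tau>)"
    unfolding fibre_iff[OF AB] using V \<tau>(1) by simp
  then show "fibre_point f \<tau> p \<in> total" "G (fibre_point f \<tau> p) = (A, B_invariant f, \<tau>)" unfolding P by blast+
  have PiE: "fst p \<in> {1..s} \<rightarrow>\<^sub>E - {0}" "snd p \<in> {1..r} \<rightarrow>\<^sub>E - {0}"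
    using crit by (auto simp: LG_torus_def)
  have z_eq: "\<tau> * (u / \<tau>) / fst f i = fst p i" if "i \<in> {1..s}" for i
    using crit that alpha_nonzero[of i] \<tau>(1) by (auto simp: u_def field_simps)
  have w_eq: "ell j (u / \<tau>, v, \<tau>) / snd f j = snd p j" if "j \<in> {1..r}" for j
    unfolding ell using crit that beta_nonzero[of j] by (auto simp: u_def v_def field_simps)
  have "(\<lambda>i\<in>{1..s}. \<tau> * (u / \<tau>) / fst f i) = restrict (fst p) {1..s}"
    by (rule restrict_ext) (rule z_eq)
  moreover have "(\<lambda>j\<in>{1..r}. ell j (u / \<tau>, v, \<tau>) / snd f j) = restrict (snd p) {1..r}"
    by (rule restrict_ext) (rule w_eq)
  ultimately show "crit_point f (fibre_point f \<tau> p) = p"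
    unfolding P crit_point_def fst_conv snd_conv PiE_restrict[OF PiE(1)] PiE_restrict[OF PiE(2)] by simp
qed

text \<open>Here \<open>P\<close> need not be in the fibre belonging to \<open>f\<close>. The factors measure the distance of \<open>G P\<close> from
the right values; this is used to differentiate along curves that meet the fibre to second order.\<close>

lemma u_v_of_affine_point:
  assumes f: "f \<in> LG_space s r" and P: "P \<in> total" and \<tau>: "snd (snd P) \<noteq> 0" "A_invariant f = A * snd (snd P) ^ Suc s"
  shows "crit_point f P \<in> LG_torus s r"
    and "LG_member.u_value s r a (fst f) (crit_point f P) = snd (snd P) * fst P * (A / fst (G P))"
    and "LG_member.v_value r (snd f) (crit_point f P) = fst (snd P) * (B_invariant f / fst (snd (G P)))"
proof -
  interpret LG_member s r a "fst f" "snd f" using LG_memberI[OF f] .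
  obtain x v \<tau>' where P_eq: "P = (x, v, \<tau>')" by (cases P)
  have \<tau>': "\<tau>' \<noteq> 0" using \<tau> by (simp add: P_eq)
  have nz: "x \<noteq> 0" "v \<noteq> 0" "\<And>j. j \<in> {1..r} \<Longrightarrow> ell j P \<noteq> 0" using P by (auto simp: total_def P_eq)
  show "crit_point f P \<in> LG_torus s r"
    using nz LG_space_nonzero[OF f] \<tau>' by (auto simp: LG_torus_def crit_point_def P_eq)
  define W where "W = (\<Prod>j=1..r. ell j P ^ a j)"
  define b where "b = (\<Prod>j=1..r. snd f j ^ a j)"
  define al where "al = (\<Prod>i=1..s. fst f i)"
  have Wnz: "W \<noteq> 0" "b \<noteq> 0" "al \<noteq> 0" using nz(3) LG_space_nonzero[OF f] by (auto simp: W_def b_def al_def)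
  have "(\<Prod>j=1..r. snd (crit_point f P) j ^ a j) = W / b"
    unfolding W_def b_def prod_dividef[symmetric] by (intro prod.cong) (auto simp: crit_point_def power_divide)
  moreover have "(\<Prod>i=1..s. fst (crit_point f P) i) = (\<tau>' * x) ^ s / al"
    unfolding al_def using prod_dividef[of "\<lambda>_. \<tau>' * x" "fst f" "{1..s}"] by (simp add: crit_point_def P_eq)
  ultimately have "u_value (crit_point f P) = fst f 0 * ((W / b) / ((\<tau>' * x) ^ s / al))"
    by (simp add: u_value_def)
  also have "\<dots> = (fst f 0 * al / b) * (W / (\<tau>' * x) ^ s)" using Wnz nz(1) \<tau>' by (simp add: field_simps)
  also have "fst f 0 * al / b = A_invariant f"
    using prod.atLeast_Suc_atMost[of 0 s "fst f"] by (simp add: A_invariant_def al_def b_def)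
  also have "A_invariant f * (W / (\<tau>' * x) ^ s) = \<tau>' * x * (A / fst (G P))"
    using Wnz nz(1) \<tau>' unfolding \<tau>(2) G_def W_def[symmetric] by (simp add: P_eq power_mult_distrib field_simps)
  finally show "u_value (crit_point f P) = snd (snd P) * fst P * (A / fst (G P))" by (simp add: P_eq)
  define L where "L = (\<Prod>j=1..r. ell j P)"
  define b1 where "b1 = (\<Prod>j=1..r. snd f j)"
  have Lnz: "L \<noteq> 0" "b1 \<noteq> 0" using nz(3) LG_space_nonzero[OF f] by (auto simp: L_def b1_def)
  have "(\<Prod>j=1..r. snd (crit_point f P) j) = L / b1"
    unfolding L_def b1_def prod_dividef[symmetric] by (intro prod.cong) (auto simp: crit_point_def)
  moreover have "B_invariant f = snd f 0 * b1"
    using prod.atLeast_Suc_atMost[of 0 r "snd f"] by (simp add: B_invariant_def b1_def)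
  moreover have GP: "fst (snd (G P)) = v * L" by (simp add: G_def L_def P_eq)
  ultimately show "v_value (crit_point f P) = fst (snd P) * (B_invariant f / fst (snd (G P)))"
    unfolding GP using Lnz nz(2) by (simp add: v_value_def P_eq)
qed

lemma crit_point_correct:
  assumes f: "f \<in> LG_space s r" and P: "P \<in> total" "G P = (A, B_invariant f, \<tau>)"
    and \<tau>: "\<tau> \<noteq> 0" "A_invariant f = A * \<tau> ^ Suc s"
  shows "crit_point f P \<in> Crit s r a f" "fibre_point f \<tau> (crit_point f P) = P"
proof -
  interpret LG_member s r a "fst f" "snd f" using LG_memberI[OF f] .
  have \<tau>_eq: "snd (snd P) = \<tau>" using P(2) by (simp add: G_def)
  have AB: "A \<noteq> 0" "B_invariant f \<noteq> 0" using A_invariant_nonzero[OF f] B_invariant_nonzero[OF f] \<tau> by auto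
  note uv = u_v_of_affine_point[OF f P(1), unfolded \<tau>_eq, OF \<tau>, unfolded P(2)]
  have u: "u_value (crit_point f P) = \<tau> * fst P" and v: "v_value (crit_point f P) = fst (snd P)"
    using uv AB by simp_all
  have "crit_point f P \<in> Crit s r a (fst f, snd f)"
    unfolding Crit_iff u v
  proof (intro conjI uv(1) ballI)
    fix i assume "i \<in> {1..s}" then show "fst f i * fst (crit_point f P) i = \<tau> * fst P"
      using alpha_nonzero[of i] by (simp add: crit_point_def \<tau>_eq)
  next
    fix j assume "j \<in> {1..r}"
    then show "snd f j * snd (crit_point f P) j = fst (snd P) - of_nat (a j) * (\<tau> * fst P)"
      using beta_nonzero[of j] \<tau>_eq by (simp add: crit_point_def ell_def split_beta)
  qed
  then show "crit_point f P \<in> Crit s r a f" by simp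
  have "fibre_point f \<tau> (crit_point f P) = (\<tau> * fst P / \<tau>, fst (snd P), \<tau>)"
    using u v by (simp add: fibre_point_def u_value_def v_value_def)
  then show "fibre_point f \<tau> (crit_point f P) = P" using \<tau> \<tau>_eq by (simp add: prod_eq_iff)
qed

text \<open>A zero of \<open>jac\<close> gives a direction in which \<open>G\<close> is stationary. The map \<open>crit_point\<close> carries the line in
this direction to a curve along which the critical equations are stationary. By
\<open>reduced_imp_no_null_tangent\<close> the coordinates \<open>z_1\<close> and \<open>w_1\<close> are stationary along this curve, which
forces the direction to be zero.\<close>

lemma reduced_imp_nondegenerate:
  assumes rs: "r \<ge> 1" "s \<ge> 1" and f: "f \<in> LG_space s r" and red: "crit_reduced s r a f"
    and \<tau>: "\<tau> \<noteq> 0" "A_invariant f = A * \<tau> ^ Suc s"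
  shows "(A, B_invariant f, \<tau>) \<in> nondegenerate"
  unfolding nondegenerate_def
proof (intro CollectI conjI ballI impI)
  interpret LG_member s r a "fst f" "snd f" using LG_memberI[OF f] .
  have AB: "A \<noteq> 0" "B_invariant f \<noteq> 0" using A_invariant_nonzero[OF f] B_invariant_nonzero[OF f] \<tau> by auto
  then show "(A, B_invariant f, \<tau>) \<in> base" by (simp add: base_def)
  fix P assume P: "P \<in> total" "G P = (A, B_invariant f, \<tau>)"
  show "jac P \<noteq> 0"
  proof
    assume jac0: "jac P = 0"
    have \<tau>_eq: "snd (snd P) = \<tau>" using P(2) by (simp add: G_def)
    have "\<exists>x v. (x, v) \<noteq> (0, 0) \<and> deriv_x P (x, v, 0) = 0 \<and> deriv_v P (x, v, 0) = 0"
    proof -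
      define m11 where "m11 = of_nat (Suc s) / fst P + snd (snd P) * pole_sum 2 P"
      define m22 where "m22 = 1 / fst (snd P) + pole_sum 0 P"
      define q where "q = pole_sum 1 P"
      have j: "m11 * m22 - \<tau> * q\<^sup>2 = 0" using jac0 by (simp add: jac_def m11_def m22_def q_def \<tau>_eq)
      have dx: "deriv_x P (x, v, 0) = m11 * x - q * v" for x v by (simp add: deriv_x_def m11_def q_def)
      have dv: "deriv_v P (x, v, 0) = - \<tau> * q * x + m22 * v" for x v by (simp add: deriv_v_def m22_def q_def \<tau>_eq)
      show ?thesis
      proof (cases "m11 = 0 \<and> q = 0")
        case True
        then show ?thesis by (intro exI[of _ 1] exI[of _ 0]) (simp add: dx dv)
      next
        case False
        have "- \<tau> * q * q + m22 * m11 = 0" using j by (simp add: power2_eq_square algebra_simps)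
        then show ?thesis using False by (intro exI[of _ q] exI[of _ m11]) (auto simp: dx dv)
      qed
    qed
    then obtain \<xi> \<eta> where \<xi>\<eta>: "(\<xi>, \<eta>) \<noteq> (0, 0)" "deriv_x P (\<xi>, \<eta>, 0) = 0" "deriv_v P (\<xi>, \<eta>, 0) = 0" by blast
    obtain x v where P_eq: "P = (x, v, \<tau>)" using \<tau>_eq by (cases P) auto
    \<comment> \<open>The line in the null direction, and its image in the torus.\<close>
    define Q where "Q \<epsilon> = (x + \<epsilon> * \<xi>, v + \<epsilon> * \<eta>, \<tau>)" for \<epsilon> :: complex
    define \<gamma> where "\<gamma> \<epsilon> = crit_point f (Q \<epsilon>)" for \<epsilon>
    have Q0: "Q 0 = P" by (simp add: Q_def P_eq)
    have Q_der: "(Q has_derivative (\<lambda>h. (h * \<xi>, h * \<eta>, 0))) (at 0)"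
      unfolding Q_def by (auto intro!: derivative_eq_intros)
    have "((\<lambda>\<epsilon>. G (Q \<epsilon>)) has_derivative (\<lambda>h. G_deriv P (h * \<xi>, h * \<eta>, 0))) (at 0)"
      using has_derivative_compose[OF Q_der, of G "G_deriv P"] G_has_derivative[OF P(1)] Q0 by simp
    moreover have "G_deriv P (h * \<xi>, h * \<eta>, 0) = 0" for h
    proof -
      have "deriv_x P (h * \<xi>, h * \<eta>, 0) = h * deriv_x P (\<xi>, \<eta>, 0)" by (simp add: deriv_x_def algebra_simps)
      moreover have "deriv_v P (h * \<xi>, h * \<eta>, 0) = h * deriv_v P (\<xi>, \<eta>, 0)" by (simp add: deriv_v_def algebra_simps)
      ultimately show ?thesis using \<xi>\<eta> by (simp add: G_deriv_def zero_prod_def)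
    qed
    ultimately have GQ: "((\<lambda>\<epsilon>. G (Q \<epsilon>)) has_derivative (\<lambda>h. 0)) (at 0)" by simp
    have G1: "((\<lambda>\<epsilon>. fst (G (Q \<epsilon>))) has_field_derivative 0) (at 0)"
      and G2: "((\<lambda>\<epsilon>. fst (snd (G (Q \<epsilon>)))) has_field_derivative 0) (at 0)"
      using has_derivative_fst[OF GQ] has_derivative_fst[OF has_derivative_snd[OF GQ]]
      by (simp_all add: has_field_derivative_def zero_prod_def lambda_zero)
    have Q_total: "\<forall>\<^sub>F \<epsilon> in nhds 0. Q \<epsilon> \<in> total"
    proof -
      have "isCont Q 0" using Q_der has_derivative_continuous by blast
      then have "(Q \<longlongrightarrow> Q 0) (nhds 0)" using tendsto_at_iff_tendsto_nhds[of Q 0] by (simp add: isCont_def)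
      then show ?thesis by (rule topological_tendstoD) (use open_total P(1) Q0 in auto)
    qed
    have \<tau>Q: "snd (snd (Q \<epsilon>)) = \<tau>" for \<epsilon> by (simp add: Q_def)
    have torus: "\<forall>\<^sub>F \<epsilon> in nhds 0. \<gamma> \<epsilon> \<in> LG_torus s r"
      using Q_total unfolding \<gamma>_def
      by eventually_elim (rule u_v_of_affine_point(1)[OF f], auto simp: \<tau>Q \<tau>)
    have u_ev: "\<forall>\<^sub>F \<epsilon> in nhds 0. u_value (\<gamma> \<epsilon>) = \<tau> * (x + \<epsilon> * \<xi>) * (A / fst (G (Q \<epsilon>)))"
      using Q_total unfolding \<gamma>_def
    proof eventually_elim
      case (elim \<epsilon>)
      show ?case using u_v_of_affine_point(2)[OF f elim, unfolded \<tau>Q, OF \<tau>] by (simp add: Q_def)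
    qed
    have v_ev: "\<forall>\<^sub>F \<epsilon> in nhds 0. v_value (\<gamma> \<epsilon>) = (v + \<epsilon> * \<eta>) * (B_invariant f / fst (snd (G (Q \<epsilon>))))"
      using Q_total unfolding \<gamma>_def
    proof eventually_elim
      case (elim \<epsilon>)
      show ?case using u_v_of_affine_point(3)[OF f elim, unfolded \<tau>Q, OF \<tau>] by (simp add: Q_def)
    qed
    have G0: "fst (G (Q 0)) = A" "fst (snd (G (Q 0))) = B_invariant f" using P(2) Q0 by simp_all
    have "((\<lambda>\<epsilon>. \<tau> * (x + \<epsilon> * \<xi>) * (A / fst (G (Q \<epsilon>)))) has_field_derivative \<tau> * \<xi>) (at 0)"
      by (rule derivative_eq_intros G1 refl | use AB G0 in force)+
    then have u_der: "((\<lambda>\<epsilon>. u_value (\<gamma> \<epsilon>)) has_field_derivative \<tau> * \<xi>) (at 0)"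
      using DERIV_cong_ev[OF refl u_ev refl] by simp
    have "((\<lambda>\<epsilon>. (v + \<epsilon> * \<eta>) * (B_invariant f / fst (snd (G (Q \<epsilon>))))) has_field_derivative \<eta>) (at 0)"
      by (rule derivative_eq_intros G2 refl | use AB G0 in force)+
    then have v_der: "((\<lambda>\<epsilon>. v_value (\<gamma> \<epsilon>)) has_field_derivative \<eta>) (at 0)"
      using DERIV_cong_ev[OF refl v_ev refl] by simp
    have z_der: "((\<lambda>\<epsilon>. fst (\<gamma> \<epsilon>) i) has_field_derivative \<tau> * \<xi> / fst f i) (at 0)" if "i \<in> {1..s}" for i
    proof -
      have "(\<lambda>\<epsilon>. fst (\<gamma> \<epsilon>) i) = (\<lambda>\<epsilon>. \<tau> * (x + \<epsilon> * \<xi>) / fst f i)"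
        using that by (simp add: \<gamma>_def crit_point_def Q_def)
      then show ?thesis using alpha_nonzero[of i] that by (auto intro!: derivative_eq_intros)
    qed
    have w_der: "((\<lambda>\<epsilon>. snd (\<gamma> \<epsilon>) j) has_field_derivative (\<eta> - of_nat (a j) * \<tau> * \<xi>) / snd f j) (at 0)" if "j \<in> {1..r}" for j
    proof -
      have "(\<lambda>\<epsilon>. snd (\<gamma> \<epsilon>) j) = (\<lambda>\<epsilon>. (v + \<epsilon> * \<eta> - of_nat (a j) * \<tau> * (x + \<epsilon> * \<xi>)) / snd f j)"
        using that by (simp add: \<gamma>_def crit_point_def Q_def ell_def)
      then show ?thesis using beta_nonzero[of j] that by (auto intro!: derivative_eq_intros)
    qed
    have p0: "\<gamma> 0 \<in> Crit s r a (fst f, snd f)"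
      using crit_point_correct(1)[OF f P \<tau>] by (simp add: \<gamma>_def Q0)
    have null: "((\<lambda>\<epsilon>. log_deriv (LG_poly s r a (fst f, snd f)) d (\<gamma> \<epsilon>)) has_field_derivative 0) (at 0)" if d: "d \<in> indices" for d
    proof -
      consider i where "d = Inl i" "i \<in> {1..s}" | j where "d = Inr j" "j \<in> {1..r}"
        using d unfolding Plus_def by blast
      then show ?thesis
      proof cases
        case 1
        have ev: "\<forall>\<^sub>F \<epsilon> in nhds 0. log_deriv (LG_poly s r a (fst f, snd f)) d (\<gamma> \<epsilon>) = fst f i * fst (\<gamma> \<epsilon>) i - u_value (\<gamma> \<epsilon>)"
          using torus by eventually_elim (use 1 log_deriv_z in simp)
        have der: "((\<lambda>\<epsilon>. fst f i * fst (\<gamma> \<epsilon>) i - u_value (\<gamma> \<epsilon>)) has_field_derivative 0) (at 0)"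
          using DERIV_diff[OF DERIV_cmult[OF z_der[OF 1(2)], of "fst f i"] u_der] alpha_nonzero[of i] 1 by simp
        show ?thesis using DERIV_cong_ev[OF refl ev refl] der by (rule iffD2)
      next
        case 2
        have ev: "\<forall>\<^sub>F \<epsilon> in nhds 0. log_deriv (LG_poly s r a (fst f, snd f)) d (\<gamma> \<epsilon>) =
            snd f j * snd (\<gamma> \<epsilon>) j + of_nat (a j) * u_value (\<gamma> \<epsilon>) - v_value (\<gamma> \<epsilon>)"
          using torus by eventually_elim (use 2 log_deriv_w in simp)
        have der: "((\<lambda>\<epsilon>. snd f j * snd (\<gamma> \<epsilon>) j + of_nat (a j) * u_value (\<gamma> \<epsilon>) - v_value (\<gamma> \<epsilon>)) has_field_derivative 0) (at 0)"
          using DERIV_diff[OF DERIV_add[OF DERIV_cmult[OF w_der[OF 2(2)], of "snd f j"] DERIV_cmult[OF u_der, of "of_nat (a j)"]] v_der]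
            beta_nonzero[of j] 2 by simp
        show ?thesis using DERIV_cong_ev[OF refl ev refl] der by (rule iffD2)
      qed
    qed
    have red': "crit_reduced s r a (fst f, snd f)" using red by simp
    have zd: "(\<lambda>\<epsilon>. fst (\<gamma> \<epsilon>) i) field_differentiable at 0" if "i \<in> {1..s}" for i
      using z_der[OF that] field_differentiable_def by blast
    have wd: "(\<lambda>\<epsilon>. snd (\<gamma> \<epsilon>) j) field_differentiable at 0" if "j \<in> {1..r}" for j
      using w_der[OF that] field_differentiable_def by blast
    note zero = reduced_imp_no_null_tangent[OF sum_a_le red' p0 torus zd wd null]
    have "((\<lambda>\<epsilon>. fst (\<gamma> \<epsilon>) 1) has_field_derivative 0) (at 0)"
      by (rule zero[of "\<lambda>p. fst p 1"]) (use rs in \<open>auto intro: laurent.z\<close>)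
    then have "\<tau> * \<xi> / fst f 1 = 0" using z_der[of 1] rs DERIV_unique by fastforce
    then have "\<xi> = 0" using \<tau>(1) alpha_nonzero[of 1] rs by simp
    have "((\<lambda>\<epsilon>. snd (\<gamma> \<epsilon>) 1) has_field_derivative 0) (at 0)"
      by (rule zero[of "\<lambda>p. snd p 1"]) (use rs in \<open>auto intro: laurent.w\<close>)
    then have "(\<eta> - of_nat (a 1) * \<tau> * \<xi>) / snd f 1 = 0" using w_der[of 1] rs DERIV_unique by fastforce
    then have "\<eta> = 0" using \<open>\<xi> = 0\<close> beta_nonzero[of 1] rs by simp
    with \<open>\<xi> = 0\<close> \<xi>\<eta>(1) show False by simp
  qed
qed

lemma many_fibre_points_imp_reduced:
  assumes f: "f \<in> LG_space s r" and \<tau>: "\<tau> \<noteq> 0" "A_invariant f = A * \<tau> ^ Suc s"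
    and Z: "finite Z" "card Z \<ge> Suc s * Suc r" "\<And>P. P \<in> Z \<Longrightarrow> P \<in> total \<and> G P = (A, B_invariant f, \<tau>)"
  shows "crit_reduced s r a f"
proof -
  interpret LG_member s r a "fst f" "snd f" using LG_memberI[OF f] .
  have inj: "inj_on (crit_point f) Z"
    by (rule inj_on_inverseI[where g = "fibre_point f \<tau>"]) (use Z(3) crit_point_correct(2)[OF f _ _ \<tau>] in blast)
  have "crit_reduced s r a (fst f, snd f)"
  proof (rule crit_reduced_if_many_points[OF sum_a_le, of "crit_point f ` Z"])
    show "crit_point f ` Z \<subseteq> Crit s r a (fst f, snd f)"
      using Z(3) crit_point_correct(1)[OF f _ _ \<tau>] by auto
    show "card (crit_point f ` Z) \<ge> Suc s * Suc r" using Z(2) card_image[OF inj] by simp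
  qed (use Z(1) in auto)
  then show ?thesis by simp
qed

end

section \<open>Smooth lifts and the fibres at the degenerate parameter\<close>

text \<open>An algebra of functions along a curve that is closed under differentiation if \<open>P\<close> lifts a smooth curve
through \<open>G\<close>; this yields all higher derivatives at once.\<close>

inductive_set curve_functions :: "(real \<Rightarrow> point3) \<Rightarrow> (real \<Rightarrow> complex) set" for P where
  const: "(\<lambda>t. c) \<in> curve_functions P"
| x: "(\<lambda>t. fst (P t)) \<in> curve_functions P"
| v: "(\<lambda>t. fst (snd (P t))) \<in> curve_functions P"
| tau: "(\<lambda>t. snd (snd (P t))) \<in> curve_functions P"
| add: "f \<in> curve_functions P \<Longrightarrow> g \<in> curve_functions P \<Longrightarrow> (\<lambda>t. f t + g t) \<in> curve_functions P"
| mult: "f \<in> curve_functions P \<Longrightarrow> g \<in> curve_functions P \<Longrightarrow> (\<lambda>t. f t * g t) \<in> curve_functions P"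
| inverse: "f \<in> curve_functions P \<Longrightarrow> (\<And>t. t \<le> 0 \<Longrightarrow> f t \<noteq> 0) \<Longrightarrow> (\<lambda>t. inverse (f t)) \<in> curve_functions P"

lemma curve_functions_diff:
  "f \<in> curve_functions P \<Longrightarrow> g \<in> curve_functions P \<Longrightarrow> (\<lambda>t. f t - g t) \<in> curve_functions P"
  using curve_functions.add[OF _ curve_functions.mult[OF curve_functions.const[of "-1"]]] by force

lemma curve_functions_sum:
  "finite J \<Longrightarrow> (\<And>j. j \<in> J \<Longrightarrow> f j \<in> curve_functions P) \<Longrightarrow> (\<lambda>t. \<Sum>j\<in>J. f j t) \<in> curve_functions P"
  by (induction J rule: finite_induct) (auto intro: curve_functions.const curve_functions.add)

lemma smooth_on_nonposI:
  assumes "f \<in> F" and closed: "\<And>f. f \<in> F \<Longrightarrow> \<exists>f'\<in>F. \<forall>t\<le>0. (f has_vector_derivative f' t) (at t within {..0})"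
  shows "smooth_on_nonpos f"
proof -
  define der where "der f = (SOME f'. f' \<in> F \<and> (\<forall>t\<le>0. (f has_vector_derivative f' t) (at t within {..0})))" for f :: "real \<Rightarrow> complex"
  have der: "der f \<in> F \<and> (\<forall>t\<le>0. (f has_vector_derivative der f t) (at t within {..0}))" if "f \<in> F" for f
  proof -
    have "\<exists>f'. f' \<in> F \<and> (\<forall>t\<le>0. (f has_vector_derivative f' t) (at t within {..0}))"
      using closed[OF that] by blast
    from someI_ex[OF this] show ?thesis unfolding der_def .
  qed
  have iter: "(der ^^ n) f \<in> F" for n using assms(1) der by (induction n) auto
  show ?thesis unfolding smooth_on_nonpos_def
    by (rule exI[of _ "\<lambda>n. (der ^^ n) f"]) (use der iter in auto)
qed

context LG_data
begin

text \<open>Locally \<open>P\<close> is the composition of the curve \<open>G (P t)\<close> with a differentiable inverse of \<open>G\<close>.\<close>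

lemma lift_has_vector_derivative:
  fixes P :: "real \<Rightarrow> point3"
  assumes cont: "continuous_on {..0} P" and P: "\<And>t. t \<le> 0 \<Longrightarrow> P t \<in> total \<and> jac (P t) \<noteq> 0"
    and der: "((\<lambda>t. G (P t)) has_vector_derivative q) (at t within {..0})" and t: "t \<le> 0"
  shows "\<exists>P'. (P has_vector_derivative P') (at t within {..0}) \<and> G_deriv (P t) P' = q"
proof -
  let ?p = "P t"
  have p: "?p \<in> total" "jac ?p \<noteq> 0" using P t by auto
  obtain g' where g': "bounded_linear g'" "g' \<circ> G_deriv ?p = id" using G_deriv_left_inverse[OF p] by blast
  have "G_deriv ?p \<circ> g' = id"
    using linear_inverse_left[of g' "G_deriv ?p"] g' G_has_derivative[OF p(1)]
    by (metis bounded_linear.linear has_derivative_linear)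
  then have "(G_deriv ?p \<circ> g') q = id q" by (rule fun_cong)
  then have right: "G_deriv ?p (g' q) = q" by (simp only: o_apply id_apply)
  obtain \<rho> where \<rho>: "\<rho> > 0" "ball ?p \<rho> \<subseteq> total" "inj_on G (ball ?p \<rho>)" using G_locally_injective[OF p] by blast
  obtain g where g: "homeomorphism (ball ?p \<rho>) (G ` ball ?p \<rho>) G g"
    using invariance_of_domain_homeomorphism[of "ball ?p \<rho>" G] \<rho> continuous_on_subset[OF continuous_G \<rho>(2)] by blast
  have opn: "open (G ` ball ?p \<rho>)"
    using \<rho> by (intro invariance_of_domain continuous_on_subset[OF continuous_G]) auto
  have Gp: "G ?p \<in> G ` ball ?p \<rho>" and gGp: "g (G ?p) = ?p"
    using \<rho>(1) g by (auto simp: homeomorphism_def)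
  have "(g has_derivative g') (at (G ?p))"
  proof (rule has_derivative_inverse_basic[of G "G_deriv ?p"])
    show "(G has_derivative G_deriv ?p) (at (g (G ?p)))" using G_has_derivative[OF p(1)] gGp by simp
    have "continuous_on (G ` ball ?p \<rho>) g" using g by (simp add: homeomorphism_def)
    then show "continuous (at (G ?p)) g" using continuous_on_eq_continuous_at[OF opn] Gp by blast
    show "G (g z) = z" if "z \<in> G ` ball ?p \<rho>" for z using g that by (auto simp: homeomorphism_def)
  qed (use g' opn Gp in auto)
  from vector_derivative_diff_chain_within[OF der has_derivative_at_withinI[OF this]]
  have d: "((g \<circ> (\<lambda>t. G (P t))) has_vector_derivative g' q) (at t within {..0})" by simp
  have "\<exists>d>0. \<forall>u\<in>{..0}. dist u t < d \<longrightarrow> dist (P u) ?p < \<rho>"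
    using cont t \<rho>(1) unfolding continuous_on_iff by auto
  then obtain d0 where d0: "d0 > 0" "\<And>u. u \<le> 0 \<Longrightarrow> dist u t < d0 \<Longrightarrow> dist (P u) ?p < \<rho>" by auto
  have "(P has_vector_derivative g' q) (at t within {..0})"
  proof (rule has_vector_derivative_transform_within[OF d \<open>d0 > 0\<close>])
    fix u assume "u \<in> {..0}" "dist u t < d0"
    then have "P u \<in> ball ?p \<rho>" using d0(2)[of u] by (simp add: dist_commute)
    then show "(g \<circ> (\<lambda>t. G (P t))) u = P u" using g by (simp add: homeomorphism_def)
  qed (use t in auto)
  then show ?thesis using right by blast
qed

text \<open>Differentiating \<open>G (P t) = (1, 1, exp (t / (s + 1)))\<close> gives a linear system for the derivatives of
\<open>x\<close> and \<open>v\<close> with determinant \<open>jac\<close>. By Cramer's rule these derivatives belong to \<open>curve_functions P\<close>.\<close>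

theorem smooth_lift:
  fixes P :: "real \<Rightarrow> point3"
  assumes cont: "continuous_on {..0} P" and P: "\<And>t. t \<le> 0 \<Longrightarrow> P t \<in> total \<and> jac (P t) \<noteq> 0"
    and G1: "\<And>t. t \<le> 0 \<Longrightarrow> fst (G (P t)) = 1" "\<And>t. t \<le> 0 \<Longrightarrow> fst (snd (G (P t))) = 1"
    and T: "\<And>t. t \<le> 0 \<Longrightarrow> snd (snd (P t)) = of_real (exp (t / of_nat (Suc s)))"
    and f: "f \<in> curve_functions P"
  shows "smooth_on_nonpos f"
  using f
proof (rule smooth_on_nonposI)
  define c where "c = complex_of_real (1 / of_nat (Suc s))"
  define X where "X t = fst (P t)" for t
  define V where "V t = fst (snd (P t))" for t
  define \<tau> where "\<tau> t = snd (snd (P t))" for t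
  define S where "S n t = pole_sum n (P t)" for n t
  define m11 where "m11 t = of_nat (Suc s) * inverse (X t) + \<tau> t * S 2 t" for t
  define m22 where "m22 t = inverse (V t) + S 0 t" for t
  define J where "J t = m11 t * m22 t - \<tau> t * (S 1 t * S 1 t)" for t
  have mem: "X \<in> curve_functions P" "V \<in> curve_functions P" "\<tau> \<in> curve_functions P"
    unfolding X_def V_def \<tau>_def by (rule curve_functions.intros)+
  have ell: "(\<lambda>t. inverse (ell j (P t))) \<in> curve_functions P" if "j \<in> {1..r}" for j
  proof (rule curve_functions.inverse)
    have "(\<lambda>t. V t - of_nat (a j) * \<tau> t * X t) \<in> curve_functions P"
      by (intro curve_functions_diff curve_functions.mult curve_functions.const mem)
    then show "(\<lambda>t. ell j (P t)) \<in> curve_functions P" by (simp add: ell_def split_beta X_def V_def \<tau>_def)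
  qed (use P totalD(3) that in blast)
  have Smem: "S n \<in> curve_functions P" for n
    unfolding S_def[abs_def] pole_sum_def divide_inverse
    by (intro curve_functions_sum curve_functions.mult curve_functions.const ell) auto
  have Xinv: "(\<lambda>t. inverse (X t)) \<in> curve_functions P" and Vinv: "(\<lambda>t. inverse (V t)) \<in> curve_functions P"
  proof -
    have "X t \<noteq> 0 \<and> V t \<noteq> 0" if "t \<le> 0" for t
      using totalD(1,2)[OF conjunct1[OF P[OF that]]] by (simp add: X_def V_def)
    then show "(\<lambda>t. inverse (X t)) \<in> curve_functions P" "(\<lambda>t. inverse (V t)) \<in> curve_functions P"
      by (auto intro!: curve_functions.inverse mem)
  qed
  have m: "m11 \<in> curve_functions P" "m22 \<in> curve_functions P"
    unfolding m11_def m22_def by (intro curve_functions.intros mem Smem Xinv Vinv)+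
  have Jmem: "J \<in> curve_functions P"
    unfolding J_def by (intro curve_functions_diff curve_functions.mult mem m Smem)
  have J_jac: "J t = jac (P t)" for t
    by (simp add: J_def jac_def m11_def m22_def S_def X_def V_def \<tau>_def divide_inverse power2_eq_square)
  have Jinv: "(\<lambda>t. inverse (J t)) \<in> curve_functions P"
    by (rule curve_functions.inverse[OF Jmem]) (simp add: J_jac P)
  \<comment> \<open>The derivatives of x and v according to Cramer's rule.\<close>
  define X' where "X' t = inverse (J t) * ((S 1 t * (X t * S 1 t) - m22 t * (X t * S 2 t)) * (c * \<tau> t))" for t
  define V' where "V' t = inverse (J t) * ((m11 t * (X t * S 1 t) - \<tau> t * S 1 t * (X t * S 2 t)) * (c * \<tau> t))" for t
  have X'mem: "X' \<in> curve_functions P" and V'mem: "V' \<in> curve_functions P"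
    unfolding X'_def V'_def
    by (intro curve_functions.mult curve_functions_diff curve_functions.const Jinv mem m Smem)+
  have der: "(X has_vector_derivative X' t) (at t within {..0}) \<and> (V has_vector_derivative V' t) (at t within {..0})
      \<and> (\<tau> has_vector_derivative c * \<tau> t) (at t within {..0})" if t: "t \<le> 0" for t
  proof -
    have "((\<lambda>t. (1, 1, complex_of_real (exp (t / of_nat (Suc s))))) has_vector_derivative (0, 0, c * \<tau> t)) (at t within {..0})"
    proof -
      have "((\<lambda>t. exp (t / of_nat (Suc s))) has_real_derivative exp (t / of_nat (Suc s)) * (1 / of_nat (Suc s))) (at t within {..0})"
        by (auto intro!: derivative_eq_intros)
      from has_vector_derivative_of_real[OF this]
      have "((\<lambda>t. complex_of_real (exp (t / of_nat (Suc s)))) has_vector_derivative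
          complex_of_real (exp (t / of_nat (Suc s)) * (1 / of_nat (Suc s)))) (at t within {..0})" .
      moreover have "complex_of_real (exp (t / of_nat (Suc s)) * (1 / of_nat (Suc s))) = c * \<tau> t"
        unfolding \<tau>_def T[OF t] c_def of_real_mult by (rule mult.commute)
      ultimately have "((\<lambda>t. complex_of_real (exp (t / of_nat (Suc s)))) has_vector_derivative c * \<tau> t) (at t within {..0})"
        by simp
      then show ?thesis by (intro has_vector_derivative_Pair has_vector_derivative_const)
    qed
    moreover have "G (P u) = (1, 1, complex_of_real (exp (u / of_nat (Suc s))))" if "u \<in> {..0}" for u
      using G1 T that by (auto simp: prod_eq_iff) (simp add: G_def)
    ultimately have "((\<lambda>t. G (P t)) has_vector_derivative (0, 0, c * \<tau> t)) (at t within {..0})"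
      using t by (intro has_vector_derivative_transform[of t "{..0}" "\<lambda>t. G (P t)"]) auto
    from lift_has_vector_derivative[OF cont P this t] obtain P' where
      P': "(P has_vector_derivative P') (at t within {..0})" "G_deriv (P t) P' = (0, 0, c * \<tau> t)" by blast
    obtain x' v' t' where P'_eq: "P' = (x', v', t')" by (cases P')
    have t': "t' = c * \<tau> t" and dx: "deriv_x (P t) P' = 0" and dv: "deriv_v (P t) P' = 0"
      using P'(2) G1[OF t] by (auto simp: G_deriv_def P'_eq)
    have dx': "m11 t * x' - S 1 t * v' + X t * S 2 t * (c * \<tau> t) = 0"
      using dx by (simp add: deriv_x_def P'_eq t' m11_def S_def X_def \<tau>_def divide_inverse)
    have dv': "- \<tau> t * S 1 t * x' + m22 t * v' - X t * S 1 t * (c * \<tau> t) = 0"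
      using dv by (simp add: deriv_v_def P'_eq t' m22_def S_def X_def V_def \<tau>_def divide_inverse)
    have J0: "J t \<noteq> 0" using P t by (simp add: J_jac)
    have "J t * x' = (S 1 t * (X t * S 1 t) - m22 t * (X t * S 2 t)) * (c * \<tau> t)"
    proof -
      have "J t * x' - (S 1 t * (X t * S 1 t) - m22 t * (X t * S 2 t)) * (c * \<tau> t) =
         m22 t * (m11 t * x' - S 1 t * v' + X t * S 2 t * (c * \<tau> t))
         + S 1 t * (- \<tau> t * S 1 t * x' + m22 t * v' - X t * S 1 t * (c * \<tau> t))"
        by (simp add: J_def algebra_simps)
      then show ?thesis unfolding dx' dv' by simp
    qed
    then have x'_eq: "x' = X' t" using J0 by (simp add: X'_def field_simps)
    have "J t * v' = (m11 t * (X t * S 1 t) - \<tau> t * S 1 t * (X t * S 2 t)) * (c * \<tau> t)"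
    proof -
      have "J t * v' - (m11 t * (X t * S 1 t) - \<tau> t * S 1 t * (X t * S 2 t)) * (c * \<tau> t) =
         \<tau> t * S 1 t * (m11 t * x' - S 1 t * v' + X t * S 2 t * (c * \<tau> t))
         + m11 t * (- \<tau> t * S 1 t * x' + m22 t * v' - X t * S 1 t * (c * \<tau> t))"
        by (simp add: J_def algebra_simps)
      then show ?thesis unfolding dx' dv' by simp
    qed
    then have v'_eq: "v' = V' t" using J0 by (simp add: V'_def field_simps)
    have comps: "((\<lambda>t. fst (P t)) has_vector_derivative x') (at t within {..0})"
      "((\<lambda>t. fst (snd (P t))) has_vector_derivative v') (at t within {..0})"
      "((\<lambda>t. snd (snd (P t))) has_vector_derivative t') (at t within {..0})"
    proof -
      have d: "(P has_derivative (\<lambda>h. (h *\<^sub>R x', h *\<^sub>R v', h *\<^sub>R t'))) (at t within {..0})"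
        using P'(1) by (simp add: has_vector_derivative_def P'_eq)
      show "((\<lambda>t. fst (P t)) has_vector_derivative x') (at t within {..0})"
        "((\<lambda>t. fst (snd (P t))) has_vector_derivative v') (at t within {..0})"
        "((\<lambda>t. snd (snd (P t))) has_vector_derivative t') (at t within {..0})"
        using has_derivative_fst[OF d] has_derivative_fst[OF has_derivative_snd[OF d]]
          has_derivative_snd[OF has_derivative_snd[OF d]] by (simp_all add: has_vector_derivative_def)
    qed
    then show ?thesis unfolding x'_eq v'_eq t' X_def V_def \<tau>_def by blast
  qed
  fix f assume "f \<in> curve_functions P"
  then show "\<exists>f'\<in>curve_functions P. \<forall>t\<le>0. (f has_vector_derivative f' t) (at t within {..0})"
  proof (induction rule: curve_functions.induct)
    case (const c)
    then show ?case by (intro bexI[of _ "\<lambda>t. 0"]) (auto intro: curve_functions.const)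
  next
    case x
    then show ?case using der by (intro bexI[OF _ X'mem]) (auto simp: X_def[abs_def])
  next
    case v
    then show ?case using der by (intro bexI[OF _ V'mem]) (auto simp: V_def[abs_def])
  next
    case tau
    have "(\<lambda>t. c * \<tau> t) \<in> curve_functions P" by (intro curve_functions.intros mem)
    then show ?case using der by (intro bexI[of _ "\<lambda>t. c * \<tau> t"]) (auto simp: \<tau>_def[abs_def])
  next
    case (add f g)
    then obtain f' g' where "f' \<in> curve_functions P" "\<forall>t\<le>0. (f has_vector_derivative f' t) (at t within {..0})"
      "g' \<in> curve_functions P" "\<forall>t\<le>0. (g has_vector_derivative g' t) (at t within {..0})" by blast
    then show ?case by (intro bexI[of _ "\<lambda>t. f' t + g' t"]) (auto intro: curve_functions.add has_vector_derivative_add)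
  next
    case (mult f g)
    then obtain f' g' where "f' \<in> curve_functions P" "\<forall>t\<le>0. (f has_vector_derivative f' t) (at t within {..0})"
      "g' \<in> curve_functions P" "\<forall>t\<le>0. (g has_vector_derivative g' t) (at t within {..0})" by blast
    then show ?case using mult.hyps
      by (intro bexI[of _ "\<lambda>t. f t * g' t + f' t * g t"])
         (auto intro: curve_functions.add curve_functions.mult has_vector_derivative_mult)
  next
    case (inverse f)
    then obtain f' where f': "f' \<in> curve_functions P" "\<forall>t\<le>0. (f has_vector_derivative f' t) (at t within {..0})" by blast
    have "(\<lambda>t. - 1 * (inverse (f t) * f' t * inverse (f t))) \<in> curve_functions P"
      using inverse f' by (intro curve_functions.intros) auto
    moreover have "((\<lambda>t. inverse (f t)) has_vector_derivative - 1 * (inverse (f t) * f' t * inverse (f t))) (at t within {..0})" if "t \<le> 0" for t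
    proof -
      have "(f has_derivative (\<lambda>h. h *\<^sub>R f' t)) (at t within {..0})" using f'(2) that by (simp add: has_vector_derivative_def)
      from Deriv.has_derivative_inverse[OF inverse(2)[OF that] this] show ?thesis
        by (simp add: has_vector_derivative_def)
    qed
    ultimately show ?case
      by (intro bexI[of _ "\<lambda>t. - 1 * (inverse (f t) * f' t * inverse (f t))"] allI impI)
  qed
qed

lemma ell_zero [simp]: "ell j (x, v, 0) = v"
  by (simp add: ell_def)

lemma zero_fibre_iff: "(x, v, 0) \<in> total \<longleftrightarrow> x \<noteq> 0 \<and> v \<noteq> 0"
  by (auto simp: total_def)

lemma G_zero: "G (x, v, 0) = (x ^ Suc s / v ^ (\<Sum>j=1..r. a j), v ^ Suc r, 0)"
  by (simp add: G_def power_sum)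

lemma jac_zero: "x \<noteq> 0 \<Longrightarrow> v \<noteq> 0 \<Longrightarrow> jac (x, v, 0) \<noteq> 0"
proof -
  assume nz: "x \<noteq> 0" "v \<noteq> 0"
  have "jac (x, v, 0) = of_nat (Suc s) / x * (of_nat (Suc r) / v)"
    by (simp add: jac_def pole_sum_def add_divide_distrib)
  also have "\<dots> \<noteq> 0" using nz of_nat_neq_0[of s, where 'a = complex] of_nat_neq_0[of r, where 'a = complex]
    by (simp del: of_nat_Suc)
  finally show ?thesis .
qed

lemma zero_fibre_card:
  assumes "A \<noteq> 0" "B \<noteq> 0"
  shows "\<exists>Z. finite Z \<and> card Z = Suc s * Suc r \<and> (\<forall>P\<in>Z. P \<in> total \<and> G P = (A, B, 0))"
proof -
  define S where "S = (SIGMA v:{v. v ^ Suc r = B}. {x. x ^ Suc s = A * v ^ (\<Sum>j=1..r. a j)})"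
  have nz: "v \<noteq> 0" if "v ^ Suc r = B" for v using that assms by auto
  have cv: "card {v. v ^ Suc r = B} = Suc r" and fv: "finite {v. v ^ Suc r = B}"
    using card_nth_roots[OF assms(2), of "Suc r"] finite_nth_roots[of "Suc r" B] by auto
  have cx: "card {x. x ^ Suc s = A * v ^ (\<Sum>j=1..r. a j)} = Suc s" "finite {x. x ^ Suc s = A * v ^ (\<Sum>j=1..r. a j)}"
    if "v ^ Suc r = B" for v
    using card_nth_roots[of "A * v ^ (\<Sum>j=1..r. a j)" "Suc s"] finite_nth_roots[of "Suc s"] nz[OF that] assms(1) by auto
  have "card S = (\<Sum>v\<in>{v. v ^ Suc r = B}. Suc s)"
    unfolding S_def using fv cx by (subst card_SigmaI) auto
  then have cS: "card S = Suc s * Suc r" using cv by simp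
  have fS: "finite S" unfolding S_def using fv cx by (intro finite_SigmaI) auto
  let ?g = "\<lambda>(v, x). (x, v, 0 :: complex)"
  have "inj_on ?g S" by (auto simp: inj_on_def)
  then have "card (?g ` S) = Suc s * Suc r" using cS by (simp add: card_image)
  moreover have "P \<in> total \<and> G P = (A, B, 0)" if "P \<in> ?g ` S" for P
  proof -
    obtain v x where vx: "P = (x, v, 0)" "v ^ Suc r = B" "x ^ Suc s = A * v ^ (\<Sum>j=1..r. a j)"
      using \<open>P \<in> ?g ` S\<close> by (auto simp: S_def)
    have "v \<noteq> 0" using nz vx by blast
    moreover have "x \<noteq> 0" using vx(3) assms(1) \<open>v \<noteq> 0\<close> by auto
    ultimately show ?thesis unfolding vx(1) zero_fibre_iff G_zero vx(2,3) by simp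
  qed
  ultimately show ?thesis using fS by blast
qed

lemma zero_regular:
  assumes "A \<noteq> 0" "B \<noteq> 0" shows "(A, B, 0) \<in> regular_values"
proof -
  obtain Z where Z: "card Z = Suc s * Suc r" "\<forall>P\<in>Z. P \<in> total \<and> G P = (A, B, 0)"
    using zero_fibre_card[OF assms] by blast
  have "Z \<noteq> {}" using Z(1) by auto
  then have "(A, B, 0) \<in> G ` total" using Z(2) by (metis ex_in_conv image_eqI)
  moreover have "(A, B, 0) \<in> nondegenerate"
    unfolding nondegenerate_def
  proof (intro CollectI conjI ballI impI)
    show "(A, B, 0) \<in> base" using assms by (simp add: base_def)
    fix P assume P: "P \<in> total" "G P = (A, B, 0)"
    then obtain x v where "P = (x, v, 0)" by (cases P) (auto simp: G_def)
    then show "jac P \<noteq> 0" using jac_zero P by (auto simp: zero_fibre_iff)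
  qed
  ultimately show ?thesis by (simp add: regular_values_def)
qed

text \<open>All points with \<open>\<tau> = 0\<close> are regular, and the torus of phases \<open>(A, B)\<close> is compact.\<close>

lemma small_tau_regular:
  "\<exists>\<tau>\<^sub>0>0. \<forall>A B \<tau>. norm A = 1 \<longrightarrow> norm B = 1 \<longrightarrow> norm \<tau> \<le> \<tau>\<^sub>0 \<longrightarrow> (A, B, \<tau>) \<in> regular_values"
proof -
  let ?K = "sphere 0 1 \<times> sphere 0 1 \<times> {0} :: point3 set"
  have "compact ?K" by (intro compact_Times compact_sphere) auto
  moreover have "?K \<subseteq> regular_values" by (auto intro!: zero_regular)
  ultimately obtain e where e: "e > 0" "(\<Union>q\<in>?K. ball q e) \<subseteq> regular_values"
    using compact_subset_open_imp_ball_epsilon_subset[OF _ open_regular_values] by blast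
  have "(A, B, \<tau>) \<in> regular_values" if "norm A = 1" "norm B = 1" "norm \<tau> \<le> e / 2" for A B \<tau>
  proof -
    have "dist (A, B, 0) (A, B, \<tau>) < e" using that e(1) by (simp add: dist_Pair_Pair)
    then show ?thesis using e(2) that by force
  qed
  then show ?thesis using e(1) by (intro exI[of _ "e / 2"]) auto
qed

lemma lift_path_unique:
  assumes "path g" "path_image g \<subseteq> regular_values"
    and "path h" "path_image h \<subseteq> covering_total" "\<And>t. t \<in> {0..1} \<Longrightarrow> G (h t) = g t"
    and "path h'" "path_image h' \<subseteq> covering_total" "\<And>t. t \<in> {0..1} \<Longrightarrow> G (h' t) = g t"
    and "t0 \<in> {0..1}" "h t0 = h' t0" "t \<in> {0..1}"
  shows "h t = h' t"
  by (rule covering_space_lift_unique[OF covering, of h t0 h' "{0..1}" g])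
     (use assms in \<open>auto simp: path_def path_image_def\<close>)

text \<open>The cardinality of the fibre at \<open>\<tau> = 0\<close> is transported along the segment by lifting it.\<close>

lemma fibre_card_near_zero:
  assumes "A \<noteq> 0" "B \<noteq> 0" and seg: "\<And>\<theta>. \<theta> \<in> {0..1} \<Longrightarrow> (A, B, of_real \<theta> * \<tau>) \<in> regular_values"
  shows "\<exists>Z. finite Z \<and> card Z = Suc s * Suc r \<and> (\<forall>P\<in>Z. P \<in> total \<and> G P = (A, B, \<tau>))"
proof -
  obtain Z where Z: "finite Z" "card Z = Suc s * Suc r" "\<forall>P\<in>Z. P \<in> total \<and> G P = (A, B, 0)"
    using zero_fibre_card[OF assms(1,2)] by blast
  define g where "g \<theta> = (A, B, of_real \<theta> * \<tau>)" for \<theta> :: real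
  have g: "path g" "path_image g \<subseteq> regular_values"
    using seg by (auto simp: g_def path_def path_image_def intro!: continuous_intros)
  have "\<forall>P. \<exists>h. P \<in> Z \<longrightarrow> path h \<and> path_image h \<subseteq> covering_total \<and> pathstart h = P \<and> (\<forall>t\<in>{0..1}. G (h t) = g t)"
  proof (intro allI)
    fix P
    show "\<exists>h. P \<in> Z \<longrightarrow> path h \<and> path_image h \<subseteq> covering_total \<and> pathstart h = P \<and> (\<forall>t\<in>{0..1}. G (h t) = g t)"
    proof (cases "P \<in> Z")
      case True
      then have "P \<in> covering_total" "pathstart g = G P"
        using Z(3) zero_regular[OF assms(1,2)] by (auto simp: covering_total_def g_def pathstart_def)
      from covering_space_lift_path_strong[OF covering this(1) g this(2)] show ?thesis by metis
    qed auto
  qed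
  from choice[OF this] obtain h where h: "\<forall>P. P \<in> Z \<longrightarrow> path (h P) \<and> path_image (h P) \<subseteq> covering_total
      \<and> pathstart (h P) = P \<and> (\<forall>t\<in>{0..1}. G (h P t) = g t)" ..
  have inj: "inj_on (\<lambda>P. h P 1) Z"
  proof (rule inj_onI)
    fix P Q assume P: "P \<in> Z" and Q: "Q \<in> Z" and eq: "h P 1 = h Q 1"
    have "h P 0 = h Q 0"
      by (rule lift_path_unique[OF g, of "h P" "h Q" 1]) (use h[rule_format, OF P] h[rule_format, OF Q] eq in auto)
    then show "P = Q" using h[rule_format, OF P] h[rule_format, OF Q] by (simp add: pathstart_def)
  qed
  have "h P 1 \<in> total \<and> G (h P 1) = (A, B, \<tau>)" if "P \<in> Z" for P
    using h[rule_format, OF that] by (auto simp: path_image_def covering_total_def g_def)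
  then show ?thesis using Z card_image[OF inj]
    by (intro exI[of _ "(\<lambda>P. h P 1) ` Z"]) auto
qed

end

section \<open>Labels as points of the degenerate fibre\<close>

context LG_data
begin

lemma LG_alpha0_in_LG_space: "b \<noteq> 0 \<Longrightarrow> LG_alpha0 s r b \<in> LG_space s r"
  by (auto simp: LG_alpha0_def LG_space_def)

lemma A_invariant_LG_alpha0: "A_invariant (LG_alpha0 s r b) = b"
proof -
  have "(\<Prod>i=0..s. fst (LG_alpha0 s r b) i) = (\<Prod>i=0..s. if i = 0 then b else 1)"
    by (intro prod.cong) (auto simp: LG_alpha0_def)
  moreover have "(\<Prod>j=1..r. snd (LG_alpha0 s r b) j ^ a j) = 1"
    by (intro prod.neutral) (auto simp: LG_alpha0_def)
  ultimately show ?thesis by (simp add: A_invariant_def)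
qed

lemma B_invariant_LG_alpha0: "B_invariant (LG_alpha0 s r b) = 1"
  unfolding B_invariant_def by (intro prod.neutral) (auto simp: LG_alpha0_def)

text \<open>The coordinate \<open>\<tau>\<close> of \<open>LG_f s r t\<close> is \<open>rt (exp t)\<close>, the positive root of \<open>\<tau>^(s+1) = exp t\<close>.\<close>

definition rt :: "real \<Rightarrow> complex" where
  "rt \<epsilon> = complex_of_real (root (Suc s) \<epsilon>)"

lemma rt_power: "\<epsilon> \<ge> 0 \<Longrightarrow> rt \<epsilon> ^ Suc s = of_real \<epsilon>"
  unfolding rt_def of_real_power[symmetric] by (simp only: real_root_pow_pos2 zero_less_Suc)

lemma rt_simps [simp]: "rt 0 = 0" "rt 1 = 1" "rt \<epsilon> = 0 \<longleftrightarrow> \<epsilon> = 0"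
  by (simp_all add: rt_def)

lemma continuous_rt [continuous_intros]: "continuous_on A f \<Longrightarrow> continuous_on A (\<lambda>x. rt (f x))"
  unfolding rt_def by (intro continuous_intros)

definition base_path :: "real \<Rightarrow> point3" where
  "base_path \<theta> = (1, 1, rt \<theta>)"

text \<open>For integers \<open>\<kappa>\<close> and \<open>\<nu>\<close> this is the point of the fibre over \<open>(1, 1, 0)\<close> with the phases prescribed
for the label \<open>(\<kappa>, \<nu>)\<close>. Real arguments describe the lift of paths on which \<open>A\<close> and \<open>B\<close> rotate.\<close>

definition label_point :: "real \<Rightarrow> real \<Rightarrow> point3" where
  "label_point \<kappa> \<nu> =
     (cis (2 * pi * (\<nu> * (\<Sum>j=1..r. real (a j)) / ((real s + 1) * (real r + 1)) + \<kappa> / (real s + 1))),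
      cis (2 * pi * \<nu> / (real r + 1)), 0)"

lemma label_point_in_total: "label_point \<kappa> \<nu> \<in> total"
  by (simp add: label_point_def zero_fibre_iff)

lemma G_label_point: "G (label_point \<kappa> \<nu>) = (cis (2 * pi * \<kappa>), cis (2 * pi * \<nu>), 0)"
proof -
  define \<sigma> where "\<sigma> = (\<Sum>j=1..r. real (a j))"
  have \<sigma>: "real (\<Sum>j=1..r. a j) = \<sigma>" by (simp add: \<sigma>_def)
  have "cis (2 * pi * (\<nu> * \<sigma> / ((real s + 1) * (real r + 1)) + \<kappa> / (real s + 1))) ^ Suc s
      = cis (2 * pi * (\<nu> * \<sigma> / (real r + 1) + \<kappa>))"
  proof -
    have "S * (2 * pi * (\<nu> * \<sigma> / (S * R) + \<kappa> / S)) = 2 * pi * (\<nu> * \<sigma> / R + \<kappa>)"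
      if "S \<noteq> 0" "R \<noteq> 0" for S R :: real
      using that by (simp add: field_simps)
    from this[of "real s + 1" "real r + 1"]
    have "(1 + real s) * (2 * pi * (\<nu> * \<sigma> / ((real s + 1) * (real r + 1)) + \<kappa> / (real s + 1)))
        = 2 * pi * (\<nu> * \<sigma> / (real r + 1) + \<kappa>)"
      unfolding add.commute[of 1 "real s"] by linarith
    then show ?thesis unfolding Complex.DeMoivre of_nat_Suc by (simp only:)
  qed
  moreover have "cis (2 * pi * \<nu> / (real r + 1)) ^ (\<Sum>j=1..r. a j) = cis (2 * pi * (\<nu> * \<sigma> / (real r + 1)))"
    unfolding Complex.DeMoivre \<sigma> by (simp add: field_simps)
  moreover have "cis (2 * pi * \<nu> / (real r + 1)) ^ Suc r = cis (2 * pi * \<nu>)"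
  proof -
    have "(1 + real r) * (2 * pi * \<nu> / (real r + 1)) = 2 * pi * \<nu>"
      using of_nat_0_le_iff[of r, where 'a = real] by (simp add: field_simps add_nonneg_eq_0_iff)
    then show ?thesis unfolding Complex.DeMoivre of_nat_Suc by (simp only:)
  qed
  ultimately show ?thesis
    unfolding label_point_def G_zero \<sigma>_def[symmetric] by (simp add: cis_divide distrib_left)
qed

lemma cis_root_inj:
  assumes "cis (2 * pi * real k / (real n + 1)) = cis (2 * pi * real k' / (real n + 1))" "k \<le> n" "k' \<le> n"
  shows "k = k'"
proof -
  have "inj_on (\<lambda>k. cis (2 * pi * real k / real (Suc n))) {..<Suc n}"
    using Complex.bij_betw_roots_unity[of "Suc n"] by (simp only: bij_betw_def zero_less_Suc simp_thms)
  then show ?thesis using assms by (auto simp: inj_on_def add.commute)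
qed

lemma label_point_inj:
  assumes "label_point (real k) (real l) = label_point (real k') (real l')"
    and "k \<le> s" "l \<le> r" "k' \<le> s" "l' \<le> r"
  shows "k = k' \<and> l = l'"
proof -
  have l: "l = l'" by (rule cis_root_inj[of l r l']) (use assms in \<open>auto simp: label_point_def\<close>)
  have "cis (2 * pi * (real l * (\<Sum>j=1..r. real (a j)) / ((real s + 1) * (real r + 1)))) * cis (2 * pi * real k / (real s + 1)) =
     cis (2 * pi * (real l * (\<Sum>j=1..r. real (a j)) / ((real s + 1) * (real r + 1)))) * cis (2 * pi * real k' / (real s + 1))"
    using assms(1) unfolding label_point_def l by (simp add: cis_mult distrib_left)
  then have "cis (2 * pi * real k / (real s + 1)) = cis (2 * pi * real k' / (real s + 1))" by simp
  then show ?thesis using cis_root_inj assms l by blast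
qed

text \<open>The points over \<open>(1, 1, 0)\<close> have coordinates of absolute value 1, so they are determined by the phases
that \<open>Theta\<close> records.\<close>

lemma unit_label_fibre:
  assumes "P \<in> total" "G P = (1, 1, 0)"
  shows "P = (sgn (fst P), sgn (fst (snd P)), 0)"
proof -
  obtain x v where P: "P = (x, v, 0)" using assms(2) by (cases P) (auto simp: G_def)
  have eq: "x ^ Suc s / v ^ (\<Sum>j=1..r. a j) = 1" "v ^ Suc r = 1" using assms(2) unfolding P G_zero by simp_all
  have "v \<noteq> 0" "x \<noteq> 0" using assms(1) by (auto simp: P zero_fibre_iff)
  have "norm v ^ Suc r = 1" using eq(2) by (metis norm_one norm_power)
  then have v: "norm v = 1" using power_eq_imp_eq_base[of "norm v" "Suc r" 1] by simp
  have "x ^ Suc s = v ^ (\<Sum>j=1..r. a j)" using eq(1) \<open>v \<noteq> 0\<close> by simp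
  then have "norm x ^ Suc s = 1" using v by (metis norm_power power_one)
  then have x: "norm x = 1" using power_eq_imp_eq_base[of "norm x" "Suc s" 1] by simp
  show ?thesis using x v by (simp add: P sgn_div_norm)
qed

lemma Theta_eq_sgn_fibre_point:
  "Theta s r a p = (sgn (fst (fibre_point (LG_f s r t) (rt (exp t)) p)), sgn (fst (snd (fibre_point (LG_f s r t) (rt (exp t)) p))))"
proof -
  have "root (Suc s) (exp t) > 0" by (intro real_root_gt_zero) auto
  then show ?thesis
    by (cases p) (simp add: Theta_def fibre_point_def LG_f_def LG_alpha0_def rt_def sgn_mult sgn_divide sgn_of_real)
qed

lemma root_exp: "root (Suc s) (exp t) = exp (t / of_nat (Suc s))"
  by (simp add: root_powr_inverse powr_def)

end

locale LG_setting = LG_data +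
  assumes r_pos: "r \<ge> 1" and s_pos: "s \<ge> 1"
    and no_discriminant: "\<And>t. t \<le> 0 \<Longrightarrow> LG_f s r t \<notin> discriminant s r a"
begin

lemma LG_f_in_LG_space: "LG_f s r t \<in> LG_space s r"
  by (simp add: LG_f_def LG_alpha0_in_LG_space)

lemma LG_f_inv: "A_invariant (LG_f s r t) = 1 * rt (exp t) ^ Suc s" "B_invariant (LG_f s r t) = 1"
  by (simp_all add: LG_f_def A_invariant_LG_alpha0 B_invariant_LG_alpha0 rt_power del: power_Suc)

text \<open>For \<open>\<theta> > 0\<close> this is the point belonging to \<open>f_t\<close> with \<open>t = ln \<theta> \<le> 0\<close>, which is not in the
discriminant.\<close>

lemma base_path_regular:
  assumes "\<theta> \<in> {0..1}" shows "base_path \<theta> \<in> regular_values"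
proof -
  have nondeg: "base_path \<theta> \<in> nondegenerate" if "\<theta> \<in> {0..1}" for \<theta>
  proof (cases "\<theta> = 0")
    case True
    then show ?thesis using zero_regular[of 1 1] by (simp add: base_path_def regular_values_def)
  next
    case False
    then have \<theta>: "\<theta> > 0" "ln \<theta> \<le> 0" using that by auto
    let ?f = "LG_f s r (ln \<theta>)"
    have "crit_reduced s r a ?f"
      using no_discriminant[OF \<theta>(2)] LG_f_in_LG_space by (auto simp: discriminant_def)
    from reduced_imp_nondegenerate[OF r_pos s_pos LG_f_in_LG_space this, of "rt \<theta>" 1]
    show ?thesis using \<theta> LG_f_inv[of "ln \<theta>"] by (simp add: base_path_def)
  qed
  have "connected (base_path ` {0..1})"
    unfolding base_path_def by (intro connected_continuous_image continuous_intros) auto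
  moreover have "base_path 0 \<in> regular_values" using zero_regular[of 1 1] by (simp add: base_path_def)
  then have "base_path ` {0..1} \<inter> regular_values \<noteq> {}" by force
  ultimately have "base_path ` {0..1} \<subseteq> regular_values"
    using nondeg by (intro connected_nondegenerate_imp_regular) auto
  then show ?thesis using assms by blast
qed

lemma path_base_path: "path base_path" "path_image base_path \<subseteq> regular_values"
  using base_path_regular by (auto simp: path_def path_image_def base_path_def[abs_def] intro!: continuous_intros)

definition lift :: "nat \<Rightarrow> nat \<Rightarrow> real \<Rightarrow> point3" where
  "lift k l = (SOME h. path h \<and> path_image h \<subseteq> covering_total \<and> pathstart h = label_point (real k) (real l)
      \<and> (\<forall>t\<in>{0..1}. G (h t) = base_path t))"

lemma cis_2pi_nat: "cis (2 * pi * real k) = 1"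
  using cis_multiple_2pi[of "real k"] by simp

lemma G_label_point_nat: "G (label_point (real k) (real l)) = base_path 0"
  by (simp add: G_label_point base_path_def cis_2pi_nat)

lemma label_point_in_covering: "label_point (real k) (real l) \<in> covering_total"
  using label_point_in_total base_path_regular[of 0] by (simp add: covering_total_def G_label_point_nat)

lemma lift:
  shows "path (lift k l)" "path_image (lift k l) \<subseteq> covering_total" "lift k l 0 = label_point (real k) (real l)"
    and "t \<in> {0..1} \<Longrightarrow> G (lift k l t) = base_path t"
proof -
  have "pathstart base_path = G (label_point (real k) (real l))" by (simp add: pathstart_def G_label_point_nat)
  from covering_space_lift_path_strong[OF covering label_point_in_covering path_base_path this]
  obtain h where h: "path h" "path_image h \<subseteq> covering_total" "pathstart h = label_point (real k) (real l)"
    "\<And>t. t \<in> {0..1} \<Longrightarrow> G (h t) = base_path t" by blast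
  then have "\<exists>h. path h \<and> path_image h \<subseteq> covering_total \<and> pathstart h = label_point (real k) (real l)
      \<and> (\<forall>t\<in>{0..1}. G (h t) = base_path t)" by (intro exI[of _ h]) auto
  from someI_ex[OF this] have "path (lift k l) \<and> path_image (lift k l) \<subseteq> covering_total
     \<and> pathstart (lift k l) = label_point (real k) (real l) \<and> (\<forall>t\<in>{0..1}. G (lift k l t) = base_path t)"
    unfolding lift_def .
  then show "path (lift k l)" "path_image (lift k l) \<subseteq> covering_total" "lift k l 0 = label_point (real k) (real l)"
    and "t \<in> {0..1} \<Longrightarrow> G (lift k l t) = base_path t" by (auto simp: pathstart_def)
qed

lemma covering_totalD:
  assumes "P \<in> covering_total" shows "P \<in> total" "jac P \<noteq> 0" "G P \<in> regular_values"
  using assms by (auto simp: covering_total_def regular_values_def nondegenerate_def)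

lemma lift_in_covering: "t \<in> {0..1} \<Longrightarrow> lift k l t \<in> covering_total"
  using lift(2)[of k l] by (auto simp: path_image_def)

text \<open>The critical point of \<open>f_X\<close> with label \<open>(k, l)\<close>, as \<open>solution_eq\<close> confirms.\<close>

definition sol :: "nat \<Rightarrow> nat \<Rightarrow> cpair" where
  "sol k l = crit_point (LG_f s r 0) (lift k l 1)"

lemma lift_crit_point:
  assumes "t \<le> 0"
  shows "crit_point (LG_f s r t) (lift k l (exp t)) \<in> Crit s r a (LG_f s r t)"
    and "fibre_point (LG_f s r t) (rt (exp t)) (crit_point (LG_f s r t) (lift k l (exp t))) = lift k l (exp t)"
proof -
  have t: "exp t \<in> {0..1}" using assms by simp
  have "G (lift k l (exp t)) = (1, B_invariant (LG_f s r t), rt (exp t))"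
    using lift(4)[OF t] LG_f_inv by (simp add: base_path_def)
  note * = crit_point_correct[OF LG_f_in_LG_space covering_totalD(1)[OF lift_in_covering[OF t]] this _ LG_f_inv(1)]
  show "crit_point (LG_f s r t) (lift k l (exp t)) \<in> Crit s r a (LG_f s r t)"
    "fibre_point (LG_f s r t) (rt (exp t)) (crit_point (LG_f s r t) (lift k l (exp t))) = lift k l (exp t)"
    using * by simp_all
qed

lemma filterlim_exp_at_0: "filterlim exp (at 0 within {0..1::real}) at_bot"
  unfolding filterlim_at
proof
  show "\<forall>\<^sub>F t in at_bot. exp t \<in> {0..1} \<and> exp t \<noteq> (0::real)"
    using eventually_le_at_bot[of "0 :: real"] by eventually_elim simp
qed (rule exp_at_bot)

text \<open>Parametrizing the lift by \<open>\<theta> = exp t\<close> gives the required curve of critical points; its limit for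
\<open>t \<rightarrow> -\<infinity>\<close> is the label point at \<open>\<theta> = 0\<close>.\<close>

lemma sol_has_label: "k \<le> s \<Longrightarrow> l \<le> r \<Longrightarrow> sol k l \<in> CritX s r a \<and> has_label s r a (sol k l) (k, l)"
proof -
  assume kl: "k \<le> s" "l \<le> r"
  define P where "P t = lift k l (exp t)" for t
  define c where "c t = crit_point (LG_f s r t) (P t)" for t
  have P_cov: "P t \<in> covering_total" and GP: "G (P t) = base_path (exp t)" if "t \<le> 0" for t
    using lift_in_covering lift(4) that by (auto simp: P_def)
  have c_Crit: "c t \<in> Crit s r a (LG_f s r t)" if "t \<le> 0" for t
    using lift_crit_point(1)[OF that] by (simp add: c_def P_def)
  have smooth: "smooth_on_nonpos f" if "f \<in> curve_functions P" for f
  proof (rule smooth_lift[OF _ _ _ _ _ that])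
    show "continuous_on {..0} P" unfolding P_def
      by (rule continuous_on_compose2[OF lift(1)[unfolded path_def]]) (auto intro!: continuous_intros)
    fix t :: real assume t: "t \<le> 0"
    show "P t \<in> total \<and> jac (P t) \<noteq> 0" using covering_totalD P_cov[OF t] by blast
    show "fst (G (P t)) = 1" "fst (snd (G (P t))) = 1" using GP[OF t] by (simp_all add: base_path_def)
    have "snd (snd (P t)) = snd (snd (G (P t)))" by (simp add: G_def)
    then show "snd (snd (P t)) = of_real (exp (t / of_nat (Suc s)))"
      using GP[OF t] by (simp add: base_path_def rt_def root_exp)
  qed
  have curve: "solution_curve s r a c"
    unfolding solution_curve_def
  proof (intro conjI allI impI ballI)
    fix i assume "i \<in> {1..s}"
    then have "(\<lambda>t. fst (c t) i) = (\<lambda>t. snd (snd (P t)) * fst (P t))"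
      by (simp add: c_def crit_point_def LG_f_def LG_alpha0_def)
    then show "smooth_on_nonpos (\<lambda>t. fst (c t) i)" by (auto intro!: smooth curve_functions.intros)
  next
    fix j assume "j \<in> {1..r}"
    then have "(\<lambda>t. snd (c t) j) = (\<lambda>t. fst (snd (P t)) - of_nat (a j) * snd (snd (P t)) * fst (P t))"
      by (simp add: c_def crit_point_def LG_f_def LG_alpha0_def ell_def split_beta)
    then show "smooth_on_nonpos (\<lambda>t. snd (c t) j)" by (auto intro!: smooth curve_functions_diff curve_functions.intros)
  qed (use c_Crit in blast)
  have c0: "c 0 = sol k l" by (simp add: c_def P_def sol_def)
  have "(lift k l \<longlongrightarrow> lift k l 0) (at 0 within {0..1})"
    using lift(1)[of k l] by (simp add: path_def continuous_on_def)
  then have "(P \<longlongrightarrow> label_point (real k) (real l)) at_bot"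
    unfolding P_def lift(3)[symmetric] by (rule filterlim_compose[OF _ filterlim_exp_at_0])
  then have lim: "((\<lambda>t. (sgn (fst (P t)), sgn (fst (snd (P t))))) \<longlongrightarrow>
      (sgn (fst (label_point (real k) (real l))), sgn (fst (snd (label_point (real k) (real l)))))) at_bot"
    by (intro tendsto_Pair tendsto_sgn tendsto_fst tendsto_snd) (auto simp: label_point_def)
  have "\<forall>\<^sub>F t in at_bot. Theta s r a (c t) = (sgn (fst (P t)), sgn (fst (snd (P t))))"
    using eventually_le_at_bot[of 0]
  proof eventually_elim
    case (elim t)
    show ?case using Theta_eq_sgn_fibre_point[of "c t" t] lift_crit_point(2)[OF elim] by (simp add: c_def P_def)
  qed
  then have "((\<lambda>t. Theta s r a (c t)) \<longlongrightarrow>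
      (fst (label_point (real k) (real l)), fst (snd (label_point (real k) (real l))))) at_bot"
    using lim by (subst tendsto_cong) (auto simp: label_point_def)
  then show ?thesis
    using kl curve c0 c_Crit[of 0] by (auto simp: has_label_def label_point_def CritX_def)
qed

text \<open>A curve of critical points is a lift of \<open>base_path\<close> over \<open>{0<..1}\<close>, and the covering extends it to
\<open>\<theta> = 0\<close>. The limit of \<open>Theta\<close> identifies the end point of the extension as the label point, so the
curve coincides with \<open>lift k l\<close>.\<close>

lemma label_unique:
  assumes "has_label s r a p (k, l)"
  shows "p = sol k l"
proof -
  obtain c where curve: "solution_curve s r a c" and c0: "c 0 = p" and
    lim: "((\<lambda>t. Theta s r a (c t)) \<longlongrightarrow>
      (fst (label_point (real k) (real l)), fst (snd (label_point (real k) (real l))))) at_bot"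
    using assms by (auto simp: has_label_def label_point_def)
  define P where "P \<theta> = fibre_point (LG_f s r (ln \<theta>)) (rt (exp (ln \<theta>))) (c (ln \<theta>))" for \<theta>
  have Crit: "c t \<in> Crit s r a (LG_f s r t)" if "t \<le> 0" for t
    using curve that by (simp add: solution_curve_def)
  have GP: "P \<theta> \<in> total" "G (P \<theta>) = base_path \<theta>" "crit_point (LG_f s r (ln \<theta>)) (P \<theta>) = c (ln \<theta>)"
    if \<theta>: "\<theta> \<in> {0<..1}" for \<theta>
    using fibre_point_correct[OF LG_f_in_LG_space _ LG_f_inv(1) Crit[of "ln \<theta>"]] \<theta>
    by (simp_all add: P_def base_path_def LG_f_inv)
  have P_cov: "P \<theta> \<in> covering_total" if "\<theta> \<in> {0<..1}" for \<theta>
    using GP[OF that] base_path_regular[of \<theta>] that by (simp add: covering_total_def)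
  have smooth_cont: "continuous_on {0<..1} (\<lambda>\<theta>. g (ln \<theta>))" if "smooth_on_nonpos g" for g
  proof (rule continuous_on_compose2[of "{..0}" g])
    obtain D where "D 0 = g" "\<forall>n. \<forall>t\<le>0. (D n has_vector_derivative D (Suc n) t) (at t within {..0})"
      using \<open>smooth_on_nonpos g\<close> unfolding smooth_on_nonpos_def by blast
    then show "continuous_on {..0} g"
      by (metis atMost_iff continuous_on_vector_derivative)
  qed (auto intro!: continuous_intros)
  have torus: "c (ln \<theta>) \<in> LG_torus s r" if "\<theta> \<in> {0<..1}" for \<theta>
    using Crit[of "ln \<theta>"] that by (simp add: Crit_def)
  have "continuous_on {0<..1} (\<lambda>\<theta>. (of_real \<theta> * ((\<Prod>j=1..r. snd (c (ln \<theta>)) j ^ a j) / (\<Prod>i=1..s. fst (c (ln \<theta>)) i)) / rt \<theta>,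
      1 * (1 / (\<Prod>j=1..r. snd (c (ln \<theta>)) j)), rt \<theta>))"
  proof (intro continuous_intros smooth_cont)
    show "smooth_on_nonpos (\<lambda>t. snd (c t) j)" if "j \<in> {1..r}" for j using curve that by (simp add: solution_curve_def)
    then show "smooth_on_nonpos (\<lambda>t. snd (c t) j)" if "j \<in> {1..r}" for j using that by blast
    show "smooth_on_nonpos (\<lambda>t. fst (c t) i)" if "i \<in> {1..s}" for i using curve that by (simp add: solution_curve_def)
    show "\<forall>\<theta>\<in>{0<..1}. (\<Prod>i=1..s. fst (c (ln \<theta>)) i) \<noteq> 0" using torus by (auto simp: LG_torus_def PiE_iff mem_Times_iff)
    show "\<forall>\<theta>\<in>{0<..1}. (\<Prod>j=1..r. snd (c (ln \<theta>)) j) \<noteq> 0" using torus by (auto simp: LG_torus_def PiE_iff mem_Times_iff)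
    show "\<forall>\<theta>\<in>{0<..1}. rt \<theta> \<noteq> 0" by simp
  qed
  then have P_cont: "continuous_on {0<..1} P"
    by (rule continuous_on_eq) (simp add: P_def fibre_point_def LG_f_def LG_alpha0_def)
  have rev: "path (reversepath base_path)" "path_image (reversepath base_path) \<subseteq> regular_values"
    using path_base_path by simp_all
  have "pathstart (reversepath base_path) = G (P 1)" using GP(2)[of 1] by (simp add: pathfinish_def)
  \<comment> \<open>Lifting the reversed path from its start at 1 produces a lift that is also defined at 0.\<close>
  from covering_space_lift_path_strong[OF covering P_cov[of 1] rev this]
  obtain h where h: "path h" "path_image h \<subseteq> covering_total" "pathstart h = P 1"
    "\<And>t. t \<in> {0..1} \<Longrightarrow> G (h t) = reversepath base_path t" by auto
  have h_cont: "continuous_on {0..1} h" using h(1) by (simp add: path_def)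
  have h_cov: "h t \<in> covering_total" if "t \<in> {0..1}" for t using h(2) that by (auto simp: path_image_def)
  have h1_total: "h 1 \<in> total" by (rule covering_totalD(1)[OF h_cov]) simp
  have P_eq: "P \<theta> = h (1 - \<theta>)" if \<theta>: "\<theta> \<in> {0<..1}" for \<theta>
  proof (rule covering_space_lift_unique[OF covering, of P 1 "\<lambda>\<theta>. h (1 - \<theta>)" "{0<..1}" base_path])
    show "P 1 = h (1 - 1)" using h(3) by (simp add: pathstart_def)
    show "continuous_on {0<..1} base_path" unfolding base_path_def by (intro continuous_intros)
    show "continuous_on {0<..1} (\<lambda>\<theta>. h (1 - \<theta>))"
      by (rule continuous_on_compose2[OF h_cont]) (auto intro!: continuous_intros)
    show "(\<lambda>\<theta>. h (1 - \<theta>)) \<in> {0<..1} \<rightarrow> covering_total" by (intro Pi_I h_cov) simp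
    show "base_path x = G (h (1 - x))" if "x \<in> {0<..1}" for x using h(4)[of "1 - x"] that by (simp add: reversepath_def)
    show "base_path \<in> {0<..1} \<rightarrow> regular_values" by (intro Pi_I base_path_regular) simp
    show "P \<in> {0<..1} \<rightarrow> covering_total" by (intro Pi_I P_cov)
    show "base_path x = G (P x)" if "x \<in> {0<..1}" for x using GP(2)[OF that] by simp
  qed (use \<theta> P_cont in simp_all)
  have h1: "h 1 = (sgn (fst (h 1)), sgn (fst (snd (h 1))), 0)"
  proof (rule unit_label_fibre)
    show "h 1 \<in> total" by (rule h1_total)
    show "G (h 1) = (1, 1, 0)" using h(4)[of 1] by (simp add: reversepath_def base_path_def)
  qed
  have "((\<lambda>\<theta>. h (1 - \<theta>)) \<longlongrightarrow> h 1) (at 0 within {0..1})"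
  proof -
    have "continuous_on {0..1} (\<lambda>\<theta>. h (1 - \<theta>))"
      by (rule continuous_on_compose2[OF h_cont]) (auto intro!: continuous_intros)
    then show ?thesis unfolding continuous_on_def by (metis atLeastAtMost_iff diff_zero order_refl zero_le_one)
  qed
  from filterlim_compose[OF this filterlim_exp_at_0]
  have "((\<lambda>t. h (1 - exp t)) \<longlongrightarrow> h 1) at_bot" .
  moreover have "fst (h 1) \<noteq> 0" "fst (snd (h 1)) \<noteq> 0"
    using totalD(1,2)[OF h1_total] by simp_all
  ultimately have lim': "((\<lambda>t. (sgn (fst (h (1 - exp t))), sgn (fst (snd (h (1 - exp t)))))) \<longlongrightarrow> (sgn (fst (h 1)), sgn (fst (snd (h 1))))) at_bot"
    by (intro tendsto_Pair tendsto_sgn tendsto_fst tendsto_snd) auto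
  have "\<forall>\<^sub>F t in at_bot. (sgn (fst (h (1 - exp t))), sgn (fst (snd (h (1 - exp t))))) = Theta s r a (c t)"
    using eventually_le_at_bot[of 0]
  proof eventually_elim
    case (elim t)
    then show ?case using P_eq[of "exp t"] Theta_eq_sgn_fibre_point[of "c t" t] by (simp add: P_def)
  qed
  then have "((\<lambda>t. Theta s r a (c t)) \<longlongrightarrow> (sgn (fst (h 1)), sgn (fst (snd (h 1))))) at_bot"
    using lim' by (subst (asm) tendsto_cong) auto
  then have "(sgn (fst (h 1)), sgn (fst (snd (h 1)))) = (fst (label_point (real k) (real l)), fst (snd (label_point (real k) (real l))))"
    using lim by (rule tendsto_unique[OF trivial_limit_at_bot_linorder])
  then have h1_label: "h 1 = label_point (real k) (real l)" using h1 by (simp add: label_point_def)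
  have "lift k l 1 = reversepath h 1"
  proof (rule lift_path_unique[OF path_base_path lift(1,2,4), of "reversepath h" 0])
    show "path (reversepath h)" "path_image (reversepath h) \<subseteq> covering_total" using h(1,2) by simp_all
    show "G (reversepath h t) = base_path t" if "t \<in> {0..1}" for t
      using h(4)[of "1 - t"] that by (simp add: reversepath_def)
    show "lift k l 0 = reversepath h 0" by (simp add: reversepath_def h1_label lift(3))
  qed auto
  then have "lift k l 1 = P 1" using h(3) by (simp add: reversepath_def pathstart_def)
  then show ?thesis using GP(3)[of 1] c0 by (simp add: sol_def)
qed

lemma solution_eq: "k \<le> s \<Longrightarrow> l \<le> r \<Longrightarrow> solution s r a (k, l) = sol k l"
  unfolding solution_def using sol_has_label[of k l] label_unique by (intro the_equality) auto

lemma sol_inj: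
  assumes "sol k l = sol k' l'" "k \<le> s" "l \<le> r" "k' \<le> s" "l' \<le> r"
  shows "k = k' \<and> l = l'"
proof -
  have eq1: "lift k l 1 = lift k' l' 1"
    using assms(1) lift_crit_point(2)[of 0 k l] lift_crit_point(2)[of 0 k' l'] by (simp add: sol_def)
  have "lift k l 0 = lift k' l' 0"
    by (rule lift_path_unique[OF path_base_path lift(1,2,4) lift(1,2,4) _ eq1]) simp_all
  then show ?thesis using label_point_inj[of k l k' l'] assms(2-) by (simp only: lift(3))
qed

end

section \<open>Monodromy of the labels\<close>

text \<open>Moves the loop \<open>q\<close> together with the path \<open>p\<close> that joins it to the base point. This is used twice: to
see that the class of the conjugated loop is independent of \<open>t\<close>, and to push it to \<open>\<tau> = 0\<close>.\<close>

lemma homotopic_conjugated_loops: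
  fixes p q :: "real \<Rightarrow> real \<Rightarrow> 'a::topological_space"
  assumes p: "continuous_on ({0..1} \<times> {0..1}) (\<lambda>y. p (fst y) (snd y))"
    and q: "continuous_on ({0..1} \<times> {0..1}) (\<lambda>y. q (fst y) (snd y))"
    and start: "\<And>\<sigma>. p \<sigma> 0 = x0" and join: "\<And>\<sigma>. q \<sigma> 0 = p \<sigma> 1" "\<And>\<sigma>. q \<sigma> 1 = p \<sigma> 1"
    and S: "\<And>\<sigma> \<theta>. \<sigma> \<in> {0..1} \<Longrightarrow> \<theta> \<in> {0..1} \<Longrightarrow> p \<sigma> \<theta> \<in> S"
      "\<And>\<sigma> \<theta>. \<sigma> \<in> {0..1} \<Longrightarrow> \<theta> \<in> {0..1} \<Longrightarrow> q \<sigma> \<theta> \<in> S"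
  shows "homotopic_paths S (p 0 +++ q 0 +++ reversepath (p 0)) (p 1 +++ q 1 +++ reversepath (p 1))"
proof -
  let ?r = "\<lambda>\<sigma>. reversepath (p \<sigma>)"
  let ?H = "\<lambda>\<sigma>. p \<sigma> +++ q \<sigma> +++ ?r \<sigma>"
  have r: "continuous_on ({0..1} \<times> {0..1}) (\<lambda>y. ?r (fst y) (snd y))"
  proof -
    have "continuous_on ({0..1} \<times> {0..1}) ((\<lambda>y. p (fst y) (snd y)) \<circ> (\<lambda>y. (fst y, 1 - snd y)))"
      by (intro continuous_on_compose continuous_on_subset[OF p] continuous_intros) auto
    then show ?thesis by (simp add: reversepath_def o_def)
  qed
  have qr: "continuous_on ({0..1} \<times> {0..1}) (\<lambda>y. (q (fst y) +++ ?r (fst y)) (snd y))"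
    by (rule continuous_on_homotopic_join_lemma[OF q r]) (simp add: pathfinish_def pathstart_def join reversepath_def)
  have cont: "continuous_on ({0..1} \<times> {0..1}) (\<lambda>y. ?H (fst y) (snd y))"
    by (rule continuous_on_homotopic_join_lemma[OF p, of "\<lambda>\<sigma>. q \<sigma> +++ ?r \<sigma>"])
       (rule qr, simp add: pathfinish_def pathstart_def join joinpaths_def)
  have mem: "?H \<sigma> \<theta> \<in> S" if "\<sigma> \<in> {0..1}" "\<theta> \<in> {0..1}" for \<sigma> \<theta>
    using that by (auto simp: joinpaths_def reversepath_def intro!: S)
  have ends: "?H \<sigma> 0 = x0" "?H \<sigma> 1 = x0" for \<sigma>
    by (simp_all add: joinpaths_def reversepath_def start)
  show ?thesis unfolding homotopic_paths
    by (rule exI[of _ "\<lambda>y. ?H (fst y) (snd y)"])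
       (intro conjI ballI cont Pi_I mem; auto simp: pathstart_def pathfinish_def ends)
qed

lemma continuous_on_restrict_coordinates:
  fixes F :: "'b \<Rightarrow> 'a::topological_space \<Rightarrow> 'c::topological_space"
  assumes "\<And>i. i \<in> I \<Longrightarrow> continuous_on S (F i)"
  shows "continuous_on S (\<lambda>y. \<lambda>i\<in>I. F i y)"
proof (rule continuous_on_coordinatewise_then_product)
  fix i show "continuous_on S (\<lambda>y. (\<lambda>i\<in>I. F i y) i)"
    by (cases "i \<in> I") (simp_all add: assms)
qed

lemma continuous_on_cpair_coordinates:
  assumes "continuous_on S (g :: 'a::topological_space \<Rightarrow> cpair)"
  shows "continuous_on S (\<lambda>x. fst (g x) i)" "continuous_on S (\<lambda>x. snd (g x) j)"
  by (rule continuous_on_product_then_coordinatewise[OF continuous_on_fst[OF assms]],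
      rule continuous_on_product_then_coordinatewise[OF continuous_on_snd[OF assms]])

context LG_data
begin

text \<open>The point over which the critical points of \<open>f\<close> lie. Its last coordinate is the \<open>(s + 1)\<close>-th root of the
absolute value of \<open>A_invariant f\<close>, while the phase stays in the first coordinate; so no branch of the
root has to be chosen and the map is continuous on all of \<open>LG_space s r\<close>.\<close>

definition base_value :: "cpair \<Rightarrow> point3" where
  "base_value f = (A_invariant f / of_real (norm (A_invariant f)), B_invariant f, rt (norm (A_invariant f)))"

lemma base_value_tau: 
  assumes "f \<in> LG_space s r"
  shows "rt (norm (A_invariant f)) \<noteq> 0" "A_invariant f = A_invariant f / of_real (norm (A_invariant f)) * rt (norm (A_invariant f)) ^ Suc s"
  using A_invariant_nonzero[OF assms] by (simp_all add: rt_power del: power_Suc)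

lemma continuous_psi: "continuous_on (LG_space s r) base_value"
proof -
  note coords = continuous_on_cpair_coordinates[OF continuous_on_id, of "LG_space s r"]
  have "\<forall>f\<in>LG_space s r. (\<Prod>j=1..r. snd f j ^ a j) \<noteq> 0" using LG_space_nonzero(2) by simp
  then have "continuous_on (LG_space s r) A_invariant" unfolding A_invariant_def
    by (intro continuous_on_divide continuous_on_prod continuous_on_power coords)
  moreover have "continuous_on (LG_space s r) B_invariant" unfolding B_invariant_def
    by (intro continuous_on_prod coords)
  ultimately show ?thesis unfolding base_value_def
    by (intro continuous_intros) (auto dest: A_invariant_nonzero)
qed

text \<open>The images of \<open>LG_segment\<close> and \<open>LG_loop\<close> under \<open>base_value\<close> for \<open>\<epsilon> = exp t\<close>. They make sense for
\<open>\<epsilon> = 0\<close> as well.\<close>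

definition base_segment :: "real \<Rightarrow> real \<Rightarrow> point3" where
  "base_segment \<epsilon> \<theta> = (1, 1, rt (1 - \<theta> + \<theta> * \<epsilon>))"

definition base_loop :: "int \<Rightarrow> int \<Rightarrow> real \<Rightarrow> real \<Rightarrow> point3" where
  "base_loop d1 d2 \<epsilon> \<theta> = (cis (2 * pi * of_int d1 * \<theta>), cis (2 * pi * of_int d2 * \<theta>), rt \<epsilon>)"

definition base_conjugate :: "int \<Rightarrow> int \<Rightarrow> real \<Rightarrow> real \<Rightarrow> point3" where
  "base_conjugate d1 d2 \<epsilon> = base_segment \<epsilon> +++ base_loop d1 d2 \<epsilon> +++ reversepath (base_segment \<epsilon>)"

abbreviation LG_conjugate :: "(nat \<Rightarrow> nat) \<times> (nat \<Rightarrow> nat) \<Rightarrow> real \<Rightarrow> real \<Rightarrow> cpair" where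
  "LG_conjugate nm t \<equiv> LG_segment s r t +++ LG_loop s r nm t +++ reversepath (LG_segment s r t)"

lemma LG_segment_eq: "LG_segment s r t \<theta> = LG_alpha0 s r (of_real (1 - \<theta> + \<theta> * exp t))"
  by (simp add: LG_segment_def linepath_def scaleR_conv_of_real)

lemma LG_segment_eq_LG_f:
  assumes "\<theta> \<in> {0..1}" "t \<le> 0"
  shows "\<exists>t'\<le>0. LG_segment s r t \<theta> = LG_f s r t'"
proof -
  have "\<theta> * exp t \<le> \<theta> * 1" using assms by (intro mult_left_mono) auto
  moreover have "1 - \<theta> + \<theta> * exp t > 0"
  proof (cases "\<theta> = 0")
    case False
    then have "\<theta> * exp t > 0" using assms by simp
    then show ?thesis using assms by (simp add: add_nonneg_pos)
  qed simp
  ultimately show ?thesis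
    by (intro exI[of _ "ln (1 - \<theta> + \<theta> * exp t)"]) (simp add: LG_segment_eq LG_f_def)
qed

lemma base_value_segment:
  assumes "\<theta> \<in> {0..1}" "t \<le> 0" shows "base_value (LG_segment s r t \<theta>) = base_segment (exp t) \<theta>"
proof -
  define e where "e = 1 - \<theta> + \<theta> * exp t"
  have "e > 0"
  proof (cases "\<theta> = 0")
    case False
    then have "\<theta> * exp t > 0" using assms by simp
    then show ?thesis using assms by (simp add: e_def add_nonneg_pos)
  qed (simp add: e_def)
  then show ?thesis
    unfolding base_value_def LG_segment_eq A_invariant_LG_alpha0 B_invariant_LG_alpha0 base_segment_def e_def[symmetric] norm_of_real
    by simp
qed

lemma LG_loop_in_LG_space: "LG_loop s r nm t \<theta> \<in> LG_space s r"
  by (cases nm) (auto simp: LG_loop_def LG_space_def)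

lemma exp_eq_cis: "exp (2 * of_real pi * \<i> * of_nat n * of_real \<theta>) = cis (2 * pi * real n * \<theta>)"
  by (simp add: cis_conv_exp mult_ac)

lemma prod_cis: "finite I \<Longrightarrow> (\<Prod>i\<in>I. cis (f i)) = cis (\<Sum>i\<in>I. f i)"
  by (induction I rule: finite_induct) (simp_all add: cis_mult)

lemma LG_loop_inv:
  assumes "a 0 = 0"
  shows "A_invariant (LG_loop s r nm t \<theta>) = of_real (exp t) * cis (2 * pi * of_int (deg1 s r a nm) * \<theta>)"
    and "B_invariant (LG_loop s r nm t \<theta>) = cis (2 * pi * of_int (deg2 r nm) * \<theta>)"
proof -
  obtain n m where nm: "nm = (n, m)" by (cases nm)
  define x where "x = 2 * pi * \<theta>"
  have c: "exp (2 * of_real pi * \<i> * of_nat k * of_real \<theta>) = cis (real k * x)" for k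
    unfolding exp_eq_cis by (simp add: x_def mult_ac)
  have "(\<Prod>i=0..s. fst (LG_loop s r nm t \<theta>) i) = (\<Prod>i=0..s. (if i = 0 then of_real (exp t) else 1) * cis (real (n i) * x))"
    by (intro prod.cong refl) (simp add: LG_loop_def nm c)
  also have "\<dots> = of_real (exp t) * cis (\<Sum>i=0..s. real (n i) * x)"
    unfolding prod.distrib by (simp add: prod_cis)
  finally have num: "(\<Prod>i=0..s. fst (LG_loop s r nm t \<theta>) i) = of_real (exp t) * cis ((\<Sum>i=0..s. real (n i)) * x)"
    by (simp only: sum_distrib_right)
  have snd_c: "snd (LG_loop s r nm t \<theta>) j = cis (real (m j) * x)" if "j \<le> r" for j
    using that by (simp add: LG_loop_def nm c)
  have "(\<Prod>j=1..r. snd (LG_loop s r nm t \<theta>) j ^ a j) = (\<Prod>j=1..r. cis (real (a j) * real (m j) * x))"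
    by (intro prod.cong refl) (simp add: snd_c Complex.DeMoivre mult.assoc)
  also have "\<dots> = cis ((\<Sum>j=1..r. real (a j) * real (m j)) * x)"
    by (simp add: prod_cis sum_distrib_right)
  finally have den: "(\<Prod>j=1..r. snd (LG_loop s r nm t \<theta>) j ^ a j) = cis ((\<Sum>j=1..r. real (a j) * real (m j)) * x)" .
  have "real_of_int (deg1 s r a nm) = (\<Sum>i=0..s. real (n i)) - (\<Sum>j=0..r. real (a j) * real (m j))"
    by (simp add: deg1_def nm)
  also have "(\<Sum>j=0..r. real (a j) * real (m j)) = (\<Sum>j=1..r. real (a j) * real (m j))"
    using assms sum.atLeast_Suc_atMost[of 0 r "\<lambda>j. real (a j) * real (m j)"] by simp
  finally have d: "real_of_int (deg1 s r a nm) * x = (\<Sum>i=0..s. real (n i)) * x - (\<Sum>j=1..r. real (a j) * real (m j)) * x"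
    by (simp only: left_diff_distrib)
  have "2 * pi * of_int (deg1 s r a nm) * \<theta> = real_of_int (deg1 s r a nm) * x" by (simp add: x_def mult_ac)
  then show "A_invariant (LG_loop s r nm t \<theta>) = of_real (exp t) * cis (2 * pi * of_int (deg1 s r a nm) * \<theta>)"
    unfolding A_invariant_def num den by (simp only: d cis_divide[symmetric] times_divide_eq_right)
  have "(\<Prod>j=0..r. snd (LG_loop s r nm t \<theta>) j) = (\<Prod>j=0..r. cis (real (m j) * x))"
    by (intro prod.cong refl) (simp add: LG_loop_def nm c)
  also have "\<dots> = cis ((\<Sum>j=0..r. real (m j)) * x)" by (simp add: prod_cis sum_distrib_right)
  also have "(\<Sum>j=0..r. real (m j)) * x = 2 * pi * of_int (deg2 r nm) * \<theta>"
    by (simp add: deg2_def nm x_def mult_ac)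
  finally show "B_invariant (LG_loop s r nm t \<theta>) = cis (2 * pi * of_int (deg2 r nm) * \<theta>)"
    by (simp add: B_invariant_def)
qed

lemma base_value_loop:
  assumes "a 0 = 0"
  shows "base_value (LG_loop s r nm t \<theta>) = base_loop (deg1 s r a nm) (deg2 r nm) (exp t) \<theta>"
  unfolding base_value_def LG_loop_inv[OF assms] base_loop_def by (simp add: norm_mult)

lemma base_value_conjugate:
  assumes "a 0 = 0" "t \<le> 0" "\<theta> \<in> {0..1}"
  shows "base_value (LG_conjugate nm t \<theta>) = base_conjugate (deg1 s r a nm) (deg2 r nm) (exp t) \<theta>"
  using assms base_value_segment[of "2 * \<theta>" t] base_value_segment[of "1 - (2 * (2 * \<theta> - 1) - 1)" t]
  by (auto simp: joinpaths_def reversepath_def base_conjugate_def base_value_loop)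

lemma LG_segment_ends: "LG_segment s r t 0 = LG_f s r 0" "LG_segment s r t 1 = LG_f s r t"
  by (simp_all add: LG_segment_eq LG_f_def)

lemma LG_loop_ends: "LG_loop s r nm t 0 = LG_f s r t" "LG_loop s r nm t 1 = LG_f s r t"
proof -
  obtain n m where nm: "nm = (n, m)" by (cases nm)
  have "cis (2 * pi * real k * 1) = 1" for k using cis_multiple_2pi[of "real k"] by simp
  then have 1: "exp (2 * of_real pi * \<i> * of_nat k * of_real 1) = 1" for k unfolding exp_eq_cis by simp
  show "LG_loop s r nm t 1 = LG_f s r t"
    unfolding LG_loop_def nm prod.case LG_f_def LG_alpha0_def 1 by simp
  show "LG_loop s r nm t 0 = LG_f s r t"
    unfolding LG_loop_def nm LG_f_def LG_alpha0_def by simp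
qed

lemma base_ends: "base_segment \<epsilon> 0 = (1, 1, 1)" "base_loop d1 d2 \<epsilon> 0 = base_segment \<epsilon> 1"
    "base_loop d1 d2 \<epsilon> 1 = base_segment \<epsilon> 1"
  by (simp_all add: base_segment_def base_loop_def)

end

context LG_setting
begin

abbreviation complement :: "cpair set" where
  "complement \<equiv> LG_space s r - discriminant s r a"

lemma base_segment_regular:
  assumes "\<epsilon> \<in> {0..1}" "\<theta> \<in> {0..1}" shows "base_segment \<epsilon> \<theta> \<in> regular_values"
proof -
  have "0 \<le> \<theta> * \<epsilon>" "\<theta> * \<epsilon> \<le> \<theta>" using assms by (simp_all add: mult_left_le)
  then have "1 - \<theta> + \<theta> * \<epsilon> \<in> {0..1}" using assms by auto
  from base_path_regular[OF this] show ?thesis by (simp add: base_segment_def base_path_def)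
qed

lemma small_loops_regular:
  "\<exists>\<epsilon>\<^sub>0>0. \<epsilon>\<^sub>0 \<le> 1 \<and> (\<forall>\<epsilon>\<in>{0..\<epsilon>\<^sub>0}. \<forall>A B x. norm A = 1 \<longrightarrow> norm B = 1 \<longrightarrow> x \<in> {0..1} \<longrightarrow>
      (A, B, of_real x * rt \<epsilon>) \<in> regular_values)"
proof -
  obtain \<tau>\<^sub>0 where \<tau>\<^sub>0: "\<tau>\<^sub>0 > 0"
    "\<forall>A B \<tau>. norm A = 1 \<longrightarrow> norm B = 1 \<longrightarrow> norm \<tau> \<le> \<tau>\<^sub>0 \<longrightarrow> (A, B, \<tau>) \<in> regular_values"
    using small_tau_regular by (elim exE conjE)
  define \<epsilon>\<^sub>0 where "\<epsilon>\<^sub>0 = min 1 (\<tau>\<^sub>0 ^ Suc s)"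
  have "norm (of_real x * rt \<epsilon>) \<le> \<tau>\<^sub>0" if "\<epsilon> \<in> {0..\<epsilon>\<^sub>0}" "x \<in> {0..1}" for \<epsilon> x
  proof -
    have "root (Suc s) \<epsilon> \<le> root (Suc s) (\<tau>\<^sub>0 ^ Suc s)"
      using that by (intro real_root_le_mono) (auto simp: \<epsilon>\<^sub>0_def)
    also have "\<dots> = \<tau>\<^sub>0" using \<tau>\<^sub>0(1) by (intro real_root_power_cancel) auto
    finally have "root (Suc s) \<epsilon> \<le> \<tau>\<^sub>0" .
    moreover have "0 \<le> root (Suc s) \<epsilon>" using that by simp
    moreover have "x * root (Suc s) \<epsilon> \<le> 1 * root (Suc s) \<epsilon>" using that by (intro mult_right_mono) auto
    ultimately show ?thesis using that by (simp add: rt_def norm_mult)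
  qed
  then show ?thesis using \<tau>\<^sub>0 by (intro exI[of _ \<epsilon>\<^sub>0]) (auto simp: \<epsilon>\<^sub>0_def)
qed

text \<open>A bound on \<open>exp t\<close> below which the loop and all loops between it and \<open>\<tau> = 0\<close> consist of regular
values.\<close>

definition loop_radius :: real where
  "loop_radius = (SOME \<epsilon>\<^sub>0. \<epsilon>\<^sub>0 > 0 \<and> \<epsilon>\<^sub>0 \<le> 1 \<and> (\<forall>\<epsilon>\<in>{0..\<epsilon>\<^sub>0}. \<forall>A B x. norm A = 1 \<longrightarrow> norm B = 1 \<longrightarrow> x \<in> {0..1} \<longrightarrow>
      (A, B, of_real x * rt \<epsilon>) \<in> regular_values))"

lemma loop_radius: "loop_radius > 0" "loop_radius \<le> 1"
  and loop_radius_regular: "\<epsilon> \<in> {0..loop_radius} \<Longrightarrow> norm A = 1 \<Longrightarrow> norm B = 1 \<Longrightarrow> x \<in> {0..1} \<Longrightarrow>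
      (A, B, of_real x * rt \<epsilon>) \<in> regular_values"
  using someI_ex[OF small_loops_regular] unfolding loop_radius_def[symmetric] by (elim conjE; simp)+

lemma base_loop_regular:
  assumes "\<epsilon> \<in> {0..loop_radius}" shows "base_loop d1 d2 \<epsilon> \<theta> \<in> regular_values"
  using loop_radius_regular[OF assms, of "cis (2 * pi * of_int d1 * \<theta>)" "cis (2 * pi * of_int d2 * \<theta>)" 1]
  by (simp add: base_loop_def)

lemma base_conjugate_homotopic:
  assumes "\<epsilon> \<in> {0..loop_radius}"
  shows "homotopic_paths regular_values (base_conjugate d1 d2 0) (base_conjugate d1 d2 \<epsilon>)"
proof -
  define p where "p \<sigma> = base_segment (\<sigma> * \<epsilon>)" for \<sigma>
  define q where "q \<sigma> = base_loop d1 d2 (\<sigma> * \<epsilon>)" for \<sigma>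
  have \<sigma>\<epsilon>: "\<sigma> * \<epsilon> \<in> {0..loop_radius}" if "\<sigma> \<in> {0..1}" for \<sigma>
  proof -
    have "0 \<le> \<sigma> * \<epsilon>" "\<sigma> * \<epsilon> \<le> \<epsilon>" using that assms by (simp_all add: mult_left_le_one_le)
    then show ?thesis using assms by auto
  qed
  have "homotopic_paths regular_values (p 0 +++ q 0 +++ reversepath (p 0)) (p 1 +++ q 1 +++ reversepath (p 1))"
  proof (rule homotopic_conjugated_loops)
    show "continuous_on ({0..1} \<times> {0..1}) (\<lambda>y. p (fst y) (snd y))"
      unfolding p_def base_segment_def by (intro continuous_intros)
    show "continuous_on ({0..1} \<times> {0..1}) (\<lambda>y. q (fst y) (snd y))"
      unfolding q_def base_loop_def by (intro continuous_intros)
    show "p \<sigma> 0 = (1, 1, 1)" "q \<sigma> 0 = p \<sigma> 1" "q \<sigma> 1 = p \<sigma> 1" for \<sigma>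
      by (simp_all add: p_def q_def base_ends)
    fix \<sigma> \<theta> :: real assume \<sigma>: "\<sigma> \<in> {0..1}" and \<theta>: "\<theta> \<in> {0..1}"
    have "\<sigma> * \<epsilon> \<in> {0..1}" using \<sigma>\<epsilon>[OF \<sigma>] loop_radius by simp
    then show "p \<sigma> \<theta> \<in> regular_values" unfolding p_def using \<theta> by (rule base_segment_regular)
    show "q \<sigma> \<theta> \<in> regular_values" unfolding q_def using \<sigma>\<epsilon>[OF \<sigma>] by (rule base_loop_regular)
  qed
  then show ?thesis by (simp add: p_def q_def base_conjugate_def)
qed

text \<open>The loop lies outside the discriminant because each of its members has \<open>(s + 1) * (r + 1)\<close> critical
points, as many as the system at \<open>\<tau> = 0\<close>.\<close>

lemma LG_loop_in_complement:
  assumes "a 0 = 0" "exp t \<le> loop_radius"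
  shows "LG_loop s r nm t \<theta> \<in> complement"
proof -
  let ?f = "LG_loop s r nm t \<theta>"
  let ?A = "cis (2 * pi * of_int (deg1 s r a nm) * \<theta>)"
  have \<tau>: "rt (exp t) \<noteq> 0" "A_invariant ?f = ?A * rt (exp t) ^ Suc s"
    by (simp_all add: LG_loop_inv[OF assms(1)] rt_power mult.commute del: power_Suc)
  have "B_invariant ?f = cis (2 * pi * of_int (deg2 r nm) * \<theta>)" by (rule LG_loop_inv(2)[OF assms(1)])
  then have "(?A, B_invariant ?f, of_real x * rt (exp t)) \<in> regular_values" if "x \<in> {0..1}" for x
    using that assms(2) by (intro loop_radius_regular) auto
  from fibre_card_near_zero[OF _ B_invariant_nonzero[OF LG_loop_in_LG_space] this]
  obtain Z where Z: "finite Z" "card Z = Suc s * Suc r" "\<forall>P\<in>Z. P \<in> total \<and> G P = (?A, B_invariant ?f, rt (exp t))"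
    by auto
  have "crit_reduced s r a ?f"
    by (rule many_fibre_points_imp_reduced[OF LG_loop_in_LG_space \<tau> Z(1)]) (use Z(2,3) in auto)
  then show ?thesis using LG_loop_in_LG_space by (simp add: discriminant_def)
qed

lemma LG_segment_in_complement:
  assumes "t \<le> 0" "\<theta> \<in> {0..1}" shows "LG_segment s r t \<theta> \<in> complement"
proof -
  obtain t' where "t' \<le> 0" "LG_segment s r t \<theta> = LG_f s r t'" using LG_segment_eq_LG_f[OF assms(2,1)] by blast
  then show ?thesis using no_discriminant[of t'] LG_f_in_LG_space by simp
qed

lemma LG_conjugate_homotopic:
  assumes a0: "a 0 = 0" and t: "exp t \<le> loop_radius" "exp t' \<le> loop_radius"
  shows "homotopic_paths complement (LG_conjugate nm t) (LG_conjugate nm t')"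
proof -
  obtain n m where nm: "nm = (n, m)" by (cases nm)
  define T where "T \<sigma> = (1 - \<sigma>) * t + \<sigma> * t'" for \<sigma>
  have T: "exp (T \<sigma>) \<le> loop_radius" if "\<sigma> \<in> {0..1}" for \<sigma>
  proof -
    have "T \<sigma> \<le> (1 - \<sigma>) * max t t' + \<sigma> * max t t'"
      unfolding T_def using that by (intro add_mono mult_left_mono) auto
    also have "\<dots> = max t t'" by (simp add: algebra_simps)
    finally have "exp (T \<sigma>) \<le> exp (max t t')" by simp
    also have "\<dots> \<le> loop_radius" using t by (simp add: max_def)
    finally show ?thesis .
  qed
  have T0: "T \<sigma> \<le> 0" if "\<sigma> \<in> {0..1}" for \<sigma>
    using order_trans[OF T[OF that] loop_radius(2)] by simp
  define p where "p \<sigma> = LG_segment s r (T \<sigma>)" for \<sigma>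
  define q where "q \<sigma> = LG_loop s r nm (T \<sigma>)" for \<sigma>
  have "homotopic_paths complement (p 0 +++ q 0 +++ reversepath (p 0)) (p 1 +++ q 1 +++ reversepath (p 1))"
  proof (rule homotopic_conjugated_loops)
    show "continuous_on ({0..1} \<times> {0..1}) (\<lambda>y. p (fst y) (snd y))"
      unfolding p_def LG_segment_eq LG_alpha0_def T_def
    proof (intro continuous_on_Pair continuous_on_restrict_coordinates)
      fix i :: nat
      show "continuous_on ({0..1} \<times> {0..1}) (\<lambda>y. if i = 0 then complex_of_real
         (1 - snd y + snd y * exp ((1 - fst y) * t + fst y * t')) else 1)"
        by (cases "i = 0") (auto intro!: continuous_intros)
    qed auto
    show "continuous_on ({0..1} \<times> {0..1}) (\<lambda>y. q (fst y) (snd y))"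
      unfolding q_def LG_loop_def nm prod.case T_def
    proof (intro continuous_on_Pair continuous_on_restrict_coordinates continuous_on_mult)
      fix i :: nat
      show "continuous_on ({0..1} \<times> {0..1}) (\<lambda>y. if i = 0 then complex_of_real (exp ((1 - fst y) * t + fst y * t')) else 1)"
        by (cases "i = 0") (auto intro!: continuous_intros)
    qed (intro continuous_intros)+
    show "p \<sigma> 0 = LG_f s r 0" "q \<sigma> 0 = p \<sigma> 1" "q \<sigma> 1 = p \<sigma> 1" for \<sigma>
      by (simp_all add: p_def q_def LG_segment_ends LG_loop_ends)
    fix \<sigma> \<theta> :: real assume \<sigma>: "\<sigma> \<in> {0..1}" and \<theta>: "\<theta> \<in> {0..1}"
    show "p \<sigma> \<theta> \<in> complement" unfolding p_def using T0[OF \<sigma>] \<theta> by (rule LG_segment_in_complement)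
    show "q \<sigma> \<theta> \<in> complement" unfolding q_def using a0 T[OF \<sigma>] by (rule LG_loop_in_complement)
  qed
  then show ?thesis by (simp add: p_def q_def T_def)
qed

text \<open>The classes stabilize as soon as \<open>exp t \<le> loop_radius\<close>, so any such \<open>t\<close> represents the limit.\<close>

lemma Gamma_class_eq:
  assumes a0: "a 0 = 0" and t: "exp t \<le> loop_radius"
  shows "Gamma_class s r a nm = loop_class complement (LG_conjugate nm t)"
  unfolding Gamma_class_def
proof (rule the_equality)
  have "\<forall>\<^sub>F t' in at_bot. t' \<le> ln loop_radius" by (rule eventually_le_at_bot)
  then show ev: "\<forall>\<^sub>F t' in at_bot. loop_class complement (LG_conjugate nm t') = loop_class complement (LG_conjugate nm t)"
  proof eventually_elim
    case (elim t')
    then have "exp t' \<le> exp (ln loop_radius)" by simp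
    then have t': "exp t' \<le> loop_radius" using loop_radius(1) by simp
    show ?case unfolding loop_class_def
      using LG_conjugate_homotopic[OF a0 t t', of nm] LG_conjugate_homotopic[OF a0 t' t, of nm]
      by (auto intro: homotopic_paths_trans)
  qed
  fix C assume "\<forall>\<^sub>F t' in at_bot. loop_class complement (LG_conjugate nm t') = C"
  with ev have "\<forall>\<^sub>F t' in (at_bot :: real filter). C = loop_class complement (LG_conjugate nm t)"
    by eventually_elim simp
  then show "C = loop_class complement (LG_conjugate nm t)" by (simp add: trivial_limit_at_bot_linorder)
qed

lemma homotopic_in_regular_values:
  assumes "homotopic_paths nondegenerate p q" "p 0 \<in> regular_values"
  shows "homotopic_paths regular_values p q"
proof -
  from assms(1)[unfolded homotopic_paths] obtain h :: "real \<times> real \<Rightarrow> point3" where hh: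
      "continuous_on ({0..1} \<times> {0..1}) h \<and> h \<in> {0..1} \<times> {0..1} \<rightarrow> nondegenerate \<and>
      (\<forall>x\<in>{0..1}. h (0, x) = p x) \<and> (\<forall>x\<in>{0..1}. h (1, x) = q x) \<and>
      (\<forall>t\<in>{0..1}. pathstart (h \<circ> Pair t) = pathstart p \<and> pathfinish (h \<circ> Pair t) = pathfinish p)" by (elim exE)
  then have h: "continuous_on ({0..1} \<times> {0..1}) h" "h \<in> {0..1} \<times> {0..1} \<rightarrow> nondegenerate" "\<forall>x\<in>{0..1}. h (0, x) = p x"
    by simp_all
  have "connected ({0..1 :: real} \<times> {0..1 :: real})" by (intro connected_Times) auto
  then have "connected (h ` ({0..1} \<times> {0..1}))" using h(1) by (intro connected_continuous_image)
  moreover have "h ` ({0..1} \<times> {0..1}) \<subseteq> nondegenerate" using h(2) by blast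
  moreover have "h (0, 0) \<in> regular_values" using h(3) assms(2) by simp
  then have "h ` ({0..1} \<times> {0..1}) \<inter> regular_values \<noteq> {}" by force
  ultimately have "h ` ({0..1} \<times> {0..1}) \<subseteq> regular_values" by (rule connected_nondegenerate_imp_regular)
  then have "h \<in> {0..1} \<times> {0..1} \<rightarrow> regular_values" by blast
  then show ?thesis unfolding homotopic_paths using hh by (intro exI[of _ h]) simp
qed

lemma base_value_nondegenerate: "f \<in> complement \<Longrightarrow> base_value f \<in> nondegenerate"
  unfolding base_value_def
  by (rule reduced_imp_nondegenerate[OF r_pos s_pos]) (use base_value_tau[of f] in \<open>auto simp: discriminant_def simp del: power_Suc\<close>)

text \<open>The heart of the monodromy computation. At \<open>\<tau> = 0\<close> the loop rotates \<open>A\<close> and \<open>B\<close> by \<open>d1\<close> and \<open>d2\<close> full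
turns, and its lift is explicit: the label moves linearly from \<open>(k1, l1)\<close> to \<open>(k1 + d1, l1 + d2)\<close>.
Before and after it, the lift runs down and up the lifts of \<open>base_path\<close>.\<close>

lemma lift_of_degenerate_loop:
  assumes "int k1 + d1 = int k2" "int l1 + d2 = int l2"
  shows "\<exists>H. path H \<and> path_image H \<subseteq> covering_total \<and> H 0 = lift k1 l1 1 \<and> H 1 = lift k2 l2 1 \<and>
     (\<forall>\<theta>\<in>{0..1}. G (H \<theta>) = base_conjugate d1 d2 0 \<theta>)"
proof -
  define L where "L \<theta> = label_point (real k1 + of_int d1 * \<theta>) (real l1 + of_int d2 * \<theta>)" for \<theta>
  have GL: "G (L \<theta>) = base_loop d1 d2 0 \<theta>" for \<theta>
  proof -
    have "cis (2 * pi * (real k + x)) = cis (2 * pi * x)" for k x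
      unfolding distrib_left cis_mult[symmetric] cis_2pi_nat by simp
    then show ?thesis by (simp add: L_def G_label_point base_loop_def mult.assoc)
  qed
  have "base_loop d1 d2 0 \<theta> \<in> regular_values" for \<theta> using loop_radius by (intro base_loop_regular) auto
  then have L_cov: "L \<theta> \<in> covering_total" for \<theta>
    using label_point_in_total unfolding covering_total_def GL[symmetric] L_def by blast
  have pathL: "path L" unfolding path_def L_def label_point_def by (intro continuous_intros) auto
  have L0: "L 0 = lift k1 l1 0" by (simp add: L_def lift(3))
  have "real k1 + of_int d1 = real k2" "real l1 + of_int d2 = real l2"
    using arg_cong[OF assms(1), of real_of_int] arg_cong[OF assms(2), of real_of_int] by simp_all
  then have L1: "L 1 = lift k2 l2 0" by (simp add: L_def lift(3))
  define H where "H = reversepath (lift k1 l1) +++ L +++ lift k2 l2"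
  have pathL2: "path (L +++ lift k2 l2)"
    by (rule path_join_imp[OF pathL lift(1)]) (simp add: pathstart_def pathfinish_def L1)
  have "path H" unfolding H_def
    by (rule path_join_imp[OF path_reversepath[THEN iffD2, OF lift(1)] pathL2])
       (simp add: pathstart_def pathfinish_def L0 joinpaths_def reversepath_def)
  moreover have "path_image H \<subseteq> covering_total"
    unfolding H_def using lift(2) L_cov
    by (intro subset_path_image_join) (auto simp: path_image_def[of L])
  moreover have "H 0 = lift k1 l1 1" "H 1 = lift k2 l2 1" by (simp_all add: H_def joinpaths_def reversepath_def)
  moreover have "G (H \<theta>) = base_conjugate d1 d2 0 \<theta>" if "\<theta> \<in> {0..1}" for \<theta>
  proof -
    have b: "base_path (1 - x) = base_segment 0 x" for x by (simp add: base_path_def base_segment_def)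
    have 1: "G (lift k1 l1 (1 - x)) = base_segment 0 x" if "x \<in> {0..1}" for x
      using lift(4)[of "1 - x" k1 l1] that b by simp
    have 2: "G (lift k2 l2 x) = base_segment 0 (1 - x)" if "x \<in> {0..1}" for x
      using lift(4)[of x k2 l2] that b[of "1 - x"] by simp
    show ?thesis using that 1[of "2 * \<theta>"] 2[of "2 * (2 * \<theta> - 1) - 1"] GL
      by (auto simp: H_def base_conjugate_def joinpaths_def reversepath_def)
  qed
  ultimately show ?thesis by blast
qed

lemma path_fibre_point:
  assumes g: "path g" "path_image g \<subseteq> LG_space s r" and h: "path h"
    and Crit: "\<And>\<theta>. \<theta> \<in> {0..1} \<Longrightarrow> h \<theta> \<in> Crit s r a (g \<theta>)"
  shows "path (\<lambda>\<theta>. fibre_point (g \<theta>) (rt (norm (A_invariant (g \<theta>)))) (h \<theta>))"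
proof -
  have gc: "continuous_on {0..1} g" and hc: "continuous_on {0..1} h" using g h by (simp_all add: path_def)
  have gL: "g \<theta> \<in> LG_space s r" if "\<theta> \<in> {0..1}" for \<theta> using g(2) that by (auto simp: path_image_def)
  have torus: "h \<theta> \<in> LG_torus s r" if "\<theta> \<in> {0..1}" for \<theta> using Crit[OF that] by (simp add: Crit_def)
  have 1: "\<forall>\<theta>\<in>{0..1}. (\<Prod>i=1..s. fst (h \<theta>) i) \<noteq> 0" and 2: "\<forall>\<theta>\<in>{0..1}. (\<Prod>j=1..r. snd (h \<theta>) j) \<noteq> 0"
    using torus by (auto simp: LG_torus_def PiE_iff mem_Times_iff)
  have 3: "\<forall>\<theta>\<in>{0..1}. (\<Prod>j=1..r. snd (g \<theta>) j ^ a j) \<noteq> 0" using LG_space_nonzero(2)[OF gL] by auto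
  note coords = continuous_on_cpair_coordinates[OF gc] continuous_on_cpair_coordinates[OF hc]
  have A: "continuous_on {0..1} (\<lambda>\<theta>. A_invariant (g \<theta>))" unfolding A_invariant_def
    by (intro continuous_on_divide continuous_on_prod continuous_on_power coords 3)
  have "continuous_on {0..1} (\<lambda>\<theta>. rt (norm (A_invariant (g \<theta>))))" by (intro continuous_intros A)
  moreover have "\<forall>\<theta>\<in>{0..1}. rt (norm (A_invariant (g \<theta>))) \<noteq> 0" using base_value_tau(1)[OF gL] by blast
  ultimately show ?thesis unfolding path_def fibre_point_def
    by (intro continuous_on_Pair continuous_on_divide continuous_on_mult continuous_on_prod continuous_on_power
          coords 1 2 continuous_on_const)
qed

lemma path_crit_point:
  assumes g: "path g" "path_image g \<subseteq> LG_space s r" and K: "path K"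
  shows "path (\<lambda>\<theta>. crit_point (g \<theta>) (K \<theta>))"
proof -
  have gc: "continuous_on {0..1} g" and Kc: "continuous_on {0..1} K" using g K by (simp_all add: path_def)
  have gL: "g \<theta> \<in> LG_space s r" if "\<theta> \<in> {0..1}" for \<theta> using g(2) that by (auto simp: path_image_def)
  have ellc: "continuous_on {0..1} (\<lambda>\<theta>. ell j (K \<theta>))" for j
    by (rule continuous_on_compose2[OF continuous_ell[of UNIV] Kc]) auto
  note coords = continuous_on_cpair_coordinates[OF gc]
  have z: "continuous_on {0..1} (\<lambda>\<theta>. snd (snd (K \<theta>)) * fst (K \<theta>) / fst (g \<theta>) i)" if "i \<in> {1..s}" for i
    using LG_space_nonzero(1)[OF gL, of _ i] that
    by (intro continuous_on_divide continuous_on_mult continuous_on_snd continuous_on_fst Kc coords) auto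
  have w: "continuous_on {0..1} (\<lambda>\<theta>. ell j (K \<theta>) / snd (g \<theta>) j)" if "j \<in> {1..r}" for j
    using LG_space_nonzero(2)[OF gL, of _ j] that
    by (intro continuous_on_divide ellc coords) auto
  show ?thesis unfolding path_def crit_point_def
    by (intro continuous_on_Pair continuous_on_restrict_coordinates z w)
qed

text \<open>A continuation of critical points along a loop in the class of \<open>(n, m)\<close> is a lift of the image of
the loop under \<open>base_value\<close>. That image is homotopic, within the regular values, to the loop at
\<open>\<tau> = 0\<close>, whose lift is known. By the monodromy theorem both lifts end at the same point.\<close>

theorem monodromy_label:
  assumes a0: "a 0 = 0"
    and k: "int k1 + deg1 s r a nm = int k2" and l: "int l1 + deg2 r nm = int l2"
  shows "monodromy s r a (Gamma_class s r a nm) (sol k1 l1) = sol k2 l2"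
proof -
  define t where "t = ln loop_radius"
  have t: "exp t \<le> loop_radius" "t \<le> 0" using loop_radius by (simp_all add: t_def)
  define lam0 where "lam0 = LG_conjugate nm t"
  \<comment> \<open>The family of loops in the base that connects \<open>\<tau> = 0\<close> to the image of the chosen representative.\<close>
  define \<mu> where "\<mu> = base_conjugate (deg1 s r a nm) (deg2 r nm)"
  have C_eq: "Gamma_class s r a nm = loop_class complement lam0"
    unfolding lam0_def by (rule Gamma_class_eq[OF a0 t(1)])
  have lam0_refl: "homotopic_paths complement lam0 lam0" unfolding lam0_def by (rule LG_conjugate_homotopic[OF a0 t(1) t(1)])
  have lam0_path: "path lam0" "path_image lam0 \<subseteq> complement" using lam0_refl by simp_all
  have lam0_ends: "lam0 0 = LG_f s r 0" "lam0 1 = LG_f s r 0"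
    by (simp_all add: lam0_def joinpaths_def reversepath_def LG_segment_ends)
  have \<mu>_hom: "homotopic_paths regular_values (\<mu> 0) (\<mu> (exp t))"
    unfolding \<mu>_def using t(1) by (intro base_conjugate_homotopic) simp
  have \<mu>_psi: "\<mu> (exp t) \<theta> = base_value (lam0 \<theta>)" if "\<theta> \<in> {0..1}" for \<theta>
    unfolding \<mu>_def lam0_def using base_value_conjugate[OF a0 t(2) that] by simp
  have \<mu>_path: "path (\<mu> (exp t))" "path_image (\<mu> (exp t)) \<subseteq> regular_values"
    using homotopic_paths_imp_path[OF \<mu>_hom] homotopic_paths_imp_subset[OF \<mu>_hom] by simp_all
  have "homotopic_paths regular_values (\<mu> (exp t)) (base_value \<circ> lam0)"
    by (rule homotopic_paths_eq[OF \<mu>_path]) (simp add: \<mu>_psi)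
  with \<mu>_hom have hom0: "homotopic_paths regular_values (\<mu> 0) (base_value \<circ> lam0)" by (rule homotopic_paths_trans)
  obtain H where H: "path H" "path_image H \<subseteq> covering_total" "H 0 = lift k1 l1 1" "H 1 = lift k2 l2 1"
     "\<forall>\<theta>\<in>{0..1}. G (H \<theta>) = \<mu> 0 \<theta>"
    using lift_of_degenerate_loop[OF k l] unfolding \<mu>_def by (elim exE conjE)
  have base_value_cont: "continuous_on complement base_value" using continuous_psi by (rule continuous_on_subset) auto
  have unique: "q = sol k2 l2" if gC: "g \<in> Gamma_class s r a nm" and cont: "continues_to s r a g (sol k1 l1) q" for g q
  proof -
    have g_hom: "homotopic_paths complement lam0 g" using gC by (simp add: C_eq loop_class_def)
    have g: "path g" "path_image g \<subseteq> complement"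
      using homotopic_paths_imp_path[OF g_hom] homotopic_paths_imp_subset[OF g_hom] by simp_all
    have g_ends: "g 0 = LG_f s r 0" "g 1 = LG_f s r 0"
      using homotopic_paths_imp_pathstart[OF g_hom] homotopic_paths_imp_pathfinish[OF g_hom] lam0_ends
      by (simp_all add: pathstart_def pathfinish_def)
    have gL: "g \<theta> \<in> LG_space s r" if "\<theta> \<in> {0..1}" for \<theta>
      using subsetD[OF g(2), of "g \<theta>"] that unfolding path_image_def by blast
    obtain h where h: "path h" "pathstart h = sol k1 l1" "pathfinish h = q" "\<forall>\<theta>\<in>{0..1}. h \<theta> \<in> Crit s r a (g \<theta>)"
      using cont unfolding continues_to_def by (elim exE conjE)
    have "homotopic_paths nondegenerate (base_value \<circ> lam0) (base_value \<circ> g)"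
      using g_hom base_value_cont base_value_nondegenerate by (intro homotopic_paths_continuous_image[of complement]) auto
    moreover have "(base_value \<circ> lam0) 0 \<in> regular_values"
      using homotopic_paths_imp_subset[OF hom0] by (auto simp: path_image_def)
    ultimately have "homotopic_paths regular_values (base_value \<circ> lam0) (base_value \<circ> g)" by (rule homotopic_in_regular_values)
    with hom0 have hom: "homotopic_paths regular_values (\<mu> 0) (base_value \<circ> g)" by (rule homotopic_paths_trans)
    define K where "K \<theta> = fibre_point (g \<theta>) (rt (norm (A_invariant (g \<theta>)))) (h \<theta>)" for \<theta>
    have K_path: "path K" unfolding K_def
      by (rule path_fibre_point[OF g(1) _ h(1)]) (use g(2) h(4) in auto)
    have GK: "K \<theta> \<in> total" "G (K \<theta>) = base_value (g \<theta>)" "crit_point (g \<theta>) (K \<theta>) = h \<theta>" if "\<theta> \<in> {0..1}" for \<theta>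
      using fibre_point_correct[OF gL[OF that] base_value_tau[OF gL[OF that]] h(4)[rule_format, OF that]]
      by (simp_all add: K_def base_value_def)
    have reg: "base_value (g \<theta>) \<in> regular_values" if "\<theta> \<in> {0..1}" for \<theta>
      using homotopic_paths_imp_subset[OF hom] that by (auto simp: path_image_def)
    have K_cov: "path_image K \<subseteq> covering_total"
      using GK reg by (auto simp: path_image_def covering_total_def)
    have tau0: "rt (norm (A_invariant (LG_f s r 0))) = rt (exp 0)"
      by (simp add: LG_f_def A_invariant_LG_alpha0)
    have "K 0 = fibre_point (LG_f s r 0) (rt (exp 0)) (sol k1 l1)"
      using h(2) unfolding K_def g_ends tau0 pathstart_def by simp
    then have "K 0 = lift k1 l1 1"
      using lift_crit_point(2)[of 0 k1 l1] by (simp add: sol_def)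
    then have starts: "pathstart H = pathstart K" using H(3) by (simp add: pathstart_def)
    have "pathfinish H = pathfinish K"
    proof (rule covering_space_monodromy[OF covering _ _ _ _ hom])
      show "path (\<mu> 0)" "path (base_value \<circ> g)" using homotopic_paths_imp_path[OF hom] by simp_all
      show "path_image (\<mu> 0) \<subseteq> regular_values" "path_image (base_value \<circ> g) \<subseteq> regular_values"
        using homotopic_paths_imp_subset[OF hom] by simp_all
      show "G (H \<theta>) = \<mu> 0 \<theta>" if "\<theta> \<in> {0..1}" for \<theta> using H(5) that by blast
      show "G (K \<theta>) = (base_value \<circ> g) \<theta>" if "\<theta> \<in> {0..1}" for \<theta> using GK(2)[OF that] by simp
    qed (rule H(1) H(2) K_path K_cov starts)+
    then have "K 1 = lift k2 l2 1" using H(4) by (simp add: pathfinish_def)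
    then show "q = sol k2 l2" using GK(3)[of 1] h(3) g_ends(2) by (simp add: sol_def pathfinish_def)
  qed
  have exists: "\<exists>q. continues_to s r a lam0 (sol k1 l1) q"
  proof -
    have base_value_path: "path (base_value \<circ> lam0)" "path_image (base_value \<circ> lam0) \<subseteq> regular_values"
      using homotopic_paths_imp_path[OF hom0] homotopic_paths_imp_subset[OF hom0] by simp_all
    have "G (lift k1 l1 1) = \<mu> 0 0" using H(3,5) by force
    also have "\<dots> = (base_value \<circ> lam0) 0" using homotopic_paths_imp_pathstart[OF hom0] by (simp add: pathstart_def)
    finally have start: "pathstart (base_value \<circ> lam0) = G (lift k1 l1 1)" by (simp add: pathstart_def)
    have "lift k1 l1 1 \<in> covering_total" by (rule lift_in_covering) simp
    from covering_space_lift_path_strong[OF covering this base_value_path start]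
    obtain K where K: "path K" "path_image K \<subseteq> covering_total" "pathstart K = lift k1 l1 1"
      "\<And>\<theta>. \<theta> \<in> {0..1} \<Longrightarrow> G (K \<theta>) = (base_value \<circ> lam0) \<theta>" by metis
    have lam0L: "lam0 \<theta> \<in> LG_space s r" if "\<theta> \<in> {0..1}" for \<theta>
      using subsetD[OF lam0_path(2), of "lam0 \<theta>"] that unfolding path_image_def by blast
    have K_total: "K \<theta> \<in> total" if "\<theta> \<in> {0..1}" for \<theta>
      
      using subsetD[OF K(2), of "K \<theta>"] that covering_totalD(1) unfolding path_image_def by blast
    define h where "h \<theta> = crit_point (lam0 \<theta>) (K \<theta>)" for \<theta>
    have "path h" unfolding h_def by (rule path_crit_point[OF lam0_path(1) _ K(1)]) (use lam0_path(2) in auto)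
    moreover have "pathstart h = sol k1 l1"
      using K(3) by (simp add: pathstart_def h_def lam0_ends sol_def)
    moreover have "h \<theta> \<in> Crit s r a (lam0 \<theta>)" if "\<theta> \<in> {0..1}" for \<theta>
      unfolding h_def
      by (rule crit_point_correct(1)[OF lam0L[OF that] K_total[OF that] _ base_value_tau[OF lam0L[OF that]]])
         (use K(4)[OF that] in \<open>simp add: base_value_def\<close>)
    ultimately show ?thesis unfolding continues_to_def by (intro exI[of _ "pathfinish h"] exI[of _ h]) simp
  qed
  have lam0C: "lam0 \<in> Gamma_class s r a nm" using lam0_refl by (simp add: C_eq loop_class_def)
  obtain q where q: "continues_to s r a lam0 (sol k1 l1) q" using exists by blast
  have "q = sol k2 l2" using lam0C q by (rule unique)
  then have "\<exists>g\<in>Gamma_class s r a nm. continues_to s r a g (sol k1 l1) (sol k2 l2)" using lam0C q by blast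
  then show ?thesis unfolding monodromy_def
    by (rule the_equality) (elim bexE, rule unique)
qed

text \<open>The bounds that define \<open>D_plus\<close> say that the target label of \<open>(n, m)\<close> is in the range in which different
labels belong to different solutions. So the target solution determines the bidegree.\<close>

theorem mon_set_eq_section_monomials:
  assumes a0: "a 0 = 0" and kl: "k1 \<le> s" "l1 \<le> r" "k2 \<le> s" "l2 \<le> r"
  shows "mon_set s r a (k1, l1) (k2, l2) = section_monomials s r a (int k2 - int k1) (int l2 - int l1)"
proof (intro set_eqI iffI)
  fix nm assume nm: "nm \<in> mon_set s r a (k1, l1) (k2, l2)"
  then have D: "nm \<in> ({0..s} \<rightarrow>\<^sub>E UNIV) \<times> ({0..r} \<rightarrow>\<^sub>E UNIV)"
      "- int k1 \<le> deg1 s r a nm" "deg1 s r a nm \<le> int s - int k1" "0 \<le> deg2 r nm" "deg2 r nm \<le> int r - int l1"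
    and M: "monodromy s r a (Gamma_class s r a nm) (solution s r a (k1, l1)) = solution s r a (k2, l2)"
    by (auto simp: mon_set_def D_plus_def)
  define k l where "k = nat (int k1 + deg1 s r a nm)" and "l = nat (int l1 + deg2 r nm)"
  have k: "int k1 + deg1 s r a nm = int k" "k \<le> s" and l: "int l1 + deg2 r nm = int l" "l \<le> r"
    using D by (simp_all add: k_def l_def)
  have "sol k l = sol k2 l2"
    using M monodromy_label[OF a0 k(1) l(1)] by (simp add: solution_eq kl)
  then have "k = k2" "l = l2" using sol_inj[of k l k2 l2] k(2) l(2) kl by simp_all
  then show "nm \<in> section_monomials s r a (int k2 - int k1) (int l2 - int l1)"
    using D(1) k(1) l(1) by (auto simp: section_monomials_def)
next
  fix nm assume "nm \<in> section_monomials s r a (int k2 - int k1) (int l2 - int l1)"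
  then have D: "nm \<in> ({0..s} \<rightarrow>\<^sub>E UNIV) \<times> ({0..r} \<rightarrow>\<^sub>E UNIV)"
      and k: "int k1 + deg1 s r a nm = int k2" and l: "int l1 + deg2 r nm = int l2"
    by (auto simp: section_monomials_def)
  have "0 \<le> deg2 r nm" by (auto simp: deg2_def split: prod.split intro: sum_nonneg)
  then have "nm \<in> D_plus s r a (k1, l1)" using D k l kl by (simp add: D_plus_def)
  then show "nm \<in> mon_set s r a (k1, l1) (k2, l2)"
    using monodromy_label[OF a0 k l] by (simp add: mon_set_def solution_eq kl)
qed

end

section \<open>The isomorphism\<close>

theorem theoremB:
  fixes s r :: nat and a :: "nat \<Rightarrow> nat" and k1 l1 k2 l2 :: nat
  assumes "r \<ge> 1" and "s \<ge> 1"
    and "a 0 = 0" and "mono_on {0..r} a" and "(\<Sum>i=1..r. a i) \<le> s"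
    and "\<And>t::real. t \<le> 0 \<Longrightarrow> LG_f s r t \<notin> discriminant s r a"
    and "k1 \<le> s" and "l1 \<le> r" and "k2 \<le> s" and "l2 \<le> r"
  shows "\<exists>\<Phi>. bij_betw \<Phi> (Hom_bundle s r a (k1, l1) (k2, l2)) (Hom_mon s r a (k1, l1) (k2, l2))
     \<and> (\<forall>\<phi>\<in>Hom_bundle s r a (k1, l1) (k2, l2). \<forall>\<psi>\<in>Hom_bundle s r a (k1, l1) (k2, l2).
          \<Phi> (\<lambda>U f p. \<phi> U f p + \<psi> U f p) = \<Phi> \<phi> + \<Phi> \<psi>)
     \<and> (\<forall>c::complex. \<forall>\<phi>\<in>Hom_bundle s r a (k1, l1) (k2, l2).
          \<Phi> (\<lambda>U f p. c * \<phi> U f p) = Poly_Mapping.map ((*) c) (\<Phi> \<phi>))"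
proof -
  interpret LG_setting s r a
    by unfold_locales (use assms in auto)
  show ?thesis
    unfolding Hom_mon_def mon_set_eq_section_monomials[OF assms(3,7-10)]
    by (rule Hom_bundle_isomorphism[OF assms(1,2)])
qed

end
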